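(* Let $p \in [1, \infty)\setminus\{2\}$. Let $(G, G_{+}, \Sigma)$ be a countable scaled Riesz group. Then there exists a spatial $L^p$ AF algebra $A$ such that $$\big( K_0 (A), K_0 (A)_{+}, \Sigma (A) \big) \cong (G, G_{+}, \Sigma)$$ as scaled preordered abelian groups.
   Context: All algebras are over $\mathbb{C}$; homomorphisms of algebras need not be unital. $L(E)$ is the Banach algebra of bounded operators on a Banach space $E$. Riesz groups: A preordered abelian group is a pair $(G,G_+)$ with $G$ an abelian group, $0\in G_+\subset G$ and $G_+ + G_+\subset G_+$; write $\eta\le\mu$ if $\mu-\eta\in G_+$. A scaled preordered abelian group is a triple $(G,G_+,\Sigma)$ with $(G,G_+)$ preordered and $0\in\Sigma\subset G_+$. An isomorphism $(G,G_+,\Sigma)\to(H,H_+,\Gamma)$ is a group isomorphism $f$ with $f(G_+)=H_+$ and $f(\Sigma)=\Gamma$. $(G,G_+,\Sigma)$ is a scaled Riesz group if: (1) $G_+-G_+=G$; (2) $G_+\cap(-G_+)=\{0\}$; (3) whenever $\eta\in G$ and $n\in\mathbb{Z}_{>0}$ satisfy $n\eta\in G_+$, then $\eta\in G_+$; (4) whenever $\eta_1,\eta_2,\mu_1,\mu_2\in G$ satisfy $\eta_j\le\mu_k$ for $j,k\in\{1,2\}$, there is $\lambda\in G$ with $\eta_j\le\lambda\le\mu_k$ for $j,k\in\{1,2\}$; (5) every $\eta\in G_+$ is a finite sum $\mu_1+\dots+\mu_n$ with $n \in \mathbb{Z}_{>0}$ and $\mu_i\in\Sigma$; (6) if $0\le\eta\le\mu$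 and $\mu\in\Sigma$ then $\eta\in\Sigma$; (7) for all $\eta,\mu\in\Sigma$ there is $\lambda\in\Sigma$ with $\eta\le\lambda$ and $\mu\le\lambda$. Matrix algebras: $l^p_d = l^p(\{1,\dots,d\})$ and $M_d^p = L(l^p_d)$ with the operator norm, algebraically identified with $M_d(\mathbb{C})$. A finite direct sum of Banach algebras is given the norm $\|(a_1,\dots,a_N)\| = \max_k \|a_k\|$. Hermitian idempotent: in a unital Banach algebra $B$ with $\|1\|=1$, an idempotent $e$ is hermitian if $\|\exp(i\lambda e)\| = 1$ for all $\lambda \in \mathbb{R}$. A spatial semisimple finite dimensional $L^p$ operator algebra is a Banach algebra isometrically isomorphic to $\bigoplus_{k=1}^N M_{d_k}^p$ for some $N, d_1,\dots,d_N \in \mathbb{Z}_{>0}$. A homomorphism $\varphi\colon \bigoplus_{k=1}^N M_{d_k}^p \to B$ between two such algebras is spatial if for every $k$ the restriction of $\varphi$ to the summand $M_{d_k}^p$ is contractive and sends the identity of $M_{d_k}^p$ to a hermitian idempotent of $B$ (the zero homomorphism is allowed). A spatial $L^p$ AF direct system consists of spatial semisimple finite dimensional $L^p$ operator algebras $A_m$ ($m \in \mathbb{Z}_{\ge 0}$) and contractive spatial homomorphisms $\varphi_{n,m}\colon A_m \to A_n$ ($m \le n$) with $\varphi_{m,m} = \mathrm{id}$ and $\varphi_{n,m}\circ\varphi_{m,k} = \varphi_{n,k}$. Its Banach algebra direct limit is the completion of the algebraic direct limit modulo elements of seminorm zero, for the seminorm that sends the class of $a\in A_m$ to $\lim_n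 \|\varphi_{n,m}(a)\|$. A spatial $L^p$ AF algebra is a Banach algebra isometrically isomorphic to the direct limit of a spatial $L^p$ AF direct system. K-theory: For a Banach algebra $A$, $K_0(A)$ is the usual Banach algebra $K_0$-group; $M_\infty(A)=\varinjlim M_n(A)$ (embeddings $a\mapsto \mathrm{diag}(a,0)$); $[e]$ is the class in $K_0(A)$ of an idempotent $e\in M_\infty(A)$; $K_0(A)_+ = \{[e] : e \text{ an idempotent in } M_\infty(A)\}$ and $\Sigma(A) = \{[e] : e \text{ an idempotent in } A\}$. *)

theory Defs
  imports
    Complex_Main
    "HOL-Library.Countable_Set"
    "HOL-Algebra.Module"
    "HOL-Algebra.Coset"
    "Jordan_Normal_Form.Matrix"
begin

section \<open>Scaled Riesz groups\<close>

text \<open>Abelian groups are commutative groups in the sense of HOL-Algebra, so that the group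
  operation is written multiplicatively: \<open>n \<eta>\<close> is \<open>\<eta> [^] n\<close> and \<open>\<mu> - \<eta>\<close> is \<open>\<mu> \<otimes> inv \<eta>\<close>.\<close>

record 'g scaled_group = "'g monoid" +
  pos :: "'g set"
  scale :: "'g set"

locale scaled_preordered_group = comm_group G for G :: "('g, 'm) scaled_group_scheme" (structure) +
  assumes pos_subset: "pos G \<subseteq> carrier G"
    and one_pos: "\<one> \<in> pos G"
    and pos_closed: "\<lbrakk>x \<in> pos G; y \<in> pos G\<rbrakk> \<Longrightarrow> x \<otimes> y \<in> pos G"
    and scale_subset: "scale G \<subseteq> pos G"
    and one_scale: "\<one> \<in> scale G"

definition pre_le :: "('g, 'm) scaled_group_scheme \<Rightarrow> 'g \<Rightarrow> 'g \<Rightarrow> bool" where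
  "pre_le G \<eta> \<mu> \<longleftrightarrow> \<mu> \<otimes>\<^bsub>G\<^esub> inv\<^bsub>G\<^esub> \<eta> \<in> pos G"

locale scaled_Riesz_group = scaled_preordered_group +
  assumes generating: "\<eta> \<in> carrier G \<Longrightarrow> \<exists>a\<in>pos G. \<exists>b\<in>pos G. \<eta> = a \<otimes> inv b"
    and proper: "\<lbrakk>\<eta> \<in> pos G; inv \<eta> \<in> pos G\<rbrakk> \<Longrightarrow> \<eta> = \<one>"
    and unperforated: "\<lbrakk>\<eta> \<in> carrier G; (n::nat) > 0; \<eta> [^] n \<in> pos G\<rbrakk> \<Longrightarrow> \<eta> \<in> pos G"
    and interpolation:
      "\<lbrakk>\<eta>1 \<in> carrier G; \<eta>2 \<in> carrier G; \<mu>1 \<in> carrier G; \<mu>2 \<in> carrier G;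
        pre_le G \<eta>1 \<mu>1; pre_le G \<eta>1 \<mu>2; pre_le G \<eta>2 \<mu>1; pre_le G \<eta>2 \<mu>2\<rbrakk> \<Longrightarrow>
        \<exists>l\<in>carrier G. pre_le G \<eta>1 l \<and> pre_le G \<eta>2 l \<and> pre_le G l \<mu>1 \<and> pre_le G l \<mu>2"
    and scale_generating:
      "\<eta> \<in> pos G \<Longrightarrow>
        \<exists>(n::nat) \<mu>. n > 0 \<and> (\<forall>i<n. \<mu> i \<in> scale G) \<and> \<eta> = finprod G \<mu> {..<n}"
    and scale_hereditary:
      "\<lbrakk>\<eta> \<in> carrier G; pre_le G \<one> \<eta>; pre_le G \<eta> \<mu>; \<mu> \<in> scale G\<rbrakk> \<Longrightarrow> \<eta> \<in> scale G"
    and scale_directed: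
      "\<lbrakk>\<eta> \<in> scale G; \<mu> \<in> scale G\<rbrakk> \<Longrightarrow> \<exists>l\<in>scale G. pre_le G \<eta> l \<and> pre_le G \<mu> l"

definition scaled_isomorphic ::
    "('g, 'm) scaled_group_scheme \<Rightarrow> ('h, 'n) scaled_group_scheme \<Rightarrow> bool" where
  "scaled_isomorphic G H \<longleftrightarrow> scaled_preordered_group G \<and> scaled_preordered_group H \<and>
     (\<exists>f \<in> iso G H. f ` pos G = pos H \<and> f ` scale G = scale H)"


section \<open>Complex Banach algebras\<close>

text \<open>Algebras need not be unital. The field \<open>one\<close>, which the HOL-Algebra record of modules
  inherits from that of rings, carries no meaning for a general algebra and is never referred to
  by the notions below; the unit of an algebra, if there is one, is \<open>alg_unit\<close>.\<close>

record 'a normed_alg = "(complex, 'a) module" +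
  nrm :: "'a \<Rightarrow> real"

locale complex_algebra = abelian_group A for A :: "(complex, 'a, 'm) module_scheme" (structure) +
  assumes mult_closed: "\<lbrakk>x \<in> carrier A; y \<in> carrier A\<rbrakk> \<Longrightarrow> x \<otimes> y \<in> carrier A"
    and mult_assoc: "\<lbrakk>x \<in> carrier A; y \<in> carrier A; z \<in> carrier A\<rbrakk> \<Longrightarrow> (x \<otimes> y) \<otimes> z = x \<otimes> (y \<otimes> z)"
    and distrib_right: "\<lbrakk>x \<in> carrier A; y \<in> carrier A; z \<in> carrier A\<rbrakk> \<Longrightarrow>
      (x \<oplus> y) \<otimes> z = x \<otimes> z \<oplus> y \<otimes> z"
    and distrib_left: "\<lbrakk>x \<in> carrier A; y \<in> carrier A; z \<in> carrier A\<rbrakk> \<Longrightarrow>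
      x \<otimes> (y \<oplus> z) = x \<otimes> y \<oplus> x \<otimes> z"
    and smult_closed: "x \<in> carrier A \<Longrightarrow> c \<odot> x \<in> carrier A"
    and smult_add: "\<lbrakk>x \<in> carrier A; y \<in> carrier A\<rbrakk> \<Longrightarrow> c \<odot> (x \<oplus> y) = c \<odot> x \<oplus> c \<odot> y"
    and add_smult: "x \<in> carrier A \<Longrightarrow> (c + d) \<odot> x = c \<odot> x \<oplus> d \<odot> x"
    and smult_smult: "x \<in> carrier A \<Longrightarrow> (c * d) \<odot> x = c \<odot> (d \<odot> x)"
    and one_smult: "x \<in> carrier A \<Longrightarrow> 1 \<odot> x = x"
    and smult_mult: "\<lbrakk>x \<in> carrier A; y \<in> carrier A\<rbrakk> \<Longrightarrow> c \<odot> (x \<otimes> y) = (c \<odot> x) \<otimes> y"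
    and mult_smult: "\<lbrakk>x \<in> carrier A; y \<in> carrier A\<rbrakk> \<Longrightarrow> c \<odot> (x \<otimes> y) = x \<otimes> (c \<odot> y)"

definition alg_cauchy :: "('a, 'm) normed_alg_scheme \<Rightarrow> (nat \<Rightarrow> 'a) \<Rightarrow> bool" where
  "alg_cauchy A X \<longleftrightarrow> (\<forall>n. X n \<in> carrier A) \<and>
     (\<forall>\<epsilon>>0. \<exists>N. \<forall>m\<ge>N. \<forall>n\<ge>N. nrm A (X m \<ominus>\<^bsub>A\<^esub> X n) < \<epsilon>)"

definition alg_tendsto :: "('a, 'm) normed_alg_scheme \<Rightarrow> (nat \<Rightarrow> 'a) \<Rightarrow> 'a \<Rightarrow> bool" where
  "alg_tendsto A X x \<longleftrightarrow> x \<in> carrier A \<and> (\<lambda>n. nrm A (X n \<ominus>\<^bsub>A\<^esub> x)) \<longlonglongrightarrow> 0"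

locale Banach_algebra = complex_algebra A for A :: "('a, 'm) normed_alg_scheme" (structure) +
  assumes nrm_eq_0_iff: "x \<in> carrier A \<Longrightarrow> nrm A x = 0 \<longleftrightarrow> x = \<zero>"
    and nrm_add: "\<lbrakk>x \<in> carrier A; y \<in> carrier A\<rbrakk> \<Longrightarrow> nrm A (x \<oplus> y) \<le> nrm A x + nrm A y"
    and nrm_smult: "x \<in> carrier A \<Longrightarrow> nrm A (c \<odot> x) = cmod c * nrm A x"
    and nrm_mult: "\<lbrakk>x \<in> carrier A; y \<in> carrier A\<rbrakk> \<Longrightarrow> nrm A (x \<otimes> y) \<le> nrm A x * nrm A y"
    and complete: "alg_cauchy A X \<Longrightarrow> \<exists>x. alg_tendsto A X x"

definition alg_hom ::
    "(complex, 'a, 'm) module_scheme \<Rightarrow> (complex, 'b, 'n) module_scheme \<Rightarrow> ('a \<Rightarrow> 'b) set" where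
  "alg_hom A B = {\<phi> \<in> carrier A \<rightarrow> carrier B.
     (\<forall>x\<in>carrier A. \<forall>y\<in>carrier A. \<phi> (x \<oplus>\<^bsub>A\<^esub> y) = \<phi> x \<oplus>\<^bsub>B\<^esub> \<phi> y) \<and>
     (\<forall>x\<in>carrier A. \<forall>y\<in>carrier A. \<phi> (x \<otimes>\<^bsub>A\<^esub> y) = \<phi> x \<otimes>\<^bsub>B\<^esub> \<phi> y) \<and>
     (\<forall>c. \<forall>x\<in>carrier A. \<phi> (c \<odot>\<^bsub>A\<^esub> x) = c \<odot>\<^bsub>B\<^esub> \<phi> x)}"

definition contractive_on ::
    "'a set \<Rightarrow> ('a, 'm) normed_alg_scheme \<Rightarrow> ('b, 'n) normed_alg_scheme \<Rightarrow> ('a \<Rightarrow> 'b) \<Rightarrow> bool" where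
  "contractive_on S A B \<phi> \<longleftrightarrow> (\<forall>x\<in>S. nrm B (\<phi> x) \<le> nrm A x)"

definition isometric_iso ::
    "('a, 'm) normed_alg_scheme \<Rightarrow> ('b, 'n) normed_alg_scheme \<Rightarrow> ('a \<Rightarrow> 'b) set" where
  "isometric_iso A B = {\<phi> \<in> alg_hom A B. bij_betw \<phi> (carrier A) (carrier B) \<and>
     (\<forall>x\<in>carrier A. nrm B (\<phi> x) = nrm A x)}"


section \<open>Hermitian idempotents\<close>

definition is_alg_unit :: "('a, 'm) normed_alg_scheme \<Rightarrow> 'a \<Rightarrow> bool" where
  "is_alg_unit B u \<longleftrightarrow> u \<in> carrier B \<and>
     (\<forall>x\<in>carrier B. u \<otimes>\<^bsub>B\<^esub> x = x \<and> x \<otimes>\<^bsub>B\<^esub> u = x)"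

definition alg_unit :: "('a, 'm) normed_alg_scheme \<Rightarrow> 'a" where
  "alg_unit B = (THE u. is_alg_unit B u)"

primrec alg_pow :: "('a, 'm) normed_alg_scheme \<Rightarrow> 'a \<Rightarrow> nat \<Rightarrow> 'a" where
  "alg_pow B x 0 = alg_unit B"
| "alg_pow B x (Suc n) = alg_pow B x n \<otimes>\<^bsub>B\<^esub> x"

definition alg_exp :: "('a, 'm) normed_alg_scheme \<Rightarrow> 'a \<Rightarrow> 'a" where
  "alg_exp B x =
     (THE y. alg_tendsto B (\<lambda>n. finsum B (\<lambda>k. (1 / fact k) \<odot>\<^bsub>B\<^esub> alg_pow B x k) {..<n}) y)"

definition hermitian_idempotent :: "('a, 'm) normed_alg_scheme \<Rightarrow> 'a \<Rightarrow> bool" where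
  "hermitian_idempotent B e \<longleftrightarrow>
     (\<exists>u. is_alg_unit B u) \<and> nrm B (alg_unit B) = 1 \<and>
     e \<in> carrier B \<and> e \<otimes>\<^bsub>B\<^esub> e = e \<and>
     (\<forall>t::real. nrm B (alg_exp B ((\<i> * complex_of_real t) \<odot>\<^bsub>B\<^esub> e)) = 1)"


section \<open>Spatial semisimple finite dimensional algebras\<close>

definition lp_norm :: "real \<Rightarrow> complex vec \<Rightarrow> real" where
  "lp_norm p v = (\<Sum>i<dim_vec v. cmod (v $ i) powr p) powr (1 / p)"

definition lp_op_norm :: "real \<Rightarrow> complex mat \<Rightarrow> real" where
  "lp_op_norm p M = Sup {lp_norm p (M *\<^sub>v v) | v. v \<in> carrier_vec (dim_col M) \<and> lp_norm p v \<le> 1}"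

text \<open>The direct sum of the matrix algebras \<open>M\<^sub>d\<^sup>p\<close>, where \<open>d\<close> runs through the list \<open>ds\<close>;
  its elements are lists of matrices of the same length.\<close>

definition lp_matrix_sum :: "real \<Rightarrow> nat list \<Rightarrow> complex mat list normed_alg" where
  "lp_matrix_sum p ds =
     \<lparr> carrier = {as. length as = length ds \<and> (\<forall>k<length ds. as ! k \<in> carrier_mat (ds ! k) (ds ! k))},
       monoid.mult = map2 (*),
       one = map (\<lambda>d. 1\<^sub>m d) ds,
       zero = map (\<lambda>d. 0\<^sub>m d d) ds,
       add = map2 (+),
       smult = (\<lambda>c. map (\<lambda>a. c \<cdot>\<^sub>m a)),
       nrm = (\<lambda>as. Max (lp_op_norm p ` set as)) \<rparr>"

definition valid_dims :: "nat list \<Rightarrow> bool" where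
  "valid_dims ds \<longleftrightarrow> ds \<noteq> [] \<and> (\<forall>d\<in>set ds. d > 0)"

definition lp_summand :: "real \<Rightarrow> nat list \<Rightarrow> nat \<Rightarrow> complex mat list set" where
  "lp_summand p ds k = {as \<in> carrier (lp_matrix_sum p ds).
     \<forall>j<length ds. j \<noteq> k \<longrightarrow> as ! j = 0\<^sub>m (ds ! j) (ds ! j)}"

definition lp_summand_one :: "nat list \<Rightarrow> nat \<Rightarrow> complex mat list" where
  "lp_summand_one ds k = (map (\<lambda>d. 0\<^sub>m d d) ds)[k := 1\<^sub>m (ds ! k)]"

definition spatial_ss_fd :: "real \<Rightarrow> ('a, 'm) normed_alg_scheme \<Rightarrow> bool" where
  "spatial_ss_fd p A \<longleftrightarrow> Banach_algebra A \<and>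
     (\<exists>ds. valid_dims ds \<and> isometric_iso (lp_matrix_sum p ds) A \<noteq> {})"

text \<open>The domain is only isometrically isomorphic to a direct sum of matrix algebras, and the
  summands are those transported by an identification \<open>\<psi>\<close>. They are the minimal nonzero ideals of
  the domain, so that the choice of \<open>\<psi>\<close> does not matter.\<close>

definition spatial_hom ::
    "real \<Rightarrow> ('a, 'm) normed_alg_scheme \<Rightarrow> ('b, 'n) normed_alg_scheme \<Rightarrow> ('a \<Rightarrow> 'b) \<Rightarrow> bool" where
  "spatial_hom p A B \<phi> \<longleftrightarrow> \<phi> \<in> alg_hom A B \<and>
     (\<exists>ds \<psi>. valid_dims ds \<and> \<psi> \<in> isometric_iso (lp_matrix_sum p ds) A \<and>
       (\<forall>k<length ds.
          contractive_on (\<psi> ` lp_summand p ds k) A B \<phi> \<and>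
          hermitian_idempotent B (\<phi> (\<psi> (lp_summand_one ds k)))))"


section \<open>Direct limits and spatial AF algebras\<close>

text \<open>In a direct system, \<open>\<phi> n m\<close> is the map from \<open>A m\<close> to \<open>A n\<close>; it matters only for \<open>m \<le> n\<close>.\<close>

definition spatial_AF_system ::
    "real \<Rightarrow> (nat \<Rightarrow> 'a normed_alg) \<Rightarrow> (nat \<Rightarrow> nat \<Rightarrow> 'a \<Rightarrow> 'a) \<Rightarrow> bool" where
  "spatial_AF_system p A \<phi> \<longleftrightarrow>
     (\<forall>m. spatial_ss_fd p (A m)) \<and>
     (\<forall>m n. m \<le> n \<longrightarrow> spatial_hom p (A m) (A n) (\<phi> n m) \<and>
                      contractive_on (carrier (A m)) (A m) (A n) (\<phi> n m)) \<and>
     (\<forall>m. \<forall>a\<in>carrier (A m). \<phi> m m a = a) \<and>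
     (\<forall>k m n. k \<le> m \<longrightarrow> m \<le> n \<longrightarrow> (\<forall>a\<in>carrier (A k). \<phi> n m (\<phi> m k a) = \<phi> n k a))"

definition dl_base :: "(nat \<Rightarrow> 'a normed_alg) \<Rightarrow> (nat \<times> 'a) set" where
  "dl_base A = (SIGMA m:UNIV. carrier (A m))"

definition dl_rel ::
    "(nat \<Rightarrow> 'a normed_alg) \<Rightarrow> (nat \<Rightarrow> nat \<Rightarrow> 'a \<Rightarrow> 'a) \<Rightarrow> ((nat \<times> 'a) \<times> (nat \<times> 'a)) set" where
  "dl_rel A \<phi> = {((m, a), (n, b)). (m, a) \<in> dl_base A \<and> (n, b) \<in> dl_base A \<and>
     (\<exists>k. m \<le> k \<and> n \<le> k \<and> \<phi> k m a = \<phi> k n b)}"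

text \<open>The algebraic direct limit. Its \<open>nrm\<close> is the limit seminorm.\<close>

definition alg_direct_limit ::
    "(nat \<Rightarrow> 'a normed_alg) \<Rightarrow> (nat \<Rightarrow> nat \<Rightarrow> 'a \<Rightarrow> 'a) \<Rightarrow> (nat \<times> 'a) set normed_alg" where
  "alg_direct_limit A \<phi> =
     \<lparr> carrier = dl_base A // dl_rel A \<phi>,
       monoid.mult = (\<lambda>X Y. \<Union>(m, a)\<in>X. \<Union>(n, b)\<in>Y. let k = max m n in
                 dl_rel A \<phi> `` {(k, \<phi> k m a \<otimes>\<^bsub>A k\<^esub> \<phi> k n b)}),
       one = undefined,
       zero = dl_rel A \<phi> `` {(0, \<zero>\<^bsub>A 0\<^esub>)},
       add = (\<lambda>X Y. \<Union>(m, a)\<in>X. \<Union>(n, b)\<in>Y. let k = max m n in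
                 dl_rel A \<phi> `` {(k, \<phi> k m a \<oplus>\<^bsub>A k\<^esub> \<phi> k n b)}),
       smult = (\<lambda>c X. \<Union>(m, a)\<in>X. dl_rel A \<phi> `` {(m, c \<odot>\<^bsub>A m\<^esub> a)}),
       nrm = (\<lambda>X. THE r. \<exists>(m, a)\<in>X. (\<lambda>n. nrm (A n) (\<phi> n m a)) \<longlonglongrightarrow> r) \<rparr>"

text \<open>Cauchy sequences modulo sequences of seminorm distance tending to zero. This is the
  completion of the quotient of a seminormed algebra by its elements of seminorm zero.\<close>

definition null_rel :: "('a, 'm) normed_alg_scheme \<Rightarrow> ((nat \<Rightarrow> 'a) \<times> (nat \<Rightarrow> 'a)) set" where
  "null_rel A = {(X, Y). alg_cauchy A X \<and> alg_cauchy A Y \<and>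
     (\<lambda>n. nrm A (X n \<ominus>\<^bsub>A\<^esub> Y n)) \<longlonglongrightarrow> 0}"

definition completion :: "('a, 'm) normed_alg_scheme \<Rightarrow> (nat \<Rightarrow> 'a) set normed_alg" where
  "completion A =
     \<lparr> carrier = {X. alg_cauchy A X} // null_rel A,
       monoid.mult = (\<lambda>C D. \<Union>X\<in>C. \<Union>Y\<in>D. null_rel A `` {\<lambda>n. X n \<otimes>\<^bsub>A\<^esub> Y n}),
       one = undefined,
       zero = null_rel A `` {\<lambda>_. \<zero>\<^bsub>A\<^esub>},
       add = (\<lambda>C D. \<Union>X\<in>C. \<Union>Y\<in>D. null_rel A `` {\<lambda>n. X n \<oplus>\<^bsub>A\<^esub> Y n}),
       smult = (\<lambda>c C. \<Union>X\<in>C. null_rel A `` {\<lambda>n. c \<odot>\<^bsub>A\<^esub> X n}),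
       nrm = (\<lambda>C. THE r. \<exists>X\<in>C. (\<lambda>n. nrm A (X n)) \<longlonglongrightarrow> r) \<rparr>"

definition Banach_direct_limit ::
    "(nat \<Rightarrow> 'a normed_alg) \<Rightarrow> (nat \<Rightarrow> nat \<Rightarrow> 'a \<Rightarrow> 'a) \<Rightarrow> (nat \<Rightarrow> (nat \<times> 'a) set) set normed_alg" where
  "Banach_direct_limit A \<phi> = completion (alg_direct_limit A \<phi>)"

text \<open>The elements of the algebras of the system are taken to be lists of matrices. Up to
  isometric isomorphism this is no restriction, since every spatial semisimple finite dimensional
  algebra is isometrically isomorphic to some \<open>lp_matrix_sum p ds\<close>.\<close>

definition spatial_Lp_AF_algebra :: "real \<Rightarrow> ('a, 'm) normed_alg_scheme \<Rightarrow> bool" where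
  "spatial_Lp_AF_algebra p A \<longleftrightarrow> Banach_algebra A \<and>
     (\<exists>(D :: nat \<Rightarrow> complex mat list normed_alg) \<phi>.
        spatial_AF_system p D \<phi> \<and> isometric_iso (Banach_direct_limit D \<phi>) A \<noteq> {})"

text \<open>A carrier type that contains, up to isometric isomorphism, every spatial \<open>L\<^sup>p\<close> AF algebra.\<close>

type_synonym AF_element = "(nat \<Rightarrow> (nat \<times> complex mat list) set) set"


section \<open>K-theory\<close>

text \<open>The elements of \<open>M\<^sub>\<infinity>(R)\<close> are infinite matrices with entries vanishing outside some
  upper left \<open>n \<times> n\<close> corner, so that \<open>a\<close> and \<open>diag(a, 0)\<close> are the same element.\<close>

definition corner :: "('a, 'm) ring_scheme \<Rightarrow> nat \<Rightarrow> (nat \<Rightarrow> nat \<Rightarrow> 'a) set" where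
  "corner R n = {a. (\<forall>i j. a i j \<in> carrier R) \<and> (\<forall>i j. i \<ge> n \<or> j \<ge> n \<longrightarrow> a i j = \<zero>\<^bsub>R\<^esub>)}"

definition M_inf :: "('a, 'm) ring_scheme \<Rightarrow> (nat \<Rightarrow> nat \<Rightarrow> 'a) set" where
  "M_inf R = (\<Union>n. corner R n)"

definition M_mult ::
    "('a, 'm) ring_scheme \<Rightarrow> (nat \<Rightarrow> nat \<Rightarrow> 'a) \<Rightarrow> (nat \<Rightarrow> nat \<Rightarrow> 'a) \<Rightarrow> nat \<Rightarrow> nat \<Rightarrow> 'a" where
  "M_mult R a b = (\<lambda>i j. finsum R (\<lambda>k. a i k \<otimes>\<^bsub>R\<^esub> b k j) {k. a i k \<noteq> \<zero>\<^bsub>R\<^esub>})"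

definition idem_inf :: "('a, 'm) ring_scheme \<Rightarrow> (nat \<Rightarrow> nat \<Rightarrow> 'a) set" where
  "idem_inf R = {e \<in> M_inf R. M_mult R e e = e}"

definition idem_rel ::
    "('a, 'm) ring_scheme \<Rightarrow> ((nat \<Rightarrow> nat \<Rightarrow> 'a) \<times> (nat \<Rightarrow> nat \<Rightarrow> 'a)) set" where
  "idem_rel R = {(e, f). e \<in> idem_inf R \<and> f \<in> idem_inf R \<and>
     (\<exists>x\<in>M_inf R. \<exists>y\<in>M_inf R. M_mult R x y = e \<and> M_mult R y x = f)}"

definition block_diag ::
    "('a, 'm) ring_scheme \<Rightarrow> nat \<Rightarrow> (nat \<Rightarrow> nat \<Rightarrow> 'a) \<Rightarrow> (nat \<Rightarrow> nat \<Rightarrow> 'a) \<Rightarrow> nat \<Rightarrow> nat \<Rightarrow> 'a" where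
  "block_diag R n e f = (\<lambda>i j.
     if i < n \<and> j < n then e i j else if i \<ge> n \<and> j \<ge> n then f (i - n) (j - n) else \<zero>\<^bsub>R\<^esub>)"

text \<open>The monoid \<open>V(R)\<close> of equivalence classes of idempotents under direct sum.\<close>

definition V_monoid :: "('a, 'm) ring_scheme \<Rightarrow> (nat \<Rightarrow> nat \<Rightarrow> 'a) set monoid" where
  "V_monoid R =
     \<lparr> carrier = idem_inf R // idem_rel R,
       monoid.mult = (\<lambda>E F. \<Union>e\<in>E. \<Union>f\<in>F. \<Union>n\<in>{n. e \<in> corner R n}. idem_rel R `` {block_diag R n e f}),
       one = idem_rel R `` {\<lambda>_ _. \<zero>\<^bsub>R\<^esub>} \<rparr>"

text \<open>The Grothendieck group of a commutative monoid; the class of \<open>(a, b)\<close> is the formal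
  difference of \<open>a\<close> and \<open>b\<close>.\<close>

definition groth_rel :: "('v, 'm) monoid_scheme \<Rightarrow> (('v \<times> 'v) \<times> ('v \<times> 'v)) set" where
  "groth_rel M = {((a, b), (c, d)).
     a \<in> carrier M \<and> b \<in> carrier M \<and> c \<in> carrier M \<and> d \<in> carrier M \<and>
     (\<exists>h\<in>carrier M. a \<otimes>\<^bsub>M\<^esub> d \<otimes>\<^bsub>M\<^esub> h = c \<otimes>\<^bsub>M\<^esub> b \<otimes>\<^bsub>M\<^esub> h)}"

definition grothendieck :: "('v, 'm) monoid_scheme \<Rightarrow> ('v \<times> 'v) set monoid" where
  "grothendieck M =
     \<lparr> carrier = (carrier M \<times> carrier M) // groth_rel M,
       monoid.mult = (\<lambda>X Y. \<Union>(a, b)\<in>X. \<Union>(c, d)\<in>Y. groth_rel M `` {(a \<otimes>\<^bsub>M\<^esub> c, b \<otimes>\<^bsub>M\<^esub> d)}),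
       one = groth_rel M `` {(\<one>\<^bsub>M\<^esub>, \<one>\<^bsub>M\<^esub>)} \<rparr>"

definition K00 :: "('a, 'm) ring_scheme \<Rightarrow> ((nat \<Rightarrow> nat \<Rightarrow> 'a) set \<times> (nat \<Rightarrow> nat \<Rightarrow> 'a) set) set monoid"
  where "K00 R = grothendieck (V_monoid R)"

definition V_map ::
    "('b, 'n) ring_scheme \<Rightarrow> ('a \<Rightarrow> 'b) \<Rightarrow> (nat \<Rightarrow> nat \<Rightarrow> 'a) set \<Rightarrow> (nat \<Rightarrow> nat \<Rightarrow> 'b) set" where
  "V_map S h E = (\<Union>e\<in>E. idem_rel S `` {\<lambda>i j. h (e i j)})"

definition K00_map ::
    "('b, 'n) ring_scheme \<Rightarrow> ('a \<Rightarrow> 'b) \<Rightarrow> ((nat \<Rightarrow> nat \<Rightarrow> 'a) set \<times> (nat \<Rightarrow> nat \<Rightarrow> 'a) set) set \<Rightarrow>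
     ((nat \<Rightarrow> nat \<Rightarrow> 'b) set \<times> (nat \<Rightarrow> nat \<Rightarrow> 'b) set) set" where
  "K00_map S h X = (\<Union>(E, F)\<in>X. groth_rel (V_monoid S) `` {(V_map S h E, V_map S h F)})"

definition complex_ring :: "complex ring" where
  "complex_ring = \<lparr> carrier = UNIV, monoid.mult = (*), one = 1, zero = 0, add = (+) \<rparr>"

text \<open>The unitization, in which a new unit is adjoined even if there already is one. Its norm is
  irrelevant for \<open>K\<^sub>0\<close>, and so is omitted.\<close>

definition unitization :: "(complex, 'a, 'm) module_scheme \<Rightarrow> ('a \<times> complex) ring" where
  "unitization A =
     \<lparr> carrier = carrier A \<times> UNIV,
       monoid.mult = (\<lambda>(a, s) (b, t). (a \<otimes>\<^bsub>A\<^esub> b \<oplus>\<^bsub>A\<^esub> s \<odot>\<^bsub>A\<^esub> b \<oplus>\<^bsub>A\<^esub> t \<odot>\<^bsub>A\<^esub> a, s * t)),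
       one = (\<zero>\<^bsub>A\<^esub>, 1),
       zero = (\<zero>\<^bsub>A\<^esub>, 0),
       add = (\<lambda>(a, s) (b, t). (a \<oplus>\<^bsub>A\<^esub> b, s + t)) \<rparr>"

text \<open>The class in \<open>K\<^sub>0(A)\<close> of an idempotent in \<open>M\<^sub>\<infinity>(A)\<close>.\<close>

definition K0_class ::
    "(complex, 'a, 'm) module_scheme \<Rightarrow> (nat \<Rightarrow> nat \<Rightarrow> 'a) \<Rightarrow>
     ((nat \<Rightarrow> nat \<Rightarrow> 'a \<times> complex) set \<times> (nat \<Rightarrow> nat \<Rightarrow> 'a \<times> complex) set) set" where
  "K0_class A e = groth_rel (V_monoid (unitization A)) ``
     {(idem_rel (unitization A) `` {\<lambda>i j. (e i j, 0)}, \<one>\<^bsub>V_monoid (unitization A)\<^esub>)}"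

text \<open>\<open>K\<^sub>0(A)\<close> is the kernel of the map on \<open>K\<^sub>0\<^sub>0\<close> induced by the projection of the unitization
  onto the complex numbers. An element of \<open>A\<close> is identified with the matrix
  in \<open>M\<^sub>\<infinity>(A)\<close> that has it as its upper left entry.\<close>

definition K0 ::
    "(complex, 'a, 'm) module_scheme \<Rightarrow>
     ((nat \<Rightarrow> nat \<Rightarrow> 'a \<times> complex) set \<times> (nat \<Rightarrow> nat \<Rightarrow> 'a \<times> complex) set) set scaled_group" where
  "K0 A =
     \<lparr> carrier = kernel (K00 (unitization A)) (K00 complex_ring) (K00_map complex_ring snd),
       monoid.mult = monoid.mult (K00 (unitization A)),
       one = one (K00 (unitization A)),
       pos = K0_class A ` idem_inf A,
       scale = K0_class A `
         {\<lambda>i j. if i = 0 \<and> j = 0 then e else \<zero>\<^bsub>A\<^esub> | e. e \<in> carrier A \<and> e \<otimes>\<^bsub>A\<^esub> e = e} \<rparr>"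

end

theory Submission
  imports Defs "HOL-Algebra.RingHom"
begin

text \<open>The algebra is built from a Bratteli diagram of the group. A countable Riesz group is the
  direct limit of a sequence of groups \<open>\<int>\<^sup>n\<close> with nonnegative integer matrices as maps (Effros,
  Handelman and Shen). The essential point is Shen's lemma: every relation between finitely many
  positive elements is killed by writing them as nonnegative combinations of suitable other
  positive elements. It follows from unperforation and Riesz decomposition (\<open>Shen_step\<close>). The
  scale is taken care of by a dimension vector at each stage: a vector \<open>x\<close> of a stage lies in the
  scale if it is dominated by the dimension vector, and every member of the scale is of this form
  at some stage (\<open>Bratteli_data\<close>).

  With the dimension vectors as the sizes of matrix algebras, the matrices of the diagram
  are realised by block diagonal embeddings of direct sums of matrix algebras. For these it is
  evident that they are contractive, as they act on disjoint sets of coordinates, and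
  that they take the identities of the summands to diagonal idempotents, which are hermitian. So the
  completed direct limit \<open>B\<close> is a spatial \<open>L\<^sup>p\<close> AF algebra.

  It remains to compute \<open>K\<^sub>0\<close> of the limit. By the definition of \<open>K\<^sub>0\<close> for algebras without a unit,
  this concerns idempotents in matrix rings over the unitizations. Two perturbation arguments in
  complete normed rings show that their equivalence classes are the limit of those of the stages: a
  nearly idempotent element is close to an idempotent, by Newton iteration
  (\<open>idempotent_near\<close>), and two elements that are nearly inverse to each other between two
  idempotents show that these are equivalent, by the Neumann series (\<open>equivalent_if_nearly_inverse\<close>).
  Hence every idempotent over the limit is equivalent to one from a stage
  (\<open>idempotent_from_stage\<close>), and an equivalence in the limit holds already at a stage
  (\<open>stage_rel_descends\<close>). At a stage, idempotents are classified by the traces of their components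
  (\<open>idem_rel_MU_iff\<close>), and the block embeddings act on the vectors of traces by the matrices of the
  diagram. The combination of the generators of \<open>G\<close> with these traces as coefficients is therefore
  an invariant that, together with the trace of the scalar part, classifies the idempotents over
  the unitization of the limit (\<open>lim_rel_iff\<close>).

  Such a classifying invariant determines the Grothendieck group at once, because the monoid of
  equivalence classes embeds into a group (\<open>K0_isomorphic_if_classified\<close>). Finally, the idempotents
  over the algebra itself are those with scalar part zero; their traces are arbitrary vectors
  of natural numbers for matrices of arbitrary size, and are those dominated by the dimension vector
  for matrices of size one. This identifies the positive cone and the scale.\<close>

section \<open>Integer combinations in an abelian group\<close>

text \<open>The coefficients \<open>a\<close> and the family \<open>g\<close> are functions on all of \<open>nat\<close>, of which only the
  values below \<open>n\<close> count. This makes it possible to enlarge and to compose families without a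
  change of type.\<close>
primrec (in comm_group) lincomb :: "nat \<Rightarrow> (nat \<Rightarrow> 'a) \<Rightarrow> (nat \<Rightarrow> int) \<Rightarrow> 'a" where
  "lincomb 0 g a = \<one>"
| "lincomb (Suc n) g a = lincomb n g a \<otimes> g n [^] a n"

text \<open>Matrices of refinements have entries in \<open>nat\<close>, with \<open>M i j\<close> the multiplicity of the old
  index \<open>j\<close> in the new index \<open>i\<close>, while the vectors to which they are applied are integer
  relations and may have negative entries.\<close>
definition mat_vec :: "nat \<Rightarrow> (nat \<Rightarrow> nat \<Rightarrow> nat) \<Rightarrow> (nat \<Rightarrow> int) \<Rightarrow> nat \<Rightarrow> int" where
  "mat_vec n M a i = (\<Sum>j<n. int (M i j) * a j)"

context comm_group begin

lemma lincomb_closed: "(\<And>i. i < n \<Longrightarrow> g i \<in> carrier G) \<Longrightarrow> lincomb n g a \<in> carrier G"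
  by (induction n) auto

lemma lincomb_cong: "(\<And>i. i < n \<Longrightarrow> g i [^] a i = h i [^] b i) \<Longrightarrow> lincomb n g a = lincomb n h b"
  by (induction n) auto

lemma lincomb_zero: "(\<And>i. i < n \<Longrightarrow> a i = 0) \<Longrightarrow> lincomb n g a = \<one>"
  by (induction n) auto

lemma lincomb_add:
  "(\<And>i. i < n \<Longrightarrow> g i \<in> carrier G) \<Longrightarrow> lincomb n g (\<lambda>i. a i + b i) = lincomb n g a \<otimes> lincomb n g b"
proof (induction n)
  case (Suc n)
  then have "lincomb n g a \<in> carrier G" "lincomb n g b \<in> carrier G" "g n \<in> carrier G"
    by (auto intro: lincomb_closed)
  with Suc show ?case by (simp add: int_pow_mult m_ac)
qed simp

lemma lincomb_uminus:
  "(\<And>i. i < n \<Longrightarrow> g i \<in> carrier G) \<Longrightarrow> lincomb n g (\<lambda>i. - a i) = inv (lincomb n g a)"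
proof (induction n)
  case (Suc n)
  then have "lincomb n g a \<in> carrier G" "g n \<in> carrier G"
    by (auto intro: lincomb_closed)
  with Suc show ?case by (simp add: int_pow_neg inv_mult)
qed simp

lemma lincomb_diff:
  assumes "\<And>i. i < n \<Longrightarrow> g i \<in> carrier G"
  shows "lincomb n g (\<lambda>i. a i - b i) = lincomb n g a \<otimes> inv (lincomb n g b)"
  using lincomb_add[of n g a "\<lambda>i. - b i"] lincomb_uminus[of n g b] assms by simp

lemma lincomb_scale:
  "(\<And>i. i < n \<Longrightarrow> g i \<in> carrier G) \<Longrightarrow> lincomb n g (\<lambda>i. c * a i) = lincomb n g a [^] c"
proof (induction n)
  case (Suc n)
  then have "lincomb n g a \<in> carrier G" "g n \<in> carrier G"
    by (auto intro: lincomb_closed)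
  with Suc show ?case by (simp add: int_pow_distrib int_pow_pow mult.commute)
qed simp

lemma lincomb_single:
  "\<lbrakk>\<And>i. i < n \<Longrightarrow> g i \<in> carrier G; j < n\<rbrakk> \<Longrightarrow> lincomb n g (\<lambda>i. if i = j then c else 0) = g j [^] c"
proof (induction n)
  case (Suc n)
  show ?case
  proof (cases "j = n")
    case True
    then have "lincomb n g (\<lambda>i. if i = j then c else 0) = \<one>" by (intro lincomb_zero) auto
    with True Suc.prems show ?thesis by simp
  next
    case False
    with Suc show ?thesis by simp
  qed
qed simp

lemma lincomb_append:
  assumes "\<And>i. i < n + m \<Longrightarrow> g i \<in> carrier G"
  shows "lincomb (n + m) g a = lincomb n g a \<otimes> lincomb m (\<lambda>i. g (n + i)) (\<lambda>i. a (n + i))"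
  using assms
proof (induction m)
  case 0
  then show ?case by (simp add: lincomb_closed)
next
  case (Suc m)
  then have "lincomb n g a \<in> carrier G" "g (n + m) \<in> carrier G"
    "lincomb m (\<lambda>i. g (n + i)) (\<lambda>i. a (n + i)) \<in> carrier G"
    by (auto intro!: lincomb_closed)
  with Suc show ?case by (simp add: m_assoc)
qed

text \<open>Substituting the expressions of the \<open>g j\<close> in terms of the \<open>h i\<close> multiplies the vector of
  coefficients by the matrix of these expressions.\<close>
lemma lincomb_compose:
  assumes "\<And>i. i < m \<Longrightarrow> h i \<in> carrier G"
    and "\<And>j. j < n \<Longrightarrow> g j = lincomb m h (\<lambda>i. int (M i j))"
  shows "lincomb n g a = lincomb m h (mat_vec n M a)"
  using assms(2)
proof (induction n)
  case 0
  then show ?case by (simp add: mat_vec_def lincomb_zero)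
next
  case (Suc n)
  have "lincomb (Suc n) g a = lincomb m h (mat_vec n M a) \<otimes> lincomb m h (\<lambda>i. int (M i n)) [^] a n"
    using Suc by simp
  also have "\<dots> = lincomb m h (\<lambda>i. mat_vec n M a i + a n * int (M i n))"
    using assms(1) by (simp add: lincomb_add lincomb_scale)
  finally show ?case by (simp add: mat_vec_def mult.commute)
qed

end

lemma mat_vec_compose:
  "mat_vec n (\<lambda>i j. \<Sum>t<m. N i t * M t j) a i = mat_vec m N (mat_vec n M a) i"
proof -
  have "mat_vec n (\<lambda>i j. \<Sum>t<m. N i t * M t j) a i = (\<Sum>j<n. \<Sum>t<m. int (N i t) * int (M t j) * a j)"
    by (simp add: mat_vec_def sum_distrib_right)
  also have "\<dots> = (\<Sum>t<m. \<Sum>j<n. int (N i t) * int (M t j) * a j)" by (rule sum.swap)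
  finally show ?thesis by (simp add: mat_vec_def sum_distrib_left mult.assoc)
qed

lemma mat_vec_cong: "(\<And>j. j < n \<Longrightarrow> a j = b j) \<Longrightarrow> mat_vec n M a i = mat_vec n M b i"
  by (simp add: mat_vec_def)

lemma mat_vec_diff: "mat_vec n M (\<lambda>j. a j - b j) i = mat_vec n M a i - mat_vec n M b i"
  by (simp add: mat_vec_def right_diff_distrib sum_subtractf)

lemma mat_vec_add: "mat_vec n M (\<lambda>j. a j + b j) i = mat_vec n M a i + mat_vec n M b i"
  by (simp add: mat_vec_def distrib_left sum.distrib)

lemma mat_vec_single: "j < n \<Longrightarrow> mat_vec n M (\<lambda>i. if i = j then 1 else 0) i = int (M i j)"
  by (simp add: mat_vec_def if_distrib sum.delta cong: if_cong)

section \<open>Riesz decomposition and Shen's lemma\<close>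

context scaled_Riesz_group begin

lemma pos_carrier: "x \<in> pos G \<Longrightarrow> x \<in> carrier G"
  using pos_subset by blast

lemma pos_int_pow: "\<lbrakk>x \<in> pos G; 0 \<le> c\<rbrakk> \<Longrightarrow> x [^] (c::int) \<in> pos G"
proof -
  assume x: "x \<in> pos G" and c: "0 \<le> c"
  have "x [^] (n::nat) \<in> pos G" for n
    by (induction n) (use x one_pos pos_closed in auto)
  then show ?thesis using c by (metis pow_nat)
qed

lemma lincomb_pos: "(\<And>i. i < n \<Longrightarrow> g i \<in> pos G \<and> 0 \<le> a i) \<Longrightarrow> lincomb n g a \<in> pos G"
  by (induction n) (use one_pos pos_closed pos_int_pow in auto)

lemma lincomb_closed': "(\<And>i. i < n \<Longrightarrow> g i \<in> pos G) \<Longrightarrow> lincomb n g a \<in> carrier G"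
  by (intro lincomb_closed pos_carrier) auto

lemma unperforated_int: "\<lbrakk>x \<in> carrier G; 0 < c; x [^] (c::int) \<in> pos G\<rbrakk> \<Longrightarrow> x \<in> pos G"
  using unperforated[of x "nat c"] by (simp add: pow_nat)

text \<open>Interpolation between the lower bounds \<open>0\<close>, \<open>x - z\<close> and the upper bounds \<open>x\<close>, \<open>y\<close> yields the
  part \<open>a\<close> of \<open>x\<close> that lies below \<open>y\<close>; the rest \<open>x - a\<close> then lies below \<open>z\<close>.\<close>
lemma Riesz_decomposition2:
  assumes x: "x \<in> pos G" and y: "y \<in> pos G" and z: "z \<in> pos G" and le: "y \<otimes> z \<otimes> inv x \<in> pos G"
  obtains a where "a \<in> pos G" "y \<otimes> inv a \<in> pos G" "x \<otimes> inv a \<in> pos G"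
    "z \<otimes> inv (x \<otimes> inv a) \<in> pos G"
proof -
  note [simp] = pos_carrier[OF x] pos_carrier[OF y] pos_carrier[OF z]
  have "x \<otimes> inv (x \<otimes> inv z) = z"
    by (simp add: inv_mult m_assoc[symmetric])
  moreover have "y \<otimes> inv (x \<otimes> inv z) = y \<otimes> z \<otimes> inv x"
    by (simp add: inv_mult m_ac)
  ultimately obtain a where a: "a \<in> carrier G" "pre_le G \<one> a" "pre_le G (x \<otimes> inv z) a"
      "pre_le G a x" "pre_le G a y"
    using interpolation[of \<one> "x \<otimes> inv z" x y] x y z le by (auto simp: pre_le_def)
  have "z \<otimes> inv (x \<otimes> inv a) = a \<otimes> inv (x \<otimes> inv z)"
    using a(1) by (simp add: inv_mult m_ac)
  with a that[of a] show ?thesis by (simp add: pre_le_def)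
qed

text \<open>The case of finitely many summands, by splitting off the last one.\<close>
lemma Riesz_decomposition:
  "\<lbrakk>\<And>j. j < n \<Longrightarrow> g j \<in> pos G; x \<in> pos G; lincomb n g (\<lambda>_. 1) \<otimes> inv x \<in> pos G\<rbrakk> \<Longrightarrow>
    \<exists>h. (\<forall>j<n. h j \<in> pos G \<and> g j \<otimes> inv h j \<in> pos G) \<and> x = lincomb n h (\<lambda>_. 1)"
proof (induction n arbitrary: x)
  case 0
  then have "x = \<one>" using proper[of x] pos_carrier[of x] by simp
  then show ?case by simp
next
  case (Suc n)
  have gn: "g n \<in> pos G" and l: "lincomb n g (\<lambda>_. 1) \<in> pos G"
    using Suc.prems by (auto intro!: lincomb_pos)
  obtain a where a: "a \<in> pos G" "lincomb n g (\<lambda>_. 1) \<otimes> inv a \<in> pos G" "x \<otimes> inv a \<in> pos G"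
    "g n \<otimes> inv (x \<otimes> inv a) \<in> pos G"
    using Riesz_decomposition2[OF Suc.prems(2) l gn] Suc.prems(3) pos_carrier[OF gn] by auto
  obtain h where h: "\<forall>j<n. h j \<in> pos G \<and> g j \<otimes> inv h j \<in> pos G" "a = lincomb n h (\<lambda>_. 1)"
    using Suc.IH[of a] Suc.prems(1) a by auto
  let ?h = "h(n := x \<otimes> inv a)"
  have "lincomb n ?h (\<lambda>_. 1) = a" unfolding h(2) by (rule lincomb_cong) auto
  moreover have "a \<otimes> (x \<otimes> inv a) = x"
    using pos_carrier[OF a(1)] pos_carrier[OF Suc.prems(2)] by (metis inv_closed m_closed m_comm inv_solve_right')
  ultimately have "x = lincomb (Suc n) ?h (\<lambda>_. 1)"
    using pos_carrier[OF a(3)] by simp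
  moreover have "\<forall>j<Suc n. ?h j \<in> pos G \<and> g j \<otimes> inv ?h j \<in> pos G"
    using h(1) a by (auto simp: less_Suc_eq)
  ultimately show ?case by blast
qed

text \<open>The simplicial group generated freely by the indices below \<open>n\<close>, which \<open>g\<close> maps to \<open>G\<close>, is
  mapped by \<open>M\<close> to the one on the indices below \<open>m\<close>, compatibly with the maps to \<open>G\<close>. Chains of
  refinements are the Bratteli diagrams sought.\<close>
definition refines ::
    "nat \<Rightarrow> (nat \<Rightarrow> 'a) \<Rightarrow> nat \<Rightarrow> (nat \<Rightarrow> 'a) \<Rightarrow> (nat \<Rightarrow> nat \<Rightarrow> nat) \<Rightarrow> bool" where
  "refines n g m h M \<longleftrightarrow> (\<forall>i<m. h i \<in> pos G) \<and> (\<forall>j<n. g j = lincomb m h (\<lambda>i. int (M i j)))"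

lemma refines_lincomb: "refines n g m h M \<Longrightarrow> lincomb n g a = lincomb m h (mat_vec n M a)"
  by (intro lincomb_compose) (auto simp: refines_def pos_carrier)

lemma refines_id: "(\<And>i. i < n \<Longrightarrow> g i \<in> pos G) \<Longrightarrow> refines n g n g (\<lambda>i j. if i = j then 1 else 0)"
  unfolding refines_def
proof (intro conjI allI impI)
  fix j assume g: "\<And>i. i < n \<Longrightarrow> g i \<in> pos G" and j: "j < n"
  have "(\<lambda>i. int (if i = j then 1 else 0)) = (\<lambda>i. if i = j then 1 else 0)" by auto
  then show "g j = lincomb n g (\<lambda>i. int (if i = j then 1 else 0))"
    using lincomb_single[of n g j 1] g j pos_carrier by simp
qed

lemma refines_trans:
  assumes "refines n g m h M" "refines m h l k N"
  shows "refines n g l k (\<lambda>i j. \<Sum>t<m. N i t * M t j)"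
  unfolding refines_def
proof (intro conjI allI impI)
  fix j assume "j < n"
  then have "g j = lincomb m h (\<lambda>i. int (M i j))" using assms(1) by (simp add: refines_def)
  also have "\<dots> = lincomb l k (mat_vec m N (\<lambda>i. int (M i j)))" by (rule refines_lincomb[OF assms(2)])
  finally show "g j = lincomb l k (\<lambda>i. int (\<Sum>t<m. N i t * M t j))"
    by (simp add: mat_vec_def[abs_def])
qed (use assms in \<open>auto simp: refines_def\<close>)

text \<open>A relation \<open>\<Sum> a\<^sub>j g\<^sub>j = 0\<close> whose largest coefficient in absolute value is \<open>a\<^sub>r > 0\<close> gives
  \<open>a\<^sub>r g\<^sub>r \<le> a\<^sub>r (\<Sum> g\<^sub>j)\<close>, where the sum is over the \<open>j\<close> with \<open>a\<^sub>j < 0\<close>. As \<open>G\<close> is unperforated,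
  \<open>g\<^sub>r\<close> is at most this sum, and Riesz decomposition writes it as \<open>\<Sum> h\<^sub>j\<close> with \<open>0 \<le> h\<^sub>j \<le> g\<^sub>j\<close>.
  Replacing each \<open>g\<^sub>j\<close> with \<open>a\<^sub>j < 0\<close> by \<open>g\<^sub>j - h\<^sub>j\<close> and \<open>h\<^sub>j\<close>, and \<open>g\<^sub>r\<close> by nothing, turns the
  coefficients into the old ones without \<open>a\<^sub>r\<close>, together with the numbers \<open>a\<^sub>j + a\<^sub>r\<close>, which are
  smaller than \<open>a\<^sub>r\<close> in absolute value. So the largest absolute value occurs once less.

  The new family has \<open>2 n\<close> members: the index \<open>n + j\<close> is that of \<open>h\<^sub>j\<close>, and indices without a use
  carry the neutral element.\<close>
lemma Shen_step:
  assumes g: "\<And>j. j < n \<Longrightarrow> g j \<in> pos G" and a: "lincomb n g a = \<one>"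
    and bound: "\<And>i. i < n \<Longrightarrow> \<bar>a i\<bar> \<le> a r" and r: "r < n" and pos: "a r > 0"
  shows "\<exists>h M. refines n g (n + n) h M \<and>
    (\<forall>i<n+n. \<bar>mat_vec n M a i\<bar> \<le> a r) \<and>
    {i. i < n + n \<and> \<bar>mat_vec n M a i\<bar> = a r} = {i. i < n \<and> \<bar>a i\<bar> = a r} - {r}"
proof -
  note gc = pos_carrier[OF g]
  define s where "s = (\<lambda>i. if a i < 0 then 1 else 0 :: int)"
  define g' where "g' = (\<lambda>i. if a i < 0 then g i else \<one>)"
  have g': "g' i \<in> pos G" if "i < n" for i using that g one_pos by (simp add: g'_def)
  have s_g': "lincomb n g s = lincomb n g' (\<lambda>_. 1)"
    by (rule lincomb_cong) (auto simp: s_def g'_def gc)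
  \<comment> \<open>Multiplied by \<open>a r\<close>, the combination \<open>b\<close> may be increased by the relation \<open>a\<close>, after which
    all its coefficients are nonnegative.\<close>
  define b where "b = (\<lambda>i. s i - (if i = r then 1 else 0))"
  have "lincomb n g b [^] a r = lincomb n g (\<lambda>i. a r * b i + a i)"
    using gc a by (simp add: lincomb_add lincomb_scale lincomb_closed)
  also have "\<dots> \<in> pos G"
  proof (rule lincomb_pos)
    fix i assume "i < n"
    then show "g i \<in> pos G \<and> 0 \<le> a r * b i + a i"
      using g bound[of i] pos by (auto simp: b_def s_def)
  qed
  finally have "lincomb n g b \<in> pos G"
    using unperforated_int[of "lincomb n g b" "a r"] gc pos lincomb_closed by auto
  moreover have "lincomb n g b = lincomb n g' (\<lambda>_. 1) \<otimes> inv (g r)"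
    unfolding b_def using gc r by (simp add: lincomb_diff lincomb_single s_g'[symmetric])
  ultimately obtain hh where hh: "\<forall>j<n. hh j \<in> pos G \<and> g' j \<otimes> inv hh j \<in> pos G"
      "g r = lincomb n hh (\<lambda>_. 1)"
    using Riesz_decomposition[of n g' "g r"] g' g[OF r] by auto
  have hh1: "hh j = \<one>" if "j < n" "\<not> a j < 0" for j
    using hh(1) that proper[of "hh j"] by (auto simp: g'_def pos_carrier)
  define h where "h = (\<lambda>i. if i < n then (if i = r then \<one> else if a i < 0 then g i \<otimes> inv (hh i) else g i)
    else hh (i - n))"
  define M where "M = (\<lambda>i j. if i < n then (if i = j \<and> j \<noteq> r then 1 else 0)
    else (if a (i - n) < 0 \<and> (j = i - n \<or> j = r) then 1 else 0) :: nat)"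
  have h: "h i \<in> pos G" if "i < n + n" for i
    using that hh(1) g one_pos by (auto simp: h_def g'_def split: if_splits)
  note hc = pos_carrier[OF h]
  have "refines n g (n + n) h M"
    unfolding refines_def
  proof (intro conjI allI impI)
    fix j assume j: "j < n"
    consider "j = r" | "j \<noteq> r" "a j < 0" | "j \<noteq> r" "\<not> a j < 0" by blast
    then show "g j = lincomb (n + n) h (\<lambda>i. int (M i j))"
    proof cases
      case 1
      have "lincomb n h (\<lambda>i. int (M i j)) = \<one>"
        by (rule lincomb_zero) (auto simp: M_def 1)
      moreover have "lincomb n (\<lambda>i. h (n + i)) (\<lambda>i. int (M (n + i) j)) = lincomb n hh (\<lambda>_. 1)"
        using hh1 by (intro lincomb_cong) (auto simp: M_def h_def 1)
      ultimately show ?thesis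
        using lincomb_append[of n n h "\<lambda>i. int (M i j)"] hc hh(2) 1 g[OF r, THEN pos_carrier] by simp
    next
      case 2
      have "(\<lambda>i. int (M i j)) = (\<lambda>i. (if i = j then 1 else 0) + (if i = n + j then 1 else 0))"
        using 2 j pos by (auto simp: M_def fun_eq_iff)
      then have "lincomb (n + n) h (\<lambda>i. int (M i j)) = h j \<otimes> h (n + j)"
        using hc j by (simp add: lincomb_add lincomb_single)
      also have "\<dots> = g j"
        using 2 j gc[OF j] hh(1) pos_carrier[of "hh j"] by (simp add: h_def m_assoc)
      finally show ?thesis ..
    next
      case 3
      have "(\<lambda>i. int (M i j)) = (\<lambda>i. if i = j then 1 else 0)"
        using 3 j by (auto simp: M_def fun_eq_iff)
      then have "lincomb (n + n) h (\<lambda>i. int (M i j)) = h j"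
        using hc j by (simp add: lincomb_single)
      then show ?thesis using 3 j by (simp add: h_def)
    qed
  qed (use h in auto)
  moreover have lo: "mat_vec n M a i = (if i = r then 0 else a i)" if "i < n" for i
  proof -
    have "mat_vec n M a i = (\<Sum>j<n. if j = i then (if i = r then 0 else a i) else 0)"
      unfolding mat_vec_def by (rule sum.cong) (auto simp: M_def that)
    then show ?thesis using that by simp
  qed
  have hi: "mat_vec n M a (n + t) = (if a t < 0 then a t + a r else 0)" if "t < n" for t
  proof (cases "a t < 0")
    case True
    then have "mat_vec n M a (n + t) = (\<Sum>j<n. (if j = t then a t else 0) + (if j = r then a r else 0))"
      unfolding mat_vec_def using pos by (intro sum.cong) (auto simp: M_def)
    then show ?thesis using that r True by (simp add: sum.distrib)
  qed (simp add: mat_vec_def M_def)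
  have split: "i < n + n \<longleftrightarrow> i < n \<or> (\<exists>t<n. i = n + t)" for i
    by (auto intro: exI[of _ "i - n"])
  have hi_less: "\<bar>mat_vec n M a (n + t)\<bar> < a r" if "t < n" for t
    using hi[OF that] bound[OF that] pos by auto
  have "\<bar>mat_vec n M a i\<bar> \<le> a r" if "i < n + n" for i
    using that[unfolded split]
  proof (elim disjE exE conjE)
    assume "i < n" then show ?thesis using lo[of i] bound[of i] pos by auto
  next
    fix t assume "t < n" "i = n + t" then show ?thesis using hi_less[of t] by simp
  qed
  moreover have "i < n + n \<and> \<bar>mat_vec n M a i\<bar> = a r \<longleftrightarrow> i < n \<and> \<bar>a i\<bar> = a r \<and> i \<noteq> r" for i
  proof (cases "i < n")
    case True
    then show ?thesis using lo[of i] pos by auto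
  next
    case False
    then show ?thesis by (metis split hi_less less_irrefl)
  qed
  then have "{i. i < n + n \<and> \<bar>mat_vec n M a i\<bar> = a r} = {i. i < n \<and> \<bar>a i\<bar> = a r} - {r}" by blast
  ultimately show ?thesis by blast
qed

text \<open>Induction on the bound \<open>b\<close> of the coefficients, and for a given bound on the number \<open>c\<close> of
  coefficients that attain it.\<close>
lemma Shen_kill_bounded:
  "\<lbrakk>\<And>j. j < n \<Longrightarrow> g j \<in> pos G; lincomb n g a = \<one>; \<And>i. i < n \<Longrightarrow> \<bar>a i\<bar> \<le> int b\<rbrakk> \<Longrightarrow>
    \<exists>m h M. refines n g m h M \<and> (\<forall>i<m. mat_vec n M a i = 0)"
proof (induction b arbitrary: n g a)
  case 0
  then have "refines n g n g (\<lambda>i j. if i = j then 1 else 0)" by (intro refines_id) auto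
  moreover have "\<forall>i<n. mat_vec n (\<lambda>i j. if i = j then 1 else 0) a i = 0"
    using 0(3) by (auto simp: mat_vec_def)
  ultimately show ?case by blast
next
  case (Suc b)
  have "\<lbrakk>\<And>j. j < n \<Longrightarrow> g j \<in> pos G; lincomb n g a = \<one>; \<And>i. i < n \<Longrightarrow> \<bar>a i\<bar> \<le> int (Suc b);
      card {i. i < n \<and> \<bar>a i\<bar> = int (Suc b)} = c\<rbrakk> \<Longrightarrow>
    \<exists>m h M. refines n g m h M \<and> (\<forall>i<m. mat_vec n M a i = 0)" for c
  proof (induction c arbitrary: n g a)
    case 0
    then have *: "\<bar>a i\<bar> \<noteq> int (Suc b)" if "i < n" for i using that by auto
    have "\<bar>a i\<bar> \<le> int b" if "i < n" for i using "0.prems"(3)[OF that] *[OF that] by simp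
    then show ?case using Suc.IH[of n g a] 0 by blast
  next
    case (Suc c)
    then have "{i. i < n \<and> \<bar>a i\<bar> = int (Suc b)} \<noteq> {}" by (metis card.empty nat.distinct(1))
    then obtain r where r: "r < n" "\<bar>a r\<bar> = int (Suc b)" by blast
    \<comment> \<open>The step above needs a positive extreme coefficient, so that the sign of the relation may
      have to be changed.\<close>
    define e :: int where "e = (if a r > 0 then 1 else - 1)"
    define a' where "a' = (\<lambda>i. e * a i)"
    have ar: "a' r = int (Suc b)" using r by (auto simp: a'_def e_def)
    have abs: "\<bar>a' i\<bar> = \<bar>a i\<bar>" for i by (auto simp: a'_def e_def)
    have "lincomb n g a' = \<one>"
      unfolding a'_def using lincomb_scale[of n g e a] Suc.prems pos_carrier by simp
    then obtain h M where hM: "refines n g (n + n) h M"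
      "\<forall>i<n+n. \<bar>mat_vec n M a' i\<bar> \<le> int (Suc b)"
      "{i. i < n + n \<and> \<bar>mat_vec n M a' i\<bar> = int (Suc b)} = {i. i < n \<and> \<bar>a i\<bar> = int (Suc b)} - {r}"
      using Shen_step[of n g a' r] Suc.prems r(1) ar abs by auto
    have "card {i. i < n + n \<and> \<bar>mat_vec n M a' i\<bar> = int (Suc b)} = c"
      unfolding hM(3) using Suc.prems(4) r by (subst card_Diff_singleton) auto
    moreover have "lincomb (n + n) h (mat_vec n M a') = \<one>"
      using refines_lincomb[OF hM(1), of a'] \<open>lincomb n g a' = \<one>\<close> by simp
    ultimately obtain m k N where N: "refines (n + n) h m k N"
        "\<forall>i<m. mat_vec (n + n) N (mat_vec n M a') i = 0"
      using Suc.IH[of "n + n" h "mat_vec n M a'"] hM by (auto simp: refines_def)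
    let ?P = "\<lambda>i j. \<Sum>t<n + n. N i t * M t j"
    have "mat_vec n ?P a i = e * mat_vec n ?P a' i" for i
      by (auto simp: mat_vec_def a'_def e_def sum_negf)
    then have "\<forall>i<m. mat_vec n ?P a i = 0"
      using N(2) by (simp add: mat_vec_compose)
    then show ?case using refines_trans[OF hM(1) N(1)] by blast
  qed
  then show ?case using Suc.prems by blast
qed

lemma Shen_kill:
  assumes "\<And>j. j < n \<Longrightarrow> g j \<in> pos G" "lincomb n g a = \<one>"
  shows "\<exists>m h M. refines n g m h M \<and> (\<forall>i<m. mat_vec n M a i = 0)"
proof -
  have "\<bar>a i\<bar> \<le> int (\<Sum>i<n. nat \<bar>a i\<bar>)" if "i < n" for i
    using member_le_sum[of i "{..<n}" "\<lambda>i. \<bar>a i\<bar>"] that by (simp del: of_nat_sum add: of_nat_sum[where ?'a = int])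
  then show ?thesis using Shen_kill_bounded assms by blast
qed

end

section \<open>Subgroups of a finitely generated free abelian group\<close>

text \<open>Subgroups of the integer vectors are described as sets that contain zero and are closed
  under differences.\<close>
lemma diff_closed_multiple:
  fixes H :: "(nat \<Rightarrow> int) set"
  assumes 0: "(\<lambda>_. 0) \<in> H" and diff: "\<And>a b. \<lbrakk>a \<in> H; b \<in> H\<rbrakk> \<Longrightarrow> (\<lambda>i. a i - b i) \<in> H"
    and a: "a \<in> H"
  shows "(\<lambda>i. q * a i) \<in> H"
proof (induction q rule: int_induct[where k = 0])
  case base
  then show ?case using 0 by simp
next
  case (step1 q)
  have "(\<lambda>i. - a i) \<in> H" using diff[OF 0 a] by simp
  from diff[OF step1(2) this] show ?case by (simp add: algebra_simps)
next
  case (step2 q)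
  from diff[OF step2(2) a] show ?case by (simp add: algebra_simps)
qed

text \<open>The usual induction on the rank: the last coordinates of the members of \<open>K\<close> are the
  multiples of the least positive one, and the members with last coordinate zero form a subgroup
  of smaller rank. That \<open>B\<close> generates \<open>K\<close> is expressed by saying that \<open>K\<close> is contained in every
  subgroup \<open>H\<close> that contains \<open>B\<close>; in the application, \<open>H\<close> consists of the relations that a
  refinement kills.\<close>
lemma int_subgroup_finitely_generated:
  fixes K :: "(nat \<Rightarrow> int) set"
  assumes "(\<lambda>_. 0) \<in> K" "\<And>a b. \<lbrakk>a \<in> K; b \<in> K\<rbrakk> \<Longrightarrow> (\<lambda>i. a i - b i) \<in> K"
    "\<And>a i. \<lbrakk>a \<in> K; i \<ge> n\<rbrakk> \<Longrightarrow> a i = 0"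
  shows "\<exists>B. finite B \<and> B \<subseteq> K \<and>
    (\<forall>H. (\<lambda>_. 0) \<in> H \<and> (\<forall>a\<in>H. \<forall>b\<in>H. (\<lambda>i. a i - b i) \<in> H) \<and> B \<subseteq> H \<longrightarrow> K \<subseteq> H)"
  using assms
proof (induction n arbitrary: K)
  case 0
  then have "K \<subseteq> {\<lambda>_. 0}" by auto
  then show ?case by (intro exI[of _ "{}"]) auto
next
  case (Suc n)
  define K0 where "K0 = {a \<in> K. a n = 0}"
  have "\<exists>B. finite B \<and> B \<subseteq> K0 \<and>
    (\<forall>H. (\<lambda>_. 0) \<in> H \<and> (\<forall>a\<in>H. \<forall>b\<in>H. (\<lambda>i. a i - b i) \<in> H) \<and> B \<subseteq> H \<longrightarrow> K0 \<subseteq> H)"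
  proof (rule Suc.IH)
    fix a i assume "a \<in> K0" "i \<ge> n"
    then show "a i = 0" using Suc.prems(3)[of a i] by (cases "i = n") (auto simp: K0_def)
  qed (use Suc.prems in \<open>auto simp: K0_def\<close>)
  then obtain B where B': "finite B" "B \<subseteq> K0"
    "\<forall>H. (\<lambda>_. 0) \<in> H \<and> (\<forall>a\<in>H. \<forall>b\<in>H. (\<lambda>i. a i - b i) \<in> H) \<and> B \<subseteq> H \<longrightarrow> K0 \<subseteq> H"
    by (elim exE conjE)
  have B: "K0 \<subseteq> H"
    if "(\<lambda>_. 0) \<in> H" "\<And>a b. \<lbrakk>a \<in> H; b \<in> H\<rbrakk> \<Longrightarrow> (\<lambda>i. a i - b i) \<in> H" "B \<subseteq> H" for H
    using B'(3)[rule_format, of H] that by blast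
  show ?case
  proof (cases "K = K0")
    case True
    show ?thesis unfolding True by (rule exI[of _ B], intro conjI B')
  next
    case False
    then obtain a0 where a0: "a0 \<in> K" "a0 n \<noteq> 0" by (auto simp: K0_def)
    have "\<exists>d>0. \<exists>a\<in>K. a n = int d"
    proof (cases "a0 n > 0")
      case True
      then show ?thesis using a0 by (intro exI[of _ "nat (a0 n)"]) auto
    next
      case False
      have "(\<lambda>i. - a0 i) \<in> K" using Suc.prems(2)[OF Suc.prems(1) a0(1)] by simp
      then show ?thesis using a0 False by (intro exI[of _ "nat (- a0 n)"]) (auto intro!: bexI)
    qed
    define d where "d = (LEAST d. d > 0 \<and> (\<exists>a\<in>K. a n = int d))"
    have d: "d > 0" "\<exists>a\<in>K. a n = int d"
      using LeastI_ex[OF \<open>\<exists>d>0. \<exists>a\<in>K. a n = int d\<close>] by (auto simp: d_def)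
    have least: "d \<le> c" if "c > 0" "a \<in> K" "a n = int c" for a c
      unfolding d_def using that by (intro Least_le) auto
    obtain a1 where a1: "a1 \<in> K" "a1 n = int d" using d(2) by blast
    have "K \<subseteq> H" if H: "(\<lambda>_. 0) \<in> H" "\<And>a b. \<lbrakk>a \<in> H; b \<in> H\<rbrakk> \<Longrightarrow> (\<lambda>i. a i - b i) \<in> H"
      "insert a1 B \<subseteq> H" for H
    proof
      fix a assume a: "a \<in> K"
      define q where "q = a n div int d"
      have a1H: "a1 \<in> H" using H(3) by blast
      have qa1: "(\<lambda>i. q * a1 i) \<in> K" "(\<lambda>i. - q * a1 i) \<in> H"
        by (rule diff_closed_multiple[OF Suc.prems(1,2) a1(1)], assumption+)
           (rule diff_closed_multiple[OF H(1,2) a1H], assumption+)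
      define c where "c = (\<lambda>i. a i - q * a1 i)"
      have cK: "c \<in> K" unfolding c_def by (rule Suc.prems(2)[OF a qa1(1)])
      have cn: "c n = a n mod int d" by (simp add: c_def q_def a1 minus_div_mult_eq_mod)
      have "c n = 0"
      proof (rule ccontr)
        assume "c n \<noteq> 0"
        moreover have "0 \<le> c n" "c n < int d" unfolding cn using d(1) by auto
        ultimately show False using least[of "nat (c n)" c] cK by auto
      qed
      then have "c \<in> K0" using cK by (simp add: K0_def)
      moreover have "K0 \<subseteq> H" using H by (intro B) auto
      ultimately have "c \<in> H" by blast
      from H(2)[OF this qa1(2)] show "a \<in> H" by (simp add: c_def)
    qed
    moreover have "finite (insert a1 B)" "insert a1 B \<subseteq> K" using B'(1,2) a1(1) by (auto simp: K0_def)
    ultimately show ?thesis by (intro exI[of _ "insert a1 B"] conjI allI impI) simp_all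
  qed
qed

section \<open>The Effros-Handelman-Shen theorem\<close>

context scaled_Riesz_group begin

text \<open>A relation that has been killed stays so under further refinement, and the others remain
  relations. They can therefore be treated one after the other.\<close>
lemma Shen_kill_finite:
  assumes "finite B" "\<And>j. j < n \<Longrightarrow> g j \<in> pos G" "\<And>a. a \<in> B \<Longrightarrow> lincomb n g a = \<one>"
  shows "\<exists>m h M. refines n g m h M \<and> (\<forall>a\<in>B. \<forall>i<m. mat_vec n M a i = 0)"
  using assms(1,3)
proof (induction B rule: finite_induct)
  case empty
  then show ?case using refines_id[of n g] assms(2) by blast
next
  case (insert b B)
  then obtain m h M where M: "refines n g m h M" "\<forall>a\<in>B. \<forall>i<m. mat_vec n M a i = 0" by auto
  have "lincomb m h (mat_vec n M b) = \<one>" using refines_lincomb[OF M(1), of b] insert.prems by simp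
  then obtain l k N where N: "refines m h l k N" "\<forall>i<l. mat_vec m N (mat_vec n M b) i = 0"
    using Shen_kill[of m h "mat_vec n M b"] M(1) by (auto simp: refines_def)
  have "mat_vec m N (mat_vec n M a) i = 0" if "a \<in> B" "i < l" for a i
    using M(2) that mat_vec_cong[of m "mat_vec n M a" "\<lambda>_. 0" N i] by (simp add: mat_vec_def[of m N "\<lambda>_. 0"])
  then have "\<forall>a\<in>insert b B. \<forall>i<l. mat_vec n (\<lambda>i j. \<Sum>t<m. N i t * M t j) a i = 0"
    using N(2) by (simp add: mat_vec_compose)
  then show ?case using refines_trans[OF M(1) N(1)] by blast
qed

text \<open>The group of all relations between the \<open>g j\<close> is finitely generated, so that a single
  refinement kills it.\<close>
lemma Shen_kill_kernel:
  assumes g: "\<And>j. j < n \<Longrightarrow> g j \<in> pos G"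
  shows "\<exists>m h M. refines n g m h M \<and> (\<forall>a. lincomb n g a = \<one> \<longrightarrow> (\<forall>i<m. mat_vec n M a i = 0))"
proof -
  note gc = pos_carrier[OF g]
  define K where "K = {a. lincomb n g a = \<one> \<and> (\<forall>i\<ge>n. a i = 0)}"
  have "\<exists>B. finite B \<and> B \<subseteq> K \<and>
    (\<forall>H. (\<lambda>_. 0) \<in> H \<and> (\<forall>a\<in>H. \<forall>b\<in>H. (\<lambda>i. a i - b i) \<in> H) \<and> B \<subseteq> H \<longrightarrow> K \<subseteq> H)"
    by (rule int_subgroup_finitely_generated[of K n]) (use gc in \<open>auto simp: K_def lincomb_diff lincomb_zero\<close>)
  then obtain B where B: "finite B" "B \<subseteq> K"
    "\<forall>H. (\<lambda>_. 0) \<in> H \<and> (\<forall>a\<in>H. \<forall>b\<in>H. (\<lambda>i. a i - b i) \<in> H) \<and> B \<subseteq> H \<longrightarrow> K \<subseteq> H"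
    by (elim exE conjE)
  obtain m h M where M: "refines n g m h M" "\<forall>a\<in>B. \<forall>i<m. mat_vec n M a i = 0"
    using Shen_kill_finite[of B n g, OF B(1) g] B(2) unfolding K_def by blast
  have K: "K \<subseteq> {a. \<forall>i<m. mat_vec n M a i = 0}"
    by (rule B(3)[rule_format]) (use M(2) in \<open>auto simp: mat_vec_diff mat_vec_def[of _ _ "\<lambda>_. 0"]\<close>)
  have "mat_vec n M a i = 0" if "lincomb n g a = \<one>" "i < m" for a i
  proof -
    let ?a = "\<lambda>j. if j < n then a j else 0"
    have "lincomb n g ?a = \<one>" unfolding that(1)[symmetric] by (rule lincomb_cong) auto
    then have "?a \<in> K" by (simp add: K_def)
    then show ?thesis using K that(2) mat_vec_cong[of n a ?a M i] by auto
  qed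
  then show ?thesis using M(1) by blast
qed

text \<open>One step of the construction of the diagram. The given data are the generators \<open>g\<close> of a
  stage, its dimension vector \<open>u\<close>, whose combination \<open>U\<close> lies in the scale, and an element \<open>s\<close> of
  the scale that the next stage has to contain. With \<open>t\<close> an upper bound of \<open>U\<close> and \<open>s\<close> in the
  scale, all relations are killed between the elements \<open>g\<close>, \<open>t - U\<close>, \<open>s\<close> and \<open>t - s\<close>. The
  dimension vector \<open>v\<close> of the new stage is the image of that of \<open>t = U + (t - U)\<close>, so that it
  dominates the image of \<open>u\<close>. The relation \<open>U + (t - U) = s + (t - s)\<close>, now an equality of
  coefficients, shows that it also dominates the coefficients \<open>x\<close> of \<open>s\<close>.\<close>
lemma Bratteli_step:
  assumes g: "\<And>j. j < n \<Longrightarrow> g j \<in> pos G" and u: "lincomb n g (\<lambda>j. int (u j)) \<in> scale G" and s: "s \<in> scale G"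
  shows "\<exists>m h v M. refines n g m h M \<and> (\<forall>a. lincomb n g a = \<one> \<longrightarrow> (\<forall>i<m. mat_vec n M a i = 0)) \<and>
    (\<forall>i<m. (\<Sum>j<n. M i j * u j) \<le> v i) \<and> lincomb m h (\<lambda>i. int (v i)) \<in> scale G \<and>
    (\<exists>x. (\<forall>i<m. x i \<le> v i) \<and> s = lincomb m h (\<lambda>i. int (x i)))"
proof -
  let ?U = "lincomb n g (\<lambda>j. int (u j))"
  obtain t where t: "t \<in> scale G" "t \<otimes> inv ?U \<in> pos G" "t \<otimes> inv s \<in> pos G"
    using scale_directed[OF u s] by (auto simp: pre_le_def)
  have c: "?U \<in> carrier G" "s \<in> carrier G" "t \<in> carrier G"
    using u s t scale_subset pos_subset by blast+
  define g' where "g' = g(n := t \<otimes> inv ?U, n + 1 := s, n + 2 := t \<otimes> inv s)"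
  have g': "g' j \<in> pos G" if "j < n + 3" for j
  proof -
    from that consider "j < n" | "j = n" | "j = n + 1" | "j = n + 2" by linarith
    then show ?thesis by cases (use g t s scale_subset in \<open>auto simp: g'_def\<close>)
  qed
  note g'c = pos_carrier[OF g']
  have lc3: "lincomb (n + 3) g' a = lincomb n g a \<otimes> (t \<otimes> inv ?U) [^] a n \<otimes> s [^] a (n + 1) \<otimes> (t \<otimes> inv s) [^] a (n + 2)" for a
  proof -
    have "lincomb n g' a = lincomb n g a" by (rule lincomb_cong) (auto simp: g'_def)
    moreover have "n + 3 = Suc (Suc (Suc n))" by simp
    ultimately show ?thesis by (simp only: lincomb.simps) (simp add: g'_def)
  qed
  obtain m h M where M: "refines (n + 3) g' m h M"
    "\<And>a i. \<lbrakk>lincomb (n + 3) g' a = \<one>; i < m\<rbrakk> \<Longrightarrow> mat_vec (n + 3) M a i = 0"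
    using Shen_kill_kernel[of "n + 3" g', OF g'] by blast
  \<comment> \<open>The coefficients of \<open>t = U + (t - U)\<close> with respect to the enlarged family.\<close>
  define u1 where "u1 = (\<lambda>j. if j < n then u j else if j = n then 1 else 0)"
  define v where "v = (\<lambda>i. \<Sum>j<n+3. M i j * u1 j)"
  have v_eq: "v i = (\<Sum>j<n. M i j * u j) + M i n" for i
    by (simp add: v_def u1_def numeral_3_eq_3)
  have mv: "mat_vec (n + 3) M (\<lambda>j. int (u1 j)) = (\<lambda>i. int (v i))"
    by (simp add: v_def mat_vec_def fun_eq_iff)
  have lcu1: "lincomb (n + 3) g' (\<lambda>j. int (u1 j)) = t"
  proof -
    have "lincomb n g (\<lambda>j. int (u1 j)) = ?U" by (rule lincomb_cong) (auto simp: u1_def)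
    moreover have "?U \<otimes> (t \<otimes> inv ?U) = t" using c by (simp add: m_lcomm)
    ultimately show ?thesis using c t(2) by (simp add: lc3 u1_def)
  qed
  have lcv: "lincomb m h (\<lambda>i. int (v i)) = t"
    using refines_lincomb[OF M(1), of "\<lambda>j. int (u1 j)"] lcu1 by (simp add: mv)
  define y where "y = (\<lambda>j. if j = n + 1 then 1 else 0 :: int)"
  define z where "z = (\<lambda>j. if j = n + 2 then 1 else 0 :: int)"
  have lcy: "lincomb (n + 3) g' y = s" and lcz: "lincomb (n + 3) g' z = t \<otimes> inv s"
    using c by (simp_all add: lc3 y_def z_def lincomb_zero)
  have "s \<otimes> (t \<otimes> inv s) = t" using c by (subst m_lcomm) auto
  then have "lincomb (n + 3) g' (\<lambda>j. int (u1 j) - (y j + z j)) = \<one>"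
    using g'c c by (simp add: lincomb_diff lincomb_add lcu1 lcy lcz)
  moreover have "mat_vec (n + 3) M y i = int (M i (n + 1))" "mat_vec (n + 3) M z i = int (M i (n + 2))" for i
    unfolding y_def z_def by (rule mat_vec_single, simp)+
  ultimately have "int (v i) = int (M i (n + 1)) + int (M i (n + 2))" if "i < m" for i
    using M(2)[OF _ that, of "\<lambda>j. int (u1 j) - (y j + z j)"] mv[THEN fun_cong, of i]
    by (simp add: mat_vec_diff mat_vec_add)
  then have x: "M i (n + 1) \<le> v i" if "i < m" for i using that by force
  have g'_eq: "g' j = lincomb m h (\<lambda>i. int (M i j))" if "j < n + 3" for j
    using M(1) that unfolding refines_def by blast
  have s_eq: "s = lincomb m h (\<lambda>i. int (M i (n + 1)))"
    using g'_eq[of "n + 1"] by (simp add: g'_def)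
  have ref: "refines n g m h M"
    unfolding refines_def
  proof (intro conjI allI impI)
    show "h i \<in> pos G" if "i < m" for i using M(1) that by (simp add: refines_def)
    show "g j = lincomb m h (\<lambda>i. int (M i j))" if "j < n" for j using g'_eq[of j] that by (simp add: g'_def)
  qed
  have kill: "mat_vec n M a i = 0" if "lincomb n g a = \<one>" "i < m" for a i
  proof -
    let ?a = "\<lambda>j. if j < n then a j else 0"
    have "lincomb n g ?a = \<one>" unfolding that(1)[symmetric] by (rule lincomb_cong) auto
    then have "lincomb (n + 3) g' ?a = \<one>" using c by (simp add: lc3)
    then have "mat_vec (n + 3) M ?a i = 0" using M(2) that by blast
    then show ?thesis by (simp add: mat_vec_def numeral_3_eq_3)
  qed
  have "(\<Sum>j<n. M i j * u j) \<le> v i" for i by (simp add: v_eq)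
  then show ?thesis using x lcv t(1)
    by (intro exI[of _ m] exI[of _ h] exI[of _ v] exI[of _ M] conjI ref exI[of _ "\<lambda>i. M i (n + 1)"] s_eq allI impI kill)
      simp_all
qed

text \<open>The theorem of Effros, Handelman and Shen in the form of a Bratteli diagram: the stage \<open>k\<close>
  has the vertices \<open>i < n k\<close> of dimensions \<open>u k i\<close>, which stand for the elements \<open>g k i\<close> of the
  group. The scale is countable, and the step \<open>k\<close> takes care of its member with the number \<open>k\<close>.
  That every relation of a stage is killed in the next one makes the map from the limit of the
  simplicial groups to \<open>G\<close> injective.\<close>
theorem Bratteli_data:
  assumes count: "countable (carrier G)"
  obtains n :: "nat \<Rightarrow> nat" and u :: "nat \<Rightarrow> nat \<Rightarrow> nat" and M :: "nat \<Rightarrow> nat \<Rightarrow> nat \<Rightarrow> nat" and g :: "nat \<Rightarrow> nat \<Rightarrow> 'a"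
  where "\<And>k. 0 < n k" "\<And>k i. 0 < u k i"
    "\<And>k. refines (n k) (g k) (n (Suc k)) (g (Suc k)) (M k)" "\<And>k i. g k i \<in> pos G"
    "\<And>k i. i < n (Suc k) \<Longrightarrow> (\<Sum>j<n k. M k i j * u k j) \<le> u (Suc k) i"
    "\<And>k a i. \<lbrakk>lincomb (n k) (g k) a = \<one>; i < n (Suc k)\<rbrakk> \<Longrightarrow> mat_vec (n k) (M k) a i = 0"
    "\<And>k x. (\<And>i. i < n k \<Longrightarrow> x i \<le> u k i) \<Longrightarrow> lincomb (n k) (g k) (\<lambda>i. int (x i)) \<in> scale G"
    "\<And>s. s \<in> scale G \<Longrightarrow> \<exists>k x. (\<forall>i<n k. x i \<le> u k i) \<and> s = lincomb (n k) (g k) (\<lambda>i. int (x i))"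
    "\<And>s. s \<in> pos G \<Longrightarrow> \<exists>k x. s = lincomb (n k) (g k) (\<lambda>i. int (x i))"
proof -
  define s where "s = from_nat_into (scale G)"
  have count': "countable (scale G)"
    using count scale_subset pos_subset by (meson countable_subset)
  have s: "range s = scale G"
    unfolding s_def using one_scale count' by (intro range_from_nat_into) auto
  \<comment> \<open>\<open>P\<close> is the invariant of a stage, \<open>Q\<close> the relation of consecutive stages.\<close>
  define P where "P = (\<lambda>(k::nat) (n, g, u). (\<forall>i<n. g i \<in> pos G) \<and> lincomb n g (\<lambda>j. int (u j :: nat)) \<in> scale G)"
  define Q where "Q = (\<lambda>k (n, g, u :: nat \<Rightarrow> nat) (m, h, v :: nat \<Rightarrow> nat). \<exists>M. refines n g m h M \<and>
    (\<forall>a. lincomb n g a = \<one> \<longrightarrow> (\<forall>i<m. mat_vec n M a i = 0)) \<and>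
    (\<forall>i<m. (\<Sum>j<n. M i j * u j) \<le> v i) \<and>
    (\<exists>x. (\<forall>i<m. x i \<le> v i) \<and> s k = lincomb m h (\<lambda>i. int (x i))))"
  have "\<exists>f. \<forall>k. P k (f k) \<and> Q k (f k) (f (Suc k))"
  proof (rule dependent_nat_choice)
    show "\<exists>x. P 0 x" by (intro exI[of _ "(0, \<lambda>_. \<one>, \<lambda>_. 0)"]) (simp add: P_def one_scale)
  next
    fix st k assume "P k st"
    moreover obtain n g u where st: "st = (n, g, u)" by (cases st)
    ultimately have gu: "\<And>i. i < n \<Longrightarrow> g i \<in> pos G" "lincomb n g (\<lambda>j. int (u j)) \<in> scale G"
      by (auto simp: P_def)
    have "s k \<in> scale G" using s by blast
    then have "\<exists>m h v M. refines n g m h M \<and> (\<forall>a. lincomb n g a = \<one> \<longrightarrow> (\<forall>i<m. mat_vec n M a i = 0)) \<and>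
        (\<forall>i<m. (\<Sum>j<n. M i j * u j) \<le> v i) \<and> lincomb m h (\<lambda>i. int (v i)) \<in> scale G \<and>
        (\<exists>x. (\<forall>i<m. x i \<le> v i) \<and> s k = lincomb m h (\<lambda>i. int (x i)))"
      by (intro Bratteli_step gu)
    then obtain m h v M where M: "refines n g m h M"
      "\<forall>a. lincomb n g a = \<one> \<longrightarrow> (\<forall>i<m. mat_vec n M a i = 0)"
      "\<forall>i<m. (\<Sum>j<n. M i j * u j) \<le> v i" "lincomb m h (\<lambda>i. int (v i)) \<in> scale G"
      "\<exists>x. (\<forall>i<m. x i \<le> v i) \<and> s k = lincomb m h (\<lambda>i. int (x i))"
      by blast
    then have "P (Suc k) (m, h, v)" by (simp add: P_def refines_def)
    moreover have "Q k st (m, h, v)" unfolding Q_def st using M by blast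
    ultimately show "\<exists>st'. P (Suc k) st' \<and> Q k st st'" by blast
  qed
  then obtain f where f: "\<And>k. P k (f k)" "\<And>k. Q k (f k) (f (Suc k))" by blast
  define n where "n = (\<lambda>k. fst (f k))"
  define g where "g = (\<lambda>k. fst (snd (f k)))"
  define u where "u = (\<lambda>k. snd (snd (f k)))"
  have feq: "f k = (n k, g k, u k)" for k by (simp add: n_def g_def u_def)
  have g: "\<And>i. i < n k \<Longrightarrow> g k i \<in> pos G" and uscale: "lincomb (n k) (g k) (\<lambda>j. int (u k j)) \<in> scale G" for k
    using f(1)[of k] by (auto simp: feq P_def)
  have "\<forall>k. \<exists>M. refines (n k) (g k) (n (Suc k)) (g (Suc k)) M \<and>
    (\<forall>a. lincomb (n k) (g k) a = \<one> \<longrightarrow> (\<forall>i<n (Suc k). mat_vec (n k) M a i = 0)) \<and>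
    (\<forall>i<n (Suc k). (\<Sum>j<n k. M i j * u k j) \<le> u (Suc k) i)"
    using f(2) unfolding feq Q_def by blast
  then obtain M where M: "\<And>k. refines (n k) (g k) (n (Suc k)) (g (Suc k)) (M k)"
    "\<And>k a i. lincomb (n k) (g k) a = \<one> \<Longrightarrow> i < n (Suc k) \<Longrightarrow> mat_vec (n k) (M k) a i = 0"
    "\<And>k i. i < n (Suc k) \<Longrightarrow> (\<Sum>j<n k. M k i j * u k j) \<le> u (Suc k) i"
    by metis
  have ex: "\<exists>x. (\<forall>i<n (Suc k). x i \<le> u (Suc k) i) \<and> s k = lincomb (n (Suc k)) (g (Suc k)) (\<lambda>i. int (x i))" for k
    using f(2)[of k] unfolding feq Q_def by blast

  \<comment> \<open>Matrix algebras have positive size. So vertices of dimension zero are turned into isolated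
    vertices of dimension one, which stand for the neutral element.\<close>
  define U where "U = (\<lambda>k i. if i < n k then u k i else 0)"
  define n' where "n' = (\<lambda>k. Suc (n k))"
  define u' where "u' = (\<lambda>k i. if U k i = 0 then 1 else U k i)"
  define g' where "g' = (\<lambda>k i. if U k i = 0 then \<one> else g k i)"
  define M' where "M' = (\<lambda>k i j. if U (Suc k) i = 0 \<or> U k j = 0 then 0 else M k i j)"
  have g': "g' k i \<in> pos G" for k i
    using g[of i k] one_pos by (auto simp: g'_def U_def)
  have lincomb': "lincomb (n' k) (g' k) a = lincomb (n k) (g k) (\<lambda>i. if U k i = 0 then 0 else a i)" for k a
  proof -
    have "lincomb (n k) (g' k) a = lincomb (n k) (g k) (\<lambda>i. if U k i = 0 then 0 else a i)"
      by (rule lincomb_cong) (auto simp: g'_def)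
    then show ?thesis using g by (simp add: n'_def g'_def U_def lincomb_closed')
  qed
  have M0: "M k i j = 0" if "i < n (Suc k)" "U (Suc k) i = 0" "j < n k" "U k j \<noteq> 0" for k i j
  proof -
    have "M k i j * u k j \<le> (\<Sum>j<n k. M k i j * u k j)"
      using that by (intro member_le_sum) auto
    then show ?thesis using M(3)[OF that(1)] that by (auto simp: U_def)
  qed
  have ref': "refines (n' k) (g' k) (n' (Suc k)) (g' (Suc k)) (M' k)" for k
    unfolding refines_def
  proof (intro conjI allI impI)
    fix j assume "j < n' k"
    show "g' k j = lincomb (n' (Suc k)) (g' (Suc k)) (\<lambda>i. int (M' k i j))"
    proof (cases "U k j = 0")
      case True
      then show ?thesis unfolding lincomb' by (subst lincomb_zero) (auto simp: M'_def g'_def)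
    next
      case False
      then have j: "j < n k" by (auto simp: U_def split: if_splits)
      have "g' k j = lincomb (n (Suc k)) (g (Suc k)) (\<lambda>i. int (M k i j))"
        using M(1)[of k] j False by (auto simp: refines_def g'_def)
      also have "\<dots> = lincomb (n' (Suc k)) (g' (Suc k)) (\<lambda>i. int (M' k i j))"
        unfolding lincomb' using M0 j False by (intro lincomb_cong) (auto simp: M'_def)
      finally show ?thesis .
    qed
  qed (use g' in auto)
  have dim': "(\<Sum>j<n' k. M' k i j * u' k j) \<le> u' (Suc k) i" if "i < n' (Suc k)" for k i
  proof (cases "U (Suc k) i = 0")
    case True
    then show ?thesis by (simp add: M'_def)
  next
    case False
    then have i: "i < n (Suc k)" by (auto simp: U_def split: if_splits)
    have "(\<Sum>j<n' k. M' k i j * u' k j) = (\<Sum>j<n k. M' k i j * u' k j)"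
      by (simp add: n'_def M'_def U_def)
    also have "\<dots> \<le> (\<Sum>j<n k. M k i j * u k j)"
      by (intro sum_mono) (auto simp: M'_def u'_def U_def)
    also have "\<dots> \<le> u' (Suc k) i" using M(3)[OF i] i False by (simp add: u'_def U_def)
    finally show ?thesis .
  qed
  have ker': "mat_vec (n' k) (M' k) a i = 0" if "lincomb (n' k) (g' k) a = \<one>" "i < n' (Suc k)" for k a i
  proof (cases "U (Suc k) i = 0")
    case True
    then show ?thesis by (simp add: mat_vec_def M'_def)
  next
    case False
    then have i: "i < n (Suc k)" by (auto simp: U_def split: if_splits)
    have "mat_vec (n' k) (M' k) a i = mat_vec (n k) (M' k) a i"
      by (simp add: mat_vec_def n'_def M'_def U_def)
    also have "\<dots> = mat_vec (n k) (M k) (\<lambda>i. if U k i = 0 then 0 else a i) i"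
      unfolding mat_vec_def using False by (intro sum.cong) (auto simp: M'_def)
    also have "\<dots> = 0" using M(2)[OF that(1)[unfolded lincomb'] i] .
    finally show ?thesis .
  qed
  have scale': "lincomb (n' k) (g' k) (\<lambda>i. int (x i)) \<in> scale G" if x: "\<And>i. i < n' k \<Longrightarrow> x i \<le> u' k i" for k x
  proof -
    let ?x = "\<lambda>i. if U k i = 0 then 0 else int (x i)"
    have le: "?x i \<le> int (u k i)" if "i < n k" for i
      using x[of i] that by (auto simp: u'_def n'_def U_def)
    have "lincomb (n k) (g k) ?x \<in> pos G" by (rule lincomb_pos) (use g in auto)
    moreover have "lincomb (n k) (g k) (\<lambda>i. int (u k i)) \<otimes> inv (lincomb (n k) (g k) ?x) \<in> pos G"
    proof -
      have "lincomb (n k) (g k) (\<lambda>i. int (u k i) - ?x i) \<in> pos G"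
        by (rule lincomb_pos) (use g le in \<open>simp add: diff_ge_0_iff_ge\<close>)
      then show ?thesis by (subst (asm) lincomb_diff) (use g pos_carrier in auto)
    qed
    ultimately have "lincomb (n k) (g k) ?x \<in> scale G"
      using uscale[of k] pos_carrier[of "lincomb (n k) (g k) ?x"]
      by (intro scale_hereditary[OF _ _ _ uscale[of k]]) (simp_all only: pre_le_def inv_one r_one)
    then show ?thesis by (simp only: lincomb')
  qed
  have exh': "\<exists>k x. (\<forall>i<n' k. x i \<le> u' k i) \<and> t = lincomb (n' k) (g' k) (\<lambda>i. int (x i))" if t: "t \<in> scale G" for t
  proof -
    obtain k where "t = s k" using t s by blast
    with ex[of k] obtain x where x: "\<forall>i<n (Suc k). x i \<le> u (Suc k) i" "t = lincomb (n (Suc k)) (g (Suc k)) (\<lambda>i. int (x i))"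
      by (elim exE conjE) simp
    let ?x = "\<lambda>i. if i < n (Suc k) then x i else 0"
    have "t = lincomb (n' (Suc k)) (g' (Suc k)) (\<lambda>i. int (?x i))"
      unfolding lincomb' x(2) using x(1) by (intro lincomb_cong) (auto simp: U_def)
    moreover have "\<forall>i<n' (Suc k). ?x i \<le> u' (Suc k) i" using x(1) by (auto simp: u'_def U_def)
    ultimately show ?thesis by (intro exI[of _ "Suc k"] exI[of _ ?x] conjI)
  qed
  \<comment> \<open>\<open>R t k\<close>: the element \<open>t\<close> is a nonnegative combination of the generators of stage \<open>k\<close>. These
    sets grow with \<open>k\<close> and are closed under addition, and they exhaust the scale, which generates
    the positive cone.\<close>
  define R where "R = (\<lambda>t k. \<exists>x. t = lincomb (n' k) (g' k) (\<lambda>i. int (x i)))"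
  have R_Suc: "R t (Suc k)" if "R t k" for t k
  proof -
    from that obtain x where x: "t = lincomb (n' k) (g' k) (\<lambda>i. int (x i))" by (auto simp: R_def)
    also have "\<dots> = lincomb (n' (Suc k)) (g' (Suc k)) (mat_vec (n' k) (M' k) (\<lambda>i. int (x i)))"
      by (rule refines_lincomb[OF ref'])
    also have "mat_vec (n' k) (M' k) (\<lambda>i. int (x i)) = (\<lambda>i. int (\<Sum>j<n' k. M' k i j * x j))"
      by (simp add: mat_vec_def fun_eq_iff)
    finally show ?thesis unfolding R_def by (rule exI[of _ "\<lambda>i. \<Sum>j<n' k. M' k i j * x j"])
  qed
  have R_mono: "R t l" if "R t k" "k \<le> l" for t k l
    using that(2,1) by (induction rule: dec_induct) (use R_Suc in auto)
  have R_mult: "\<exists>k. R (t \<otimes> t') k" if Rt: "R t k" "R t' l" for t t' k l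
  proof -
    have "R t (max k l)" "R t' (max k l)"
      by (rule R_mono[OF Rt(1)], simp) (rule R_mono[OF Rt(2)], simp)
    then obtain x y where "t = lincomb (n' (max k l)) (g' (max k l)) (\<lambda>i. int (x i))"
        "t' = lincomb (n' (max k l)) (g' (max k l)) (\<lambda>i. int (y i))"
      unfolding R_def by (elim exE)
    then have "t \<otimes> t' = lincomb (n' (max k l)) (g' (max k l)) (\<lambda>i. int (x i + y i))"
      using lincomb_add[of "n' (max k l)" "g' (max k l)" "\<lambda>i. int (x i)" "\<lambda>i. int (y i)"] g' pos_carrier by simp
    then show ?thesis unfolding R_def by (intro exI)
  qed
  have pos': "\<exists>k x. t = lincomb (n' k) (g' k) (\<lambda>i. int (x i))" if t: "t \<in> pos G" for t
  proof -
    obtain N \<mu> where \<mu>: "\<forall>i<(N::nat). \<mu> i \<in> scale G" "t = finprod G \<mu> {..<N}"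
      using scale_generating[OF t] by blast
    have "\<exists>k. R (finprod G \<mu> {..<m}) k" if "m \<le> N" for m
      using that
    proof (induction m)
      case 0
      then show ?case unfolding R_def by (intro exI[of _ 0] exI[of _ "\<lambda>_. 0"]) (simp add: lincomb_zero)
    next
      case (Suc m)
      have "\<mu> \<in> {..<m} \<rightarrow> carrier G" "\<mu> m \<in> scale G" "\<mu> m \<in> carrier G"
        using \<mu>(1) Suc.prems scale_subset pos_subset by (auto simp: Pi_def subset_iff)
      moreover have "\<exists>k. R (\<mu> m) k" using exh'[OF \<open>\<mu> m \<in> scale G\<close>] unfolding R_def by (elim exE conjE) (intro exI)
      moreover have "\<exists>k. R (finprod G \<mu> {..<m}) k" using Suc by simp
      ultimately obtain k l where "R (\<mu> m) k" "R (finprod G \<mu> {..<m}) l"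
        "\<mu> \<in> {..<m} \<rightarrow> carrier G" "\<mu> m \<in> carrier G" by (elim exE)
      then show ?case using R_mult[of "\<mu> m" k "finprod G \<mu> {..<m}" l] by (simp add: lessThan_Suc finprod_insert)
    qed
    then show ?thesis using \<mu>(2) by (auto simp: R_def)
  qed
  show thesis
  proof (rule that[of n' u' g' M'])
    show "0 < n' k" "0 < u' k i" for k i by (auto simp: n'_def u'_def)
  qed (fact ref' g' dim' ker' scale' exh' pos')+
qed

end

section \<open>Seminormed algebras\<close>

context complex_algebra begin

lemma smult_zero_left [simp]: "x \<in> carrier A \<Longrightarrow> 0 \<odot> x = \<zero>"
proof -
  assume x: "x \<in> carrier A"
  have "0 \<odot> x \<oplus> 0 \<odot> x = 0 \<odot> x \<oplus> \<zero>" using add_smult[OF x, of 0 0] smult_closed[OF x, of 0] by simp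
  then show ?thesis using smult_closed[OF x, of 0] by (metis add.l_cancel_one r_zero)
qed

lemma smult_zero_right [simp]: "c \<odot> \<zero> = \<zero>"
  using smult_smult[of \<zero> c 0] by simp

lemma minus_eq_smult: "x \<in> carrier A \<Longrightarrow> \<ominus> x = (- 1) \<odot> x"
proof -
  assume x: "x \<in> carrier A"
  have "x \<oplus> (- 1) \<odot> x = (1 + (- 1)) \<odot> x" using add_smult[OF x, of 1 "- 1"] one_smult[OF x] by simp
  then show ?thesis using x smult_closed[OF x] by (metis add.right_inverse minus_equality a_comm smult_zero_left)
qed

lemma minus_zero_eq [simp]: "\<ominus> \<zero> = \<zero>"
  by (simp add: minus_eq_smult)

lemma diff_eq_smult: "\<lbrakk>x \<in> carrier A; y \<in> carrier A\<rbrakk> \<Longrightarrow> x \<ominus> y = x \<oplus> (- 1) \<odot> y"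
  by (simp add: a_minus_def minus_eq_smult)

lemma mult_zero_left [simp]: "x \<in> carrier A \<Longrightarrow> \<zero> \<otimes> x = \<zero>"
  using smult_mult[of \<zero> x 0] mult_closed[of \<zero> x] by simp

lemma mult_zero_right [simp]: "x \<in> carrier A \<Longrightarrow> x \<otimes> \<zero> = \<zero>"
  using mult_smult[of x \<zero> 0] mult_closed[of x \<zero>] by simp

lemma mult_diff_left:
  "\<lbrakk>x \<in> carrier A; y \<in> carrier A; z \<in> carrier A\<rbrakk> \<Longrightarrow> (x \<ominus> y) \<otimes> z = x \<otimes> z \<ominus> y \<otimes> z"
  by (simp add: diff_eq_smult distrib_right mult_closed smult_closed smult_mult[symmetric])

lemma mult_diff_right:
  "\<lbrakk>x \<in> carrier A; y \<in> carrier A; z \<in> carrier A\<rbrakk> \<Longrightarrow> x \<otimes> (y \<ominus> z) = x \<otimes> y \<ominus> x \<otimes> z"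
  by (simp add: diff_eq_smult distrib_left mult_closed smult_closed mult_smult[symmetric])

end

text \<open>An algebraic direct limit of Banach algebras is in general neither complete nor separated.
  This is the common generality of direct limits and Banach algebras from which completions are
  formed.\<close>
locale seminormed_algebra = complex_algebra A for A :: "('a, 'm) normed_alg_scheme" (structure) +
  assumes nrm_add: "\<lbrakk>x \<in> carrier A; y \<in> carrier A\<rbrakk> \<Longrightarrow> nrm A (x \<oplus> y) \<le> nrm A x + nrm A y"
    and nrm_smult: "x \<in> carrier A \<Longrightarrow> nrm A (c \<odot> x) = cmod c * nrm A x"
    and nrm_mult: "\<lbrakk>x \<in> carrier A; y \<in> carrier A\<rbrakk> \<Longrightarrow> nrm A (x \<otimes> y) \<le> nrm A x * nrm A y"

sublocale Banach_algebra \<subseteq> seminormed_algebra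
  by unfold_locales (rule nrm_add nrm_smult nrm_mult; assumption)+

context seminormed_algebra begin

lemma nrm_zero [simp]: "nrm A \<zero> = 0"
  using nrm_smult[of \<zero> 0] by simp

lemma nrm_minus [simp]: "x \<in> carrier A \<Longrightarrow> nrm A (\<ominus> x) = nrm A x"
  by (simp add: minus_eq_smult nrm_smult)

lemma nrm_nonneg: "x \<in> carrier A \<Longrightarrow> 0 \<le> nrm A x"
  using nrm_add[of x "\<ominus> x"] by (simp add: r_neg)

lemma nrm_diff_commute: "\<lbrakk>x \<in> carrier A; y \<in> carrier A\<rbrakk> \<Longrightarrow> nrm A (x \<ominus> y) = nrm A (y \<ominus> x)"
  using nrm_minus[of "x \<ominus> y"] by (simp add: a_minus_def minus_add a_comm)

lemma diff_telescope:
  "\<lbrakk>x \<in> carrier A; y \<in> carrier A; z \<in> carrier A\<rbrakk> \<Longrightarrow> x \<ominus> z = (x \<ominus> y) \<oplus> (y \<ominus> z)"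
  by (simp add: a_minus_def a_assoc r_neg1 )

lemma nrm_diff_triangle:
  "\<lbrakk>x \<in> carrier A; y \<in> carrier A; z \<in> carrier A\<rbrakk> \<Longrightarrow> nrm A (x \<ominus> z) \<le> nrm A (x \<ominus> y) + nrm A (y \<ominus> z)"
  by (subst diff_telescope[of x y z]) (auto intro: nrm_add)

lemma nrm_triangle_diff: "\<lbrakk>x \<in> carrier A; y \<in> carrier A\<rbrakk> \<Longrightarrow> \<bar>nrm A x - nrm A y\<bar> \<le> nrm A (x \<ominus> y)"
  using nrm_diff_triangle[of x y \<zero>] nrm_diff_triangle[of y x \<zero>] nrm_diff_commute[of x y]
  by (simp add: a_minus_def)

lemma diff_add: "\<lbrakk>x \<in> carrier A; y \<in> carrier A; x' \<in> carrier A; y' \<in> carrier A\<rbrakk> \<Longrightarrow>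
    (x \<oplus> y) \<ominus> (x' \<oplus> y') = (x \<ominus> x') \<oplus> (y \<ominus> y')"
  by (simp add: a_minus_def minus_add a_ac)

lemma diff_smult: "\<lbrakk>x \<in> carrier A; y \<in> carrier A\<rbrakk> \<Longrightarrow> c \<odot> x \<ominus> c \<odot> y = c \<odot> (x \<ominus> y)"
  by (simp add: diff_eq_smult smult_closed smult_add smult_smult[symmetric] mult.commute)

lemma nrm_diff_mult:
  assumes "x \<in> carrier A" "y \<in> carrier A" "x' \<in> carrier A" "y' \<in> carrier A"
  shows "nrm A (x \<otimes> y \<ominus> x' \<otimes> y') \<le> nrm A (x \<ominus> x') * nrm A y + nrm A x' * nrm A (y \<ominus> y')"
proof -
  have "x \<otimes> y \<ominus> x' \<otimes> y' = (x \<otimes> y \<ominus> x' \<otimes> y) \<oplus> (x' \<otimes> y \<ominus> x' \<otimes> y')"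
    using assms by (intro diff_telescope mult_closed)
  also have "\<dots> = (x \<ominus> x') \<otimes> y \<oplus> x' \<otimes> (y \<ominus> y')"
    using assms by (simp add: mult_diff_left mult_diff_right)
  finally show ?thesis
    using assms nrm_add[of "(x \<ominus> x') \<otimes> y" "x' \<otimes> (y \<ominus> y')"] nrm_mult[of "x \<ominus> x'" y] nrm_mult[of x' "y \<ominus> y'"]
    by (auto simp: mult_closed)
qed

lemma alg_cauchyD: "alg_cauchy A X \<Longrightarrow> X n \<in> carrier A"
  by (simp add: alg_cauchy_def)

lemma cauchy_nrm: "alg_cauchy A X \<Longrightarrow> Cauchy (\<lambda>n. nrm A (X n))"
proof (rule metric_CauchyI)
  fix e :: real assume X: "alg_cauchy A X" and e: "0 < e"
  then obtain N where N: "\<forall>m\<ge>N. \<forall>n\<ge>N. nrm A (X m \<ominus> X n) < e" by (auto simp: alg_cauchy_def)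
  have "dist (nrm A (X m)) (nrm A (X n)) < e" if "m \<ge> N" "n \<ge> N" for m n
    using N that nrm_triangle_diff[OF alg_cauchyD[OF X, of m] alg_cauchyD[OF X, of n]]
    by (fastforce simp: dist_real_def)
  then show "\<exists>N. \<forall>m\<ge>N. \<forall>n\<ge>N. dist (nrm A (X m)) (nrm A (X n)) < e" by blast
qed

lemma cauchy_bounded: "alg_cauchy A X \<Longrightarrow> \<exists>B>0. \<forall>n. nrm A (X n) \<le> B"
proof -
  assume X: "alg_cauchy A X"
  then have "Bseq (\<lambda>n. nrm A (X n))" by (intro Cauchy_Bseq cauchy_nrm)
  then obtain B where "B > 0" "\<forall>n. norm (nrm A (X n)) \<le> B" by (rule BseqE)
  then show ?thesis by (metis abs_le_D1 real_norm_def)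
qed

text \<open>The operations of the algebra are Lipschitz on bounded sets, and therefore preserve Cauchy
  sequences.\<close>
lemma cauchyI_bound:
  assumes c: "\<And>n. Z n \<in> carrier A" and X: "alg_cauchy A X" and Y: "alg_cauchy A Y"
    and B: "\<And>m n. nrm A (Z m \<ominus> Z n) \<le> B * nrm A (X m \<ominus> X n) + B * nrm A (Y m \<ominus> Y n)" "B > 0"
  shows "alg_cauchy A Z"
  unfolding alg_cauchy_def
proof (intro conjI allI impI)
  fix e :: real assume e: "0 < e"
  then have e': "e / (2 * B) > 0" using B(2) by simp
  obtain N where N: "\<forall>m\<ge>N. \<forall>n\<ge>N. nrm A (X m \<ominus> X n) < e / (2 * B)"
    using X e' unfolding alg_cauchy_def by blast
  obtain M where M: "\<forall>m\<ge>M. \<forall>n\<ge>M. nrm A (Y m \<ominus> Y n) < e / (2 * B)"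
    using Y e' unfolding alg_cauchy_def by blast
  have "nrm A (Z m \<ominus> Z n) < e" if "m \<ge> max M N" "n \<ge> max M N" for m n
  proof -
    have "nrm A (Z m \<ominus> Z n) \<le> B * nrm A (X m \<ominus> X n) + B * nrm A (Y m \<ominus> Y n)" by (rule B)
    also have "\<dots> < B * (e / (2 * B)) + B * (e / (2 * B))"
      using N M that B(2) by (intro add_strict_mono mult_strict_left_mono) auto
    also have "\<dots> = e" using B(2) by simp
    finally show ?thesis .
  qed
  then show "\<exists>N. \<forall>m\<ge>N. \<forall>n\<ge>N. nrm A (Z m \<ominus> Z n) < e" by blast
qed (rule c)

lemma cauchy_add:
  assumes X: "alg_cauchy A X" and Y: "alg_cauchy A Y"
  shows "alg_cauchy A (\<lambda>n. X n \<oplus> Y n)"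
proof (rule cauchyI_bound[OF _ X Y])
  note [simp] = alg_cauchyD[OF X] alg_cauchyD[OF Y]
  show "nrm A (X m \<oplus> Y m \<ominus> (X n \<oplus> Y n)) \<le> 1 * nrm A (X m \<ominus> X n) + 1 * nrm A (Y m \<ominus> Y n)" for m n
    by (simp add: diff_add nrm_add)
qed (use X Y alg_cauchyD in auto)

lemma cauchy_mult:
  assumes X: "alg_cauchy A X" and Y: "alg_cauchy A Y"
  shows "alg_cauchy A (\<lambda>n. X n \<otimes> Y n)"
proof -
  note [simp] = alg_cauchyD[OF X] alg_cauchyD[OF Y]
  obtain B C where B: "B > 0" "\<forall>n. nrm A (X n) \<le> B" and C: "C > 0" "\<forall>n. nrm A (Y n) \<le> C"
    using cauchy_bounded X Y by metis
  show ?thesis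
  proof (rule cauchyI_bound[OF _ X Y])
    fix m n
    have "nrm A (X m \<otimes> Y m \<ominus> X n \<otimes> Y n) \<le> nrm A (X m \<ominus> X n) * nrm A (Y m) + nrm A (X n) * nrm A (Y m \<ominus> Y n)"
      by (rule nrm_diff_mult) auto
    also have "\<dots> \<le> nrm A (X m \<ominus> X n) * max B C + max B C * nrm A (Y m \<ominus> Y n)"
      by (intro add_mono mult_mono) (use B C in \<open>auto simp: nrm_nonneg intro: le_max_iff_disj[THEN iffD2]\<close>)
    finally show "nrm A (X m \<otimes> Y m \<ominus> X n \<otimes> Y n) \<le> max B C * nrm A (X m \<ominus> X n) + max B C * nrm A (Y m \<ominus> Y n)"
      by (simp add: mult.commute)
  qed (use B in \<open>auto simp: mult_closed\<close>)
qed

lemma cauchy_smult: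
  assumes X: "alg_cauchy A X"
  shows "alg_cauchy A (\<lambda>n. c \<odot> X n)"
proof (rule cauchyI_bound[OF _ X X])
  note [simp] = alg_cauchyD[OF X]
  show "nrm A (c \<odot> X m \<ominus> c \<odot> X n) \<le> (cmod c + 1) * nrm A (X m \<ominus> X n) + (cmod c + 1) * nrm A (X m \<ominus> X n)" for m n
    using nrm_nonneg[of "X m \<ominus> X n"] norm_ge_zero[of c]
    by (simp add: diff_smult nrm_smult algebra_simps del: norm_ge_zero)
  show "0 < cmod c + 1" using norm_ge_zero[of c] by linarith
qed (use X alg_cauchyD smult_closed in auto)

lemma cauchy_const: "x \<in> carrier A \<Longrightarrow> alg_cauchy A (\<lambda>_. x)"
  by (simp add: alg_cauchy_def a_minus_def r_neg)

end

section \<open>Algebras covered by images of algebras\<close>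

text \<open>The axioms of an algebra are identities in at most three variables. They hold in \<open>Q\<close> as soon
  as any three of its elements lie in the image of one homomorphism from an algebra. This applies
  both to the completion, a quotient of the algebra of Cauchy sequences, and to a direct limit,
  where three elements come from a common stage.\<close>
lemma complex_algebra_covered:
  fixes Q :: "(complex, 'a, 'm) module_scheme"
  assumes z: "\<zero>\<^bsub>Q\<^esub> \<in> carrier Q"
    and cov: "\<And>x y z. \<lbrakk>x \<in> carrier Q; y \<in> carrier Q; z \<in> carrier Q\<rbrakk> \<Longrightarrow>
      \<exists>(B :: (complex, 'b, 'n) module_scheme) q. complex_algebra B \<and> q \<in> alg_hom B Q \<and> q \<zero>\<^bsub>B\<^esub> = \<zero>\<^bsub>Q\<^esub> \<and>
        x \<in> q ` carrier B \<and> y \<in> q ` carrier B \<and> z \<in> q ` carrier B"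
  shows "complex_algebra Q"
proof -
  have ex: "\<exists>(B :: (complex, 'b, 'n) module_scheme) q a b c. complex_algebra B \<and> q \<in> alg_hom B Q \<and> q \<zero>\<^bsub>B\<^esub> = \<zero>\<^bsub>Q\<^esub> \<and>
      a \<in> carrier B \<and> b \<in> carrier B \<and> c \<in> carrier B \<and> x = q a \<and> y = q b \<and> z = q c"
    if "x \<in> carrier Q" "y \<in> carrier Q" "z \<in> carrier Q" for x y z
    using cov[OF that] by blast
  have hom: "q a \<in> carrier Q" "q a \<oplus>\<^bsub>Q\<^esub> q b = q (a \<oplus>\<^bsub>B\<^esub> b)" "q a \<otimes>\<^bsub>Q\<^esub> q b = q (a \<otimes>\<^bsub>B\<^esub> b)"
    "s \<odot>\<^bsub>Q\<^esub> q a = q (s \<odot>\<^bsub>B\<^esub> a)"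
    if "q \<in> alg_hom B Q" "a \<in> carrier B" "b \<in> carrier B" for B :: "(complex, 'b, 'n) module_scheme" and q a b s
    using that by (auto simp: alg_hom_def)
  have ag: "abelian_group Q"
  proof (rule abelian_groupI)
    fix x y z assume xyz: "x \<in> carrier Q" "y \<in> carrier Q" "z \<in> carrier Q"
    obtain B :: "(complex, 'b, 'n) module_scheme" and q a b c where B: "complex_algebra B" "q \<in> alg_hom B Q" "q \<zero>\<^bsub>B\<^esub> = \<zero>\<^bsub>Q\<^esub>"
      "a \<in> carrier B" "b \<in> carrier B" "c \<in> carrier B" "x = q a" "y = q b" "z = q c"
      using ex[OF xyz] by blast
    interpret B: complex_algebra B by fact
    note h = hom[OF B(2)]
    show "x \<oplus>\<^bsub>Q\<^esub> y \<oplus>\<^bsub>Q\<^esub> z = x \<oplus>\<^bsub>Q\<^esub> (y \<oplus>\<^bsub>Q\<^esub> z)"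
      using B by (simp add: h(2) B.a_assoc)
  next
    fix x y assume xyz: "x \<in> carrier Q" "y \<in> carrier Q"
    obtain B :: "(complex, 'b, 'n) module_scheme" and q a b c where B: "complex_algebra B" "q \<in> alg_hom B Q" "q \<zero>\<^bsub>B\<^esub> = \<zero>\<^bsub>Q\<^esub>"
      "a \<in> carrier B" "b \<in> carrier B" "c \<in> carrier B" "x = q a" "y = q b" "x = q c"
      using ex[OF xyz xyz(1)] by blast
    interpret B: complex_algebra B by fact
    note h = hom[OF B(2)]
    show "x \<oplus>\<^bsub>Q\<^esub> y \<in> carrier Q" using B by (simp add: h)
    show "x \<oplus>\<^bsub>Q\<^esub> y = y \<oplus>\<^bsub>Q\<^esub> x" using B by (simp add: h(2) B.a_comm)
    show "\<zero>\<^bsub>Q\<^esub> \<oplus>\<^bsub>Q\<^esub> x = x" using B h(2)[of "\<zero>\<^bsub>B\<^esub>" a] by simp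
    show "\<exists>y\<in>carrier Q. y \<oplus>\<^bsub>Q\<^esub> x = \<zero>\<^bsub>Q\<^esub>"
      using B h(1)[of "\<ominus>\<^bsub>B\<^esub> a"] h(2)[of "\<ominus>\<^bsub>B\<^esub> a" a] by (intro bexI[of _ "q (\<ominus>\<^bsub>B\<^esub> a)"]) (auto simp: B.l_neg)
  qed (use z in auto)
  show ?thesis
  proof (intro complex_algebra.intro ag complex_algebra_axioms.intro)
    fix x y z assume xyz: "x \<in> carrier Q" "y \<in> carrier Q" "z \<in> carrier Q"
    obtain B :: "(complex, 'b, 'n) module_scheme" and q a b c where B: "complex_algebra B" "q \<in> alg_hom B Q" "q \<zero>\<^bsub>B\<^esub> = \<zero>\<^bsub>Q\<^esub>"
      "a \<in> carrier B" "b \<in> carrier B" "c \<in> carrier B" "x = q a" "y = q b" "z = q c"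
      using ex[OF xyz] by blast
    interpret B: complex_algebra B by fact
    note h = hom[OF B(2)]
    show "x \<otimes>\<^bsub>Q\<^esub> y \<otimes>\<^bsub>Q\<^esub> z = x \<otimes>\<^bsub>Q\<^esub> (y \<otimes>\<^bsub>Q\<^esub> z)"
      using B by (simp add: h(3) B.mult_assoc B.mult_closed)
    show "(x \<oplus>\<^bsub>Q\<^esub> y) \<otimes>\<^bsub>Q\<^esub> z = x \<otimes>\<^bsub>Q\<^esub> z \<oplus>\<^bsub>Q\<^esub> y \<otimes>\<^bsub>Q\<^esub> z"
      using B by (simp add: h(2,3) B.distrib_right B.mult_closed)
    show "x \<otimes>\<^bsub>Q\<^esub> (y \<oplus>\<^bsub>Q\<^esub> z) = x \<otimes>\<^bsub>Q\<^esub> y \<oplus>\<^bsub>Q\<^esub> x \<otimes>\<^bsub>Q\<^esub> z"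
      using B by (simp add: h(2,3) B.distrib_left B.mult_closed)
  next
    fix x y and s t :: complex assume xyz: "x \<in> carrier Q" "y \<in> carrier Q"
    obtain B :: "(complex, 'b, 'n) module_scheme" and q a b c where B: "complex_algebra B" "q \<in> alg_hom B Q" "q \<zero>\<^bsub>B\<^esub> = \<zero>\<^bsub>Q\<^esub>"
      "a \<in> carrier B" "b \<in> carrier B" "c \<in> carrier B" "x = q a" "y = q b" "x = q c"
      using ex[OF xyz xyz(1)] by blast
    interpret B: complex_algebra B by fact
    note h = hom[OF B(2)]
    show "x \<otimes>\<^bsub>Q\<^esub> y \<in> carrier Q" using B by (simp add: h(1,3) B.mult_closed)
    show "s \<odot>\<^bsub>Q\<^esub> (x \<oplus>\<^bsub>Q\<^esub> y) = s \<odot>\<^bsub>Q\<^esub> x \<oplus>\<^bsub>Q\<^esub> s \<odot>\<^bsub>Q\<^esub> y"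
      using B by (simp add: h(2,4)[of _ a] h(2,4) B.smult_add B.smult_closed)
    show "s \<odot>\<^bsub>Q\<^esub> (x \<otimes>\<^bsub>Q\<^esub> y) = (s \<odot>\<^bsub>Q\<^esub> x) \<otimes>\<^bsub>Q\<^esub> y"
      using B by (simp add: h(3) h(4)[of _ a] B.smult_mult B.smult_closed B.mult_closed)
    show "s \<odot>\<^bsub>Q\<^esub> (x \<otimes>\<^bsub>Q\<^esub> y) = x \<otimes>\<^bsub>Q\<^esub> (s \<odot>\<^bsub>Q\<^esub> y)"
      using B by (simp add: h(3) h(4)[of _ a] B.mult_smult B.smult_closed B.mult_closed)
  next
    fix x and s t :: complex assume x: "x \<in> carrier Q"
    obtain B :: "(complex, 'b, 'n) module_scheme" and q a b c where B: "complex_algebra B" "q \<in> alg_hom B Q" "q \<zero>\<^bsub>B\<^esub> = \<zero>\<^bsub>Q\<^esub>"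
      "a \<in> carrier B" "b \<in> carrier B" "c \<in> carrier B" "x = q a" "x = q b" "x = q c"
      using ex[OF x x x] by blast
    interpret B: complex_algebra B by fact
    have h: "q u \<in> carrier Q" "s \<odot>\<^bsub>Q\<^esub> q u = q (s \<odot>\<^bsub>B\<^esub> u)" if "u \<in> carrier B" for s u
      using hom[OF B(2) that that] by auto
    have h2: "q u \<oplus>\<^bsub>Q\<^esub> q v = q (u \<oplus>\<^bsub>B\<^esub> v)" if "u \<in> carrier B" "v \<in> carrier B" for u v
      using hom[OF B(2) that] by auto
    show "s \<odot>\<^bsub>Q\<^esub> x \<in> carrier Q" using B by (simp add: h B.smult_closed)
    show "(s + t) \<odot>\<^bsub>Q\<^esub> x = s \<odot>\<^bsub>Q\<^esub> x \<oplus>\<^bsub>Q\<^esub> t \<odot>\<^bsub>Q\<^esub> x"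
      using B by (simp add: h(2) h2 B.add_smult B.smult_closed)
    show "(s * t) \<odot>\<^bsub>Q\<^esub> x = s \<odot>\<^bsub>Q\<^esub> (t \<odot>\<^bsub>Q\<^esub> x)"
      using B by (simp add: h(2) B.smult_smult B.smult_closed)
    show "1 \<odot>\<^bsub>Q\<^esub> x = x" using B by (simp add: h(2) B.one_smult)
  qed
qed

section \<open>Completions\<close>

definition cauchy_algebra :: "('a, 'm) normed_alg_scheme \<Rightarrow> (complex, nat \<Rightarrow> 'a) module" where
  "cauchy_algebra A = \<lparr> carrier = {X. alg_cauchy A X}, monoid.mult = (\<lambda>X Y n. X n \<otimes>\<^bsub>A\<^esub> Y n),
     one = undefined, zero = (\<lambda>_. \<zero>\<^bsub>A\<^esub>), add = (\<lambda>X Y n. X n \<oplus>\<^bsub>A\<^esub> Y n), smult = (\<lambda>c X n. c \<odot>\<^bsub>A\<^esub> X n) \<rparr>"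

context seminormed_algebra begin

lemma cauchy_algebra: "complex_algebra (cauchy_algebra A)"
proof (intro complex_algebra.intro abelian_groupI complex_algebra_axioms.intro)
  fix X assume "X \<in> carrier (cauchy_algebra A)"
  then have X: "alg_cauchy A X" by (simp add: cauchy_algebra_def)
  show "\<exists>Y\<in>carrier (cauchy_algebra A). Y \<oplus>\<^bsub>cauchy_algebra A\<^esub> X = \<zero>\<^bsub>cauchy_algebra A\<^esub>"
    using cauchy_smult[OF X, of "- 1"] alg_cauchyD[OF X]
    by (intro bexI[of _ "\<lambda>n. (- 1) \<odot> X n"]) (auto simp: cauchy_algebra_def minus_eq_smult[symmetric] l_neg)
qed (auto simp: cauchy_algebra_def cauchy_add cauchy_mult cauchy_smult cauchy_const alg_cauchyD
    a_assoc distrib_right distrib_left mult_closed smult_closed mult_assoc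
    smult_add add_smult smult_smult one_smult smult_mult[symmetric] mult_smult[symmetric] intro!: ext a_comm)

lemma null_relI:
  "\<lbrakk>alg_cauchy A X; alg_cauchy A Y; (\<lambda>n. nrm A (X n \<ominus> Y n)) \<longlonglongrightarrow> 0\<rbrakk> \<Longrightarrow> (X, Y) \<in> null_rel A"
  by (simp add: null_rel_def)

lemma null_relD:
  assumes "(X, Y) \<in> null_rel A"
  shows "alg_cauchy A X" "alg_cauchy A Y" "(\<lambda>n. nrm A (X n \<ominus> Y n)) \<longlonglongrightarrow> 0"
  using assms by (auto simp: null_rel_def)

lemma null_rel_bound:
  assumes Z: "alg_cauchy A Z" "alg_cauchy A Z'" and "(X, X') \<in> null_rel A" "(Y, Y') \<in> null_rel A"
    and B: "\<And>n. nrm A (Z n \<ominus> Z' n) \<le> B * nrm A (X n \<ominus> X' n) + B * nrm A (Y n \<ominus> Y' n)"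
  shows "(Z, Z') \<in> null_rel A"
proof (rule null_relI[OF Z])
  have "(\<lambda>n. B * nrm A (X n \<ominus> X' n) + B * nrm A (Y n \<ominus> Y' n)) \<longlonglongrightarrow> B * 0 + B * 0"
    by (intro tendsto_add tendsto_mult_left null_relD(3)[OF assms(3)] null_relD(3)[OF assms(4)])
  then have lim: "(\<lambda>n. B * nrm A (X n \<ominus> X' n) + B * nrm A (Y n \<ominus> Y' n)) \<longlonglongrightarrow> 0" by simp
  show "(\<lambda>n. nrm A (Z n \<ominus> Z' n)) \<longlonglongrightarrow> 0"
    by (rule tendsto_sandwich[OF always_eventually always_eventually tendsto_const lim])
       (simp_all add: B nrm_nonneg alg_cauchyD[OF Z(1)] alg_cauchyD[OF Z(2)])
qed

lemma null_rel_equiv: "equiv {X. alg_cauchy A X} (null_rel A)"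
proof (rule equivI)
  show "null_rel A \<subseteq> {X. alg_cauchy A X} \<times> {X. alg_cauchy A X}" by (auto simp: null_rel_def)
  show "refl_on {X. alg_cauchy A X} (null_rel A)"
    by (auto simp: refl_on_def null_rel_def a_minus_def r_neg alg_cauchyD)
  show "sym (null_rel A)"
    by (auto simp: sym_def null_rel_def nrm_diff_commute alg_cauchyD)
  show "trans (null_rel A)"
  proof (rule transI)
    fix X Y Z assume XY: "(X, Y) \<in> null_rel A" and YZ: "(Y, Z) \<in> null_rel A"
    show "(X, Z) \<in> null_rel A"
      by (rule null_rel_bound[OF _ _ XY YZ, of _ _ 1])
         (use null_relD[OF XY] null_relD[OF YZ] nrm_diff_triangle alg_cauchyD in auto)
  qed
qed

lemma null_rel_refl: "alg_cauchy A X \<Longrightarrow> (X, X) \<in> null_rel A"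
  using null_rel_equiv by (auto simp: equiv_def refl_on_def)

abbreviation (input) cls :: "(nat \<Rightarrow> 'a) \<Rightarrow> (nat \<Rightarrow> 'a) set" where
  "cls X \<equiv> null_rel A `` {X}"

lemma cls_eq_iff: "\<lbrakk>alg_cauchy A X; alg_cauchy A Y\<rbrakk> \<Longrightarrow> cls X = cls Y \<longleftrightarrow> (X, Y) \<in> null_rel A"
  using eq_equiv_class_iff[OF null_rel_equiv] by simp

lemma completion_carrier: "carrier (completion A) = cls ` {X. alg_cauchy A X}"
  by (auto simp: completion_def quotient_def)

lemma completion_zero: "\<zero>\<^bsub>completion A\<^esub> = cls (\<lambda>_. \<zero>)"
  by (simp add: completion_def)

lemma completion_add:
  assumes "alg_cauchy A X" "alg_cauchy A Y"
  shows "cls X \<oplus>\<^bsub>completion A\<^esub> cls Y = cls (\<lambda>n. X n \<oplus> Y n)"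
proof -
  have "congruent2 (null_rel A) (null_rel A) (\<lambda>X Y. cls (\<lambda>n. X n \<oplus> Y n))"
  proof (rule congruent2I')
    fix X X' Y Y' assume XX: "(X, X') \<in> null_rel A" and YY: "(Y, Y') \<in> null_rel A"
    note [simp] = alg_cauchyD[OF null_relD(1)[OF XX]] alg_cauchyD[OF null_relD(2)[OF XX]]
      alg_cauchyD[OF null_relD(1)[OF YY]] alg_cauchyD[OF null_relD(2)[OF YY]]
    show "cls (\<lambda>n. X n \<oplus> Y n) = cls (\<lambda>n. X' n \<oplus> Y' n)"
      by (subst cls_eq_iff; (intro cauchy_add null_relD[OF XX] null_relD[OF YY])?)
         (rule null_rel_bound[OF _ _ XX YY, of _ _ 1];
           (intro cauchy_add null_relD[OF XX] null_relD[OF YY])?; simp add: diff_add nrm_add)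
  qed
  then show ?thesis using UN_equiv_class2[OF null_rel_equiv null_rel_equiv] assms
    by (simp add: completion_def)
qed

lemma completion_mult:
  assumes "alg_cauchy A X" "alg_cauchy A Y"
  shows "cls X \<otimes>\<^bsub>completion A\<^esub> cls Y = cls (\<lambda>n. X n \<otimes> Y n)"
proof -
  have "congruent2 (null_rel A) (null_rel A) (\<lambda>X Y. cls (\<lambda>n. X n \<otimes> Y n))"
  proof (rule congruent2I')
    fix X X' Y Y' assume XX: "(X, X') \<in> null_rel A" and YY: "(Y, Y') \<in> null_rel A"
    note [simp] = alg_cauchyD[OF null_relD(1)[OF XX]] alg_cauchyD[OF null_relD(2)[OF XX]]
      alg_cauchyD[OF null_relD(1)[OF YY]] alg_cauchyD[OF null_relD(2)[OF YY]]
    obtain B C where B: "B > 0" "\<forall>n. nrm A (X' n) \<le> B" and C: "C > 0" "\<forall>n. nrm A (Y n) \<le> C"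
      using cauchy_bounded[OF null_relD(2)[OF XX]] cauchy_bounded[OF null_relD(1)[OF YY]] by metis
    have "nrm A (X n \<otimes> Y n \<ominus> X' n \<otimes> Y' n) \<le> max B C * nrm A (X n \<ominus> X' n) + max B C * nrm A (Y n \<ominus> Y' n)" for n
    proof -
      have "nrm A (X n \<otimes> Y n \<ominus> X' n \<otimes> Y' n) \<le> nrm A (X n \<ominus> X' n) * nrm A (Y n) + nrm A (X' n) * nrm A (Y n \<ominus> Y' n)"
        by (rule nrm_diff_mult) auto
      also have "\<dots> \<le> nrm A (X n \<ominus> X' n) * max B C + max B C * nrm A (Y n \<ominus> Y' n)"
        by (intro add_mono mult_mono) (use B C in \<open>auto simp: nrm_nonneg intro: le_max_iff_disj[THEN iffD2]\<close>)
      finally show ?thesis by (simp add: mult.commute)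
    qed
    then show "cls (\<lambda>n. X n \<otimes> Y n) = cls (\<lambda>n. X' n \<otimes> Y' n)"
      by (subst cls_eq_iff; (intro cauchy_mult null_relD[OF XX] null_relD[OF YY])?)
         (rule null_rel_bound[OF _ _ XX YY]; (intro cauchy_mult null_relD[OF XX] null_relD[OF YY])?; assumption?)
  qed
  then show ?thesis using UN_equiv_class2[OF null_rel_equiv null_rel_equiv] assms
    by (simp add: completion_def)
qed

lemma completion_smult:
  assumes "alg_cauchy A X"
  shows "c \<odot>\<^bsub>completion A\<^esub> cls X = cls (\<lambda>n. c \<odot> X n)"
proof -
  have "congruent (null_rel A) (\<lambda>X. cls (\<lambda>n. c \<odot> X n))"
  proof (rule congruentI)
    fix X X' assume XX: "(X, X') \<in> null_rel A"
    note [simp] = alg_cauchyD[OF null_relD(1)[OF XX]] alg_cauchyD[OF null_relD(2)[OF XX]]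
    have "nrm A (c \<odot> X n \<ominus> c \<odot> X' n) \<le> cmod c * nrm A (X n \<ominus> X' n) + cmod c * nrm A (X n \<ominus> X' n)" for n
      using nrm_nonneg[of "X n \<ominus> X' n"] by (simp add: diff_smult nrm_smult)
    then show "cls (\<lambda>n. c \<odot> X n) = cls (\<lambda>n. c \<odot> X' n)"
      by (subst cls_eq_iff; (intro cauchy_smult null_relD[OF XX])?)
         (rule null_rel_bound[OF _ _ XX XX]; (intro cauchy_smult null_relD[OF XX])?; assumption?)
  qed
  then show ?thesis using UN_equiv_class[OF null_rel_equiv] assms
    by (simp add: completion_def)
qed

text \<open>The norms of equivalent Cauchy sequences have the same limit, which makes the description of
  the norm of the completion definite.\<close>
lemma completion_nrm_tendsto:
  assumes X: "alg_cauchy A X"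
  shows "(\<lambda>n. nrm A (X n)) \<longlonglongrightarrow> nrm (completion A) (cls X)"
proof -
  obtain r where r: "(\<lambda>n. nrm A (X n)) \<longlonglongrightarrow> r"
    using cauchy_nrm[OF X] by (auto simp: Cauchy_convergent_iff convergent_def)
  have "s = r" if "\<exists>Y\<in>cls X. (\<lambda>n. nrm A (Y n)) \<longlonglongrightarrow> s" for s
  proof -
    obtain Y where XY: "(X, Y) \<in> null_rel A" and s: "(\<lambda>n. nrm A (Y n)) \<longlonglongrightarrow> s"
      using \<open>\<exists>Y\<in>cls X. _ Y\<close> by auto
    have "(\<lambda>n. nrm A (X n) - nrm A (Y n)) \<longlonglongrightarrow> 0"
    proof (rule tendsto_0_le[where K = 1])
      show "(\<lambda>n. nrm A (X n \<ominus> Y n)) \<longlonglongrightarrow> 0" by (rule null_relD[OF XY])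
      show "\<forall>\<^sub>F n in sequentially. norm (nrm A (X n) - nrm A (Y n)) \<le> norm (nrm A (X n \<ominus> Y n)) * 1"
      proof (intro always_eventually allI)
        fix n
        have "X n \<in> carrier A" "Y n \<in> carrier A"
          using null_relD[OF XY] by (auto intro: alg_cauchyD)
        then show "norm (nrm A (X n) - nrm A (Y n)) \<le> norm (nrm A (X n \<ominus> Y n)) * 1"
          using nrm_triangle_diff[of "X n" "Y n"] nrm_nonneg[of "X n \<ominus> Y n"] by simp
      qed
    qed
    moreover have "(\<lambda>n. nrm A (X n) - nrm A (Y n)) \<longlonglongrightarrow> r - s" by (intro tendsto_intros r s)
    ultimately show "s = r" using LIMSEQ_unique by fastforce
  qed
  moreover have "X \<in> cls X" using null_rel_refl[OF X] by simp
  ultimately have "(THE r. \<exists>Y\<in>cls X. (\<lambda>n. nrm A (Y n)) \<longlonglongrightarrow> r) = r"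
    using r by (intro the_equality) blast+
  then show ?thesis using r by (simp add: completion_def)
qed

lemma completion_nrm_eq: "\<lbrakk>alg_cauchy A X; (\<lambda>n. nrm A (X n)) \<longlonglongrightarrow> r\<rbrakk> \<Longrightarrow> nrm (completion A) (cls X) = r"
  using completion_nrm_tendsto LIMSEQ_unique by blast

lemma completion_algebra: "complex_algebra (completion A)"
proof (rule complex_algebra_covered)
  show "\<zero>\<^bsub>completion A\<^esub> \<in> carrier (completion A)"
    by (simp add: completion_zero completion_carrier cauchy_const)
  fix x y z assume "x \<in> carrier (completion A)" "y \<in> carrier (completion A)" "z \<in> carrier (completion A)"
  moreover have "cls \<in> alg_hom (cauchy_algebra A) (completion A)"
    by (auto simp: alg_hom_def cauchy_algebra_def completion_carrier completion_add completion_mult completion_smult)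
  ultimately show "\<exists>(B :: (complex, nat \<Rightarrow> 'a) module) q. complex_algebra B \<and> q \<in> alg_hom B (completion A) \<and>
      q \<zero>\<^bsub>B\<^esub> = \<zero>\<^bsub>completion A\<^esub> \<and> x \<in> q ` carrier B \<and> y \<in> q ` carrier B \<and> z \<in> q ` carrier B"
    using cauchy_algebra
    by (intro exI[of _ "cauchy_algebra A"] exI[of _ cls]) (simp_all add: completion_zero completion_carrier cauchy_algebra_def)
qed

lemma completion_seminormed: "seminormed_algebra (completion A)"
proof (intro seminormed_algebra.intro completion_algebra seminormed_algebra_axioms.intro)
  fix x y assume "x \<in> carrier (completion A)" "y \<in> carrier (completion A)"
  then obtain X Y where X: "alg_cauchy A X" "x = cls X" and Y: "alg_cauchy A Y" "y = cls Y"
    by (auto simp: completion_carrier)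
  note [simp] = alg_cauchyD[OF X(1)] alg_cauchyD[OF Y(1)]
  note lim = completion_nrm_tendsto[OF X(1)] completion_nrm_tendsto[OF Y(1)]
  show "nrm (completion A) (x \<oplus>\<^bsub>completion A\<^esub> y) \<le> nrm (completion A) x + nrm (completion A) y"
    unfolding X(2) Y(2) completion_add[OF X(1) Y(1)]
    by (rule LIMSEQ_le[OF completion_nrm_tendsto[OF cauchy_add[OF X(1) Y(1)]] tendsto_add[OF lim]])
       (intro exI[of _ 0] allI impI nrm_add; simp)
  show "nrm (completion A) (x \<otimes>\<^bsub>completion A\<^esub> y) \<le> nrm (completion A) x * nrm (completion A) y"
    unfolding X(2) Y(2) completion_mult[OF X(1) Y(1)]
    by (rule LIMSEQ_le[OF completion_nrm_tendsto[OF cauchy_mult[OF X(1) Y(1)]] tendsto_mult[OF lim]])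
       (intro exI[of _ 0] allI impI nrm_mult; simp)
next
  fix x c assume "x \<in> carrier (completion A)"
  then obtain X where X: "alg_cauchy A X" "x = cls X" by (auto simp: completion_carrier)
  show "nrm (completion A) (c \<odot>\<^bsub>completion A\<^esub> x) = cmod c * nrm (completion A) x"
    unfolding X(2) completion_smult[OF X(1)]
    by (rule completion_nrm_eq[OF cauchy_smult[OF X(1)]])
       (simp add: nrm_smult alg_cauchyD[OF X(1)] tendsto_mult_left completion_nrm_tendsto[OF X(1)])
qed

lemma completion_diff:
  assumes "alg_cauchy A X" "alg_cauchy A Y"
  shows "cls X \<ominus>\<^bsub>completion A\<^esub> cls Y = cls (\<lambda>n. X n \<ominus> Y n)"
proof -
  interpret C: complex_algebra "completion A" by (rule completion_algebra)
  have "cls X \<in> carrier (completion A)" "cls Y \<in> carrier (completion A)"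
    using assms by (auto simp: completion_carrier)
  then show ?thesis
    using assms by (simp add: C.diff_eq_smult completion_smult completion_add cauchy_smult diff_eq_smult alg_cauchyD)
qed

lemma cauchy_diff: "\<lbrakk>alg_cauchy A X; alg_cauchy A Y\<rbrakk> \<Longrightarrow> alg_cauchy A (\<lambda>n. X n \<ominus> Y n)"
  using cauchy_add[of X "\<lambda>n. (- 1) \<odot> Y n"] cauchy_smult[of Y "- 1"] by (simp add: diff_eq_smult alg_cauchyD)

lemma completion_dense:
  assumes x: "x \<in> carrier (completion A)" and e: "0 < e"
  shows "\<exists>a\<in>carrier A. nrm (completion A) (x \<ominus>\<^bsub>completion A\<^esub> cls (\<lambda>_. a)) < e"
proof -
  obtain X where X: "alg_cauchy A X" "x = cls X" using x by (auto simp: completion_carrier)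
  obtain N where N: "\<forall>m\<ge>N. \<forall>n\<ge>N. nrm A (X m \<ominus> X n) < e / 2"
    using X(1) e unfolding alg_cauchy_def by (meson half_gt_zero)
  have c: "alg_cauchy A (\<lambda>_. X N)" using X(1) by (simp add: cauchy_const alg_cauchyD)
  have "nrm (completion A) (x \<ominus>\<^bsub>completion A\<^esub> cls (\<lambda>_. X N)) \<le> e / 2"
    unfolding X(2) completion_diff[OF X(1) c]
    by (rule LIMSEQ_le_const2[OF completion_nrm_tendsto[OF cauchy_diff[OF X(1) c]]])
       (use N in \<open>auto intro!: exI[of _ N] less_imp_le\<close>)
  then show ?thesis using e alg_cauchyD[OF X(1), of N] by (intro bexI[of _ "X N"]) auto
qed

text \<open>A Cauchy sequence \<open>X\<close> in the completion is approximated by constant sequences \<open>a n\<close>, up to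
  \<open>1 / (n + 1)\<close>. The sequence \<open>a\<close> is again Cauchy, and its class is the limit of \<open>X\<close>.\<close>
lemma completion_Banach: "Banach_algebra (completion A)"
proof -
  interpret C: seminormed_algebra "completion A" by (rule completion_seminormed)
  show ?thesis
  proof (intro Banach_algebra.intro completion_algebra Banach_algebra_axioms.intro C.nrm_add C.nrm_smult C.nrm_mult)
    fix x assume "x \<in> carrier (completion A)"
    then obtain X where X: "alg_cauchy A X" "x = cls X" by (auto simp: completion_carrier)
    have "x = \<zero>\<^bsub>completion A\<^esub>" if "nrm (completion A) x = 0"
    proof -
      have "(\<lambda>n. nrm A (X n \<ominus> \<zero>)) \<longlonglongrightarrow> 0"
        using completion_nrm_tendsto[OF X(1)] that X(2) alg_cauchyD[OF X(1)] by (simp add: a_minus_def)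
      then show ?thesis
        unfolding X(2) completion_zero by (subst cls_eq_iff) (auto intro!: null_relI X(1) cauchy_const)
    qed
    then show "nrm (completion A) x = 0 \<longleftrightarrow> x = \<zero>\<^bsub>completion A\<^esub>" by auto
  next
    fix X assume X: "alg_cauchy (completion A) X"
    let ?j = "\<lambda>a. cls (\<lambda>_. a)"
    have jc: "?j a \<in> carrier (completion A)" if "a \<in> carrier A" for a
      using that by (simp add: completion_carrier cauchy_const)
    have Xc: "X n \<in> carrier (completion A)" for n using C.alg_cauchyD[OF X] .
    have "\<exists>a\<in>carrier A. nrm (completion A) (X n \<ominus>\<^bsub>completion A\<^esub> ?j a) < 1 / real (Suc n)" for n
      by (rule completion_dense[OF Xc]) simp
    then obtain a where a: "\<And>n. a n \<in> carrier A"
      "\<And>n. nrm (completion A) (X n \<ominus>\<^bsub>completion A\<^esub> ?j (a n)) < 1 / real (Suc n)" by metis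
    have jdiff: "nrm (completion A) (?j s \<ominus>\<^bsub>completion A\<^esub> ?j t) = nrm A (s \<ominus> t)"
      if "s \<in> carrier A" "t \<in> carrier A" for s t
      using that by (simp add: completion_diff cauchy_const) (rule completion_nrm_eq, auto intro: cauchy_const)
    have ac: "alg_cauchy A a"
      unfolding alg_cauchy_def
    proof (intro conjI allI impI a(1))
      fix e :: real assume e: "0 < e"
      obtain N where N: "\<forall>m\<ge>N. \<forall>n\<ge>N. nrm (completion A) (X m \<ominus>\<^bsub>completion A\<^esub> X n) < e / 3"
        using X e unfolding alg_cauchy_def by (metis divide_pos_pos zero_less_numeral)
      obtain K where K: "1 / real (Suc K) < e / 3"
        using e by (metis divide_pos_pos zero_less_numeral nat_approx_posE)
      have small: "nrm (completion A) (X n \<ominus>\<^bsub>completion A\<^esub> ?j (a n)) < e / 3" if "n \<ge> K" for n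
      proof -
        have "1 / real (Suc n) \<le> 1 / real (Suc K)" using that by (simp add: frac_le)
        then show ?thesis using a(2)[of n] K by linarith
      qed
      have "nrm A (a m \<ominus> a n) < e" if "m \<ge> max N K" "n \<ge> max N K" for m n
      proof -
        have "nrm A (a m \<ominus> a n) = nrm (completion A) (?j (a m) \<ominus>\<^bsub>completion A\<^esub> ?j (a n))"
          using jdiff a(1) by simp
        also have "\<dots> \<le> nrm (completion A) (?j (a m) \<ominus>\<^bsub>completion A\<^esub> X m) + nrm (completion A) (X m \<ominus>\<^bsub>completion A\<^esub> ?j (a n))"
          by (intro C.nrm_diff_triangle jc a Xc)
        also have "nrm (completion A) (X m \<ominus>\<^bsub>completion A\<^esub> ?j (a n)) \<le>
            nrm (completion A) (X m \<ominus>\<^bsub>completion A\<^esub> X n) + nrm (completion A) (X n \<ominus>\<^bsub>completion A\<^esub> ?j (a n))"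
          by (intro C.nrm_diff_triangle jc a Xc)
        also have "nrm (completion A) (?j (a m) \<ominus>\<^bsub>completion A\<^esub> X m) = nrm (completion A) (X m \<ominus>\<^bsub>completion A\<^esub> ?j (a m))"
          by (intro C.nrm_diff_commute jc a Xc)
        finally show ?thesis using small[of m] small[of n] N that by fastforce
      qed
      then show "\<exists>N. \<forall>m\<ge>N. \<forall>n\<ge>N. nrm A (a m \<ominus> a n) < e" by blast
    qed
    have cc: "cls a \<in> carrier (completion A)" using ac by (simp add: completion_carrier)
    have lim: "(\<lambda>n. nrm (completion A) (X n \<ominus>\<^bsub>completion A\<^esub> cls a)) \<longlonglongrightarrow> 0"
    proof (rule LIMSEQ_I)
      fix e :: real assume e: "0 < e"
      obtain N where N: "\<forall>m\<ge>N. \<forall>n\<ge>N. nrm A (a m \<ominus> a n) < e / 3"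
        using ac e unfolding alg_cauchy_def by (metis divide_pos_pos zero_less_numeral)
      obtain K where K: "1 / real (Suc K) < e / 3"
        using e by (metis divide_pos_pos zero_less_numeral nat_approx_posE)
      have "norm (nrm (completion A) (X n \<ominus>\<^bsub>completion A\<^esub> cls a) - 0) < e" if "n \<ge> max N K" for n
      proof -
        have "1 / real (Suc n) \<le> 1 / real (Suc K)" using that by (simp add: frac_le)
        then have 1: "nrm (completion A) (X n \<ominus>\<^bsub>completion A\<^esub> ?j (a n)) < e / 3" using a(2)[of n] K by linarith
        have ca: "alg_cauchy A (\<lambda>_. a n)" using a(1) by (rule cauchy_const)
        have 2: "nrm (completion A) (?j (a n) \<ominus>\<^bsub>completion A\<^esub> cls a) \<le> e / 3"
          unfolding completion_diff[OF ca ac]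
          by (rule LIMSEQ_le_const2[OF completion_nrm_tendsto[OF cauchy_diff[OF ca ac]]])
             (use N that in \<open>auto intro!: exI[of _ N] less_imp_le\<close>)
        have "nrm (completion A) (X n \<ominus>\<^bsub>completion A\<^esub> cls a) \<le>
            nrm (completion A) (X n \<ominus>\<^bsub>completion A\<^esub> ?j (a n)) + nrm (completion A) (?j (a n) \<ominus>\<^bsub>completion A\<^esub> cls a)"
          by (intro C.nrm_diff_triangle jc a Xc cc)
        then show ?thesis using 1 2 e C.nrm_nonneg[of "X n \<ominus>\<^bsub>completion A\<^esub> cls a"] Xc cc by simp
      qed
      then show "\<exists>no. \<forall>n\<ge>no. norm (nrm (completion A) (X n \<ominus>\<^bsub>completion A\<^esub> cls a) - 0) < e" by blast
    qed
    then show "\<exists>x. alg_tendsto (completion A) X x"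
      unfolding alg_tendsto_def using cc by blast
  qed (use C.nrm_zero in auto)
qed

end

section \<open>Direct limits\<close>

text \<open>A direct system of Banach algebras with contractive maps; the norms \<open>nrm (D n) (\<phi> n m a)\<close>
  then decrease with \<open>n\<close> and have a limit.\<close>
locale contractive_system =
  fixes D :: "nat \<Rightarrow> 'a normed_alg" and \<phi> :: "nat \<Rightarrow> nat \<Rightarrow> 'a \<Rightarrow> 'a"
  assumes Banach: "Banach_algebra (D k)"
    and hom: "m \<le> n \<Longrightarrow> \<phi> n m \<in> alg_hom (D m) (D n)"
    and contr: "\<lbrakk>m \<le> n; a \<in> carrier (D m)\<rbrakk> \<Longrightarrow> nrm (D n) (\<phi> n m a) \<le> nrm (D m) a"
    and ident: "a \<in> carrier (D m) \<Longrightarrow> \<phi> m m a = a"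
    and comp: "\<lbrakk>k \<le> m; m \<le> n; a \<in> carrier (D k)\<rbrakk> \<Longrightarrow> \<phi> n m (\<phi> m k a) = \<phi> n k a"
begin

sublocale Dk: Banach_algebra "D k" for k by (rule Banach)

lemma hom_closed: "\<lbrakk>m \<le> n; a \<in> carrier (D m)\<rbrakk> \<Longrightarrow> \<phi> n m a \<in> carrier (D n)"
  using hom[of m n] by (auto simp: alg_hom_def)

lemma hom_add: "\<lbrakk>m \<le> n; a \<in> carrier (D m); b \<in> carrier (D m)\<rbrakk> \<Longrightarrow>
    \<phi> n m (a \<oplus>\<^bsub>D m\<^esub> b) = \<phi> n m a \<oplus>\<^bsub>D n\<^esub> \<phi> n m b"
  using hom[of m n] by (auto simp: alg_hom_def)

lemma hom_mult: "\<lbrakk>m \<le> n; a \<in> carrier (D m); b \<in> carrier (D m)\<rbrakk> \<Longrightarrow>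
    \<phi> n m (a \<otimes>\<^bsub>D m\<^esub> b) = \<phi> n m a \<otimes>\<^bsub>D n\<^esub> \<phi> n m b"
  using hom[of m n] by (auto simp: alg_hom_def)

lemma hom_smult: "\<lbrakk>m \<le> n; a \<in> carrier (D m)\<rbrakk> \<Longrightarrow> \<phi> n m (c \<odot>\<^bsub>D m\<^esub> a) = c \<odot>\<^bsub>D n\<^esub> \<phi> n m a"
  using hom[of m n] by (auto simp: alg_hom_def)

lemma hom_zero: "m \<le> n \<Longrightarrow> \<phi> n m \<zero>\<^bsub>D m\<^esub> = \<zero>\<^bsub>D n\<^esub>"
  using hom_smult[of m n "\<zero>\<^bsub>D m\<^esub>" 0] hom_closed[of m n "\<zero>\<^bsub>D m\<^esub>"] by simp

abbreviation "L \<equiv> alg_direct_limit D \<phi>"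

definition \<iota> :: "nat \<Rightarrow> 'a \<Rightarrow> (nat \<times> 'a) set" where
  "\<iota> m a = dl_rel D \<phi> `` {(m, a)}"

lemma dl_base_iff [simp]: "(m, a) \<in> dl_base D \<longleftrightarrow> a \<in> carrier (D m)"
  by (simp add: dl_base_def)

lemma dl_rel_equiv: "equiv (dl_base D) (dl_rel D \<phi>)"
proof (rule equivI)
  show "dl_rel D \<phi> \<subseteq> dl_base D \<times> dl_base D" by (auto simp: dl_rel_def)
  show "refl_on (dl_base D) (dl_rel D \<phi>)" by (auto simp: refl_on_def dl_rel_def)
  show "sym (dl_rel D \<phi>)" by (fastforce simp: sym_def dl_rel_def)
  show "trans (dl_rel D \<phi>)"
  proof (rule transI, clarify)
    fix l a m b n c assume "((l, a), (m, b)) \<in> dl_rel D \<phi>" "((m, b), (n, c)) \<in> dl_rel D \<phi>"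
    then obtain i j where ij: "a \<in> carrier (D l)" "b \<in> carrier (D m)" "c \<in> carrier (D n)"
      "l \<le> i" "m \<le> i" "\<phi> i l a = \<phi> i m b" "m \<le> j" "n \<le> j" "\<phi> j m b = \<phi> j n c"
      by (auto simp: dl_rel_def)
    have "\<phi> (max i j) l a = \<phi> (max i j) i (\<phi> i l a)" using ij by (subst comp) auto
    also have "\<dots> = \<phi> (max i j) m b" unfolding ij(6) using ij by (subst comp) auto
    also have "\<dots> = \<phi> (max i j) j (\<phi> j m b)" using ij by (subst comp) auto
    also have "\<dots> = \<phi> (max i j) n c" unfolding ij(9) using ij by (subst comp) auto
    finally show "((l, a), (n, c)) \<in> dl_rel D \<phi>"
      using ij by (auto simp: dl_rel_def intro!: exI[of _ "max i j"])
  qed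
qed

lemma \<iota>_eq_iff:
  "\<lbrakk>a \<in> carrier (D m); b \<in> carrier (D n)\<rbrakk> \<Longrightarrow>
    \<iota> m a = \<iota> n b \<longleftrightarrow> (\<exists>k. m \<le> k \<and> n \<le> k \<and> \<phi> k m a = \<phi> k n b)"
  unfolding \<iota>_def using eq_equiv_class_iff[OF dl_rel_equiv, of "(m, a)" "(n, b)"]
  by (auto simp: dl_rel_def)

lemma \<iota>_push: "\<lbrakk>m \<le> n; a \<in> carrier (D m)\<rbrakk> \<Longrightarrow> \<iota> n (\<phi> n m a) = \<iota> m a"
  using \<iota>_eq_iff[OF hom_closed[of m n a], of a m] comp[of m n n a] by auto

lemma limit_carrier: "carrier L = (\<Union>m. \<iota> m ` carrier (D m))"
  by (auto simp: alg_direct_limit_def quotient_def \<iota>_def dl_base_def)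

lemma limit_carrierI: "a \<in> carrier (D m) \<Longrightarrow> \<iota> m a \<in> carrier L"
  by (auto simp: limit_carrier)

lemma limit_carrierE:
  assumes "x \<in> carrier L"
  obtains m a where "a \<in> carrier (D m)" "\<And>n. m \<le> n \<Longrightarrow> x = \<iota> n (\<phi> n m a)"
proof -
  obtain m a where "a \<in> carrier (D m)" "x = \<iota> m a" using assms unfolding limit_carrier by blast
  then show thesis using \<iota>_push[of m _ a] by (intro that[of a m]) auto
qed

text \<open>The binary operations of the limit are defined by unions over representatives. For an
  operation \<open>h\<close> that commutes with the maps of the system, all the classes in this union
  coincide.\<close>
lemma dl_congruent2:
  assumes hc: "\<And>k a b. \<lbrakk>a \<in> carrier (D k); b \<in> carrier (D k)\<rbrakk> \<Longrightarrow> h k a b \<in> carrier (D k)"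
    and hh: "\<And>k l a b. \<lbrakk>k \<le> l; a \<in> carrier (D k); b \<in> carrier (D k)\<rbrakk> \<Longrightarrow> \<phi> l k (h k a b) = h l (\<phi> l k a) (\<phi> l k b)"
  shows "a \<in> carrier (D m) \<Longrightarrow> b \<in> carrier (D n) \<Longrightarrow>
    (\<Union>(m, a)\<in>\<iota> m a. \<Union>(n, b)\<in>\<iota> n b. let k = max m n in \<iota> k (h k (\<phi> k m a) (\<phi> k n b))) =
    \<iota> (max m n) (h (max m n) (\<phi> (max m n) m a) (\<phi> (max m n) n b))"
proof -
  assume ab: "a \<in> carrier (D m)" "b \<in> carrier (D n)"
  define F where "F = (\<lambda>(m, a) (n, b). let k = max m n in \<iota> k (h k (\<phi> k m a) (\<phi> k n b)))"
  have F: "F (m, a) (n, b) = \<iota> k (h k (\<phi> k m a) (\<phi> k n b))"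
    if "a \<in> carrier (D m)" "b \<in> carrier (D n)" "m \<le> k" "n \<le> k" for m n k a b
  proof -
    let ?M = "max m n"
    have "\<iota> ?M (h ?M (\<phi> ?M m a) (\<phi> ?M n b)) = \<iota> k (\<phi> k ?M (h ?M (\<phi> ?M m a) (\<phi> ?M n b)))"
      using that by (intro \<iota>_push[symmetric] hc hom_closed) auto
    also have "\<phi> k ?M (h ?M (\<phi> ?M m a) (\<phi> ?M n b)) = h k (\<phi> k m a) (\<phi> k n b)"
      using that by (simp add: hh hom_closed comp)
    finally show ?thesis by (simp add: F_def Let_def)
  qed
  have "congruent2 (dl_rel D \<phi>) (dl_rel D \<phi>) F"
  proof (rule congruent2I', clarify)
    fix m a m' a' n b n' b' assume "((m, a), (m', a')) \<in> dl_rel D \<phi>" "((n, b), (n', b')) \<in> dl_rel D \<phi>"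
    then obtain i j where ij: "a \<in> carrier (D m)" "a' \<in> carrier (D m')" "b \<in> carrier (D n)" "b' \<in> carrier (D n')"
      "m \<le> i" "m' \<le> i" "\<phi> i m a = \<phi> i m' a'" "n \<le> j" "n' \<le> j" "\<phi> j n b = \<phi> j n' b'"
      by (auto simp: dl_rel_def)
    let ?k = "max i j"
    have "\<phi> ?k m a = \<phi> ?k m' a'"
      using comp[of m i ?k a] comp[of m' i ?k a'] ij by simp
    moreover have "\<phi> ?k n b = \<phi> ?k n' b'"
      using comp[of n j ?k b] comp[of n' j ?k b'] ij by simp
    ultimately show "F (m, a) (n, b) = F (m', a') (n', b')"
      using F[of a m b n ?k] F[of a' m' b' n' ?k] ij by simp
  qed
  from UN_equiv_class2[OF dl_rel_equiv dl_rel_equiv this, of "(m, a)" "(n, b)"] ab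
  have "(\<Union>x\<in>\<iota> m a. \<Union>y\<in>\<iota> n b. F x y) = F (m, a) (n, b)" by (simp add: \<iota>_def)
  then show ?thesis by (simp add: F_def split_def Let_def)
qed

lemma \<iota>_add: "\<lbrakk>a \<in> carrier (D k); b \<in> carrier (D k)\<rbrakk> \<Longrightarrow> \<iota> k a \<oplus>\<^bsub>L\<^esub> \<iota> k b = \<iota> k (a \<oplus>\<^bsub>D k\<^esub> b)"
  using dl_congruent2[of "\<lambda>k. add (D k)" a k b k] hom_add
  by (simp add: alg_direct_limit_def \<iota>_def[symmetric] ident)

lemma \<iota>_mult: "\<lbrakk>a \<in> carrier (D k); b \<in> carrier (D k)\<rbrakk> \<Longrightarrow> \<iota> k a \<otimes>\<^bsub>L\<^esub> \<iota> k b = \<iota> k (a \<otimes>\<^bsub>D k\<^esub> b)"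
  using dl_congruent2[of "\<lambda>k. monoid.mult (D k)" a k b k] hom_mult
  by (simp add: alg_direct_limit_def \<iota>_def[symmetric] ident Dk.mult_closed)

lemma \<iota>_smult: "a \<in> carrier (D m) \<Longrightarrow> c \<odot>\<^bsub>L\<^esub> \<iota> m a = \<iota> m (c \<odot>\<^bsub>D m\<^esub> a)"
proof -
  assume a: "a \<in> carrier (D m)"
  have "congruent (dl_rel D \<phi>) (\<lambda>(m, a). \<iota> m (c \<odot>\<^bsub>D m\<^esub> a))"
  proof (rule congruentI, clarify)
    fix m a n b assume "((m, a), (n, b)) \<in> dl_rel D \<phi>"
    then obtain k where "a \<in> carrier (D m)" "b \<in> carrier (D n)" "m \<le> k" "n \<le> k" "\<phi> k m a = \<phi> k n b"
      by (auto simp: dl_rel_def)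
    then show "\<iota> m (c \<odot>\<^bsub>D m\<^esub> a) = \<iota> n (c \<odot>\<^bsub>D n\<^esub> b)"
      by (subst \<iota>_eq_iff) (auto simp: Dk.smult_closed hom_smult intro!: exI[of _ k])
  qed
  from UN_equiv_class[OF dl_rel_equiv this, of "(m, a)"] a show ?thesis
    by (simp add: alg_direct_limit_def \<iota>_def split_def)
qed

lemma \<iota>_zero: "\<iota> k \<zero>\<^bsub>D k\<^esub> = \<zero>\<^bsub>L\<^esub>"
  using \<iota>_push[of 0 k "\<zero>\<^bsub>D 0\<^esub>"] hom_zero[of 0 k] by (simp add: alg_direct_limit_def \<iota>_def)

lemma nrm_stages_convergent: "a \<in> carrier (D m) \<Longrightarrow> convergent (\<lambda>n. nrm (D n) (\<phi> n m a))"
proof -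
  assume a: "a \<in> carrier (D m)"
  have "decseq (\<lambda>i. nrm (D (i + m)) (\<phi> (i + m) m a))"
  proof (rule decseq_SucI)
    fix i
    have "\<phi> (Suc i + m) m a = \<phi> (Suc i + m) (i + m) (\<phi> (i + m) m a)" using a by (simp add: comp)
    then show "nrm (D (Suc i + m)) (\<phi> (Suc i + m) m a) \<le> nrm (D (i + m)) (\<phi> (i + m) m a)"
      using a contr[of "i + m" "Suc i + m" "\<phi> (i + m) m a"] by (simp add: hom_closed)
  qed
  moreover have "\<And>i. 0 \<le> nrm (D (i + m)) (\<phi> (i + m) m a)" using a by (simp add: hom_closed Dk.nrm_nonneg)
  ultimately obtain l where "(\<lambda>i. nrm (D (i + m)) (\<phi> (i + m) m a)) \<longlonglongrightarrow> l"
    using decseq_convergent[of "\<lambda>i. nrm (D (i + m)) (\<phi> (i + m) m a)" 0] by blast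
  then show ?thesis using LIMSEQ_offset[of "\<lambda>n. nrm (D n) (\<phi> n m a)" m l] by (auto simp: convergent_def)
qed

lemma limit_nrm_tendsto:
  assumes a: "a \<in> carrier (D m)"
  shows "(\<lambda>n. nrm (D n) (\<phi> n m a)) \<longlonglongrightarrow> nrm L (\<iota> m a)"
proof -
  obtain r where r: "(\<lambda>n. nrm (D n) (\<phi> n m a)) \<longlonglongrightarrow> r"
    using nrm_stages_convergent[OF a] by (auto simp: convergent_def)
  have "s = r" if "\<exists>(m, a)\<in>\<iota> m a. (\<lambda>n. nrm (D n) (\<phi> n m a)) \<longlonglongrightarrow> s" for s
  proof -
    obtain m' b where "((m, a), (m', b)) \<in> dl_rel D \<phi>" and s: "(\<lambda>n. nrm (D n) (\<phi> n m' b)) \<longlonglongrightarrow> s"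
      using \<open>\<exists>(m, a)\<in>\<iota> m a. _ m a\<close> by (auto simp: \<iota>_def)
    then obtain k where k: "b \<in> carrier (D m')" "m \<le> k" "m' \<le> k" "\<phi> k m a = \<phi> k m' b" by (auto simp: dl_rel_def)
    have "\<phi> n m a = \<phi> n m' b" if "n \<ge> k" for n
      using comp[of m k n a] comp[of m' k n b] k a that by simp
    then have "\<forall>\<^sub>F n in sequentially. nrm (D n) (\<phi> n m' b) = nrm (D n) (\<phi> n m a)"
      by (auto simp: eventually_sequentially intro!: exI[of _ k])
    then have "(\<lambda>n. nrm (D n) (\<phi> n m a)) \<longlonglongrightarrow> s" using s tendsto_cong by fastforce
    then show "s = r" using r LIMSEQ_unique by blast
  qed
  moreover have "(m, a) \<in> \<iota> m a" using a dl_rel_equiv by (auto simp: \<iota>_def equiv_def refl_on_def)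
  ultimately have "(THE r. \<exists>(m, a)\<in>\<iota> m a. (\<lambda>n. nrm (D n) (\<phi> n m a)) \<longlonglongrightarrow> r) = r"
    using r by (intro the_equality) blast+
  then show ?thesis using r by (simp add: alg_direct_limit_def)
qed

lemma limit_algebra: "complex_algebra L"
proof (rule complex_algebra_covered)
  show "\<zero>\<^bsub>L\<^esub> \<in> carrier L" using limit_carrierI[of "\<zero>\<^bsub>D 0\<^esub>" 0] by (simp add: \<iota>_zero)
  fix x y z assume "x \<in> carrier L" "y \<in> carrier L" "z \<in> carrier L"
  then obtain m a n b l c where "a \<in> carrier (D m)" "\<And>k. m \<le> k \<Longrightarrow> x = \<iota> k (\<phi> k m a)"
    "b \<in> carrier (D n)" "\<And>k. n \<le> k \<Longrightarrow> y = \<iota> k (\<phi> k n b)"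
    "c \<in> carrier (D l)" "\<And>k. l \<le> k \<Longrightarrow> z = \<iota> k (\<phi> k l c)"
    by (elim limit_carrierE) blast
  then have "x = \<iota> (max m (max n l)) (\<phi> (max m (max n l)) m a) \<and> \<phi> (max m (max n l)) m a \<in> carrier (D (max m (max n l)))"
    "y = \<iota> (max m (max n l)) (\<phi> (max m (max n l)) n b) \<and> \<phi> (max m (max n l)) n b \<in> carrier (D (max m (max n l)))"
    "z = \<iota> (max m (max n l)) (\<phi> (max m (max n l)) l c) \<and> \<phi> (max m (max n l)) l c \<in> carrier (D (max m (max n l)))"
    by (auto intro!: hom_closed)
  then have "x \<in> \<iota> (max m (max n l)) ` carrier (D (max m (max n l))) \<and>
    y \<in> \<iota> (max m (max n l)) ` carrier (D (max m (max n l))) \<and>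
    z \<in> \<iota> (max m (max n l)) ` carrier (D (max m (max n l)))"
    by blast
  moreover have "\<iota> k \<in> alg_hom (D k) L" for k
    by (auto simp: alg_hom_def limit_carrierI \<iota>_add \<iota>_mult \<iota>_smult)
  ultimately show "\<exists>(B :: 'a normed_alg) q. complex_algebra B \<and> q \<in> alg_hom B L \<and> q \<zero>\<^bsub>B\<^esub> = \<zero>\<^bsub>L\<^esub> \<and>
      x \<in> q ` carrier B \<and> y \<in> q ` carrier B \<and> z \<in> q ` carrier B"
    by (intro exI[of _ "D (max m (max n l))"] exI[of _ "\<iota> (max m (max n l))"] conjI Dk.complex_algebra_axioms)
       (simp_all add: \<iota>_zero)
qed

lemma limit_seminormed: "seminormed_algebra L"
proof (intro seminormed_algebra.intro limit_algebra seminormed_algebra_axioms.intro)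
  fix x y assume "x \<in> carrier L" "y \<in> carrier L"
  then obtain m a n b where a: "a \<in> carrier (D m)" "\<And>k. m \<le> k \<Longrightarrow> x = \<iota> k (\<phi> k m a)"
    and b: "b \<in> carrier (D n)" "\<And>k. n \<le> k \<Longrightarrow> y = \<iota> k (\<phi> k n b)"
    by (elim limit_carrierE) blast
  define k where "k = max m n"
  define a' b' where "a' = \<phi> k m a" and "b' = \<phi> k n b"
  have c: "a' \<in> carrier (D k)" "b' \<in> carrier (D k)" "x = \<iota> k a'" "y = \<iota> k b'"
    using a b by (auto simp: a'_def b'_def k_def hom_closed)
  note lim = limit_nrm_tendsto[OF c(1)] limit_nrm_tendsto[OF c(2)]
  have cl: "a' \<oplus>\<^bsub>D k\<^esub> b' \<in> carrier (D k)" "a' \<otimes>\<^bsub>D k\<^esub> b' \<in> carrier (D k)"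
    using c by (auto intro: Dk.mult_closed)
  show "nrm L (x \<oplus>\<^bsub>L\<^esub> y) \<le> nrm L x + nrm L y"
    unfolding c(3,4) \<iota>_add[OF c(1,2)]
  proof (rule LIMSEQ_le[OF limit_nrm_tendsto[OF cl(1)] tendsto_add[OF lim]])
    show "\<exists>N. \<forall>n\<ge>N. nrm (D n) (\<phi> n k (a' \<oplus>\<^bsub>D k\<^esub> b')) \<le> nrm (D n) (\<phi> n k a') + nrm (D n) (\<phi> n k b')"
      using c by (intro exI[of _ k]) (simp add: hom_add Dk.nrm_add hom_closed)
  qed
  show "nrm L (x \<otimes>\<^bsub>L\<^esub> y) \<le> nrm L x * nrm L y"
    unfolding c(3,4) \<iota>_mult[OF c(1,2)]
  proof (rule LIMSEQ_le[OF limit_nrm_tendsto[OF cl(2)] tendsto_mult[OF lim]])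
    show "\<exists>N. \<forall>n\<ge>N. nrm (D n) (\<phi> n k (a' \<otimes>\<^bsub>D k\<^esub> b')) \<le> nrm (D n) (\<phi> n k a') * nrm (D n) (\<phi> n k b')"
      using c by (intro exI[of _ k]) (simp add: hom_mult Dk.nrm_mult hom_closed)
  qed
next
  fix x c assume "x \<in> carrier L"
  then obtain m a where a: "a \<in> carrier (D m)" "x = \<iota> m a"
    unfolding limit_carrier by blast
  have "\<forall>\<^sub>F n in sequentially. cmod c * nrm (D n) (\<phi> n m a) = nrm (D n) (\<phi> n m (c \<odot>\<^bsub>D m\<^esub> a))"
    using a by (auto simp: eventually_sequentially hom_smult hom_closed Dk.nrm_smult intro!: exI[of _ m])
  from tendsto_cong[OF this] tendsto_mult_left[OF limit_nrm_tendsto[OF a(1)], of "cmod c"]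
  have "(\<lambda>n. nrm (D n) (\<phi> n m (c \<odot>\<^bsub>D m\<^esub> a))) \<longlonglongrightarrow> cmod c * nrm L (\<iota> m a)" by blast
  then show "nrm L (c \<odot>\<^bsub>L\<^esub> x) = cmod c * nrm L x"
    unfolding a(2) \<iota>_smult[OF a(1)]
    using limit_nrm_tendsto[OF Dk.smult_closed[OF a(1)], of c] LIMSEQ_unique by blast
qed

sublocale L: seminormed_algebra L by (rule limit_seminormed)

text \<open>The canonical map of a stage to the completed limit.\<close>
definition \<psi> :: "nat \<Rightarrow> 'a \<Rightarrow> (nat \<Rightarrow> (nat \<times> 'a) set) set" where
  "\<psi> m a = null_rel L `` {\<lambda>_. \<iota> m a}"

abbreviation "B \<equiv> Banach_direct_limit D \<phi>"

lemma limit_Banach: "Banach_algebra B"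
  unfolding Banach_direct_limit_def by (rule L.completion_Banach)

sublocale B: Banach_algebra B by (rule limit_Banach)

lemma \<psi>_hom: "\<psi> m \<in> alg_hom (D m) B"
  by (auto simp: alg_hom_def \<psi>_def Banach_direct_limit_def L.completion_carrier L.completion_add
      L.completion_mult L.completion_smult L.cauchy_const limit_carrierI \<iota>_add \<iota>_mult \<iota>_smult)

lemma \<psi>_push: "\<lbrakk>m \<le> n; a \<in> carrier (D m)\<rbrakk> \<Longrightarrow> \<psi> n (\<phi> n m a) = \<psi> m a"
  by (simp add: \<psi>_def \<iota>_push)

lemma \<psi>_nrm: "a \<in> carrier (D m) \<Longrightarrow> (\<lambda>n. nrm (D n) (\<phi> n m a)) \<longlonglongrightarrow> nrm B (\<psi> m a)"
  using limit_nrm_tendsto[of a m] L.completion_nrm_eq[OF L.cauchy_const[OF limit_carrierI], OF _ tendsto_const, of a m]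
  by (simp add: \<psi>_def Banach_direct_limit_def)

lemma \<psi>_dense:
  assumes "x \<in> carrier B" "0 < e"
  shows "\<exists>m. \<exists>a\<in>carrier (D m). nrm B (x \<ominus>\<^bsub>B\<^esub> \<psi> m a) < e"
  using L.completion_dense[of x e] assms unfolding limit_carrier \<psi>_def Banach_direct_limit_def by auto

end

section \<open>Complete normed rings\<close>

text \<open>Only the ring structure and the norm matter for the perturbation of idempotents. Scalar
  multiplication is left out so that matrix rings over unitizations, which carry none here, are
  covered. The norm of the unit may exceed one, as it does for the norm of matrices below.\<close>
locale Banach_ring = ring R for R :: "('a, 'm) ring_scheme" (structure) +
  fixes N :: "'a \<Rightarrow> real"
  assumes N_eq_0: "\<lbrakk>x \<in> carrier R; N x = 0\<rbrakk> \<Longrightarrow> x = \<zero>"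
    and N_zero: "N \<zero> = 0"
    and N_minus: "x \<in> carrier R \<Longrightarrow> N (\<ominus> x) = N x"
    and N_add: "\<lbrakk>x \<in> carrier R; y \<in> carrier R\<rbrakk> \<Longrightarrow> N (x \<oplus> y) \<le> N x + N y"
    and N_mult: "\<lbrakk>x \<in> carrier R; y \<in> carrier R\<rbrakk> \<Longrightarrow> N (x \<otimes> y) \<le> N x * N y"
    and N_complete: "\<lbrakk>\<And>n. X n \<in> carrier R; \<And>e. 0 < e \<Longrightarrow> \<exists>M. \<forall>m\<ge>M. \<forall>n\<ge>M. N (X m \<ominus> X n) < e\<rbrakk> \<Longrightarrow>
      \<exists>x\<in>carrier R. (\<lambda>n. N (X n \<ominus> x)) \<longlonglongrightarrow> 0"
begin

lemma N_nonneg: "x \<in> carrier R \<Longrightarrow> 0 \<le> N x"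
  using N_add[of x "\<ominus> x"] by (simp add: r_neg N_zero N_minus)

lemma N_diff_commute: "\<lbrakk>x \<in> carrier R; y \<in> carrier R\<rbrakk> \<Longrightarrow> N (x \<ominus> y) = N (y \<ominus> x)"
  using N_minus[of "x \<ominus> y"] by (simp add: a_minus_def minus_add a_comm)

lemma N_diff_triangle:
  assumes "x \<in> carrier R" "y \<in> carrier R" "z \<in> carrier R"
  shows "N (x \<ominus> z) \<le> N (x \<ominus> y) + N (y \<ominus> z)"
proof -
  have "x \<ominus> z = (x \<ominus> y) \<oplus> (y \<ominus> z)" using assms by algebra
  then show ?thesis using N_add[of "x \<ominus> y" "y \<ominus> z"] assms by simp
qed

definition lims :: "(nat \<Rightarrow> 'a) \<Rightarrow> 'a \<Rightarrow> bool" where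
  "lims X x \<longleftrightarrow> (\<forall>n. X n \<in> carrier R) \<and> x \<in> carrier R \<and> (\<lambda>n. N (X n \<ominus> x)) \<longlonglongrightarrow> 0"

lemma limsD: "lims X x \<Longrightarrow> X n \<in> carrier R" "lims X x \<Longrightarrow> x \<in> carrier R"
  "lims X x \<Longrightarrow> (\<lambda>n. N (X n \<ominus> x)) \<longlonglongrightarrow> 0"
  by (auto simp: lims_def)

lemma lims_bound:
  assumes "\<And>n. X n \<in> carrier R" "x \<in> carrier R" "\<And>n. N (X n \<ominus> x) \<le> b n" "b \<longlonglongrightarrow> 0"
  shows "lims X x"
  unfolding lims_def
proof (intro conjI allI assms)
  show "(\<lambda>n. N (X n \<ominus> x)) \<longlonglongrightarrow> 0"
    by (rule tendsto_sandwich[OF always_eventually always_eventually tendsto_const assms(4)])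
       (use assms in \<open>auto intro!: N_nonneg\<close>)
qed

lemma lims_const: "x \<in> carrier R \<Longrightarrow> lims (\<lambda>_. x) x"
  by (simp add: lims_def a_minus_def r_neg N_zero)

lemma lims_unique:
  assumes X: "lims X x" "lims X y"
  shows "x = y"
proof -
  note [simp] = limsD(1)[OF X(1)] limsD(2)[OF X(1)] limsD(2)[OF X(2)]
  have "N (x \<ominus> y) \<le> N (X n \<ominus> x) + N (X n \<ominus> y)" for n
    using N_diff_triangle[of x "X n" y] N_diff_commute[of x "X n"] by simp
  then have "N (x \<ominus> y) \<le> 0 + 0"
    by (intro LIMSEQ_le_const[OF tendsto_add[OF limsD(3)[OF X(1)] limsD(3)[OF X(2)]]]) auto
  then have "x \<ominus> y = \<zero>" using N_nonneg[of "x \<ominus> y"] by (intro N_eq_0) auto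
  moreover have "x = (x \<ominus> y) \<oplus> y" using limsD(2)[OF X(1)] limsD(2)[OF X(2)] by algebra
  ultimately show ?thesis by simp
qed

lemma lims_Suc: "lims X x \<Longrightarrow> lims (\<lambda>n. X (Suc n)) x"
  using LIMSEQ_Suc by (fastforce simp: lims_def)

lemma lims_add:
  assumes X: "lims X x" and Y: "lims Y y"
  shows "lims (\<lambda>n. X n \<oplus> Y n) (x \<oplus> y)"
proof (rule lims_bound)
  note [simp] = limsD(1)[OF X] limsD(2)[OF X] limsD(1)[OF Y] limsD(2)[OF Y]
  fix n
  have "X n \<oplus> Y n \<ominus> (x \<oplus> y) = (X n \<ominus> x) \<oplus> (Y n \<ominus> y)"
    using limsD(1)[OF X, of n] limsD(2)[OF X] limsD(1)[OF Y, of n] limsD(2)[OF Y] by algebra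
  then show "N (X n \<oplus> Y n \<ominus> (x \<oplus> y)) \<le> N (X n \<ominus> x) + N (Y n \<ominus> y)" by (simp add: N_add)
next
  show "(\<lambda>n. N (X n \<ominus> x) + N (Y n \<ominus> y)) \<longlonglongrightarrow> 0"
    using tendsto_add[OF limsD(3)[OF X] limsD(3)[OF Y]] by simp
qed (use X Y in \<open>auto dest: limsD\<close>)

lemma lims_minus: "lims X x \<Longrightarrow> lims (\<lambda>n. \<ominus> X n) (\<ominus> x)"
proof (rule lims_bound[where b = "\<lambda>n. N (X n \<ominus> x)"])
  fix n assume X: "lims X x"
  then have "\<ominus> X n \<ominus> \<ominus> x = \<ominus> (X n \<ominus> x)"
    using limsD(1)[OF X, of n] limsD(2)[OF X] by algebra
  then show "N (\<ominus> X n \<ominus> \<ominus> x) \<le> N (X n \<ominus> x)" using limsD[OF X] by (simp add: N_minus)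
qed (auto dest: limsD)

lemma lims_diff: "\<lbrakk>lims X x; lims Y y\<rbrakk> \<Longrightarrow> lims (\<lambda>n. X n \<ominus> Y n) (x \<ominus> y)"
  unfolding a_minus_def by (intro lims_add lims_minus)

lemma lims_N:
  assumes X: "lims X x"
  shows "(\<lambda>n. N (X n)) \<longlonglongrightarrow> N x"
proof -
  note [simp] = limsD(1)[OF X] limsD(2)[OF X]
  have "(\<lambda>n. N (X n) - N x) \<longlonglongrightarrow> 0"
  proof (rule tendsto_0_le[OF limsD(3)[OF X], of _ 1], intro always_eventually allI)
    fix n
    have "N (X n) \<le> N (X n \<ominus> x) + N x" "N x \<le> N (X n \<ominus> x) + N (X n)"
      using N_add[of "X n \<ominus> x" x] N_add[of "x \<ominus> X n" "X n"] N_diff_commute[of x "X n"]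
      by (simp_all add: a_minus_def a_assoc l_neg)
    then show "norm (N (X n) - N x) \<le> norm (N (X n \<ominus> x)) * 1" using N_nonneg[of "X n \<ominus> x"] by simp
  qed
  then show ?thesis by (simp add: LIM_zero_iff)
qed

lemma lims_mult:
  assumes X: "lims X x" and Y: "lims Y y"
  shows "lims (\<lambda>n. X n \<otimes> Y n) (x \<otimes> y)"
proof (rule lims_bound)
  note [simp] = limsD(1)[OF X] limsD(2)[OF X] limsD(1)[OF Y] limsD(2)[OF Y]
  fix n
  have "X n \<otimes> Y n \<ominus> x \<otimes> y = (X n \<ominus> x) \<otimes> Y n \<oplus> x \<otimes> (Y n \<ominus> y)"
    using limsD(1)[OF X, of n] limsD(2)[OF X] limsD(1)[OF Y, of n] limsD(2)[OF Y] by algebra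
  then have "N (X n \<otimes> Y n \<ominus> x \<otimes> y) \<le> N ((X n \<ominus> x) \<otimes> Y n) + N (x \<otimes> (Y n \<ominus> y))" by (simp add: N_add)
  also have "\<dots> \<le> N (X n \<ominus> x) * N (Y n) + N x * N (Y n \<ominus> y)" by (intro add_mono N_mult) auto
  finally show "N (X n \<otimes> Y n \<ominus> x \<otimes> y) \<le> N (X n \<ominus> x) * N (Y n) + N x * N (Y n \<ominus> y)" .
next
  have "(\<lambda>n. N (X n \<ominus> x) * N (Y n) + N x * N (Y n \<ominus> y)) \<longlonglongrightarrow> 0 * N y + N x * 0"
    by (intro tendsto_add tendsto_mult tendsto_const limsD(3)[OF X] limsD(3)[OF Y] lims_N[OF Y])
  then show "(\<lambda>n. N (X n \<ominus> x) * N (Y n) + N x * N (Y n \<ominus> y)) \<longlonglongrightarrow> 0" by simp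
qed (use X Y in \<open>auto dest: limsD\<close>)

text \<open>The sequence is Cauchy since its increments are dominated by a convergent geometric series,
  whose sum also bounds the distance of the limit from the start.\<close>
lemma lims_geometric:
  assumes Y: "\<And>n. Y n \<in> carrier R" and C: "0 \<le> C" and q: "0 \<le> q" "q < 1"
    and step: "\<And>n. N (Y (Suc n) \<ominus> Y n) \<le> C * q ^ n"
  shows "\<exists>y. lims Y y \<and> N (y \<ominus> Y 0) \<le> C / (1 - q)"
proof -
  have est: "N (Y (n + k) \<ominus> Y n) \<le> C * q ^ n * ((1 - q ^ k) / (1 - q))" for n k
  proof (induction k)
    case 0
    then show ?case using Y by (simp add: a_minus_def r_neg N_zero)
  next
    case (Suc k)
    have "N (Y (n + Suc k) \<ominus> Y n) \<le> N (Y (Suc (n + k)) \<ominus> Y (n + k)) + N (Y (n + k) \<ominus> Y n)"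
      using N_diff_triangle[OF Y Y Y] by simp
    also have "\<dots> \<le> C * q ^ (n + k) + C * q ^ n * ((1 - q ^ k) / (1 - q))"
      by (intro add_mono step Suc)
    also have "\<dots> = C * q ^ n * ((1 - q ^ Suc k) / (1 - q))"
      using q by (simp add: power_add field_simps)
    finally show ?case .
  qed
  have est': "N (Y (n + k) \<ominus> Y n) \<le> C / (1 - q) * q ^ n" for n k
  proof -
    have "C * q ^ n * ((1 - q ^ k) / (1 - q)) \<le> C * q ^ n * (1 / (1 - q))"
      using q C by (intro mult_left_mono divide_right_mono) auto
    then show ?thesis using est[of n k] by (simp add: mult.commute)
  qed
  have "\<exists>x\<in>carrier R. (\<lambda>n. N (Y n \<ominus> x)) \<longlonglongrightarrow> 0"
  proof (rule N_complete[OF Y])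
    fix e :: real assume e: "0 < e"
    have "(\<lambda>n. C / (1 - q) * q ^ n) \<longlonglongrightarrow> C / (1 - q) * 0"
      by (intro tendsto_mult_left LIMSEQ_power_zero) (use q in auto)
    then have "\<forall>\<^sub>F n in sequentially. C / (1 - q) * q ^ n < e"
      using order_tendstoD(2)[of _ "C / (1 - q) * 0" sequentially e] e by simp
    then obtain M where M: "\<And>n. n \<ge> M \<Longrightarrow> C / (1 - q) * q ^ n < e" by (auto simp: eventually_sequentially)
    have less: "N (Y m \<ominus> Y n) < e" if "m \<ge> n" "n \<ge> M" for m n
      using est'[of n "m - n"] M[of n] that by simp
    have "N (Y m \<ominus> Y n) < e" if "m \<ge> M" "n \<ge> M" for m n
      using less[of m n] less[of n m] N_diff_commute[OF Y Y, of m n] that by (cases "m \<ge> n") auto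
    then show "\<exists>M. \<forall>m\<ge>M. \<forall>n\<ge>M. N (Y m \<ominus> Y n) < e" by blast
  qed
  then obtain y where y: "lims Y y" using Y by (auto simp: lims_def)
  have "(\<lambda>n. N (Y n \<ominus> Y 0)) \<longlonglongrightarrow> N (y \<ominus> Y 0)"
    by (intro lims_N lims_diff lims_const y Y)
  then have "N (y \<ominus> Y 0) \<le> C / (1 - q)"
    using est'[of 0] by (intro LIMSEQ_le_const2[of _ "N (y \<ominus> Y 0)"]) auto
  with y show ?thesis by blast
qed

text \<open>The inverse is the limit of the partial sums of the Neumann series, here generated by the
  iteration of \<open>y \<mapsto> 1 + x y\<close> from zero.\<close>
lemma Neumann:
  assumes x: "x \<in> carrier R" and N: "N x < 1"
  shows "\<exists>y\<in>carrier R. (\<one> \<ominus> x) \<otimes> y = \<one> \<and> y \<otimes> (\<one> \<ominus> x) = \<one>"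
proof -
  define Y where "Y = rec_nat \<zero> (\<lambda>_ y. \<one> \<oplus> x \<otimes> y)"
  have Y0: "Y 0 = \<zero>" and YS: "Y (Suc n) = \<one> \<oplus> x \<otimes> Y n" for n by (simp_all add: Y_def)
  have Y: "Y n \<in> carrier R" for n by (induction n) (use x in \<open>simp_all add: Y0 YS\<close>)
  have Yx: "Y n \<otimes> x = x \<otimes> Y n" for n
    by (induction n) (use x Y in \<open>simp_all add: Y0 YS l_distr r_distr m_assoc\<close>)
  have step: "N (Y (Suc n) \<ominus> Y n) \<le> N \<one> * N x ^ n" for n
  proof (induction n)
    case 0
    then show ?case using x by (simp add: Y0 YS a_minus_def)
  next
    case (Suc n)
    have "Y (Suc (Suc n)) \<ominus> Y (Suc n) = x \<otimes> (Y (Suc n) \<ominus> Y n)"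
      unfolding YS[of "Suc n"] YS[of n, symmetric] using x Y[of n] unfolding YS[of n] by algebra
    then have "N (Y (Suc (Suc n)) \<ominus> Y (Suc n)) \<le> N x * N (Y (Suc n) \<ominus> Y n)"
      using N_mult[of x "Y (Suc n) \<ominus> Y n"] x Y by simp
    also have "\<dots> \<le> N x * (N \<one> * N x ^ n)" using Suc N_nonneg[OF x] by (rule mult_left_mono)
    finally show ?case by (simp add: mult_ac)
  qed
  obtain y where y: "lims Y y"
    using lims_geometric[of Y "N \<one>" "N x"] Y step N N_nonneg x by auto
  have yc: "y \<in> carrier R" using limsD(2)[OF y] .
  have "lims (\<lambda>n. \<one> \<oplus> x \<otimes> Y n) (\<one> \<oplus> x \<otimes> y)"
    by (intro lims_add lims_mult lims_const y x one_closed)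
  then have 1: "y = \<one> \<oplus> x \<otimes> y" by (rule lims_unique[OF lims_Suc[OF y], unfolded YS])
  have "lims (\<lambda>n. Y n \<otimes> x) (x \<otimes> y)"
    unfolding Yx by (rule lims_mult[OF lims_const[OF x] y])
  then have 2: "y \<otimes> x = x \<otimes> y" by (rule lims_unique[OF lims_mult[OF y lims_const[OF x]]])
  have "(\<one> \<ominus> x) \<otimes> y = y \<ominus> x \<otimes> y" "y \<otimes> (\<one> \<ominus> x) = y \<ominus> y \<otimes> x"
    using x yc by (simp_all add: a_minus_def l_distr r_distr l_minus r_minus)
  moreover have "y \<ominus> x \<otimes> y = (\<one> \<oplus> x \<otimes> y) \<ominus> x \<otimes> y" by (rule arg_cong[OF 1])
  moreover have "(\<one> \<oplus> x \<otimes> y) \<ominus> x \<otimes> y = \<one>" using x yc by algebra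
  ultimately have "(\<one> \<ominus> x) \<otimes> y = \<one>" "y \<otimes> (\<one> \<ominus> x) = \<one>" unfolding 2 by (simp_all only:)
  then show ?thesis using yc by blast
qed

text \<open>In the corner rings of \<open>e\<close> and \<open>f\<close> the products \<open>x y\<close> and \<open>y x\<close> are invertible, by the
  Neumann series for \<open>1 - (e - x y)\<close> and \<open>1 - (f - y x)\<close>. So \<open>x\<close> has a right and a left inverse
  between \<open>e\<close> and \<open>f\<close>, and the two agree.\<close>
lemma equivalent_if_nearly_inverse:
  assumes e: "e \<in> carrier R" "e \<otimes> e = e" and f: "f \<in> carrier R" "f \<otimes> f = f"
    and x: "x \<in> carrier R" "e \<otimes> x = x" "x \<otimes> f = x" and y: "y \<in> carrier R" "f \<otimes> y = y" "y \<otimes> e = y"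
    and small: "N (e \<ominus> x \<otimes> y) < 1" "N (f \<ominus> y \<otimes> x) < 1"
  shows "\<exists>y'\<in>carrier R. x \<otimes> y' = e \<and> y' \<otimes> x = f"
proof -
  obtain v where v: "v \<in> carrier R" "(\<one> \<ominus> (e \<ominus> x \<otimes> y)) \<otimes> v = \<one>"
    using Neumann[OF _ small(1)] e x y by auto
  obtain w where w: "w \<in> carrier R" "w \<otimes> (\<one> \<ominus> (f \<ominus> y \<otimes> x)) = \<one>"
    using Neumann[OF _ small(2)] f x y by auto
  have "e \<otimes> (\<one> \<ominus> (e \<ominus> x \<otimes> y)) = e \<otimes> \<one> \<ominus> e \<otimes> e \<oplus> (e \<otimes> x) \<otimes> y" using e(1) x(1) y(1) by algebra
  also have "\<dots> = e \<ominus> e \<otimes> e \<oplus> (e \<otimes> x) \<otimes> y" using e(1) by simp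
  also have "\<dots> = x \<otimes> y" unfolding e(2) x(2) using e(1) x(1) y(1) by algebra
  finally have "x \<otimes> y \<otimes> v = e \<otimes> (\<one> \<ominus> (e \<ominus> x \<otimes> y)) \<otimes> v" by simp
  also have "\<dots> = e" using v e x y by (subst m_assoc) auto
  finally have 1: "x \<otimes> (y \<otimes> v \<otimes> e) = e"
    using e x(1) y(1) v(1) by (simp add: m_assoc[symmetric])
  have "(\<one> \<ominus> (f \<ominus> y \<otimes> x)) \<otimes> f = f \<ominus> f \<otimes> f \<oplus> y \<otimes> (x \<otimes> f)" using f(1) x(1) y(1) by algebra
  also have "\<dots> = y \<otimes> x" unfolding f(2) x(3) using f(1) x(1) y(1) by algebra
  finally have "w \<otimes> (y \<otimes> x) = w \<otimes> ((\<one> \<ominus> (f \<ominus> y \<otimes> x)) \<otimes> f)" by simp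
  also have "\<dots> = f" using w f x y by (subst m_assoc[symmetric]) auto
  finally have 2: "(f \<otimes> w \<otimes> y) \<otimes> x = f"
    using f x(1) y(1) w(1) by (simp add: m_assoc)
  let ?y = "y \<otimes> v \<otimes> e" and ?z = "f \<otimes> w \<otimes> y"
  have "f \<otimes> ?y = ?y" using f(1) y(1) v(1) e(1) by (simp add: m_assoc[symmetric] y(2))
  then have "?y = (?z \<otimes> x) \<otimes> ?y" using 2 by simp
  also have "\<dots> = ?z \<otimes> (x \<otimes> ?y)" using f(1) y(1) v(1) e(1) w(1) x(1) by (simp add: m_assoc)
  also have "\<dots> = ?z" unfolding 1 using f(1) y(1) e(1) w(1) by (simp add: m_assoc y(3))
  finally have "?y \<otimes> x = f" using 2 by simp
  then show ?thesis using 1 y(1) v(1) e(1) by (intro bexI[of _ ?y]) auto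
qed

text \<open>The Newton step \<open>h(a) = a + (a\<^sup>2 - a) (1 - 2 a) = 3 a\<^sup>2 - 2 a\<^sup>3\<close> for the equation \<open>a\<^sup>2 = a\<close>
  squares the defect \<open>x = a\<^sup>2 - a\<close>, up to a factor: with \<open>c = 1 - 2 a\<close> one has \<open>c\<^sup>2 = 1 + 4 x\<close>,
  and everything commutes.\<close>
lemma Newton_identity:
  assumes a: "a \<in> carrier R"
  defines "x \<equiv> a \<otimes> a \<ominus> a"
  defines "h \<equiv> a \<oplus> x \<otimes> (\<one> \<ominus> (a \<oplus> a))"
  shows "h \<otimes> h \<ominus> h = x \<otimes> x \<otimes> (x \<oplus> x \<oplus> x \<oplus> x \<ominus> (\<one> \<oplus> \<one> \<oplus> \<one>))"
proof -
  have x: "x \<in> carrier R" using a by (simp add: x_def)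
  have ax: "a \<otimes> x = x \<otimes> a" unfolding x_def using a by algebra
  have xx: "a \<otimes> a = x \<oplus> a" unfolding x_def using a by algebra
  define c where "c = \<one> \<ominus> (a \<oplus> a)"
  have c: "c \<in> carrier R" using a by (simp add: c_def)
  have ac: "a \<otimes> c = c \<otimes> a" unfolding c_def using a by (simp add: a_minus_def r_distr l_distr r_minus l_minus)
  have cx: "c \<otimes> x = x \<otimes> c"
    unfolding c_def using a x ax by (simp add: a_minus_def r_distr l_distr r_minus l_minus)
  have aa: "a \<oplus> a = \<one> \<ominus> c" unfolding c_def using a by (simp add: a_minus_def minus_add minus_minus r_neg2 a_assoc[symmetric] r_neg)
  have cc: "c \<otimes> c = \<one> \<oplus> x \<oplus> x \<oplus> x \<oplus> x"
  proof -
    have "c \<otimes> c = c \<ominus> c \<otimes> (a \<oplus> a)" unfolding c_def using a by (simp add: a_minus_def r_distr r_minus)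
    also have "c \<otimes> (a \<oplus> a) = (a \<oplus> a) \<ominus> (a \<oplus> a) \<otimes> (a \<oplus> a)"
      unfolding c_def using a by (simp add: a_minus_def l_distr l_minus)
    also have "(a \<oplus> a) \<otimes> (a \<oplus> a) = a \<otimes> a \<oplus> a \<otimes> a \<oplus> a \<otimes> a \<oplus> a \<otimes> a" using a by algebra
    also have "\<dots> = (x \<oplus> a) \<oplus> (x \<oplus> a) \<oplus> (x \<oplus> a) \<oplus> (x \<oplus> a)" unfolding xx ..
    finally have "c \<otimes> c = (\<one> \<ominus> (a \<oplus> a)) \<ominus> ((a \<oplus> a) \<ominus> ((x \<oplus> a) \<oplus> (x \<oplus> a) \<oplus> (x \<oplus> a) \<oplus> (x \<oplus> a)))"
      by (simp add: c_def)
    also have "\<dots> = \<one> \<oplus> x \<oplus> x \<oplus> x \<oplus> x" using a x by algebra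
    finally show ?thesis .
  qed
  have "h \<otimes> h = a \<otimes> a \<oplus> (a \<otimes> x) \<otimes> c \<oplus> x \<otimes> (c \<otimes> a) \<oplus> x \<otimes> (c \<otimes> x) \<otimes> c"
    unfolding h_def c_def[symmetric] using a x c by algebra
  also have "\<dots> = x \<oplus> a \<oplus> x \<otimes> ((a \<oplus> a) \<otimes> c) \<oplus> x \<otimes> x \<otimes> (c \<otimes> c)"
    unfolding xx ax cx ac[symmetric] using a x c by algebra
  also have "\<dots> = x \<oplus> a \<oplus> x \<otimes> c \<ominus> x \<otimes> (c \<otimes> c) \<oplus> x \<otimes> x \<otimes> (c \<otimes> c)"
    unfolding aa using a x c by algebra
  finally have "h \<otimes> h \<ominus> h = x \<ominus> x \<otimes> (c \<otimes> c) \<oplus> x \<otimes> x \<otimes> (c \<otimes> c)"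
    unfolding h_def c_def[symmetric] using a x c by algebra
  also have "\<dots> = x \<ominus> (x \<oplus> x \<otimes> x \<oplus> x \<otimes> x \<oplus> x \<otimes> x \<oplus> x \<otimes> x) \<oplus>
      (x \<otimes> x \<oplus> x \<otimes> x \<otimes> x \<oplus> x \<otimes> x \<otimes> x \<oplus> x \<otimes> x \<otimes> x \<oplus> x \<otimes> x \<otimes> x)"
    unfolding cc using x by (simp add: r_distr)
  also have "\<dots> = x \<otimes> x \<otimes> x \<oplus> x \<otimes> x \<otimes> x \<oplus> x \<otimes> x \<otimes> x \<oplus> x \<otimes> x \<otimes> x \<ominus> (x \<otimes> x \<oplus> x \<otimes> x \<oplus> x \<otimes> x)"
    using x by algebra
  also have "\<dots> = x \<otimes> x \<otimes> x \<oplus> x \<otimes> x \<otimes> x \<oplus> x \<otimes> x \<otimes> x \<oplus> x \<otimes> x \<otimes> x \<ominus> (x \<otimes> x \<otimes> \<one> \<oplus> x \<otimes> x \<otimes> \<one> \<oplus> x \<otimes> x \<otimes> \<one>)"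
    using x by simp
  also have "\<dots> = x \<otimes> x \<otimes> (x \<oplus> x \<oplus> x \<oplus> x \<ominus> (\<one> \<oplus> \<one> \<oplus> \<one>))"
    using x by algebra
  finally show ?thesis .
qed

text \<open>Newton iteration, which replaces holomorphic functional calculus. By the bound on the
  initial defect, each step divides the defect \<open>d n\<close> by at least four, while the bound \<open>c n\<close> of
  the factor \<open>1 - 2 a\<close> at most doubles. The increments \<open>d n * c n\<close> are thus at most
  \<open>d 0 * c 0 / 2 ^ n\<close>.\<close>
lemma idempotent_near:
  assumes a: "a \<in> carrier R" and K: "1 \<le> K" "N \<one> \<le> K" and small: "N (a \<otimes> a \<ominus> a) \<le> 1 / (16 * K)"
  shows "\<exists>e\<in>carrier R. e \<otimes> e = e \<and> N (e \<ominus> a) \<le> 2 * N (a \<otimes> a \<ominus> a) * (K + 2 * N a)"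
proof -
  define h where "h = (\<lambda>a. a \<oplus> (a \<otimes> a \<ominus> a) \<otimes> (\<one> \<ominus> (a \<oplus> a)))"
  define Y where "Y = rec_nat a (\<lambda>_. h)"
  have Y0: "Y 0 = a" and YS: "Y (Suc n) = h (Y n)" for n by (simp_all add: Y_def)
  have Y: "Y n \<in> carrier R" for n by (induction n) (use a in \<open>simp_all add: Y0 YS h_def\<close>)
  define d where "d = (\<lambda>n. N (Y n \<otimes> Y n \<ominus> Y n))"
  define c where "c = (\<lambda>n. K + 2 * N (Y n))"
  have d0: "0 \<le> d n" and c0: "0 \<le> c n" for n
    using N_nonneg Y K by (auto simp: d_def c_def)
  have N3: "N (x \<oplus> x \<oplus> x \<oplus> x \<ominus> (\<one> \<oplus> \<one> \<oplus> \<one>)) \<le> 4 * N x + 3 * K" if "x \<in> carrier R" for x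
  proof -
    have "N (x \<oplus> x \<oplus> x \<oplus> x) \<le> 4 * N x" "N (\<one> \<oplus> \<one> \<oplus> \<one>) \<le> 3 * N \<one>"
      using that N_add[of "x \<oplus> x \<oplus> x" x] N_add[of "x \<oplus> x" x] N_add[of x x]
        N_add[of "\<one> \<oplus> \<one>" \<one>] N_add[of \<one> \<one>] by simp_all
    then show ?thesis
      using that K N_add[of "x \<oplus> x \<oplus> x \<oplus> x" "\<ominus> (\<one> \<oplus> \<one> \<oplus> \<one>)"] by (simp add: a_minus_def N_minus)
  qed
  have dS: "d (Suc n) \<le> d n * d n * (4 * d n + 3 * K)" for n
  proof -
    let ?x = "Y n \<otimes> Y n \<ominus> Y n"
    have x: "?x \<in> carrier R" using Y by simp
    have "d (Suc n) = N (?x \<otimes> ?x \<otimes> (?x \<oplus> ?x \<oplus> ?x \<oplus> ?x \<ominus> (\<one> \<oplus> \<one> \<oplus> \<one>)))"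
      unfolding d_def YS h_def Newton_identity[OF Y] ..
    also have "\<dots> \<le> N (?x \<otimes> ?x) * N (?x \<oplus> ?x \<oplus> ?x \<oplus> ?x \<ominus> (\<one> \<oplus> \<one> \<oplus> \<one>))"
      using x by (intro N_mult) simp_all
    also have "\<dots> \<le> N ?x * N ?x * (4 * N ?x + 3 * K)"
      by (intro mult_mono N_mult N3 x mult_nonneg_nonneg N_nonneg) (use x in simp_all)
    finally show ?thesis by (simp add: d_def)
  qed
  have step1: "N (Y (Suc n) \<ominus> Y n) \<le> d n * c n" for n
  proof -
    have "Y (Suc n) \<ominus> Y n = (Y n \<otimes> Y n \<ominus> Y n) \<otimes> (\<one> \<ominus> (Y n \<oplus> Y n))"
      unfolding YS h_def using Y[of n] by (simp add: a_minus_def a_ac r_neg1 r_neg2)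
    then have "N (Y (Suc n) \<ominus> Y n) \<le> d n * N (\<one> \<ominus> (Y n \<oplus> Y n))"
      using N_mult[of "Y n \<otimes> Y n \<ominus> Y n" "\<one> \<ominus> (Y n \<oplus> Y n)"] Y by (simp add: d_def)
    also have "N (\<one> \<ominus> (Y n \<oplus> Y n)) \<le> c n"
      using N_add[of \<one> "\<ominus> (Y n \<oplus> Y n)"] N_add[of "Y n" "Y n"] Y[of n] K
      by (simp add: a_minus_def N_minus c_def)
    finally show ?thesis using d0[of n] by (simp add: mult_left_mono)
  qed
  have K16: "1 / (16 * K) \<le> 1 / 16" using K(1) by (simp add: field_simps)
  have d4: "d 0 / 4 ^ n \<le> d 0" for n :: nat
    using mult_left_mono[OF one_le_power[of 4 n] d0[of 0]] by (simp add: divide_le_eq)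
  have d_bound: "d n \<le> d 0 / 4 ^ n" for n
  proof (induction n)
    case (Suc n)
    have dn: "d n \<le> 1 / (16 * K)" using Suc small d4[of n] by (simp add: d_def Y0)
    then have dn16: "d n \<le> 1 / 16" using K16 by linarith
    have "d n * (4 * d n + 3 * K) \<le> 1 / (16 * K) * (4 * (1 / 16) + 3 * K)"
      by (intro mult_mono add_mono) (use dn dn16 d0[of n] K in auto)
    also have "\<dots> \<le> 1 / 4" using K(1) by (simp add: field_simps)
    finally have "d n * (d n * (4 * d n + 3 * K)) \<le> d n * (1 / 4)" using d0 by (rule mult_left_mono)
    then have "d (Suc n) \<le> d n / 4" using dS[of n] by (simp only: mult.assoc mult_1_right times_divide_eq_right)
    also have "\<dots> \<le> d 0 / 4 ^ n / 4" using Suc by simp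
    finally show ?case by (simp add: mult.commute)
  qed simp
  have c_bound: "c n \<le> c 0 * 2 ^ n" for n
  proof (induction n)
    case (Suc n)
    have "d 0 \<le> 1 / 16" using small K16 by (simp add: d_def Y0)
    then have dn: "d n \<le> 1 / 16" using d_bound[of n] d4[of n] by linarith
    have "N (Y (Suc n)) \<le> N (Y (Suc n) \<ominus> Y n) + N (Y n)"
      using N_add[of "Y (Suc n) \<ominus> Y n" "Y n"] Y[of n] Y[of "Suc n"] by (simp add: a_minus_def a_assoc l_neg)
    then have "c (Suc n) \<le> c n + 2 * (d n * c n)" using step1[of n] by (simp add: c_def)
    also have "\<dots> \<le> c n + 2 * (1 / 16 * c n)" using dn c0[of n] by (intro add_left_mono mult_left_mono mult_right_mono) auto
    also have "\<dots> \<le> 2 * c n" using c0[of n] by simp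
    finally show ?case using Suc by simp
  qed simp
  have step: "N (Y (Suc n) \<ominus> Y n) \<le> (d 0 * c 0) * (1 / 2) ^ n" for n
  proof -
    have "d n * c n \<le> d 0 / 4 ^ n * (c 0 * 2 ^ n)"
      by (intro mult_mono d_bound c_bound) (use d0 c0 in auto)
    also have "\<dots> = (d 0 * c 0) * (1 / 2) ^ n"
    proof -
      have "(4 :: real) ^ n = 2 ^ n * 2 ^ n" by (simp flip: power_mult_distrib)
      then show ?thesis by (simp add: power_divide)
    qed
    finally show ?thesis using step1[of n] by linarith
  qed
  have "\<exists>e. lims Y e \<and> N (e \<ominus> Y 0) \<le> d 0 * c 0 / (1 - 1 / 2)"
    by (rule lims_geometric[OF Y _ _ _ step]) (use d0 c0 in auto)
  then obtain e where e: "lims Y e" "N (e \<ominus> a) \<le> 2 * (d 0 * c 0)" by (auto simp: Y0)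
  have "(\<lambda>n. d 0 * (1 / 4) ^ n) \<longlonglongrightarrow> d 0 * 0"
    by (intro tendsto_mult_left LIMSEQ_power_zero) simp
  then have lim0: "(\<lambda>n. d 0 / 4 ^ n) \<longlonglongrightarrow> 0" by (simp add: power_one_over)
  have "lims (\<lambda>n. Y n \<otimes> Y n \<ominus> Y n) \<zero>"
  proof (rule lims_bound[OF _ _ _ lim0])
    fix n show "N (Y n \<otimes> Y n \<ominus> Y n \<ominus> \<zero>) \<le> d 0 / 4 ^ n"
      using d_bound[of n] Y[of n] by (simp add: d_def a_minus_def)
  qed (use Y in auto)
  moreover have "lims (\<lambda>n. Y n \<otimes> Y n \<ominus> Y n) (e \<otimes> e \<ominus> e)"
    by (intro lims_diff lims_mult e)
  ultimately have "e \<otimes> e \<ominus> e = \<zero>" using lims_unique by blast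
  moreover have "e \<otimes> e = (e \<otimes> e \<ominus> e) \<oplus> e" using limsD(2)[OF e(1)] by algebra
  ultimately have "e \<otimes> e = e" using limsD(2)[OF e(1)] by simp
  then show ?thesis using e limsD(2)[OF e(1)] by (intro bexI[of _ e]) (auto simp: d_def c_def Y0)
qed

text \<open>The elements \<open>x = e f\<close> and \<open>y = f e\<close> are nearly inverse to each other, because
  \<open>e - x y = e (e - f) e\<close>.\<close>
lemma equivalent_if_near:
  assumes e: "e \<in> carrier R" "e \<otimes> e = e" and f: "f \<in> carrier R" "f \<otimes> f = f"
    and small: "N e * N (e \<ominus> f) * N e < 1" "N f * N (e \<ominus> f) * N f < 1"
  shows "\<exists>x\<in>carrier R. \<exists>y\<in>carrier R. x \<otimes> y = e \<and> y \<otimes> x = f"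
proof -
  have 1: "N (a \<otimes> b \<otimes> a) \<le> N a * N b * N a" if "a \<in> carrier R" "b \<in> carrier R" for a b
  proof -
    have "N (a \<otimes> b \<otimes> a) \<le> N (a \<otimes> b) * N a" using that by (intro N_mult) auto
    also have "\<dots> \<le> N a * N b * N a" using that by (intro mult_right_mono N_mult N_nonneg)
    finally show ?thesis .
  qed
  have "e \<ominus> (e \<otimes> f) \<otimes> (f \<otimes> e) = e \<otimes> (e \<ominus> f) \<otimes> e"
  proof -
    have "e \<otimes> (e \<ominus> f) \<otimes> e = (e \<otimes> e) \<otimes> e \<ominus> e \<otimes> f \<otimes> e" using e(1) f(1) by algebra
    moreover have "(e \<otimes> f) \<otimes> (f \<otimes> e) = e \<otimes> (f \<otimes> f) \<otimes> e" using e(1) f(1) by algebra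
    ultimately show ?thesis by (simp add: e(2) f(2))
  qed
  then have s1: "N (e \<ominus> (e \<otimes> f) \<otimes> (f \<otimes> e)) < 1"
    using 1[of e "e \<ominus> f"] e f small by simp
  have "f \<ominus> (f \<otimes> e) \<otimes> (e \<otimes> f) = f \<otimes> (f \<ominus> e) \<otimes> f"
  proof -
    have "f \<otimes> (f \<ominus> e) \<otimes> f = (f \<otimes> f) \<otimes> f \<ominus> f \<otimes> e \<otimes> f" using e(1) f(1) by algebra
    moreover have "(f \<otimes> e) \<otimes> (e \<otimes> f) = f \<otimes> (e \<otimes> e) \<otimes> f" using e(1) f(1) by algebra
    ultimately show ?thesis by (simp add: e(2) f(2))
  qed
  then have s2: "N (f \<ominus> (f \<otimes> e) \<otimes> (e \<otimes> f)) < 1"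
    using 1[of f "f \<ominus> e"] e f small N_diff_commute[of e f] by simp
  have "\<exists>y'\<in>carrier R. (e \<otimes> f) \<otimes> y' = e \<and> y' \<otimes> (e \<otimes> f) = f"
    using e f s1 s2 by (intro equivalent_if_nearly_inverse[of e f "e \<otimes> f" "f \<otimes> e"])
      (simp_all add: m_assoc, simp_all add: m_assoc[symmetric])
  then show ?thesis using e f by blast
qed

end

section \<open>Matrix rings\<close>

text \<open>The ring of \<open>n \<times> n\<close> matrices, realised as the corner of the infinite matrices, so that its
  multiplication is that of \<open>M\<^sub>\<infinity>\<close>.\<close>
definition mat_ring :: "('a, 'm) ring_scheme \<Rightarrow> nat \<Rightarrow> (nat \<Rightarrow> nat \<Rightarrow> 'a) ring" where
  "mat_ring R n = \<lparr> carrier = corner R n, monoid.mult = M_mult R,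
     one = (\<lambda>i j. if i < n \<and> i = j then \<one>\<^bsub>R\<^esub> else \<zero>\<^bsub>R\<^esub>), zero = (\<lambda>_ _. \<zero>\<^bsub>R\<^esub>), add = (\<lambda>a b i j. a i j \<oplus>\<^bsub>R\<^esub> b i j) \<rparr>"

lemma mat_ring_simps [simp]:
  "carrier (mat_ring R n) = corner R n" "monoid.mult (mat_ring R n) = M_mult R"
  "\<zero>\<^bsub>mat_ring R n\<^esub> = (\<lambda>_ _. \<zero>\<^bsub>R\<^esub>)" "x \<oplus>\<^bsub>mat_ring R n\<^esub> y = (\<lambda>i j. x i j \<oplus>\<^bsub>R\<^esub> y i j)"
  by (simp_all add: mat_ring_def)

lemma cornerD: "a \<in> corner R n \<Longrightarrow> a i j \<in> carrier R" "\<lbrakk>a \<in> corner R n; n \<le> i \<or> n \<le> j\<rbrakk> \<Longrightarrow> a i j = \<zero>\<^bsub>R\<^esub>"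
  by (auto simp: corner_def)

lemma cornerI: "\<lbrakk>\<And>i j. a i j \<in> carrier R; \<And>i j. n \<le> i \<or> n \<le> j \<Longrightarrow> a i j = \<zero>\<^bsub>R\<^esub>\<rbrakk> \<Longrightarrow> a \<in> corner R n"
  by (auto simp: corner_def)

lemma corner_mono: "\<lbrakk>a \<in> corner R n; n \<le> m\<rbrakk> \<Longrightarrow> a \<in> corner R m"
  by (auto simp: corner_def)

context ring begin

lemma finsum_swap:
  assumes "finite A" "finite B" "\<And>i j. \<lbrakk>i \<in> A; j \<in> B\<rbrakk> \<Longrightarrow> f i j \<in> carrier R"
  shows "(\<Oplus>i\<in>A. \<Oplus>j\<in>B. f i j) = (\<Oplus>j\<in>B. \<Oplus>i\<in>A. f i j)"
  using assms(1,3)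
proof (induction A rule: finite_induct)
  case empty
  then show ?case by simp
next
  case (insert a A)
  have "(\<Oplus>i\<in>insert a A. \<Oplus>j\<in>B. f i j) = (\<Oplus>j\<in>B. f a j) \<oplus> (\<Oplus>i\<in>A. \<Oplus>j\<in>B. f i j)"
    using insert by (subst finsum_insert) (auto intro!: finsum_closed)
  also have "\<dots> = (\<Oplus>j\<in>B. f a j) \<oplus> (\<Oplus>j\<in>B. \<Oplus>i\<in>A. f i j)" using insert by simp
  also have "\<dots> = (\<Oplus>j\<in>B. f a j \<oplus> (\<Oplus>i\<in>A. f i j))"
    using insert by (subst finsum_addf) (auto intro!: finsum_closed)
  also have "\<dots> = (\<Oplus>j\<in>B. \<Oplus>i\<in>insert a A. f i j)"
    using insert by (intro finsum_cong') (auto intro!: finsum_closed finsum_insert[symmetric])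
  finally show ?case .
qed

text \<open>The product of \<open>M\<^sub>\<infinity>\<close> sums over the nonzero entries of a row. In a corner it can be taken
  over all indices of the corner.\<close>
lemma M_mult_eq:
  assumes a: "a \<in> corner R n" and b: "\<And>i j. b i j \<in> carrier R"
  shows "M_mult R a b i j = (\<Oplus>k\<in>{..<n}. a i k \<otimes> b k j)"
  unfolding M_mult_def
proof (rule add.finprod_mono_neutral_cong_left)
  show "{k. a i k \<noteq> \<zero>} \<subseteq> {..<n}" using cornerD(2)[OF a] by (auto simp: not_le[symmetric])
qed (use cornerD(1)[OF a] b in auto)

lemma M_mult_closed: "\<lbrakk>a \<in> corner R n; b \<in> corner R n\<rbrakk> \<Longrightarrow> M_mult R a b \<in> corner R n"
proof (rule cornerI)
  fix i j assume a: "a \<in> corner R n" and b: "b \<in> corner R n"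
  show "M_mult R a b i j \<in> carrier R"
    using cornerD[OF a] cornerD[OF b] by (subst M_mult_eq[OF a]) (auto intro!: finsum_closed)
  assume "n \<le> i \<or> n \<le> j"
  then have "a i k \<otimes> b k j = \<zero>" for k using cornerD[OF a] cornerD[OF b] by auto
  then show "M_mult R a b i j = \<zero>" using cornerD[OF b] by (subst M_mult_eq[OF a]) auto
qed

lemma mat_ring: "ring (mat_ring R n)"
proof (rule ringI)
  show "abelian_group (mat_ring R n)"
  proof (rule abelian_groupI)
    fix x assume x: "x \<in> carrier (mat_ring R n)"
    show "\<exists>y\<in>carrier (mat_ring R n). y \<oplus>\<^bsub>mat_ring R n\<^esub> x = \<zero>\<^bsub>mat_ring R n\<^esub>"
      using x by (intro bexI[of _ "\<lambda>i j. \<ominus> x i j"]) (auto simp: corner_def l_neg)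
  qed (auto simp: corner_def a_assoc intro!: ext a_comm)
  show "monoid (mat_ring R n)"
  proof (rule monoidI)
    fix x y z assume "x \<in> carrier (mat_ring R n)" "y \<in> carrier (mat_ring R n)" "z \<in> carrier (mat_ring R n)"
    then have x: "x \<in> corner R n" and y: "y \<in> corner R n" and z: "z \<in> corner R n" by auto
    note [simp] = cornerD(1)[OF x] cornerD(1)[OF y] cornerD(1)[OF z]
    have "M_mult R (M_mult R x y) z i j = M_mult R x (M_mult R y z) i j" for i j
    proof -
      have "M_mult R (M_mult R x y) z i j = (\<Oplus>k\<in>{..<n}. (\<Oplus>l\<in>{..<n}. x i l \<otimes> y l k) \<otimes> z k j)"
        by (subst M_mult_eq[OF M_mult_closed[OF x y]]) (auto simp: M_mult_eq[OF x])
      also have "\<dots> = (\<Oplus>k\<in>{..<n}. \<Oplus>l\<in>{..<n}. x i l \<otimes> y l k \<otimes> z k j)"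
        by (intro finsum_cong' finsum_ldistr) (auto intro!: finsum_closed)
      also have "\<dots> = (\<Oplus>l\<in>{..<n}. \<Oplus>k\<in>{..<n}. x i l \<otimes> y l k \<otimes> z k j)"
        by (intro finsum_swap) auto
      also have "\<dots> = (\<Oplus>l\<in>{..<n}. x i l \<otimes> (\<Oplus>k\<in>{..<n}. y l k \<otimes> z k j))"
        by (intro finsum_cong') (auto simp: finsum_rdistr m_assoc intro!: finsum_closed)
      also have "\<dots> = M_mult R x (M_mult R y z) i j"
        using cornerD(1)[OF M_mult_closed[OF y z]] by (subst M_mult_eq[OF x]) (auto simp: M_mult_eq[OF y])
      finally show ?thesis .
    qed
    then show "x \<otimes>\<^bsub>mat_ring R n\<^esub> y \<otimes>\<^bsub>mat_ring R n\<^esub> z = x \<otimes>\<^bsub>mat_ring R n\<^esub> (y \<otimes>\<^bsub>mat_ring R n\<^esub> z)" by auto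
  next
    fix x assume "x \<in> carrier (mat_ring R n)"
    then have x: "x \<in> corner R n" by auto
    have one: "\<one>\<^bsub>mat_ring R n\<^esub> \<in> corner R n" by (auto simp: mat_ring_def corner_def)
    have "M_mult R \<one>\<^bsub>mat_ring R n\<^esub> x i j = x i j" for i j
    proof -
      have "M_mult R \<one>\<^bsub>mat_ring R n\<^esub> x i j = (\<Oplus>k\<in>{..<n}. if i = k then x k j else \<zero>)"
        using cornerD(1)[OF x] by (subst M_mult_eq[OF one]) (auto simp: mat_ring_def intro!: finsum_cong')
      also have "\<dots> = x i j"
        using cornerD[OF x] by (cases "i < n") (auto simp: finsum_singleton intro!: add.finprod_one_eqI)
      finally show ?thesis .
    qed
    then show "\<one>\<^bsub>mat_ring R n\<^esub> \<otimes>\<^bsub>mat_ring R n\<^esub> x = x" by auto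
    have "M_mult R x \<one>\<^bsub>mat_ring R n\<^esub> i j = x i j" for i j
    proof -
      have "M_mult R x \<one>\<^bsub>mat_ring R n\<^esub> i j = (\<Oplus>k\<in>{..<n}. if j = k then x i k else \<zero>)"
        using cornerD(1)[OF x] cornerD(1)[OF one]
        by (subst M_mult_eq[OF x]) (auto simp: mat_ring_def intro!: finsum_cong')
      also have "\<dots> = x i j"
        using cornerD[OF x] by (cases "j < n") (auto simp: finsum_singleton intro!: add.finprod_one_eqI)
      finally show ?thesis .
    qed
    then show "x \<otimes>\<^bsub>mat_ring R n\<^esub> \<one>\<^bsub>mat_ring R n\<^esub> = x" by auto
  qed (auto simp: M_mult_closed, auto simp: mat_ring_def corner_def)
next
  fix x y z assume "x \<in> carrier (mat_ring R n)" "y \<in> carrier (mat_ring R n)" "z \<in> carrier (mat_ring R n)"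
  then have x: "x \<in> corner R n" and y: "y \<in> corner R n" and z: "z \<in> corner R n" by auto
  note [simp] = cornerD(1)[OF x] cornerD(1)[OF y] cornerD(1)[OF z]
  have xy: "(\<lambda>i j. x i j \<oplus> y i j) \<in> corner R n" using x y by (auto simp: corner_def)
  have "M_mult R (\<lambda>i j. x i j \<oplus> y i j) z i j = M_mult R x z i j \<oplus> M_mult R y z i j" for i j
    by (subst M_mult_eq[OF xy], simp, subst M_mult_eq[OF x], simp, subst M_mult_eq[OF y], simp,
        subst finsum_addf[symmetric]) (auto simp: l_distr)
  then show "(x \<oplus>\<^bsub>mat_ring R n\<^esub> y) \<otimes>\<^bsub>mat_ring R n\<^esub> z = x \<otimes>\<^bsub>mat_ring R n\<^esub> z \<oplus>\<^bsub>mat_ring R n\<^esub> y \<otimes>\<^bsub>mat_ring R n\<^esub> z"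
    by auto
  have "M_mult R z (\<lambda>i j. x i j \<oplus> y i j) i j = M_mult R z x i j \<oplus> M_mult R z y i j" for i j
    by (subst (1 2 3) M_mult_eq[OF z]) (auto simp: r_distr finsum_addf)
  then show "z \<otimes>\<^bsub>mat_ring R n\<^esub> (x \<oplus>\<^bsub>mat_ring R n\<^esub> y) = z \<otimes>\<^bsub>mat_ring R n\<^esub> x \<oplus>\<^bsub>mat_ring R n\<^esub> z \<otimes>\<^bsub>mat_ring R n\<^esub> y"
    by auto
qed

lemma mat_ring_minus: "x \<in> corner R n \<Longrightarrow> \<ominus>\<^bsub>mat_ring R n\<^esub> x = (\<lambda>i j. \<ominus> x i j)"
proof -
  assume x: "x \<in> corner R n"
  interpret M: ring "mat_ring R n" by (rule mat_ring)
  show ?thesis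
    by (rule M.minus_equality) (use x in \<open>auto simp: corner_def l_neg\<close>)
qed

lemma mat_ring_diff: "\<lbrakk>x \<in> corner R n; y \<in> corner R n\<rbrakk> \<Longrightarrow> x \<ominus>\<^bsub>mat_ring R n\<^esub> y = (\<lambda>i j. x i j \<ominus> y i j)"
  by (simp add: a_minus_def mat_ring_minus)

end

text \<open>The sum of the norms of the entries is submultiplicative and complete. It is not the
  operator norm, but it suffices since only the equivalence of idempotents matters.\<close>
definition mat_norm :: "('a \<Rightarrow> real) \<Rightarrow> nat \<Rightarrow> (nat \<Rightarrow> nat \<Rightarrow> 'a) \<Rightarrow> real" where
  "mat_norm N n a = (\<Sum>i<n. \<Sum>j<n. N (a i j))"

context Banach_ring begin

lemma N_finsum:
  "\<lbrakk>finite A; \<And>i. i \<in> A \<Longrightarrow> f i \<in> carrier R\<rbrakk> \<Longrightarrow> N (\<Oplus>i\<in>A. f i) \<le> (\<Sum>i\<in>A. N (f i))"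
proof (induction A rule: finite_induct)
  case (insert a A)
  then have "N (\<Oplus>i\<in>insert a A. f i) \<le> N (f a) + N (\<Oplus>i\<in>A. f i)"
    by (subst finsum_insert) (auto intro!: N_add finsum_closed)
  then show ?case using insert by fastforce
qed (simp add: N_zero)

lemma entry_le_mat_norm:
  assumes "a \<in> corner R n" "i < n" "j < n"
  shows "N (a i j) \<le> mat_norm N n a"
proof -
  have "N (a i j) \<le> (\<Sum>j<n. N (a i j))"
    using assms by (intro member_le_sum[of j "{..<n}" "\<lambda>j. N (a i j)"]) (auto intro: N_nonneg cornerD)
  also have "\<dots> \<le> mat_norm N n a"
    unfolding mat_norm_def using assms
    by (intro member_le_sum[of i "{..<n}" "\<lambda>i. \<Sum>j<n. N (a i j)"]) (auto intro!: sum_nonneg N_nonneg cornerD)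
  finally show ?thesis .
qed

lemma mat_Banach_ring: "Banach_ring (mat_ring R n) (mat_norm N n)"
proof (intro Banach_ring.intro mat_ring Banach_ring_axioms.intro)
  fix x assume x: "x \<in> carrier (mat_ring R n)" and 0: "mat_norm N n x = 0"
  have "x i j = \<zero>" for i j
  proof (cases "i < n \<and> j < n")
    case True
    then have "N (x i j) = 0"
      using x 0 entry_le_mat_norm[of x n i j] N_nonneg[of "x i j"] cornerD[of x R n] by auto
    then show ?thesis using x cornerD[of x R n] by (intro N_eq_0) auto
  next
    case False
    then show ?thesis using x cornerD[of x R n] by auto
  qed
  then show "x = \<zero>\<^bsub>mat_ring R n\<^esub>" by auto
next
  fix x y assume x: "x \<in> carrier (mat_ring R n)" and y: "y \<in> carrier (mat_ring R n)"
  have xc: "x i j \<in> carrier R" "y i j \<in> carrier R" for i j using x y by (auto simp: corner_def)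
  show "mat_norm N n (x \<oplus>\<^bsub>mat_ring R n\<^esub> y) \<le> mat_norm N n x + mat_norm N n y"
    by (simp add: mat_norm_def sum.distrib[symmetric] sum_mono N_add xc)
  have p: "0 \<le> N (x i j)" "0 \<le> N (y i j)" for i j by (simp_all add: N_nonneg xc)
  have "mat_norm N n (x \<otimes>\<^bsub>mat_ring R n\<^esub> y) \<le> (\<Sum>i<n. \<Sum>j<n. \<Sum>k<n. N (x i k) * N (y k j))"
    unfolding mat_norm_def
  proof (intro sum_mono)
    fix i j
    have "N (\<Oplus>k\<in>{..<n}. x i k \<otimes> y k j) \<le> (\<Sum>k<n. N (x i k \<otimes> y k j))" by (intro N_finsum) (auto simp: xc)
    also have "\<dots> \<le> (\<Sum>k<n. N (x i k) * N (y k j))" by (intro sum_mono N_mult xc)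
    finally show "N ((x \<otimes>\<^bsub>mat_ring R n\<^esub> y) i j) \<le> (\<Sum>k<n. N (x i k) * N (y k j))"
      using x by (simp add: M_mult_eq[of x n y] xc)
  qed
  also have "\<dots> = (\<Sum>i<n. \<Sum>k<n. N (x i k) * (\<Sum>j<n. N (y k j)))"
    unfolding sum_distrib_left by (intro sum.cong refl sum.swap)
  also have "\<dots> \<le> (\<Sum>i<n. \<Sum>k<n. N (x i k) * mat_norm N n y)"
  proof (intro sum_mono mult_left_mono p)
    fix k assume "k \<in> {..<n}"
    then show "(\<Sum>j<n. N (y k j)) \<le> mat_norm N n y"
      unfolding mat_norm_def by (intro member_le_sum[of k "{..<n}" "\<lambda>k. \<Sum>j<n. N (y k j)"]) (auto intro!: sum_nonneg p)
  qed
  also have "\<dots> = mat_norm N n x * mat_norm N n y" by (simp add: mat_norm_def sum_distrib_right)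
  finally show "mat_norm N n (x \<otimes>\<^bsub>mat_ring R n\<^esub> y) \<le> mat_norm N n x * mat_norm N n y" .
next
  fix x assume x: "x \<in> carrier (mat_ring R n)"
  then show "mat_norm N n (\<ominus>\<^bsub>mat_ring R n\<^esub> x) = mat_norm N n x"
    by (simp add: mat_norm_def mat_ring_minus N_minus cornerD)
next
  fix X :: "nat \<Rightarrow> nat \<Rightarrow> nat \<Rightarrow> 'a" assume X: "\<And>k. X k \<in> carrier (mat_ring R n)"
    and C: "\<And>e. 0 < e \<Longrightarrow> \<exists>M. \<forall>k\<ge>M. \<forall>l\<ge>M. mat_norm N n (X k \<ominus>\<^bsub>mat_ring R n\<^esub> X l) < e"
  have Xc: "X k \<in> corner R n" "X k i j \<in> carrier R" for k i j using X[of k] by (auto simp: corner_def)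
  have "\<exists>x\<in>carrier R. (\<lambda>k. N (X k i j \<ominus> x)) \<longlonglongrightarrow> 0" for i j
  proof (rule N_complete[OF Xc(2)])
    fix e :: real assume e: "0 < e"
    obtain M where M: "\<forall>k\<ge>M. \<forall>l\<ge>M. mat_norm N n (X k \<ominus>\<^bsub>mat_ring R n\<^esub> X l) < e" using C[OF e] by blast
    have "N (X k i j \<ominus> X l i j) < e" if "k \<ge> M" "l \<ge> M" for k l
    proof (cases "i < n \<and> j < n")
      case True
      have d: "X k \<ominus>\<^bsub>mat_ring R n\<^esub> X l = (\<lambda>i j. X k i j \<ominus> X l i j)" by (rule mat_ring_diff) (rule Xc)+
      have "(\<lambda>i j. X k i j \<ominus> X l i j) \<in> corner R n"
        using Xc(1)[of k] Xc(1)[of l] by (auto simp: corner_def a_minus_def)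
      from entry_le_mat_norm[OF this, of i j] True M that show ?thesis unfolding d[symmetric] by fastforce
    next
      case False
      then have "X k i j = \<zero>" "X l i j = \<zero>" using Xc(1) cornerD(2) by (metis not_le)+
      then show ?thesis using e by (simp add: a_minus_def N_zero)
    qed
    then show "\<exists>M. \<forall>k\<ge>M. \<forall>l\<ge>M. N (X k i j \<ominus> X l i j) < e" by blast
  qed
  then obtain x where x: "\<And>i j. x i j \<in> carrier R" "\<And>i j. (\<lambda>k. N (X k i j \<ominus> x i j)) \<longlonglongrightarrow> 0" by metis
  define y where "y = (\<lambda>i j. if i < n \<and> j < n then x i j else \<zero>)"
  have y: "y \<in> corner R n" using x by (auto simp: y_def corner_def)
  have "(\<lambda>k. \<Sum>i<n. \<Sum>j<n. N (X k i j \<ominus> x i j)) \<longlonglongrightarrow> (\<Sum>i<n. \<Sum>j<n. 0)"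
    by (intro tendsto_sum x)
  moreover have "mat_norm N n (X k \<ominus>\<^bsub>mat_ring R n\<^esub> y) = (\<Sum>i<n. \<Sum>j<n. N (X k i j \<ominus> x i j))" for k
    unfolding mat_ring_diff[OF Xc(1) y] mat_norm_def by (simp add: y_def)
  ultimately have "(\<lambda>k. mat_norm N n (X k \<ominus>\<^bsub>mat_ring R n\<^esub> y)) \<longlonglongrightarrow> 0" by simp
  then show "\<exists>x\<in>carrier (mat_ring R n). (\<lambda>k. mat_norm N n (X k \<ominus>\<^bsub>mat_ring R n\<^esub> x)) \<longlonglongrightarrow> 0"
    using y by auto
qed (simp_all add: mat_norm_def N_zero)

end

section \<open>Equivalence of idempotents\<close>

context ring begin

lemma M_inf_common:
  assumes "x \<in> M_inf R" "y \<in> M_inf R"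
  obtains n where "x \<in> corner R n" "y \<in> corner R n"
proof -
  obtain k l where "x \<in> corner R k" "y \<in> corner R l" using assms by (auto simp: M_inf_def)
  then show thesis by (intro that[of "max k l"]) (auto intro: corner_mono)
qed

lemma corner_M_inf: "x \<in> corner R n \<Longrightarrow> x \<in> M_inf R"
  by (auto simp: M_inf_def)

lemma M_mult_left_corner: "\<lbrakk>e \<in> corner R n; z \<in> corner R m; n \<le> i\<rbrakk> \<Longrightarrow> M_mult R e z i j = \<zero>"
  using cornerD[of e R n] cornerD[of z R m] by (subst M_mult_eq) (auto intro!: add.finprod_one_eqI)

lemma M_mult_right_corner: "\<lbrakk>z \<in> corner R m; e \<in> corner R n; n \<le> j\<rbrakk> \<Longrightarrow> M_mult R z e i j = \<zero>"
  using cornerD[of e R n] cornerD[of z R m] by (subst M_mult_eq) (auto intro!: add.finprod_one_eqI)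

lemma M_mult_assoc:
  assumes "x \<in> corner R n" "y \<in> corner R n" "z \<in> corner R n"
  shows "M_mult R (M_mult R x y) z = M_mult R x (M_mult R y z)"
proof -
  interpret M: ring "mat_ring R n" by (rule mat_ring)
  show ?thesis using M.m_assoc[of x y z] assms by simp
qed

lemma idem_infI: "\<lbrakk>e \<in> corner R n; M_mult R e e = e\<rbrakk> \<Longrightarrow> e \<in> idem_inf R"
  by (auto simp: idem_inf_def M_inf_def)

lemma idem_relI:
  assumes "x \<in> corner R n" "y \<in> corner R n" "M_mult R x y = e" "M_mult R y x = f" "e \<in> idem_inf R" "f \<in> idem_inf R"
  shows "(e, f) \<in> idem_rel R"
  using assms by (auto simp: idem_rel_def M_inf_def)

text \<open>Replacing \<open>x\<close> by \<open>e x f\<close> and \<open>y\<close> by \<open>f y e\<close> makes them intertwine \<open>e\<close> and \<open>f\<close>, and puts them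
  into any corner that contains both idempotents.\<close>
lemma idem_rel_corner:
  assumes "(e, f) \<in> idem_rel R" and en: "e \<in> corner R n" and fn: "f \<in> corner R n"
  obtains x y where "x \<in> corner R n" "y \<in> corner R n" "M_mult R x y = e" "M_mult R y x = f"
    "M_mult R e x = x" "M_mult R x f = x" "M_mult R f y = y" "M_mult R y e = y"
proof -
  obtain x y where xy: "x \<in> M_inf R" "y \<in> M_inf R" "M_mult R x y = e" "M_mult R y x = f"
    and ef: "M_mult R e e = e" "M_mult R f f = f"
    using assms(1) by (auto simp: idem_rel_def idem_inf_def)
  obtain m where m: "x \<in> corner R m" "y \<in> corner R m" using M_inf_common[OF xy(1,2)] by blast
  define N where "N = max n m"
  interpret M: ring "mat_ring R N" by (rule mat_ring)
  have c: "x \<in> corner R N" "y \<in> corner R N" "e \<in> corner R N" "f \<in> corner R N"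
    using m en fn by (auto simp: N_def intro: corner_mono)
  note a = M.m_assoc[simplified, simplified mat_ring_simps]
  have assoc: "\<And>u v w. \<lbrakk>u \<in> corner R N; v \<in> corner R N; w \<in> corner R N\<rbrakk> \<Longrightarrow>
    M_mult R (M_mult R u v) w = M_mult R u (M_mult R v w)" by (rule M_mult_assoc)
  let ?x = "M_mult R e (M_mult R x f)" and ?y = "M_mult R f (M_mult R y e)"
  have xN: "?x \<in> corner R N" "?y \<in> corner R N" using c by (auto intro: M_mult_closed)
  have xn: "?x \<in> corner R n" "?y \<in> corner R n"
    using xN M_mult_left_corner[OF en M_mult_closed[OF c(1,4)]] M_mult_left_corner[OF fn M_mult_closed[OF c(2,3)]]
      M_mult_right_corner[OF M_mult_closed[OF c(3,1)] fn] M_mult_right_corner[OF M_mult_closed[OF c(4,2)] en]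
      assoc[OF c(3,1,4)] assoc[OF c(4,2,3)]
    by (auto simp: corner_def)
  have e4: "M_mult R e (M_mult R x u) = M_mult R x (M_mult R f u)" if "u \<in> corner R N" for u
    using c that by (simp add: xy(3)[symmetric] xy(4)[symmetric] assoc M_mult_closed)
  have 1: "M_mult R ?x ?y = e"
  proof -
    have "M_mult R ?x ?y = M_mult R e (M_mult R x (M_mult R f (M_mult R f (M_mult R y e))))"
      using c by (simp add: assoc M_mult_closed)
    also have "\<dots> = M_mult R e (M_mult R x (M_mult R f (M_mult R y e)))"
      using c ef by (simp add: assoc[symmetric] M_mult_closed)
    also have "\<dots> = M_mult R e (M_mult R e (M_mult R x (M_mult R y e)))"
      using c by (simp add: e4 M_mult_closed)
    also have "\<dots> = e" using c xy(3) ef by (simp add: assoc[symmetric] M_mult_closed)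
    finally show ?thesis .
  qed
  have f4: "M_mult R f (M_mult R y u) = M_mult R y (M_mult R e u)" if "u \<in> corner R N" for u
    using c that by (simp add: xy(3)[symmetric] xy(4)[symmetric] assoc M_mult_closed)
  have 2: "M_mult R ?y ?x = f"
  proof -
    have "M_mult R ?y ?x = M_mult R f (M_mult R y (M_mult R e (M_mult R e (M_mult R x f))))"
      using c by (simp add: assoc M_mult_closed)
    also have "\<dots> = M_mult R f (M_mult R y (M_mult R e (M_mult R x f)))"
      using c ef by (simp add: assoc[symmetric] M_mult_closed)
    also have "\<dots> = M_mult R f (M_mult R f (M_mult R y (M_mult R x f)))"
      using c by (simp add: f4 M_mult_closed)
    also have "\<dots> = f" using c xy(4) ef by (simp add: assoc[symmetric] M_mult_closed)
    finally show ?thesis .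
  qed
  show thesis
    by (rule that[of ?x ?y]) (use xn 1 2 c ef in \<open>simp_all add: assoc M_mult_closed\<close>,
      simp_all add: assoc[symmetric] M_mult_closed)
qed

lemma idem_rel_refl: "e \<in> idem_inf R \<Longrightarrow> (e, e) \<in> idem_rel R"
  by (auto simp: idem_rel_def idem_inf_def)

lemma idem_rel_sym: "(e, f) \<in> idem_rel R \<Longrightarrow> (f, e) \<in> idem_rel R"
  by (auto simp: idem_rel_def)

lemma idem_relD: "(e, f) \<in> idem_rel R \<Longrightarrow> e \<in> idem_inf R \<and> f \<in> idem_inf R"
  by (auto simp: idem_rel_def)

lemma idem_inf_common:
  assumes "e \<in> idem_inf R" "f \<in> idem_inf R"
  obtains n where "e \<in> corner R n" "f \<in> corner R n"
  using assms M_inf_common[of e f] by (auto simp: idem_inf_def)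

lemma idem_rel_trans:
  assumes ef: "(e, f) \<in> idem_rel R" and fg: "(f, g) \<in> idem_rel R"
  shows "(e, g) \<in> idem_rel R"
proof -
  obtain k where k: "e \<in> corner R k" "f \<in> corner R k" using idem_inf_common idem_relD[OF ef] by metis
  obtain l where l: "f \<in> corner R l" "g \<in> corner R l" using idem_inf_common idem_relD[OF fg] by metis
  define n where "n = max k l"
  have c: "e \<in> corner R n" "f \<in> corner R n" "g \<in> corner R n"
    using k l by (auto simp: n_def intro: corner_mono)
  obtain x y where x: "x \<in> corner R n" "y \<in> corner R n" "M_mult R x y = e" "M_mult R y x = f"
    "M_mult R e x = x" "M_mult R x f = x" "M_mult R f y = y" "M_mult R y e = y"
    using idem_rel_corner[OF ef c(1,2)] by blast
  obtain z w where z: "z \<in> corner R n" "w \<in> corner R n" "M_mult R z w = f" "M_mult R w z = g"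
    "M_mult R f z = z" "M_mult R z g = z" "M_mult R g w = w" "M_mult R w f = w"
    using idem_rel_corner[OF fg c(2,3)] by blast
  have "M_mult R (M_mult R x z) (M_mult R w y) = M_mult R x (M_mult R (M_mult R z w) y)"
    using x(1,2) z(1,2) by (simp add: M_mult_assoc[of _ n] M_mult_closed)
  also have "\<dots> = e" using x z by simp
  finally have 1: "M_mult R (M_mult R x z) (M_mult R w y) = e" .
  have "M_mult R (M_mult R w y) (M_mult R x z) = M_mult R w (M_mult R (M_mult R y x) z)"
    using x(1,2) z(1,2) by (simp add: M_mult_assoc[of _ n] M_mult_closed)
  also have "\<dots> = g" using x z by simp
  finally have 2: "M_mult R (M_mult R w y) (M_mult R x z) = g" .
  show ?thesis
    using x z idem_relD[OF ef] idem_relD[OF fg]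
    by (intro idem_relI[OF _ _ 1 2]) (auto intro: M_mult_closed)
qed

lemma idem_rel_equiv: "equiv (idem_inf R) (idem_rel R)"
  by (rule equivI)
     (auto simp: refl_on_def sym_def trans_def dest: idem_relD intro: idem_rel_refl idem_rel_sym idem_rel_trans)

lemma block_diag_corner:
  "\<lbrakk>a \<in> corner R n; b \<in> corner R m\<rbrakk> \<Longrightarrow> block_diag R n a b \<in> corner R (n + m)"
  by (auto simp: block_diag_def corner_def)

lemma block_diag_mult:
  assumes a: "a \<in> corner R n" and b: "b \<in> corner R m" and c: "c \<in> corner R n" and d: "d \<in> corner R m"
  shows "M_mult R (block_diag R n a b) (block_diag R n c d) = block_diag R n (M_mult R a c) (M_mult R b d)"
proof (intro ext)
  fix i j
  note cl = cornerD(1)[OF a] cornerD(1)[OF b] cornerD(1)[OF c] cornerD(1)[OF d]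
  let ?t = "\<lambda>k. block_diag R n a b i k \<otimes> block_diag R n c d k j"
  have cl2: "block_diag R n a b i k \<in> carrier R" "block_diag R n c d i k \<in> carrier R" for i k
    using cl by (auto simp: block_diag_def)
  have "M_mult R (block_diag R n a b) (block_diag R n c d) i j = (\<Oplus>k\<in>{..<n + m}. ?t k)"
    by (rule M_mult_eq[OF block_diag_corner[OF a b] cl2(2)])
  also have "\<dots> = (\<Oplus>k\<in>{..<n} \<union> (\<lambda>k. n + k) ` {..<m}. ?t k)"
  proof (rule arg_cong[where f = "\<lambda>S. finsum R ?t S"])
    have "k \<in> (\<lambda>k. n + k) ` {..<m}" if "k < n + m" "\<not> k < n" for k
      using that by (intro image_eqI[of _ _ "k - n"]) auto
    then show "{..<n + m} = {..<n} \<union> (\<lambda>k. n + k) ` {..<m}" by auto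
  qed
  also have "\<dots> = (\<Oplus>k\<in>{..<n}. ?t k) \<oplus> (\<Oplus>k\<in>(\<lambda>k. n + k) ` {..<m}. ?t k)"
    by (rule finsum_Un_disjoint) (auto simp: cl2)
  also have "(\<Oplus>k\<in>(\<lambda>k. n + k) ` {..<m}. ?t k) = (\<Oplus>k\<in>{..<m}. ?t (n + k))"
    by (rule finsum_reindex) (auto simp: cl2)
  also have "(\<Oplus>k\<in>{..<n}. ?t k) = (if i < n \<and> j < n then M_mult R a c i j else \<zero>)"
    using cl by (auto simp: M_mult_eq[OF a] block_diag_def intro!: finsum_cong' add.finprod_one_eqI)
  also have "(\<Oplus>k\<in>{..<m}. ?t (n + k)) = (if n \<le> i \<and> n \<le> j then M_mult R b d (i - n) (j - n) else \<zero>)"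
    using cl by (auto simp: M_mult_eq[OF b] block_diag_def intro!: finsum_cong' add.finprod_one_eqI)
  finally show "M_mult R (block_diag R n a b) (block_diag R n c d) i j = block_diag R n (M_mult R a c) (M_mult R b d) i j"
    using cornerD(1)[OF M_mult_closed[OF a c]] cornerD(1)[OF M_mult_closed[OF b d]]
    by (auto simp: block_diag_def)
qed

lemma block_diag_idem:
  "\<lbrakk>e \<in> corner R n; e \<in> idem_inf R; f \<in> idem_inf R\<rbrakk> \<Longrightarrow> block_diag R n e f \<in> idem_inf R"
proof -
  assume e: "e \<in> corner R n" "e \<in> idem_inf R" and f: "f \<in> idem_inf R"
  obtain m where m: "f \<in> corner R m" using f by (auto simp: idem_inf_def M_inf_def)
  show ?thesis
    using block_diag_mult[OF e(1) m e(1) m] e f by (intro idem_infI[OF block_diag_corner[OF e(1) m]]) (auto simp: idem_inf_def)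
qed

lemma block_diag_rel:
  assumes e: "e \<in> corner R n" "e' \<in> corner R n" "(e, e') \<in> idem_rel R" and f: "(f, f') \<in> idem_rel R"
  shows "(block_diag R n e f, block_diag R n e' f') \<in> idem_rel R"
proof -
  obtain m where m: "f \<in> corner R m" "f' \<in> corner R m" using idem_inf_common idem_relD[OF f] by metis
  obtain x y where x: "x \<in> corner R n" "y \<in> corner R n" "M_mult R x y = e" "M_mult R y x = e'"
    using idem_rel_corner[OF e(3,1,2)] by blast
  obtain z w where z: "z \<in> corner R m" "w \<in> corner R m" "M_mult R z w = f" "M_mult R w z = f'"
    using idem_rel_corner[OF f m] by blast
  show ?thesis
    by (rule idem_relI[of "block_diag R n x z" "n + m" "block_diag R n y w"])
       (use x z e idem_relD[OF e(3)] idem_relD[OF f] in \<open>auto simp: block_diag_mult intro: block_diag_corner block_diag_idem\<close>)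
qed

lemma zero_idem: "(\<lambda>_ _. \<zero>) \<in> idem_inf R"
  by (rule idem_infI[of _ 0]) (auto simp: corner_def M_mult_def fun_eq_iff)

end

section \<open>Idempotent complex matrices\<close>

lemma complex_ring_simps [simp]:
  "carrier complex_ring = UNIV" "x \<otimes>\<^bsub>complex_ring\<^esub> y = x * y" "\<zero>\<^bsub>complex_ring\<^esub> = 0"
  "x \<oplus>\<^bsub>complex_ring\<^esub> y = x + y" "\<one>\<^bsub>complex_ring\<^esub> = 1"
  by (simp_all add: complex_ring_def)

lemma complex_ring: "ring complex_ring"
  by (intro ringI abelian_groupI monoidI) (auto simp: algebra_simps intro: exI[of _ "- _"] exI[of _ "uminus _"] add.left_inverse)

interpretation C: ring complex_ring by (rule complex_ring)

lemma finsum_complex: "finite A \<Longrightarrow> finsum complex_ring f A = sum f A"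
  by (induction A rule: finite_induct) (simp_all add: C.finsum_insert)

lemma C_mult: "a \<in> corner complex_ring n \<Longrightarrow> M_mult complex_ring a b i j = (\<Sum>k<n. a i k * b k j)"
  by (subst C.M_mult_eq) (auto simp: finsum_complex)

text \<open>The trace on \<open>M\<^sub>\<infinity>\<close> of the complex numbers; the set of summation is finite for the matrices
  in question.\<close>
definition ctrace :: "(nat \<Rightarrow> nat \<Rightarrow> complex) \<Rightarrow> complex" where
  "ctrace a = (\<Sum>i | a i i \<noteq> 0. a i i)"

lemma ctrace_eq: "a \<in> corner complex_ring n \<Longrightarrow> ctrace a = (\<Sum>i<n. a i i)"
  unfolding ctrace_def
  by (rule sum.mono_neutral_left) (auto simp: corner_def not_le[symmetric])

lemma ctrace_commute:
  assumes "x \<in> corner complex_ring n" "y \<in> corner complex_ring n"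
  shows "ctrace (M_mult complex_ring x y) = ctrace (M_mult complex_ring y x)"
proof -
  have "ctrace (M_mult complex_ring x y) = (\<Sum>i<n. \<Sum>k<n. x i k * y k i)"
    using assms by (subst ctrace_eq[OF C.M_mult_closed[OF assms]]) (simp add: C_mult)
  also have "\<dots> = (\<Sum>k<n. \<Sum>i<n. x i k * y k i)" by (rule sum.swap)
  also have "\<dots> = ctrace (M_mult complex_ring y x)"
    using assms by (subst ctrace_eq[OF C.M_mult_closed[OF assms(2,1)]]) (simp add: C_mult mult.commute)
  finally show ?thesis .
qed

lemma ctrace_rel:
  assumes "(e, f) \<in> idem_rel complex_ring"
  shows "ctrace e = ctrace f"
proof -
  obtain n where n: "e \<in> corner complex_ring n" "f \<in> corner complex_ring n"
    using C.idem_inf_common C.idem_relD[OF assms] by metis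
  from C.idem_rel_corner[OF assms n] show ?thesis by (metis ctrace_commute)
qed

definition cdiag :: "nat \<Rightarrow> nat \<Rightarrow> nat \<Rightarrow> complex" where
  "cdiag r i j = (if i = j \<and> i < r then 1 else 0)"

text \<open>A factorization \<open>e = x y\<close> through a space of the least possible dimension \<open>r\<close> has \<open>y x = 1\<close>:
  the matrix \<open>m = y x\<close> has \<open>x m y = e\<^sup>2 = x y\<close>, and it is injective, since a vector in its kernel
  would lead to a factorization of \<open>e\<close> of smaller size. From \<open>m\<^sup>3 = y e\<^sup>2 x = y e x = m\<^sup>2\<close> it
  follows that \<open>m = 1\<close>.\<close>
lemma idempotent_rank_factorization:
  assumes e: "e \<in> corner complex_ring n" and idem: "M_mult complex_ring e e = e"
  shows "\<exists>r\<le>n. \<exists>x\<in>corner complex_ring n. \<exists>y\<in>corner complex_ring n.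
    M_mult complex_ring x y = e \<and> M_mult complex_ring y x = cdiag r"
proof -
  \<comment> \<open>The index set \<open>I\<close> of the inner dimension is arbitrary, so that one of its members can be
    dropped without renumbering.\<close>
  define P where "P = (\<lambda>r. \<exists>I x y. finite (I :: nat set) \<and> card I = r \<and> (\<forall>i j. e i j = (\<Sum>k\<in>I. x i k * y k j)))"
  have e2: "e i j = (\<Sum>k<n. e i k * e k j)" for i j
    using C_mult[OF e, of e i j] idem by simp
  have Pn: "P n"
    unfolding P_def by (intro exI[of _ "{..<n}"] exI[of _ e] conjI allI e2) simp_all
  define r where "r = (LEAST r. P r)"
  have Pr: "P r" unfolding r_def by (rule LeastI[of P n, OF Pn])
  have rn: "r \<le> n" unfolding r_def by (rule Least_le[of P n, OF Pn])
  have min: "\<not> P s" if "s < r" for s using that not_less_Least unfolding r_def by blast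
  obtain I x0 y0 where I: "finite (I :: nat set)" "card I = r" "\<And>i j. e i j = (\<Sum>k\<in>I. x0 i k * y0 k j)"
    using Pr unfolding P_def by blast
  define x where "x = (\<lambda>i k. if i < n then x0 i k else 0)"
  define y where "y = (\<lambda>k j. if j < n then y0 k j else 0)"
  have fac: "e i j = (\<Sum>k\<in>I. x i k * y k j)" for i j
    using I(3)[of i j] cornerD(2)[OF e, of i j] by (cases "i < n \<and> j < n") (auto simp: x_def y_def)
  define m where "m = (\<lambda>k l. \<Sum>i<n. y k i * x i l)"
  have xmy: "e i j = (\<Sum>k\<in>I. \<Sum>l\<in>I. x i k * m k l * y l j)" for i j
  proof -
    have "e i j = (\<Sum>t<n. e i t * e t j)" by (rule e2)
    also have "\<dots> = (\<Sum>t<n. (\<Sum>k\<in>I. x i k * y k t) * (\<Sum>l\<in>I. x t l * y l j))"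
      by (simp only: fac)
    also have "\<dots> = (\<Sum>t<n. \<Sum>k\<in>I. \<Sum>l\<in>I. x i k * (y k t * x t l) * y l j)"
      unfolding sum_product by (simp only: mult.assoc)
    also have "\<dots> = (\<Sum>k\<in>I. \<Sum>t<n. \<Sum>l\<in>I. x i k * (y k t * x t l) * y l j)" by (rule sum.swap)
    also have "\<dots> = (\<Sum>k\<in>I. \<Sum>l\<in>I. \<Sum>t<n. x i k * (y k t * x t l) * y l j)"
      by (intro sum.cong refl sum.swap)
    finally show ?thesis by (simp add: m_def sum_distrib_left sum_distrib_right)
  qed
  have inj: "v i0 = 0" if v: "\<And>k. k \<in> I \<Longrightarrow> (\<Sum>l\<in>I. m k l * v l) = 0" and i0: "i0 \<in> I" for v i0
  proof (rule ccontr)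
    assume v0: "v i0 \<noteq> 0"
    \<comment> \<open>A kernel vector, scaled to have the entry \<open>1\<close> at \<open>i0\<close>, eliminates the index \<open>i0\<close> from the
      factorization \<open>e = (x m) y\<close>.\<close>
    define w where "w = (\<lambda>l. v l / v i0)"
    have w: "(\<Sum>l\<in>I. m k l * w l) = 0" if "k \<in> I" for k
      using v[OF that] by (simp add: w_def sum_divide_distrib[symmetric])
    define x' where "x' = (\<lambda>i l. \<Sum>k\<in>I. x i k * m k l)"
    define y' where "y' = (\<lambda>l j. y l j - w l * y i0 j)"
    have "e i j = (\<Sum>l\<in>I - {i0}. x' i l * y' l j)" for i j
    proof -
      have 0: "(\<Sum>l\<in>I. x' i l * w l) = 0"
      proof -
        have "(\<Sum>l\<in>I. x' i l * w l) = (\<Sum>l\<in>I. \<Sum>k\<in>I. x i k * (m k l * w l))"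
          unfolding x'_def sum_distrib_right by (simp only: mult.assoc)
        also have "\<dots> = (\<Sum>k\<in>I. x i k * (\<Sum>l\<in>I. m k l * w l))"
          by (subst sum.swap) (simp add: sum_distrib_left)
        finally show ?thesis using w by simp
      qed
      have "(\<Sum>l\<in>I - {i0}. x' i l * y' l j) = (\<Sum>l\<in>I. x' i l * y' l j)"
        using I(1) i0 v0 by (subst sum.remove[OF I(1) i0]) (simp add: y'_def w_def)
      also have "\<dots> = (\<Sum>l\<in>I. x' i l * y l j) - (\<Sum>l\<in>I. x' i l * w l) * y i0 j"
        by (simp add: y'_def right_diff_distrib sum_subtractf sum_distrib_right mult.assoc)
      also have "\<dots> = (\<Sum>l\<in>I. \<Sum>k\<in>I. x i k * m k l * y l j)" unfolding 0 by (simp add: x'_def sum_distrib_right)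
      also have "\<dots> = e i j" unfolding xmy by (rule sum.swap)
      finally show ?thesis ..
    qed
    then have "P (card (I - {i0}))" unfolding P_def using I(1) by blast
    moreover have "card (I - {i0}) < r" using I i0 by (metis card_Diff1_less)
    ultimately show False using min by blast
  qed
  have m_id: "m k l = (if k = l then 1 else 0)" if kl: "k \<in> I" "l \<in> I" for k l
  proof -
    \<comment> \<open>The column \<open>l\<close> of \<open>m - 1\<close>, which \<open>m\<^sup>2\<close> annihilates.\<close>
    define a where "a = (\<lambda>k. m k l - (if k = l then 1 else 0))"
    have mm: "(\<Sum>t\<in>I. m k t * m t l) = (\<Sum>i<n. \<Sum>j<n. y k i * e i j * x j l)" for k
    proof -
      have "(\<Sum>t\<in>I. m k t * m t l) = (\<Sum>t\<in>I. \<Sum>i<n. \<Sum>j<n. y k i * (x i t * y t j) * x j l)"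
        by (simp add: m_def sum_product mult_ac)
      also have "\<dots> = (\<Sum>i<n. \<Sum>t\<in>I. \<Sum>j<n. y k i * (x i t * y t j) * x j l)" by (rule sum.swap)
      also have "\<dots> = (\<Sum>i<n. \<Sum>j<n. \<Sum>t\<in>I. y k i * (x i t * y t j) * x j l)"
        by (intro sum.cong refl sum.swap)
      finally show ?thesis by (simp add: fac sum_distrib_left sum_distrib_right)
    qed
    have mmm: "(\<Sum>t\<in>I. m k t * (\<Sum>s\<in>I. m t s * m s l)) = (\<Sum>t\<in>I. m k t * m t l)" for k
    proof -
      have "(\<Sum>t\<in>I. m k t * (\<Sum>s\<in>I. m t s * m s l)) =
          (\<Sum>t\<in>I. (\<Sum>h<n. y k h * x h t) * (\<Sum>i<n. \<Sum>j<n. y t i * e i j * x j l))"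
        unfolding mm by (simp add: m_def)
      also have "\<dots> = (\<Sum>t\<in>I. \<Sum>h<n. \<Sum>i<n. \<Sum>j<n. y k h * (x h t * y t i) * e i j * x j l)"
        unfolding sum_distrib_right unfolding sum_distrib_left by (simp only: mult.assoc)
      also have "\<dots> = (\<Sum>h<n. \<Sum>t\<in>I. \<Sum>i<n. \<Sum>j<n. y k h * (x h t * y t i) * e i j * x j l)" by (rule sum.swap)
      also have "\<dots> = (\<Sum>h<n. \<Sum>i<n. \<Sum>t\<in>I. \<Sum>j<n. y k h * (x h t * y t i) * e i j * x j l)"
        by (intro sum.cong refl sum.swap)
      also have "\<dots> = (\<Sum>h<n. \<Sum>i<n. \<Sum>j<n. \<Sum>t\<in>I. y k h * (x h t * y t i) * e i j * x j l)"
        by (intro sum.cong refl sum.swap)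
      also have "\<dots> = (\<Sum>h<n. \<Sum>i<n. \<Sum>j<n. y k h * e h i * e i j * x j l)"
      proof (intro sum.cong refl)
        fix h i j
        show "(\<Sum>t\<in>I. y k h * (x h t * y t i) * e i j * x j l) = y k h * e h i * e i j * x j l"
          by (simp add: fac[of h i] sum_distrib_left sum_distrib_right)
      qed
      also have "\<dots> = (\<Sum>h<n. \<Sum>j<n. \<Sum>i<n. y k h * (e h i * e i j) * x j l)"
        by (simp add: mult.assoc) (intro sum.cong refl sum.swap)
      also have "\<dots> = (\<Sum>h<n. \<Sum>j<n. y k h * e h j * x j l)"
        unfolding sum_distrib_left[symmetric] sum_distrib_right[symmetric] e2[symmetric] ..
      finally show ?thesis unfolding mm .
    qed
    have "(\<Sum>t\<in>I. m k t * (\<Sum>s\<in>I. m t s * a s)) = 0" for k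
    proof -
      have 1: "(\<Sum>s\<in>I. m t s * a s) = (\<Sum>s\<in>I. m t s * m s l) - m t l" for t
        unfolding a_def using I(1) kl
        by (simp add: right_diff_distrib sum_subtractf if_distrib[of "\<lambda>z. _ * z"] cong: if_cong)
      show ?thesis unfolding 1 by (simp add: right_diff_distrib sum_subtractf mmm)
    qed
    then have "(\<Sum>s\<in>I. m t s * a s) = 0" if "t \<in> I" for t using inj[of "\<lambda>t. \<Sum>s\<in>I. m t s * a s" t] that by blast
    then have "a k = 0" using inj[of a k] kl by blast
    then show ?thesis by (simp add: a_def)
  qed
  \<comment> \<open>Now the index set is renumbered as \<open>{..<r}\<close>, to obtain matrices in the corner.\<close>
  obtain h where h: "bij_betw h {..<r} I" using ex_bij_betw_nat_finite[OF I(1)] I(2) by (auto simp: atLeast0LessThan)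
  define X where "X = (\<lambda>i k. if i < n \<and> k < r then x i (h k) else 0)"
  define Y where "Y = (\<lambda>k j. if k < r \<and> j < n then y (h k) j else 0)"
  have X: "X \<in> corner complex_ring n" and Y: "Y \<in> corner complex_ring n" using rn by (auto simp: X_def Y_def corner_def)
  have "M_mult complex_ring X Y i j = e i j" for i j
  proof -
    have "M_mult complex_ring X Y i j = (\<Sum>k<n. X i k * Y k j)" by (rule C_mult[OF X])
    also have "\<dots> = (\<Sum>k<r. X i k * Y k j)" using rn by (intro sum.mono_neutral_right) (auto simp: X_def)
    also have "\<dots> = (\<Sum>k<r. x i (h k) * y (h k) j)" by (intro sum.cong) (auto simp: X_def Y_def x_def y_def)
    also have "\<dots> = (\<Sum>k\<in>I. x i k * y k j)" by (rule sum.reindex_bij_betw[OF h])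
    finally show ?thesis by (simp add: fac)
  qed
  moreover have "M_mult complex_ring Y X k l = cdiag r k l" for k l
  proof -
    have "M_mult complex_ring Y X k l = (\<Sum>i<n. Y k i * X i l)" by (rule C_mult[OF Y])
    also have "\<dots> = (if k < r \<and> l < r then m (h k) (h l) else 0)" by (auto simp: m_def X_def Y_def intro!: sum.cong)
    also have "\<dots> = cdiag r k l"
      using h m_id[of "h k" "h l"] by (auto simp: cdiag_def bij_betw_def inj_on_def)
    finally show ?thesis .
  qed
  ultimately have "M_mult complex_ring X Y = e" "M_mult complex_ring Y X = cdiag r" by (auto intro!: ext)
  then show ?thesis using rn X Y by blast
qed

lemma cdiag_corner: "r \<le> n \<Longrightarrow> cdiag r \<in> corner complex_ring n"
  by (auto simp: cdiag_def corner_def)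

lemma cdiag_idem: "cdiag r \<in> idem_inf complex_ring"
proof (rule C.idem_infI[OF cdiag_corner[OF order_refl]], intro ext)
  fix i j
  have "(\<Sum>k<r. cdiag r i k * cdiag r k j) = (\<Sum>k<r. if k = i then cdiag r i j else 0)"
    by (intro sum.cong) (auto simp: cdiag_def)
  then show "M_mult complex_ring (cdiag r) (cdiag r) i j = cdiag r i j"
    by (simp add: C_mult[OF cdiag_corner[OF order_refl]]) (simp add: cdiag_def)
qed

lemma ctrace_cdiag: "ctrace (cdiag r) = of_nat r"
  by (subst ctrace_eq[OF cdiag_corner[OF order_refl]]) (simp add: cdiag_def)

lemma idempotent_rel_cdiag:
  assumes "e \<in> corner complex_ring n" "M_mult complex_ring e e = e"
  shows "\<exists>r\<le>n. (e, cdiag r) \<in> idem_rel complex_ring \<and> ctrace e = of_nat r"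
proof -
  obtain r x y where r: "r \<le> n" "x \<in> corner complex_ring n" "y \<in> corner complex_ring n"
    "M_mult complex_ring x y = e" "M_mult complex_ring y x = cdiag r"
    using idempotent_rank_factorization[OF assms] by blast
  have "(e, cdiag r) \<in> idem_rel complex_ring"
    by (rule C.idem_relI[OF r(2-5) C.idem_infI[OF assms] cdiag_idem])
  then show ?thesis using r(1) ctrace_rel ctrace_cdiag by metis
qed

text \<open>Both idempotents are equivalent to diagonal ones, whose size is the trace.\<close>
lemma complex_idem_rel_iff:
  assumes e: "e \<in> idem_inf complex_ring" and f: "f \<in> idem_inf complex_ring"
  shows "(e, f) \<in> idem_rel complex_ring \<longleftrightarrow> ctrace e = ctrace f"
proof
  assume tr: "ctrace e = ctrace f"
  obtain n where n: "e \<in> corner complex_ring n" "f \<in> corner complex_ring n"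
    using C.idem_inf_common e f by metis
  have i: "M_mult complex_ring e e = e" "M_mult complex_ring f f = f" using e f by (auto simp: idem_inf_def)
  obtain r where r: "(e, cdiag r) \<in> idem_rel complex_ring" "ctrace e = of_nat r"
    using idempotent_rel_cdiag[OF n(1) i(1)] by blast
  obtain s where s: "(f, cdiag s) \<in> idem_rel complex_ring" "ctrace f = of_nat s"
    using idempotent_rel_cdiag[OF n(2) i(2)] by blast
  have "r = s" using r s tr by simp
  then show "(e, f) \<in> idem_rel complex_ring" using r s C.idem_rel_trans C.idem_rel_sym by metis
qed (rule ctrace_rel)

lemma ctrace_block_diag:
  assumes "e \<in> corner complex_ring n" "f \<in> corner complex_ring m"
  shows "ctrace (block_diag complex_ring n e f) = ctrace e + ctrace f"
proof -
  have "ctrace (block_diag complex_ring n e f) = (\<Sum>i<n + m. block_diag complex_ring n e f i i)"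
    by (rule ctrace_eq[OF C.block_diag_corner[OF assms]])
  also have "\<dots> = (\<Sum>i<n. e i i) + (\<Sum>i<m. f i i)"
    by (simp add: lessThan_atLeast0 sum.atLeastLessThan_concat[of 0 n "n + m", symmetric] block_diag_def)
       (simp add: sum.shift_bounds_nat_ivl[of _ 0 n m, simplified add_0 add.commute[of m]] )
  finally show ?thesis using assms by (simp add: ctrace_eq)
qed

section \<open>The norm of matrices acting on finite dimensional l^p spaces\<close>

text \<open>The graph of \<open>z \<mapsto> z powr p\<close> lies above its tangents, by the mean value theorem and the
  monotonicity of the derivative.\<close>
lemma powr_tangent:
  fixes x y p :: real
  assumes p: "p \<ge> 1" and x: "0 < x" and y: "0 < y"
  shows "x powr p + p * x powr (p - 1) * (y - x) \<le> y powr p"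
proof -
  consider "x = y" | "x < y" | "y < x" by linarith
  then show ?thesis
  proof cases
    case 2
    obtain z where z: "x < z" "z < y" "y powr p - x powr p = (y - x) * (p * z powr (p - 1))"
      using MVT2[of x y "\<lambda>z. z powr p" "\<lambda>z. p * z powr (p - 1)"] 2 x has_real_derivative_powr by force
    have "p * x powr (p - 1) * (y - x) \<le> p * z powr (p - 1) * (y - x)"
      using z p x by (intro mult_right_mono mult_left_mono powr_mono2) auto
    then show ?thesis using z(3) by (simp add: mult_ac)
  next
    case 3
    obtain z where z: "y < z" "z < x" "x powr p - y powr p = (x - y) * (p * z powr (p - 1))"
      using MVT2[of y x "\<lambda>z. z powr p" "\<lambda>z. p * z powr (p - 1)"] 3 y has_real_derivative_powr by force
    have "p * z powr (p - 1) * (x - y) \<le> p * x powr (p - 1) * (x - y)"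
      using z p y by (intro mult_right_mono mult_left_mono powr_mono2) auto
    then show ?thesis using z(3) by (simp add: algebra_simps)
  qed simp
qed

lemma powr_convex_nonneg:
  fixes a b t p :: real
  assumes "p \<ge> 1" "0 \<le> a" "0 \<le> b" "0 \<le> t" "t \<le> 1"
  shows "((1 - t) * a + t * b) powr p \<le> (1 - t) * a powr p + t * b powr p"
proof -
  have small: "s powr p \<le> s" if "0 \<le> s" "s \<le> 1" for s :: real
    using powr_mono'[of 1 p s] that assms(1) by (cases "s = 0") auto
  consider "a = 0" | "b = 0" | "a > 0" "b > 0" using assms by linarith
  then show ?thesis
  proof cases
    case 1
    then show ?thesis using small[of t] assms by (simp add: powr_mult mult_right_mono)
  next
    case 2
    then show ?thesis using small[of "1 - t"] assms by (simp add: powr_mult mult_right_mono)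
  next
    case 3
    define m where "m = (1 - t) * a + t * b"
    define c where "c = p * m powr (p - 1)"
    have m: "m > 0" unfolding m_def using 3 assms
      by (cases "t = 0") (auto intro!: add_nonneg_pos mult_nonneg_nonneg mult_pos_pos)
    have "(1 - t) * (m powr p + c * (a - m)) + t * (m powr p + c * (b - m)) \<le> (1 - t) * a powr p + t * b powr p"
      unfolding c_def using 3 m assms by (intro add_mono mult_left_mono powr_tangent) auto
    moreover have "(1 - t) * (m powr p + c * (a - m)) + t * (m powr p + c * (b - m)) = m powr p + c * ((1 - t) * a + t * b - m)"
      by (simp add: algebra_simps)
    ultimately show ?thesis by (simp add: m_def)
  qed
qed

locale lp_exponent =
  fixes p :: real
  assumes p_ge_1: "p \<ge> 1"
begin

definition lp_sum :: "complex vec \<Rightarrow> real" where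
  "lp_sum v = (\<Sum>i<dim_vec v. cmod (v $ i) powr p)"

lemma lp_sum_nonneg: "0 \<le> lp_sum v"
  by (simp add: lp_sum_def sum_nonneg)

lemma lp_norm_eq: "lp_norm p v = lp_sum v powr (1 / p)"
  by (simp add: lp_norm_def lp_sum_def)

lemma lp_norm_nonneg: "0 \<le> lp_norm p v"
  by (simp add: lp_norm_def)

lemma lp_norm_powr: "lp_norm p v powr p = lp_sum v"
  using p_ge_1 lp_sum_nonneg[of v] by (simp add: lp_norm_eq powr_powr)

lemma lp_norm_le_iff: "0 \<le> c \<Longrightarrow> lp_norm p v \<le> c \<longleftrightarrow> lp_sum v \<le> c powr p"
proof
  assume "0 \<le> c" "lp_norm p v \<le> c"
  then show "lp_sum v \<le> c powr p"
    using powr_mono2[of p "lp_norm p v" c] p_ge_1 lp_norm_nonneg[of v] by (simp add: lp_norm_powr)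
next
  assume c: "0 \<le> c" and "lp_sum v \<le> c powr p"
  then have "lp_norm p v \<le> (c powr p) powr (1 / p)"
    unfolding lp_norm_eq using p_ge_1 lp_sum_nonneg by (intro powr_mono2) auto
  then show "lp_norm p v \<le> c" using c p_ge_1 by (simp add: powr_powr)
qed

lemma entry_le_lp_norm: "i < dim_vec v \<Longrightarrow> cmod (v $ i) \<le> lp_norm p v"
proof -
  assume i: "i < dim_vec v"
  have "cmod (v $ i) powr p \<le> lp_sum v"
    unfolding lp_sum_def using i by (intro member_le_sum) auto
  also have "\<dots> = lp_norm p v powr p" by (simp add: lp_norm_powr)
  finally have le: "cmod (v $ i) powr p \<le> lp_norm p v powr p" .
  show ?thesis
  proof (rule ccontr)
    assume "\<not> ?thesis"
    then have "lp_norm p v powr p < cmod (v $ i) powr p"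
      using p_ge_1 lp_norm_nonneg[of v] by (intro powr_less_mono2) auto
    with le show False by simp
  qed
qed

lemma lp_norm_smult: "lp_norm p (c \<cdot>\<^sub>v v) = cmod c * lp_norm p v"
proof -
  have "lp_sum (c \<cdot>\<^sub>v v) = cmod c powr p * lp_sum v"
    by (simp add: lp_sum_def norm_mult powr_mult sum_distrib_left)
  then show ?thesis using p_ge_1 by (simp add: lp_norm_eq powr_mult powr_powr)
qed

lemma lp_norm_zero: "lp_norm p (0\<^sub>v d) = 0"
  by (simp add: lp_norm_def)

lemma lp_norm_eq_0:
  assumes "v \<in> carrier_vec d" "lp_norm p v = 0"
  shows "v = 0\<^sub>v d"
proof (rule eq_vecI)
  fix i assume "i < dim_vec (0\<^sub>v d :: complex vec)"
  then show "v $ i = 0\<^sub>v d $ i" using entry_le_lp_norm[of i v] assms by auto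
qed (use assms in auto)

text \<open>Minkowski's inequality. The vector \<open>v + w\<close> is \<open>a + b\<close> times a convex combination of \<open>v / a\<close>
  and \<open>w / b\<close>, where \<open>a\<close> and \<open>b\<close> are the norms of \<open>v\<close> and \<open>w\<close>, and the \<open>p\<close>-th power is convex.\<close>
lemma lp_norm_triangle:
  assumes v: "v \<in> carrier_vec d" and w: "w \<in> carrier_vec d"
  shows "lp_norm p (v + w) \<le> lp_norm p v + lp_norm p w"
proof (cases "lp_norm p v = 0 \<or> lp_norm p w = 0")
  case True
  then show ?thesis using lp_norm_eq_0[OF v] lp_norm_eq_0[OF w] v w by (auto simp: lp_norm_zero)
next
  case False
  define a where "a = lp_norm p v"
  define b where "b = lp_norm p w"
  have ab: "a > 0" "b > 0" using False lp_norm_nonneg[of v] lp_norm_nonneg[of w] by (auto simp: a_def b_def)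
  define t where "t = b / (a + b)"
  have t: "0 \<le> t" "t \<le> 1" "1 - t = a / (a + b)" using ab by (auto simp: t_def field_simps)
  have ab': "a powr p = lp_sum v" "b powr p = lp_sum w" by (simp_all add: a_def b_def lp_norm_powr)
  have pos: "lp_sum v > 0" "lp_sum w > 0" using ab by (simp_all flip: ab')
  have "lp_sum (v + w) \<le> (\<Sum>i<d. (a + b) powr p * ((1 - t) * (cmod (v $ i) / a) powr p + t * (cmod (w $ i) / b) powr p))"
    unfolding lp_sum_def carrier_vecD[OF add_carrier_vec[OF v w]]
  proof (rule sum_mono)
    fix i assume "i \<in> {..<d}"
    then have i: "i < dim_vec v" "i < dim_vec w" using v w by auto
    have "cmod ((v + w) $ i) \<le> cmod (v $ i) + cmod (w $ i)" using i by (simp add: norm_triangle_ineq)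
    also have "\<dots> = (a + b) * ((1 - t) * (cmod (v $ i) / a) + t * (cmod (w $ i) / b))"
      unfolding t(3) unfolding t_def using ab add_pos_pos[OF ab] by (simp add: distrib_left)
    finally have "cmod ((v + w) $ i) powr p \<le> ((a + b) * ((1 - t) * (cmod (v $ i) / a) + t * (cmod (w $ i) / b))) powr p"
      using p_ge_1 by (intro powr_mono2) auto
    also have "\<dots> = (a + b) powr p * ((1 - t) * (cmod (v $ i) / a) + t * (cmod (w $ i) / b)) powr p"
      by (rule powr_mult)
    also have "\<dots> \<le> (a + b) powr p * ((1 - t) * (cmod (v $ i) / a) powr p + t * (cmod (w $ i) / b) powr p)"
      using ab t p_ge_1 by (intro mult_left_mono powr_convex_nonneg) auto
    finally show "cmod ((v + w) $ i) powr p \<le> (a + b) powr p * ((1 - t) * (cmod (v $ i) / a) powr p + t * (cmod (w $ i) / b) powr p)" .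
  qed
  also have "\<dots> = (a + b) powr p * ((1 - t) * (\<Sum>i<d. (cmod (v $ i) / a) powr p) + t * (\<Sum>i<d. (cmod (w $ i) / b) powr p))"
    by (simp add: sum_distrib_left sum.distrib distrib_left)
  also have "(\<Sum>i<d. (cmod (v $ i) / a) powr p) = 1"
    using v pos ab'(1) by (simp add: powr_divide sum_divide_distrib[symmetric]) (simp add: lp_sum_def)
  also have "(\<Sum>i<d. (cmod (w $ i) / b) powr p) = 1"
    using w pos ab'(2) by (simp add: powr_divide sum_divide_distrib[symmetric]) (simp add: lp_sum_def)
  finally have "lp_sum (v + w) \<le> (a + b) powr p" by simp
  then show ?thesis using ab by (subst lp_norm_le_iff) (auto simp: a_def b_def)
qed

lemma lp_norm_le_sum: "lp_norm p v \<le> (\<Sum>i<dim_vec v. cmod (v $ i))"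
proof -
  define s where "s = (\<Sum>i<dim_vec v. cmod (v $ i))"
  have s: "0 \<le> s" by (simp add: s_def sum_nonneg)
  have le: "cmod (v $ i) \<le> s" if "i < dim_vec v" for i
    unfolding s_def using that by (intro member_le_sum[of i _ "\<lambda>i. cmod (v $ i)"]) auto
  have "lp_sum v \<le> s powr p"
  proof (cases "s = 0")
    case True
    then have "cmod (v $ i) = 0" if "i < dim_vec v" for i using le[OF that] by auto
    then show ?thesis by (simp add: lp_sum_def)
  next
    case False
    then have s0: "s > 0" using s by simp
    have "cmod (v $ i) powr p \<le> s powr p * (cmod (v $ i) / s)" if "i < dim_vec v" for i
    proof -
      have "(cmod (v $ i) / s) powr p \<le> (cmod (v $ i) / s) powr 1" if "v $ i \<noteq> 0"
        using le[OF \<open>i < dim_vec v\<close>] s0 p_ge_1 that by (intro powr_mono') auto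
      then have "(cmod (v $ i) / s) powr p \<le> cmod (v $ i) / s" using s0 by (cases "v $ i = 0") auto
      then show ?thesis using s0 by (simp add: powr_divide divide_le_eq mult.commute)
    qed
    then have "lp_sum v \<le> (\<Sum>i<dim_vec v. s powr p * (cmod (v $ i) / s))"
      unfolding lp_sum_def by (intro sum_mono) auto
    also have "\<dots> = s powr p * (s / s)" by (simp add: sum_distrib_left[symmetric] sum_divide_distrib[symmetric] s_def)
    finally show ?thesis using s0 by simp
  qed
  then show ?thesis using s by (simp add: lp_norm_le_iff s_def)
qed

text \<open>A crude bound of the operator norm. It shows that the supremum in the definition of the
  operator norm is over a bounded set, and that convergence of the entries implies convergence in
  norm.\<close>
definition entry_sum :: "complex mat \<Rightarrow> real" where
  "entry_sum M = (\<Sum>i<dim_row M. \<Sum>j<dim_col M. cmod (M $$ (i, j)))"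

lemma entry_sum_nonneg: "0 \<le> entry_sum M"
  by (simp add: entry_sum_def sum_nonneg)

lemma lp_norm_mult_le_entry_sum:
  assumes "M \<in> carrier_mat d d" "v \<in> carrier_vec d"
  shows "lp_norm p (M *\<^sub>v v) \<le> entry_sum M * lp_norm p v"
proof -
  have "lp_norm p (M *\<^sub>v v) \<le> (\<Sum>i<d. cmod ((M *\<^sub>v v) $ i))" using lp_norm_le_sum[of "M *\<^sub>v v"] assms by simp
  also have "\<dots> \<le> (\<Sum>i<d. \<Sum>j<d. cmod (M $$ (i, j)) * lp_norm p v)"
  proof (rule sum_mono)
    fix i assume i: "i \<in> {..<d}"
    have "(M *\<^sub>v v) $ i = (\<Sum>j<d. M $$ (i, j) * v $ j)"
      using assms i by (auto simp: scalar_prod_def lessThan_atLeast0 intro!: sum.cong)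
    then have "cmod ((M *\<^sub>v v) $ i) \<le> (\<Sum>j<d. cmod (M $$ (i, j) * v $ j))" by (simp add: norm_sum)
    also have "\<dots> \<le> (\<Sum>j<d. cmod (M $$ (i, j)) * lp_norm p v)"
      using assms by (intro sum_mono) (auto simp: norm_mult intro!: mult_left_mono entry_le_lp_norm)
    finally show "cmod ((M *\<^sub>v v) $ i) \<le> (\<Sum>j<d. cmod (M $$ (i, j)) * lp_norm p v)" .
  qed
  also have "\<dots> = entry_sum M * lp_norm p v" using assms by (simp add: entry_sum_def sum_distrib_right)
  finally show ?thesis .
qed

lemma op_norm_set_bounded:
  assumes "M \<in> carrier_mat d d"
  shows "bdd_above {lp_norm p (M *\<^sub>v v) | v. v \<in> carrier_vec (dim_col M) \<and> lp_norm p v \<le> 1}"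
proof (rule bdd_aboveI, clarify)
  fix v assume "v \<in> carrier_vec (dim_col M)" "lp_norm p v \<le> 1"
  then show "lp_norm p (M *\<^sub>v v) \<le> entry_sum M"
    using lp_norm_mult_le_entry_sum[OF assms, of v] mult_left_mono[OF _ entry_sum_nonneg, of "lp_norm p v" 1 M] assms by fastforce
qed

lemma op_norm_nonneg: "M \<in> carrier_mat d d \<Longrightarrow> 0 \<le> lp_op_norm p M"
  unfolding lp_op_norm_def
  by (rule cSup_upper2[OF _ _ op_norm_set_bounded, of "lp_norm p (M *\<^sub>v 0\<^sub>v d)"])
     (auto simp: lp_norm_nonneg lp_norm_zero intro!: exI[of _ "0\<^sub>v d"])

lemma op_norm_mult_vec:
  assumes M: "M \<in> carrier_mat d d" and v: "v \<in> carrier_vec d"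
  shows "lp_norm p (M *\<^sub>v v) \<le> lp_op_norm p M * lp_norm p v"
proof (cases "lp_norm p v = 0")
  case True
  then have "v = 0\<^sub>v d" by (rule lp_norm_eq_0[OF v])
  moreover have "M *\<^sub>v 0\<^sub>v d = 0\<^sub>v d" using M by (intro eq_vecI) auto
  ultimately show ?thesis by (simp add: lp_norm_zero)
next
  case False
  define c where "c = lp_norm p v"
  have c: "c > 0" using False lp_norm_nonneg[of v] by (simp add: c_def)
  let ?w = "complex_of_real (1 / c) \<cdot>\<^sub>v v"
  have "lp_norm p ?w = 1" using c by (simp add: lp_norm_smult c_def[symmetric] norm_divide)
  then have "lp_norm p (M *\<^sub>v ?w) \<le> lp_op_norm p M"
    unfolding lp_op_norm_def using v M by (intro cSup_upper[OF _ op_norm_set_bounded[OF M]]) auto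
  moreover have "M *\<^sub>v ?w = complex_of_real (1 / c) \<cdot>\<^sub>v (M *\<^sub>v v)" using M v by (simp add: mult_mat_vec)
  ultimately have "lp_norm p (M *\<^sub>v v) / c \<le> lp_op_norm p M"
    using c by (simp add: lp_norm_smult norm_divide)
  then show ?thesis using c by (simp add: divide_le_eq c_def)
qed

lemma op_norm_le:
  assumes M: "M \<in> carrier_mat d d" and c: "0 \<le> c"
    and le: "\<And>v. v \<in> carrier_vec d \<Longrightarrow> lp_norm p (M *\<^sub>v v) \<le> c * lp_norm p v"
  shows "lp_op_norm p M \<le> c"
  unfolding lp_op_norm_def
proof (rule cSup_least)
  show "{lp_norm p (M *\<^sub>v v) | v. v \<in> carrier_vec (dim_col M) \<and> lp_norm p v \<le> 1} \<noteq> {}"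
    by (auto intro!: exI[of _ "0\<^sub>v (dim_col M)"] simp: lp_norm_zero)
  fix x assume "x \<in> {lp_norm p (M *\<^sub>v v) | v. v \<in> carrier_vec (dim_col M) \<and> lp_norm p v \<le> 1}"
  then obtain v where v: "v \<in> carrier_vec d" "lp_norm p v \<le> 1" "x = lp_norm p (M *\<^sub>v v)" using M by auto
  then have "x \<le> c * lp_norm p v" using le by simp
  also have "\<dots> \<le> c" using v c lp_norm_nonneg[of v] by (simp add: mult_left_le)
  finally show "x \<le> c" .
qed

lemma op_norm_le_entry_sum: "M \<in> carrier_mat d d \<Longrightarrow> lp_op_norm p M \<le> entry_sum M"
  by (intro op_norm_le entry_sum_nonneg lp_norm_mult_le_entry_sum)

lemma entry_le_op_norm:
  assumes M: "M \<in> carrier_mat d d" and ij: "i < d" "j < d"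
  shows "cmod (M $$ (i, j)) \<le> lp_op_norm p M"
proof -
  have "lp_sum (unit_vec d j) = (\<Sum>i<d. if i = j then 1 else 0)"
    unfolding lp_sum_def by (intro sum.cong) (auto simp: unit_vec_def)
  then have u: "lp_norm p (unit_vec d j) = 1" using ij by (simp add: lp_norm_eq)
  have "M $$ (i, j) = (M *\<^sub>v unit_vec d j) $ i" using M ij by simp
  then have "cmod (M $$ (i, j)) \<le> lp_norm p (M *\<^sub>v unit_vec d j)"
    using entry_le_lp_norm[of i "M *\<^sub>v unit_vec d j"] M ij by simp
  then show ?thesis using op_norm_mult_vec[OF M, of "unit_vec d j"] u by simp
qed

lemma op_norm_add:
  assumes M: "M \<in> carrier_mat d d" and N: "N \<in> carrier_mat d d"
  shows "lp_op_norm p (M + N) \<le> lp_op_norm p M + lp_op_norm p N"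
proof (rule op_norm_le)
  fix v :: "complex vec" assume v: "v \<in> carrier_vec d"
  have "lp_norm p ((M + N) *\<^sub>v v) \<le> lp_norm p (M *\<^sub>v v) + lp_norm p (N *\<^sub>v v)"
    unfolding add_mult_distrib_mat_vec[OF M N v] using M N v by (intro lp_norm_triangle[of _ d]) auto
  then show "lp_norm p ((M + N) *\<^sub>v v) \<le> (lp_op_norm p M + lp_op_norm p N) * lp_norm p v"
    using op_norm_mult_vec[OF M v] op_norm_mult_vec[OF N v] by (simp add: distrib_right)
qed (use M N op_norm_nonneg in \<open>auto intro!: add_nonneg_nonneg\<close>)

lemma op_norm_mult:
  assumes M: "M \<in> carrier_mat d d" and N: "N \<in> carrier_mat d d"
  shows "lp_op_norm p (M * N) \<le> lp_op_norm p M * lp_op_norm p N"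
proof (rule op_norm_le)
  fix v :: "complex vec" assume v: "v \<in> carrier_vec d"
  have "lp_norm p ((M * N) *\<^sub>v v) \<le> lp_op_norm p M * lp_norm p (N *\<^sub>v v)"
    unfolding assoc_mult_mat_vec[OF M N v] using N v by (intro op_norm_mult_vec[OF M]) auto
  also have "\<dots> \<le> lp_op_norm p M * (lp_op_norm p N * lp_norm p v)"
    by (intro mult_left_mono op_norm_mult_vec[OF N v] op_norm_nonneg[OF M])
  finally show "lp_norm p ((M * N) *\<^sub>v v) \<le> (lp_op_norm p M * lp_op_norm p N) * lp_norm p v" by (simp add: mult.assoc)
qed (use M N op_norm_nonneg in \<open>auto intro!: mult_nonneg_nonneg\<close>)

lemma op_norm_smult_le:
  assumes M: "M \<in> carrier_mat d d"
  shows "lp_op_norm p (c \<cdot>\<^sub>m M) \<le> cmod c * lp_op_norm p M"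
proof (rule op_norm_le)
  fix v :: "complex vec" assume v: "v \<in> carrier_vec d"
  have "(c \<cdot>\<^sub>m M) *\<^sub>v v = c \<cdot>\<^sub>v (M *\<^sub>v v)" using M v by (intro eq_vecI) (auto simp: scalar_prod_def sum_distrib_left mult.assoc)
  then show "lp_norm p ((c \<cdot>\<^sub>m M) *\<^sub>v v) \<le> cmod c * lp_op_norm p M * lp_norm p v"
    using op_norm_mult_vec[OF M v] by (simp add: lp_norm_smult mult.assoc mult_left_mono)
qed (use M op_norm_nonneg in \<open>auto intro!: mult_nonneg_nonneg\<close>)

lemma op_norm_smult:
  assumes M: "M \<in> carrier_mat d d"
  shows "lp_op_norm p (c \<cdot>\<^sub>m M) = cmod c * lp_op_norm p M"
proof (cases "c = 0")
  case True
  have cM: "c \<cdot>\<^sub>m M \<in> carrier_mat d d" using M by simp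
  show ?thesis using op_norm_smult_le[OF M, of c] op_norm_nonneg[OF cM] True by simp
next
  case False
  have cM: "c \<cdot>\<^sub>m M \<in> carrier_mat d d" using M by simp
  have "inverse c \<cdot>\<^sub>m (c \<cdot>\<^sub>m M) = M" using False M by (intro eq_matI) auto
  then have "lp_op_norm p M \<le> inverse (cmod c) * lp_op_norm p (c \<cdot>\<^sub>m M)"
    using op_norm_smult_le[OF cM, of "inverse c"] by (simp add: norm_inverse)
  then have "cmod c * lp_op_norm p M \<le> lp_op_norm p (c \<cdot>\<^sub>m M)" using False by (simp add: field_simps)
  then show ?thesis using op_norm_smult_le[OF M, of c] by simp
qed

text \<open>Such a matrix acts isometrically.\<close>
lemma op_norm_unimodular_diag:
  assumes M: "M \<in> carrier_mat d d" and d: "0 < d"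
    and diag: "\<And>i j. \<lbrakk>i < d; j < d; i \<noteq> j\<rbrakk> \<Longrightarrow> M $$ (i, j) = 0" and uni: "\<And>i. i < d \<Longrightarrow> cmod (M $$ (i, i)) = 1"
  shows "lp_op_norm p M = 1"
proof (rule antisym)
  show "lp_op_norm p M \<le> 1"
  proof (rule op_norm_le[OF M])
    fix v :: "complex vec" assume v: "v \<in> carrier_vec d"
    have "cmod ((M *\<^sub>v v) $ i) = cmod (v $ i)" if i: "i < d" for i
    proof -
      have "(M *\<^sub>v v) $ i = (\<Sum>j\<in>{0..<d}. M $$ (i, j) * v $ j)"
        using M v i by (auto simp: scalar_prod_def)
      also have "\<dots> = (\<Sum>j\<in>{0..<d}. if j = i then M $$ (i, i) * v $ i else 0)"
        by (intro sum.cong refl) (use i diag in auto)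
      finally show ?thesis using i uni by (simp add: norm_mult)
    qed
    then have "lp_sum (M *\<^sub>v v) = lp_sum v" using M v by (simp add: lp_sum_def)
    then show "lp_norm p (M *\<^sub>v v) \<le> 1 * lp_norm p v" by (simp add: lp_norm_eq)
  qed simp
  show "1 \<le> lp_op_norm p M" using entry_le_op_norm[OF M d d] uni[OF d] by simp
qed

end

section \<open>Direct sums of matrix algebras\<close>

lemma lp_matrix_sum_simps [simp]:
  "carrier (lp_matrix_sum p ds) = {as. length as = length ds \<and> (\<forall>k<length ds. as ! k \<in> carrier_mat (ds ! k) (ds ! k))}"
  "as \<otimes>\<^bsub>lp_matrix_sum p ds\<^esub> bs = map2 (*) as bs"
  "as \<oplus>\<^bsub>lp_matrix_sum p ds\<^esub> bs = map2 (+) as bs"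
  "\<zero>\<^bsub>lp_matrix_sum p ds\<^esub> = map (\<lambda>d. 0\<^sub>m d d) ds"
  "c \<odot>\<^bsub>lp_matrix_sum p ds\<^esub> as = map (\<lambda>a. c \<cdot>\<^sub>m a) as"
  "nrm (lp_matrix_sum p ds) as = Max (lp_op_norm p ` set as)"
  by (simp_all add: lp_matrix_sum_def)

lemma lp_matrix_sum_algebra: "complex_algebra (lp_matrix_sum p ds)"
proof (intro complex_algebra.intro abelian_groupI complex_algebra_axioms.intro)
  fix x assume "x \<in> carrier (lp_matrix_sum p ds)"
  then show "\<exists>y\<in>carrier (lp_matrix_sum p ds). y \<oplus>\<^bsub>lp_matrix_sum p ds\<^esub> x = \<zero>\<^bsub>lp_matrix_sum p ds\<^esub>"
    by (intro bexI[of _ "map uminus x"]) (auto intro!: nth_equalityI)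
next
  fix x y z assume "x \<in> carrier (lp_matrix_sum p ds)" "y \<in> carrier (lp_matrix_sum p ds)" "z \<in> carrier (lp_matrix_sum p ds)"
  then have l: "length x = length ds" "length y = length ds" "length z = length ds"
    and "\<forall>i<length ds. x ! i \<in> carrier_mat (ds ! i) (ds ! i) \<and> y ! i \<in> carrier_mat (ds ! i) (ds ! i) \<and> z ! i \<in> carrier_mat (ds ! i) (ds ! i)"
    by auto
  then have c: "x ! i \<in> carrier_mat (ds ! i) (ds ! i)" "y ! i \<in> carrier_mat (ds ! i) (ds ! i)" "z ! i \<in> carrier_mat (ds ! i) (ds ! i)"
      if "i < length ds" for i using that by auto
  show "x \<otimes>\<^bsub>lp_matrix_sum p ds\<^esub> y \<otimes>\<^bsub>lp_matrix_sum p ds\<^esub> z = x \<otimes>\<^bsub>lp_matrix_sum p ds\<^esub> (y \<otimes>\<^bsub>lp_matrix_sum p ds\<^esub> z)"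
    by (rule nth_equalityI) (simp_all add: l assoc_mult_mat[OF c])
  show "(x \<oplus>\<^bsub>lp_matrix_sum p ds\<^esub> y) \<otimes>\<^bsub>lp_matrix_sum p ds\<^esub> z =
      x \<otimes>\<^bsub>lp_matrix_sum p ds\<^esub> z \<oplus>\<^bsub>lp_matrix_sum p ds\<^esub> y \<otimes>\<^bsub>lp_matrix_sum p ds\<^esub> z"
    by (rule nth_equalityI) (simp_all add: l add_mult_distrib_mat[OF c])
  show "x \<otimes>\<^bsub>lp_matrix_sum p ds\<^esub> (y \<oplus>\<^bsub>lp_matrix_sum p ds\<^esub> z) =
      x \<otimes>\<^bsub>lp_matrix_sum p ds\<^esub> y \<oplus>\<^bsub>lp_matrix_sum p ds\<^esub> x \<otimes>\<^bsub>lp_matrix_sum p ds\<^esub> z"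
    by (rule nth_equalityI) (simp_all add: l mult_add_distrib_mat[OF c])
next
  fix x y and s :: complex assume "x \<in> carrier (lp_matrix_sum p ds)" "y \<in> carrier (lp_matrix_sum p ds)"
  then have l: "length x = length ds" "length y = length ds"
    and "\<forall>i<length ds. x ! i \<in> carrier_mat (ds ! i) (ds ! i) \<and> y ! i \<in> carrier_mat (ds ! i) (ds ! i)"
    by auto
  then have c: "x ! i \<in> carrier_mat (ds ! i) (ds ! i)" "y ! i \<in> carrier_mat (ds ! i) (ds ! i)"
      if "i < length ds" for i using that by auto
  show "s \<odot>\<^bsub>lp_matrix_sum p ds\<^esub> (x \<oplus>\<^bsub>lp_matrix_sum p ds\<^esub> y) =
      s \<odot>\<^bsub>lp_matrix_sum p ds\<^esub> x \<oplus>\<^bsub>lp_matrix_sum p ds\<^esub> s \<odot>\<^bsub>lp_matrix_sum p ds\<^esub> y"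
    by (rule nth_equalityI) (simp_all add: l add_smult_distrib_left_mat[OF c])
  show "s \<odot>\<^bsub>lp_matrix_sum p ds\<^esub> (x \<otimes>\<^bsub>lp_matrix_sum p ds\<^esub> y) = (s \<odot>\<^bsub>lp_matrix_sum p ds\<^esub> x) \<otimes>\<^bsub>lp_matrix_sum p ds\<^esub> y"
    by (rule nth_equalityI) (simp_all add: l mult_smult_assoc_mat[OF c])
  show "s \<odot>\<^bsub>lp_matrix_sum p ds\<^esub> (x \<otimes>\<^bsub>lp_matrix_sum p ds\<^esub> y) = x \<otimes>\<^bsub>lp_matrix_sum p ds\<^esub> (s \<odot>\<^bsub>lp_matrix_sum p ds\<^esub> y)"
    by (rule nth_equalityI) (simp_all add: l mult_smult_distrib[OF c])
qed (auto intro!: nth_equalityI simp: assoc_add_mat[of _ _ _ _ _] comm_add_mat add_smult_distrib_right_mat)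

lemma (in Banach_algebra) alg_tendsto_unique:
  assumes X: "\<And>n. X n \<in> carrier A" and lim: "alg_tendsto A X x" "alg_tendsto A X y"
  shows "x = y"
proof -
  have c: "x \<in> carrier A" "y \<in> carrier A" using lim by (auto simp: alg_tendsto_def)
  have "nrm A (x \<ominus> y) \<le> nrm A (X n \<ominus> x) + nrm A (X n \<ominus> y)" for n
    using nrm_diff_triangle[OF c(1) X c(2), of n] nrm_diff_commute[OF c(1) X, of n] by simp
  then have "nrm A (x \<ominus> y) \<le> 0 + 0"
    using lim by (intro LIMSEQ_le_const[OF tendsto_add[of "\<lambda>n. nrm A (X n \<ominus> x)" _ _ "\<lambda>n. nrm A (X n \<ominus> y)"]])
      (auto simp: alg_tendsto_def)
  then have "x \<ominus> y = \<zero>" using nrm_nonneg[of "x \<ominus> y"] nrm_eq_0_iff[of "x \<ominus> y"] c by simp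
  moreover have "x = (x \<ominus> y) \<oplus> y" using c by (simp add: a_minus_def a_assoc l_neg)
  ultimately show ?thesis using c by simp
qed

definition unit_list :: "nat list \<Rightarrow> complex mat list" where
  "unit_list ds = map (\<lambda>d. 1\<^sub>m d) ds"

lemma unit_list_unit: "is_alg_unit (lp_matrix_sum p ds) (unit_list ds)"
  by (auto simp: is_alg_unit_def unit_list_def intro!: nth_equalityI)

lemma alg_unit_eq: "alg_unit (lp_matrix_sum p ds) = unit_list ds"
  unfolding alg_unit_def
proof (rule the_equality[of "is_alg_unit (lp_matrix_sum p ds)", OF unit_list_unit])
  fix u assume u: "is_alg_unit (lp_matrix_sum p ds) u"
  show "u = unit_list ds"
    using u unit_list_unit[of p ds] unfolding is_alg_unit_def by metis
qed

text \<open>Lists of diagonal matrices. All the idempotents and exponentials that occur in hermiticity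
  are of this form.\<close>
definition diag_list :: "nat list \<Rightarrow> (nat \<Rightarrow> nat \<Rightarrow> complex) \<Rightarrow> complex mat list" where
  "diag_list ds h = map (\<lambda>k. mat (ds ! k) (ds ! k) (\<lambda>(r, c). if r = c then h k r else 0)) [0..<length ds]"

lemma diag_list_nth: "k < length ds \<Longrightarrow> diag_list ds h ! k = mat (ds ! k) (ds ! k) (\<lambda>(r, c). if r = c then h k r else 0)"
  by (simp add: diag_list_def cong: if_cong)

lemma mat_mult_entry:
  "\<lbrakk>A \<in> carrier_mat d d; B \<in> carrier_mat d d; i < d; j < d\<rbrakk> \<Longrightarrow>
    (A * B) $$ (i, j) = (\<Sum>s<d. A $$ (i, s) * (B $$ (s, j) :: complex))"
  by (auto simp: scalar_prod_def lessThan_atLeast0)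

lemma mat_vec_entry:
  "\<lbrakk>A \<in> carrier_mat d d; v \<in> carrier_vec d; i < d\<rbrakk> \<Longrightarrow>
    (A *\<^sub>v v) $ i = (\<Sum>s<d. A $$ (i, s) * (v $ s :: complex))"
  by (auto simp: scalar_prod_def lessThan_atLeast0)

lemma diag_list_carrier: "diag_list ds h \<in> carrier (lp_matrix_sum p ds)"
  by (simp add: diag_list_def)

lemma unit_list_diag: "unit_list ds = diag_list ds (\<lambda>_ _. 1)"
  by (rule nth_equalityI) (auto simp: unit_list_def diag_list_def intro!: eq_matI)

lemma diag_list_mult: "diag_list ds h \<otimes>\<^bsub>lp_matrix_sum p ds\<^esub> diag_list ds h' = diag_list ds (\<lambda>k r. h k r * h' k r)"
proof (rule nth_equalityI)
  fix k assume "k < length (diag_list ds h \<otimes>\<^bsub>lp_matrix_sum p ds\<^esub> diag_list ds h')"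
  then have k: "k < length ds" by (simp add: diag_list_def)
  have "(diag_list ds h ! k * diag_list ds h' ! k) $$ (i, j) = (if i = j then h k i * h' k i else 0)"
    if ij: "i < ds ! k" "j < ds ! k" for i j
  proof -
    have "(diag_list ds h ! k * diag_list ds h' ! k) $$ (i, j) =
        (\<Sum>t\<in>{0..<ds ! k}. (if i = t then h k i else 0) * (if t = j then h' k t else 0))"
      using ij k by (simp add: diag_list_nth scalar_prod_def)
    also have "\<dots> = (\<Sum>t\<in>{0..<ds ! k}. if t = i then (if i = j then h k i * h' k i else 0) else 0)"
      by (intro sum.cong) auto
    finally show ?thesis using ij by simp
  qed
  then have "diag_list ds h ! k * diag_list ds h' ! k = diag_list ds (\<lambda>k r. h k r * h' k r) ! k"
    using k by (intro eq_matI) (auto simp: diag_list_nth)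
  then show "(diag_list ds h \<otimes>\<^bsub>lp_matrix_sum p ds\<^esub> diag_list ds h') ! k = diag_list ds (\<lambda>k r. h k r * h' k r) ! k"
    using k by (simp add: diag_list_def del: nth_map) (simp add: diag_list_def)
qed (simp add: diag_list_def)

lemma diag_list_smult: "c \<odot>\<^bsub>lp_matrix_sum p ds\<^esub> diag_list ds h = diag_list ds (\<lambda>k r. c * h k r)"
  by (rule nth_equalityI) (auto simp: diag_list_def intro!: eq_matI)

lemma diag_list_add: "diag_list ds h \<oplus>\<^bsub>lp_matrix_sum p ds\<^esub> diag_list ds h' = diag_list ds (\<lambda>k r. h k r + h' k r)"
  by (rule nth_equalityI) (auto simp: diag_list_def intro!: eq_matI)

lemma diag_list_zero: "\<zero>\<^bsub>lp_matrix_sum p ds\<^esub> = diag_list ds (\<lambda>_ _. 0)"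
  by (rule nth_equalityI) (auto simp: diag_list_def intro!: eq_matI)

lemma diag_list_pow: "alg_pow (lp_matrix_sum p ds) (diag_list ds h) n = diag_list ds (\<lambda>k r. h k r ^ n)"
  by (induction n) (simp_all add: alg_unit_eq unit_list_diag diag_list_mult mult.commute del: lp_matrix_sum_simps)

lemma diag_list_finsum:
  fixes n :: nat
  shows "finsum (lp_matrix_sum p ds) (\<lambda>j. diag_list ds (h j)) {..<n} = diag_list ds (\<lambda>k r. \<Sum>j<n. h j k r)"
proof -
  interpret complex_algebra "lp_matrix_sum p ds" by (rule lp_matrix_sum_algebra)
  show ?thesis
  proof (induction n)
    case (Suc n)
    have "finsum (lp_matrix_sum p ds) (\<lambda>j. diag_list ds (h j)) (insert n {..<n}) =
        diag_list ds (h n) \<oplus>\<^bsub>lp_matrix_sum p ds\<^esub> finsum (lp_matrix_sum p ds) (\<lambda>j. diag_list ds (h j)) {..<n}"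
      by (rule finsum_insert) (auto simp: diag_list_carrier simp del: lp_matrix_sum_simps)
    then show ?case by (simp add: Suc lessThan_Suc diag_list_add add.commute del: lp_matrix_sum_simps)
  qed (simp add: diag_list_zero[of p] del: lp_matrix_sum_simps)
qed

context lp_exponent begin

abbreviation (input) "LP \<equiv> lp_matrix_sum p"

lemma LP_nth: "\<lbrakk>as \<in> carrier (LP ds); k < length ds\<rbrakk> \<Longrightarrow> as ! k \<in> carrier_mat (ds ! k) (ds ! k)"
  by simp

lemma le_LP_nrm: "\<lbrakk>as \<in> carrier (LP ds); k < length ds\<rbrakk> \<Longrightarrow> lp_op_norm p (as ! k) \<le> nrm (LP ds) as"
  by (auto intro!: Max_ge)

lemma LP_nrm_le:
  "\<lbrakk>valid_dims ds; as \<in> carrier (LP ds); \<And>k. k < length ds \<Longrightarrow> lp_op_norm p (as ! k) \<le> c\<rbrakk> \<Longrightarrow> nrm (LP ds) as \<le> c"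
  by (auto simp: valid_dims_def in_set_conv_nth intro!: Max.boundedI)

lemma LP_nrm_nonneg:
  assumes "valid_dims ds" "as \<in> carrier (LP ds)"
  shows "0 \<le> nrm (LP ds) as"
proof -
  have 0: "0 < length ds" using assms(1) by (simp add: valid_dims_def)
  show ?thesis by (rule order_trans[OF op_norm_nonneg[OF LP_nth[OF assms(2) 0]] le_LP_nrm[OF assms(2) 0]])
qed

lemma LP_diff_nth:
  assumes "as \<in> carrier (LP ds)" "bs \<in> carrier (LP ds)" "k < length ds" "i < ds ! k" "j < ds ! k"
  shows "((as \<ominus>\<^bsub>LP ds\<^esub> bs) ! k) $$ (i, j) = (as ! k) $$ (i, j) - (bs ! k) $$ (i, j)"
proof -
  interpret complex_algebra "LP ds" by (rule lp_matrix_sum_algebra)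
  note c = carrier_matD[OF LP_nth[OF assms(1,3)]] carrier_matD[OF LP_nth[OF assms(2,3)]]
  show ?thesis unfolding diff_eq_smult[OF assms(1,2)] using c assms by simp
qed

lemma LP_tendsto_entries:
  assumes ds: "valid_dims ds" and X: "\<And>n. X n \<in> carrier (LP ds)" and y: "y \<in> carrier (LP ds)"
    and lim: "\<And>k i j. \<lbrakk>k < length ds; i < ds ! k; j < ds ! k\<rbrakk> \<Longrightarrow> (\<lambda>n. (X n ! k) $$ (i, j)) \<longlonglongrightarrow> (y ! k) $$ (i, j)"
  shows "alg_tendsto (LP ds) X y"
proof -
  interpret complex_algebra "LP ds" by (rule lp_matrix_sum_algebra)
  define b where "b = (\<lambda>n. \<Sum>k<length ds. \<Sum>i<ds ! k. \<Sum>j<ds ! k. cmod ((X n ! k) $$ (i, j) - (y ! k) $$ (i, j)))"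
  have b: "b \<longlonglongrightarrow> (\<Sum>k<length ds. \<Sum>i<ds ! k. \<Sum>j<ds ! k. 0)"
    unfolding b_def by (intro tendsto_sum tendsto_norm_zero LIM_zero lim) auto
  have d: "X n \<ominus>\<^bsub>LP ds\<^esub> y \<in> carrier (LP ds)" for n by (rule minus_closed[OF X y])
  have le: "nrm (LP ds) (X n \<ominus>\<^bsub>LP ds\<^esub> y) \<le> b n" for n
  proof (rule LP_nrm_le[OF ds d])
    fix k assume k: "k < length ds"
    note c = LP_nth[OF d[of n] k]
    have "lp_op_norm p ((X n \<ominus>\<^bsub>LP ds\<^esub> y) ! k) \<le> entry_sum ((X n \<ominus>\<^bsub>LP ds\<^esub> y) ! k)" by (rule op_norm_le_entry_sum[OF c])
    also have "\<dots> = (\<Sum>i<ds ! k. \<Sum>j<ds ! k. cmod ((X n ! k) $$ (i, j) - (y ! k) $$ (i, j)))"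
      unfolding entry_sum_def carrier_matD[OF c] using LP_diff_nth[OF X y k] by simp
    also have "\<dots> \<le> b n" unfolding b_def
      using k by (intro member_le_sum[of k _ "\<lambda>k. \<Sum>i<ds ! k. \<Sum>j<ds ! k. cmod ((X n ! k) $$ (i, j) - (y ! k) $$ (i, j))"])
        (auto intro!: sum_nonneg)
    finally show "lp_op_norm p ((X n \<ominus>\<^bsub>LP ds\<^esub> y) ! k) \<le> b n" .
  qed
  have "(\<lambda>n. nrm (LP ds) (X n \<ominus>\<^bsub>LP ds\<^esub> y)) \<longlonglongrightarrow> 0"
    by (rule tendsto_sandwich[OF always_eventually always_eventually tendsto_const b[simplified]])
       (auto simp del: lp_matrix_sum_simps intro!: LP_nrm_nonneg[OF ds d] le)
  then show ?thesis using y unfolding alg_tendsto_def by blast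
qed

text \<open>Completeness is that of the complex numbers in each of the finitely many entries.\<close>
lemma LP_Banach:
  assumes ds: "valid_dims ds"
  shows "Banach_algebra (LP ds)"
proof -
  interpret complex_algebra "LP ds" by (rule lp_matrix_sum_algebra)
  show ?thesis
  proof (intro Banach_algebra.intro lp_matrix_sum_algebra Banach_algebra_axioms.intro)
    fix x assume x: "x \<in> carrier (LP ds)"
    have "x = \<zero>\<^bsub>LP ds\<^esub>" if "nrm (LP ds) x = 0"
    proof (rule nth_equalityI)
      fix k assume "k < length x"
      then have k: "k < length ds" using x by simp
      note c = LP_nth[OF x k]
      have "(x ! k) $$ (i, j) = 0" if ij: "i < ds ! k" "j < ds ! k" for i j
      proof -
        have "cmod ((x ! k) $$ (i, j)) \<le> 0"
          using entry_le_op_norm[OF c ij] le_LP_nrm[OF x k] \<open>nrm (LP ds) x = 0\<close> by linarith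
        then show ?thesis by simp
      qed
      then show "x ! k = \<zero>\<^bsub>LP ds\<^esub> ! k" using c k by (intro eq_matI) auto
    qed (use x in simp)
    moreover have "nrm (LP ds) \<zero>\<^bsub>LP ds\<^esub> = 0"
    proof (rule antisym[OF LP_nrm_le[OF ds zero_closed] LP_nrm_nonneg[OF ds zero_closed]])
      fix k assume k: "k < length ds"
      show "lp_op_norm p (\<zero>\<^bsub>LP ds\<^esub> ! k) \<le> 0"
        using op_norm_le_entry_sum[OF LP_nth[OF zero_closed k]] k by (simp add: entry_sum_def)
    qed
    ultimately show "nrm (LP ds) x = 0 \<longleftrightarrow> x = \<zero>\<^bsub>LP ds\<^esub>" by blast
  next
    fix x y assume x: "x \<in> carrier (LP ds)" and y: "y \<in> carrier (LP ds)"
    show "nrm (LP ds) (x \<oplus>\<^bsub>LP ds\<^esub> y) \<le> nrm (LP ds) x + nrm (LP ds) y"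
    proof (rule LP_nrm_le[OF ds])
      fix k assume k: "k < length ds"
      have "lp_op_norm p ((x \<oplus>\<^bsub>LP ds\<^esub> y) ! k) = lp_op_norm p (x ! k + y ! k)" using k x y by simp
      also have "\<dots> \<le> nrm (LP ds) x + nrm (LP ds) y"
        using op_norm_add[OF LP_nth[OF x k] LP_nth[OF y k]] le_LP_nrm[OF x k] le_LP_nrm[OF y k] by linarith
      finally show "lp_op_norm p ((x \<oplus>\<^bsub>LP ds\<^esub> y) ! k) \<le> nrm (LP ds) x + nrm (LP ds) y" .
    qed (rule a_closed[OF x y])
    show "nrm (LP ds) (x \<otimes>\<^bsub>LP ds\<^esub> y) \<le> nrm (LP ds) x * nrm (LP ds) y"
    proof (rule LP_nrm_le[OF ds])
      fix k assume k: "k < length ds"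
      have "lp_op_norm p ((x \<otimes>\<^bsub>LP ds\<^esub> y) ! k) = lp_op_norm p (x ! k * y ! k)" using k x y by simp
      also have "\<dots> \<le> lp_op_norm p (x ! k) * lp_op_norm p (y ! k)" by (rule op_norm_mult[OF LP_nth[OF x k] LP_nth[OF y k]])
      also have "\<dots> \<le> nrm (LP ds) x * nrm (LP ds) y"
        by (intro mult_mono le_LP_nrm x y k LP_nrm_nonneg ds op_norm_nonneg[OF LP_nth[OF y k]])
      finally show "lp_op_norm p ((x \<otimes>\<^bsub>LP ds\<^esub> y) ! k) \<le> nrm (LP ds) x * nrm (LP ds) y" .
    qed (rule mult_closed[OF x y])
  next
    fix x c assume x: "x \<in> carrier (LP ds)"
    have s: "lp_op_norm p ((c \<odot>\<^bsub>LP ds\<^esub> x) ! k) = cmod c * lp_op_norm p (x ! k)" if k: "k < length ds" for k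
      using op_norm_smult[OF LP_nth[OF x k], of c] k x by simp
    show "nrm (LP ds) (c \<odot>\<^bsub>LP ds\<^esub> x) = cmod c * nrm (LP ds) x"
    proof (rule antisym)
      show "nrm (LP ds) (c \<odot>\<^bsub>LP ds\<^esub> x) \<le> cmod c * nrm (LP ds) x"
        by (rule LP_nrm_le[OF ds smult_closed[OF x]], subst s) (auto intro!: mult_left_mono le_LP_nrm[OF x] simp del: lp_matrix_sum_simps)
      show "cmod c * nrm (LP ds) x \<le> nrm (LP ds) (c \<odot>\<^bsub>LP ds\<^esub> x)"
      proof (cases "c = 0")
        case True
        then show ?thesis using LP_nrm_nonneg[OF ds smult_closed[OF x], of c] by (simp del: lp_matrix_sum_simps)
      next
        case False
        have "nrm (LP ds) x \<le> nrm (LP ds) (c \<odot>\<^bsub>LP ds\<^esub> x) / cmod c"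
        proof (rule LP_nrm_le[OF ds x])
          fix k assume k: "k < length ds"
          show "lp_op_norm p (x ! k) \<le> nrm (LP ds) (c \<odot>\<^bsub>LP ds\<^esub> x) / cmod c"
            using le_LP_nrm[OF smult_closed[OF x] k, of c] False unfolding s[OF k]
            by (simp add: le_divide_eq mult.commute del: lp_matrix_sum_simps)
        qed
        then show ?thesis using False by (simp add: le_divide_eq mult.commute del: lp_matrix_sum_simps)
      qed
    qed
  next
    fix X assume "alg_cauchy (LP ds) X"
    then have X: "X n \<in> carrier (LP ds)"
      and C: "0 < e \<Longrightarrow> \<exists>N. \<forall>m\<ge>N. \<forall>n\<ge>N. nrm (LP ds) (X m \<ominus>\<^bsub>LP ds\<^esub> X n) < e" for n e
      unfolding alg_cauchy_def by blast+
    have "convergent (\<lambda>n. (X n ! k) $$ (i, j))" if ij: "k < length ds" "i < ds ! k" "j < ds ! k" for k i j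
      unfolding Cauchy_convergent_iff[symmetric]
    proof (rule metric_CauchyI)
      fix e :: real assume "0 < e"
      then obtain N where N: "\<forall>m\<ge>N. \<forall>n\<ge>N. nrm (LP ds) (X m \<ominus>\<^bsub>LP ds\<^esub> X n) < e" using C by blast
      have "dist ((X m ! k) $$ (i, j)) ((X n ! k) $$ (i, j)) < e" if "m \<ge> N" "n \<ge> N" for m n
      proof -
        have d: "X m \<ominus>\<^bsub>LP ds\<^esub> X n \<in> carrier (LP ds)" by (rule minus_closed[OF X X])
        have "dist ((X m ! k) $$ (i, j)) ((X n ! k) $$ (i, j)) \<le> nrm (LP ds) (X m \<ominus>\<^bsub>LP ds\<^esub> X n)"
          using entry_le_op_norm[OF LP_nth[OF d ij(1)] ij(2,3)] le_LP_nrm[OF d ij(1)]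
          unfolding LP_diff_nth[OF X X ij] dist_norm by linarith
        also have "\<dots> < e" using N that by blast
        finally show ?thesis .
      qed
      then show "\<exists>N. \<forall>m\<ge>N. \<forall>n\<ge>N. dist ((X m ! k) $$ (i, j)) ((X n ! k) $$ (i, j)) < e" by blast
    qed
    then obtain x where x: "(\<lambda>n. (X n ! k) $$ (i, j)) \<longlonglongrightarrow> x k i j" if "k < length ds" "i < ds ! k" "j < ds ! k" for k i j
      unfolding convergent_def by metis
    define y where "y = map (\<lambda>k. mat (ds ! k) (ds ! k) (\<lambda>(i, j). x k i j)) [0..<length ds]"
    have "alg_tendsto (LP ds) X y"
      by (rule LP_tendsto_entries[OF ds X]) (use x in \<open>auto simp: y_def\<close>)
    then show "\<exists>x. alg_tendsto (LP ds) X x" ..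
  qed
qed

lemma diag_list_nrm:
  assumes ds: "valid_dims ds" and h: "\<And>k r. cmod (h k r) = 1"
  shows "nrm (LP ds) (diag_list ds h) = 1"
proof -
  have 1: "lp_op_norm p (diag_list ds h ! k) = 1" if k: "k < length ds" for k
    using k ds h by (intro op_norm_unimodular_diag[of _ "ds ! k"]) (auto simp: diag_list_nth valid_dims_def)
  have 0: "0 < length ds" using ds by (simp add: valid_dims_def)
  show ?thesis
  proof (rule antisym)
    show "nrm (LP ds) (diag_list ds h) \<le> 1" by (rule LP_nrm_le[OF ds diag_list_carrier]) (simp add: 1)
    show "1 \<le> nrm (LP ds) (diag_list ds h)" using le_LP_nrm[OF diag_list_carrier 0, of h] 1[OF 0] by simp
  qed
qed

lemma diag_list_exp:
  assumes ds: "valid_dims ds"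
  shows "alg_exp (LP ds) (diag_list ds h) = diag_list ds (\<lambda>k r. exp (h k r))"
proof -
  interpret Banach_algebra "LP ds" by (rule LP_Banach[OF ds])
  let ?S = "\<lambda>n. finsum (LP ds) (\<lambda>k. (1 / fact k) \<odot>\<^bsub>LP ds\<^esub> alg_pow (LP ds) (diag_list ds h) k) {..<n}"
  have S: "?S n = diag_list ds (\<lambda>k r. \<Sum>j<n. 1 / fact j * h k r ^ j)" for n
    by (simp only: diag_list_pow diag_list_smult diag_list_finsum)
  have "(\<lambda>n. \<Sum>j<n. 1 / fact j * z ^ j) \<longlonglongrightarrow> exp z" for z :: complex
    using exp_converges[of z] by (simp add: sums_def scaleR_conv_of_real inverse_eq_divide)
  then have lim: "alg_tendsto (LP ds) ?S (diag_list ds (\<lambda>k r. exp (h k r)))"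
    unfolding S by (intro LP_tendsto_entries[OF ds diag_list_carrier diag_list_carrier]) (auto simp: diag_list_nth)
  have Sc: "?S n \<in> carrier (LP ds)" for n unfolding S by (rule diag_list_carrier)
  show ?thesis
    unfolding alg_exp_def using lim alg_tendsto_unique[OF Sc _ lim] by (intro the_equality)
qed

text \<open>The exponentials are diagonal matrices with entries of absolute value one.\<close>
lemma diag_list_hermitian:
  assumes ds: "valid_dims ds" and h: "\<And>k r. h k r = 0 \<or> h k r = 1"
  shows "hermitian_idempotent (LP ds) (diag_list ds h)"
proof -
  have "(\<lambda>k r. h k r * h k r) = h" using h by (intro ext) (metis mult_zero_left mult_1)
  moreover have "nrm (LP ds) (alg_exp (LP ds) ((\<i> * complex_of_real t) \<odot>\<^bsub>LP ds\<^esub> diag_list ds h)) = 1" for t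
  proof -
    have "cmod (exp (\<i> * complex_of_real t * h k r)) = 1" for k r
      using h[of k r] by (auto simp flip: cis_conv_exp)
    then show ?thesis unfolding diag_list_smult diag_list_exp[OF ds] by (intro diag_list_nrm[OF ds])
  qed
  moreover have "nrm (LP ds) (alg_unit (LP ds)) = 1"
    unfolding alg_unit_eq unit_list_diag by (intro diag_list_nrm[OF ds]) simp
  ultimately show ?thesis
    unfolding hermitian_idempotent_def using unit_list_unit diag_list_carrier[of ds h p] diag_list_mult[of p ds h h]
    by (auto simp del: lp_matrix_sum_simps)
qed

end

section \<open>Block diagonal embeddings\<close>

text \<open>The homomorphism that takes the list of the matrices \<open>a\<^sub>j\<close> to the list whose entry \<open>i\<close> is
  the block diagonal matrix with \<open>M i j\<close> blocks \<open>a\<^sub>j\<close>. The diagonal positions that are left over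
  are filled with zeros, so that the homomorphism need not be unital.\<close>
locale block_embedding =
  fixes ds ds' :: "nat list" and M :: "nat \<Rightarrow> nat \<Rightarrow> nat"
  assumes dims: "i < length ds' \<Longrightarrow> (\<Sum>j<length ds. M i j * ds ! j) \<le> ds' ! i"
begin

text \<open>The pair \<open>(j, q)\<close> is the \<open>q\<close>-th copy of the summand \<open>j\<close> in the summand \<open>i\<close>, and
  \<open>((j, q), s)\<close> the basis vector \<open>s\<close> of that copy.\<close>
definition copies :: "nat \<Rightarrow> (nat \<times> nat) set" where
  "copies i = (SIGMA j:{..<length ds}. {..<M i j})"

definition slots :: "nat \<Rightarrow> ((nat \<times> nat) \<times> nat) set" where
  "slots i = (SIGMA jq:copies i. {..<ds ! fst jq})"

lemma finite_copies_slots [simp]: "finite (copies i)" "finite (slots i)"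
  by (auto simp: copies_def slots_def)

lemma sum_copies: "(\<Sum>jq\<in>copies i. f (fst jq)) = (\<Sum>j<length ds. of_nat (M i j) * (f j :: 'a :: comm_semiring_1))"
  unfolding copies_def using sum.Sigma[of "{..<length ds}" "\<lambda>j. {..<M i j}" "\<lambda>j q. f j"] by (simp add: split_def)

lemma sum_slots: "(\<Sum>x\<in>slots i. f x) = (\<Sum>jq\<in>copies i. \<Sum>s<ds ! fst jq. f (jq, s))"
  unfolding slots_def using sum.Sigma[of "copies i" "\<lambda>jq. {..<ds ! fst jq}" "\<lambda>jq s. f (jq, s)"] by (simp add: split_def)

lemma card_slots: "card (slots i) = (\<Sum>j<length ds. M i j * ds ! j)"
  using sum_slots[of "\<lambda>_. 1 :: nat" i] sum_copies[of "\<lambda>j. ds ! j" i] by simp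

text \<open>The order in which the copies are placed along the diagonal does not matter, and so an
  arbitrary injection into the coordinates is chosen. This avoids arithmetic with offsets.\<close>
definition place :: "nat \<Rightarrow> (nat \<times> nat) \<times> nat \<Rightarrow> nat" where
  "place i = (SOME f. inj_on f (slots i) \<and> f ` slots i \<subseteq> {..<ds' ! i})"

lemma place:
  assumes "i < length ds'"
  shows "inj_on (place i) (slots i)" "place i ` slots i \<subseteq> {..<ds' ! i}"
proof -
  have "card (slots i) \<le> card {..<ds' ! i}" using dims[OF assms] by (simp add: card_slots)
  then have "\<exists>f. inj_on f (slots i) \<and> f ` slots i \<subseteq> {..<ds' ! i}"
    using card_le_inj[of "slots i" "{..<ds' ! i}"] by auto
  from someI_ex[OF this] show "inj_on (place i) (slots i)" "place i ` slots i \<subseteq> {..<ds' ! i}" by (auto simp: place_def)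
qed

definition entry :: "complex mat list \<Rightarrow> nat \<Rightarrow> nat \<Rightarrow> nat \<Rightarrow> complex" where
  "entry as i r c = (if r \<in> place i ` slots i \<and> c \<in> place i ` slots i then
     (let x = the_inv_into (slots i) (place i) r; y = the_inv_into (slots i) (place i) c in
      if fst x = fst y then (as ! fst (fst x)) $$ (snd x, snd y) else 0) else 0)"

lemma entry_place:
  "\<lbrakk>i < length ds'; x \<in> slots i; y \<in> slots i\<rbrakk> \<Longrightarrow>
    entry as i (place i x) (place i y) = (if fst x = fst y then (as ! fst (fst x)) $$ (snd x, snd y) else 0)"
  using place(1)[of i] by (simp add: entry_def the_inv_into_f_f)

lemma entry_0: "r \<notin> place i ` slots i \<or> c \<notin> place i ` slots i \<Longrightarrow> entry as i r c = 0"
  by (auto simp: entry_def)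

lemma sum_place:
  assumes "i < length ds'" "\<And>r. r \<notin> place i ` slots i \<Longrightarrow> f r = 0"
  shows "(\<Sum>r<ds' ! i. f r) = (\<Sum>x\<in>slots i. f (place i x))"
proof -
  have "(\<Sum>r<ds' ! i. f r) = (\<Sum>r\<in>place i ` slots i. f r)"
    using place(2)[OF assms(1)] assms(2) by (intro sum.mono_neutral_right) auto
  also have "\<dots> = (\<Sum>x\<in>slots i. f (place i x))" using sum.reindex[OF place(1)[OF assms(1)], of f] by (simp add: o_def)
  finally show ?thesis .
qed

definition block :: "complex mat list \<Rightarrow> complex mat list" where
  "block as = map (\<lambda>i. mat (ds' ! i) (ds' ! i) (\<lambda>(r, c). entry as i r c)) [0..<length ds']"

lemma block_nth: "i < length ds' \<Longrightarrow> block as ! i = mat (ds' ! i) (ds' ! i) (\<lambda>(r, c). entry as i r c)"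
  by (simp add: block_def)

lemma block_length [simp]: "length (block as) = length ds'"
  by (simp add: block_def)

lemma slots_D: "x \<in> slots i \<Longrightarrow> fst (fst x) < length ds \<and> snd x < ds ! fst (fst x)"
  by (auto simp: slots_def copies_def)

lemma entry_cases:
  assumes "i < length ds'"
    and "\<And>x y. \<lbrakk>x \<in> slots i; y \<in> slots i; r = place i x; c = place i y\<rbrakk> \<Longrightarrow> thesis"
    and "r \<notin> place i ` slots i \<or> c \<notin> place i ` slots i \<Longrightarrow> thesis"
  shows thesis
  using assms by blast

lemma entry_mult:
  assumes i: "i < length ds'" and as: "as \<in> carrier (lp_matrix_sum p ds)" and bs: "bs \<in> carrier (lp_matrix_sum p ds)"
  shows "entry (map2 (*) as bs) i r c = (\<Sum>k<ds' ! i. entry as i r k * entry bs i k c)"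
proof (rule entry_cases[OF i, of r c])
  fix x y assume xy: "x \<in> slots i" "y \<in> slots i" "r = place i x" "c = place i y"
  let ?j = "fst (fst x)"
  have j: "?j < length ds" "snd x < ds ! ?j" using slots_D[OF xy(1)] by auto
  have copies: "fst x \<in> copies i" using xy(1) by (auto simp: slots_def)
  have "(\<Sum>k<ds' ! i. entry as i r k * entry bs i k c) = (\<Sum>z\<in>slots i. entry as i r (place i z) * entry bs i (place i z) c)"
    by (rule sum_place[OF i]) (simp add: entry_0)
  also have "\<dots> = (\<Sum>z\<in>slots i. if fst z = fst x then
      (if fst x = fst y then (as ! ?j) $$ (snd x, snd z) * (bs ! ?j) $$ (snd z, snd y) else 0) else 0)"
    by (intro sum.cong refl) (auto simp: xy entry_place[OF i])
  also have "\<dots> = (\<Sum>jq\<in>copies i. if jq = fst x then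
      (\<Sum>s<ds ! ?j. if fst x = fst y then (as ! ?j) $$ (snd x, s) * (bs ! ?j) $$ (s, snd y) else 0) else 0)"
    unfolding sum_slots
  proof (rule sum.cong[OF refl])
    fix jq assume "jq \<in> copies i"
    show "(\<Sum>s<ds ! fst jq. if fst (jq, s) = fst x then
        (if fst x = fst y then (as ! ?j) $$ (snd x, snd (jq, s)) * (bs ! ?j) $$ (snd (jq, s), snd y) else 0) else 0) =
      (if jq = fst x then
        (\<Sum>s<ds ! ?j. if fst x = fst y then (as ! ?j) $$ (snd x, s) * (bs ! ?j) $$ (s, snd y) else 0) else 0)"
      by (cases "jq = fst x") (simp_all cong: if_cong)
  qed
  also have "\<dots> = (\<Sum>s<ds ! ?j. if fst x = fst y then (as ! ?j) $$ (snd x, s) * (bs ! ?j) $$ (s, snd y) else 0)"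
    using copies by simp
  also have "\<dots> = (if fst x = fst y then (as ! ?j * bs ! ?j) $$ (snd x, snd y) else 0)"
  proof (cases "fst x = fst y")
    case True
    then have "snd y < ds ! ?j" using slots_D[OF xy(2)] by simp
    moreover have "as ! ?j \<in> carrier_mat (ds ! ?j) (ds ! ?j)" "bs ! ?j \<in> carrier_mat (ds ! ?j) (ds ! ?j)"
      using as bs j by auto
    ultimately show ?thesis using True j(2) by (simp only: if_True mat_mult_entry simp_thms)
  qed simp
  also have "\<dots> = entry (map2 (*) as bs) i r c"
    using as bs j(1) by (cases "fst x = fst y") (simp_all add: xy entry_place[OF i])
  finally show ?thesis ..
qed (auto simp: entry_0)

lemma block_hom: "block \<in> alg_hom (lp_matrix_sum p ds) (lp_matrix_sum p ds')"
  unfolding alg_hom_def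
proof (intro CollectI conjI ballI allI)
  show "block \<in> carrier (lp_matrix_sum p ds) \<rightarrow> carrier (lp_matrix_sum p ds')"
    by (auto simp: block_nth)
next
  fix as bs assume as: "as \<in> carrier (lp_matrix_sum p ds)" and bs: "bs \<in> carrier (lp_matrix_sum p ds)"
  have "entry (map2 (+) as bs) i r c = entry as i r c + entry bs i r c" if i: "i < length ds'" for i r c
  proof (rule entry_cases[OF i, of r c])
    fix x y assume xy: "x \<in> slots i" "y \<in> slots i" "r = place i x" "c = place i y"
    then show ?thesis using as bs slots_D[OF xy(1)] slots_D[OF xy(2)] by (auto simp: entry_place[OF i])
  qed (auto simp: entry_0)
  then show "block (as \<oplus>\<^bsub>lp_matrix_sum p ds\<^esub> bs) = block as \<oplus>\<^bsub>lp_matrix_sum p ds'\<^esub> block bs"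
    by (auto intro!: nth_equalityI eq_matI simp: block_nth)
  show "block (as \<otimes>\<^bsub>lp_matrix_sum p ds\<^esub> bs) = block as \<otimes>\<^bsub>lp_matrix_sum p ds'\<^esub> block bs"
    using entry_mult[OF _ as bs]
    by (auto intro!: nth_equalityI eq_matI simp: block_nth scalar_prod_def lessThan_atLeast0)
next
  fix z as assume as: "as \<in> carrier (lp_matrix_sum p ds)"
  have "entry (map (\<lambda>a. z \<cdot>\<^sub>m a) as) i r c = z * entry as i r c" if i: "i < length ds'" for i r c
  proof (rule entry_cases[OF i, of r c])
    fix x y assume xy: "x \<in> slots i" "y \<in> slots i" "r = place i x" "c = place i y"
    then show ?thesis using as slots_D[OF xy(1)] slots_D[OF xy(2)] by (auto simp: entry_place[OF i])
  qed (auto simp: entry_0)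
  then show "block (z \<odot>\<^bsub>lp_matrix_sum p ds\<^esub> as) = z \<odot>\<^bsub>lp_matrix_sum p ds'\<^esub> block as"
    by (auto intro!: nth_equalityI eq_matI simp: block_nth)
qed

lemma block_trace:
  assumes i: "i < length ds'"
  shows "(\<Sum>r<ds' ! i. (block as ! i) $$ (r, r)) = (\<Sum>j<length ds. of_nat (M i j) * (\<Sum>s<ds ! j. (as ! j) $$ (s, s)))"
proof -
  have "(\<Sum>r<ds' ! i. (block as ! i) $$ (r, r)) = (\<Sum>r<ds' ! i. entry as i r r)"
    using i by (intro sum.cong) (auto simp: block_nth)
  also have "\<dots> = (\<Sum>x\<in>slots i. entry as i (place i x) (place i x))" by (rule sum_place[OF i]) (simp add: entry_0)
  also have "\<dots> = (\<Sum>x\<in>slots i. (as ! fst (fst x)) $$ (snd x, snd x))" by (intro sum.cong) (auto simp: entry_place[OF i])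
  finally show ?thesis by (simp add: sum_slots sum_copies[of "\<lambda>j. \<Sum>s<ds ! j. (as ! j) $$ (s, s)"])
qed

text \<open>Diagonal idempotents are preserved, which is what makes the embedding spatial.\<close>
lemma block_diag_list:
  assumes h: "\<And>k r. h k r = 0 \<or> h k r = (1 :: complex)"
  obtains h' where "block (diag_list ds h) = diag_list ds' h'" "\<And>k r. h' k r = 0 \<or> h' k r = 1"
proof
  let ?h = "\<lambda>i r. entry (diag_list ds h) i r r"
  have off: "entry (diag_list ds h) i r c = 0" if i: "i < length ds'" and "r \<noteq> c" for i r c
  proof (rule entry_cases[OF i, of r c])
    fix x y assume xy: "x \<in> slots i" "y \<in> slots i" "r = place i x" "c = place i y"
    then have "x \<noteq> y" using \<open>r \<noteq> c\<close> by auto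
    then show ?thesis
      using slots_D[OF xy(1)] slots_D[OF xy(2)] unfolding xy(3,4)
      by (auto simp: entry_place[OF i] xy(1,2) diag_list_nth prod_eq_iff)
  qed (simp add: entry_0)
  have on: "?h i r = 0 \<or> ?h i r = 1" if i: "i < length ds'" for i r
  proof (cases "r \<in> place i ` slots i")
    case True
    then obtain x where x: "x \<in> slots i" "r = place i x" by blast
    then show ?thesis using h slots_D[OF x(1)] by (simp add: entry_place[OF i x(1) x(1)] diag_list_nth)
  qed (simp add: entry_0)
  let ?h' = "\<lambda>i r. if i < length ds' then ?h i r else 0"
  show "block (diag_list ds h) = diag_list ds' ?h'"
  proof (rule nth_equalityI)
    fix i assume "i < length (block (diag_list ds h))"
    then have i: "i < length ds'" by simp
    show "block (diag_list ds h) ! i = diag_list ds' ?h' ! i"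
      unfolding block_nth[OF i] diag_list_nth[OF i] using i off[OF i] by (intro eq_matI) auto
  qed (simp add: diag_list_def)
  show "?h' k r = 0 \<or> ?h' k r = 1" for k r using on[of k r] by auto
qed

end

locale lp_block_embedding = block_embedding + lp_exponent
begin

text \<open>The coordinates of \<open>v\<close> that belong to different copies are disjoint, and the \<open>p\<close>-th power of
  the norm is additive for disjoint supports. On each copy the norm is multiplied by at most that
  of the corresponding summand.\<close>
lemma block_contractive:
  assumes as: "as \<in> carrier (LP ds)" and ds: "valid_dims ds" "valid_dims ds'"
  shows "nrm (LP ds') (block as) \<le> nrm (LP ds) as"
proof (rule LP_nrm_le[OF ds(2)])
  show "block as \<in> carrier (LP ds')" using block_hom[of p] as by (auto simp: alg_hom_def)
  fix i assume i: "i < length ds'"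
  define C where "C = nrm (LP ds) as"
  have C: "0 \<le> C" unfolding C_def by (rule LP_nrm_nonneg[OF ds(1) as])
  have B: "block as ! i \<in> carrier_mat (ds' ! i) (ds' ! i)" using i by (simp add: block_nth)
  show "lp_op_norm p (block as ! i) \<le> nrm (LP ds) as"
    unfolding C_def[symmetric]
  proof (rule op_norm_le[OF B C])
    fix v :: "complex vec" assume v: "v \<in> carrier_vec (ds' ! i)"
    \<comment> \<open>The restriction of \<open>v\<close> to the coordinates of the copy \<open>jq\<close>.\<close>
    define w where "w = (\<lambda>jq. vec (ds ! fst jq) (\<lambda>s. v $ place i (jq, s)))"
    have Bv: "(block as ! i *\<^sub>v v) $ r = (\<Sum>c<ds' ! i. entry as i r c * v $ c)" if "r < ds' ! i" for r
      using that i v by (simp add: block_nth scalar_prod_def lessThan_atLeast0)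
    have place_less: "place i x < ds' ! i" if "x \<in> slots i" for x using place(2)[OF i] that by auto
    have row: "(block as ! i *\<^sub>v v) $ place i (jq, s) = (as ! fst jq *\<^sub>v w jq) $ s" if jq: "jq \<in> copies i" "s < ds ! fst jq" for jq s
    proof -
      have x: "(jq, s) \<in> slots i" and j: "fst jq < length ds" using jq by (auto simp: slots_def copies_def)
      have "(block as ! i *\<^sub>v v) $ place i (jq, s) = (\<Sum>y\<in>slots i. entry as i (place i (jq, s)) (place i y) * v $ place i y)"
        unfolding Bv[OF place_less[OF x]] by (rule sum_place[OF i]) (simp add: entry_0)
      also have "\<dots> = (\<Sum>y\<in>slots i. if fst y = jq then (as ! fst jq) $$ (s, snd y) * v $ place i (jq, snd y) else 0)"
        by (intro sum.cong refl) (auto simp: entry_place[OF i x])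
      also have "\<dots> = (\<Sum>jq'\<in>copies i. if jq' = jq then (\<Sum>t<ds ! fst jq. (as ! fst jq) $$ (s, t) * v $ place i (jq, t)) else 0)"
        unfolding sum_slots by (intro sum.cong refl) auto
      also have "\<dots> = (\<Sum>t<ds ! fst jq. (as ! fst jq) $$ (s, t) * v $ place i (jq, t))" using jq by simp
      also have "\<dots> = (as ! fst jq *\<^sub>v w jq) $ s"
        by (subst mat_vec_entry[OF LP_nth[OF as j]]) (simp_all add: w_def jq)
      finally show ?thesis .
    qed
    have Bv0: "(block as ! i *\<^sub>v v) $ r = 0" if "r < ds' ! i" "r \<notin> place i ` slots i" for r
      using that by (simp add: Bv entry_0)
    have "lp_sum (block as ! i *\<^sub>v v) = (\<Sum>r<ds' ! i. if r \<in> place i ` slots i then cmod ((block as ! i *\<^sub>v v) $ r) powr p else 0)"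
      unfolding lp_sum_def using B Bv0 by (intro sum.cong) (auto simp: block_nth i)
    also have "\<dots> = (\<Sum>x\<in>slots i. cmod ((block as ! i *\<^sub>v v) $ place i x) powr p)"
      by (subst sum_place[OF i]) auto
    also have "\<dots> = (\<Sum>jq\<in>copies i. \<Sum>s<ds ! fst jq. cmod ((as ! fst jq *\<^sub>v w jq) $ s) powr p)"
      unfolding sum_slots by (intro sum.cong refl) (simp add: row)
    also have "\<dots> = (\<Sum>jq\<in>copies i. lp_sum (as ! fst jq *\<^sub>v w jq))"
      using as by (intro sum.cong refl) (auto simp: lp_sum_def copies_def)
    also have "\<dots> \<le> (\<Sum>jq\<in>copies i. C powr p * lp_sum (w jq))"
    proof (rule sum_mono)
      fix jq assume "jq \<in> copies i"
      then have j: "fst jq < length ds" by (auto simp: copies_def)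
      have "lp_norm p (as ! fst jq *\<^sub>v w jq) \<le> lp_op_norm p (as ! fst jq) * lp_norm p (w jq)"
        by (rule op_norm_mult_vec[OF LP_nth[OF as j]]) (simp add: w_def)
      also have "\<dots> \<le> C * lp_norm p (w jq)"
        unfolding C_def by (intro mult_right_mono le_LP_nrm[OF as j] lp_norm_nonneg)
      finally have "lp_sum (as ! fst jq *\<^sub>v w jq) \<le> (C * lp_norm p (w jq)) powr p"
        using C lp_norm_nonneg by (subst (asm) lp_norm_le_iff) auto
      then show "lp_sum (as ! fst jq *\<^sub>v w jq) \<le> C powr p * lp_sum (w jq)"
        by (simp add: powr_mult lp_norm_powr)
    qed
    also have "\<dots> = C powr p * (\<Sum>x\<in>slots i. cmod (v $ place i x) powr p)"
      by (simp add: sum_slots lp_sum_def w_def sum_distrib_left)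
    also have "(\<Sum>x\<in>slots i. cmod (v $ place i x) powr p) = (\<Sum>r\<in>place i ` slots i. cmod (v $ r) powr p)"
      using sum.reindex[OF place(1)[OF i], of "\<lambda>r. cmod (v $ r) powr p"] by (simp add: o_def)
    also have "\<dots> \<le> lp_sum v" unfolding lp_sum_def using place(2)[OF i] v by (intro sum_mono2) auto
    finally have "lp_sum (block as ! i *\<^sub>v v) \<le> C powr p * lp_sum v" by (simp add: mult_left_mono)
    then show "lp_norm p (block as ! i *\<^sub>v v) \<le> C * lp_norm p v"
      using C lp_norm_nonneg[of v] by (subst lp_norm_le_iff) (auto simp: powr_mult lp_norm_powr)
  qed
qed

end

section \<open>Unitizations\<close>

lemma unitization_simps [simp]:
  "carrier (unitization A) = carrier A \<times> UNIV"
  "\<zero>\<^bsub>unitization A\<^esub> = (\<zero>\<^bsub>A\<^esub>, 0)" "\<one>\<^bsub>unitization A\<^esub> = (\<zero>\<^bsub>A\<^esub>, 1)"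
  "(a, s) \<oplus>\<^bsub>unitization A\<^esub> (b, t) = (a \<oplus>\<^bsub>A\<^esub> b, s + t)"
  "(a, s) \<otimes>\<^bsub>unitization A\<^esub> (b, t) = (a \<otimes>\<^bsub>A\<^esub> b \<oplus>\<^bsub>A\<^esub> s \<odot>\<^bsub>A\<^esub> b \<oplus>\<^bsub>A\<^esub> t \<odot>\<^bsub>A\<^esub> a, s * t)"
  by (simp_all add: unitization_def)

lemma (in complex_algebra) unitization_ring: "ring (unitization A)"
proof (intro ringI abelian_groupI monoidI)
  fix x assume "x \<in> carrier (unitization A)"
  then show "\<exists>y\<in>carrier (unitization A). y \<oplus>\<^bsub>unitization A\<^esub> x = \<zero>\<^bsub>unitization A\<^esub>"
    by (intro bexI[of _ "(\<ominus> fst x, - snd x)"]) (auto simp: l_neg)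
qed (auto simp: a_ac mult_closed smult_closed distrib_left distrib_right smult_add add_smult smult_smult[symmetric]
    smult_mult[symmetric] mult_smult[symmetric] mult_assoc one_smult algebra_simps)

text \<open>Any complete norm on the unitization serves to perturb idempotents; the sum of the norms of
  the two components is the simplest.\<close>
definition unit_norm :: "('a, 'm) normed_alg_scheme \<Rightarrow> 'a \<times> complex \<Rightarrow> real" where
  "unit_norm A x = nrm A (fst x) + cmod (snd x)"

lemma (in complex_algebra) unitization_minus:
  "x \<in> carrier (unitization A) \<Longrightarrow> \<ominus>\<^bsub>unitization A\<^esub> x = (\<ominus> fst x, - snd x)"
proof -
  assume x: "x \<in> carrier (unitization A)"
  interpret U: ring "unitization A" by (rule unitization_ring)
  show ?thesis by (rule U.minus_equality) (use x in \<open>auto simp: l_neg\<close>)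
qed

lemma (in complex_algebra) unitization_diff:
  "\<lbrakk>x \<in> carrier (unitization A); y \<in> carrier (unitization A)\<rbrakk> \<Longrightarrow>
    x \<ominus>\<^bsub>unitization A\<^esub> y = (fst x \<ominus> fst y, snd x - snd y)"
  by (cases x; cases y) (simp add: a_minus_def[of "unitization A"] unitization_minus a_minus_def[of A])

lemma (in Banach_algebra) unitization_Banach_ring: "Banach_ring (unitization A) (unit_norm A)"
proof (intro Banach_ring.intro unitization_ring Banach_ring_axioms.intro)
  fix x assume x: "x \<in> carrier (unitization A)" "unit_norm A x = 0"
  then have "nrm A (fst x) = 0" "snd x = 0"
    using nrm_nonneg[of "fst x"] norm_ge_zero[of "snd x"] by (auto simp: unit_norm_def add_nonneg_eq_0_iff)
  then show "x = \<zero>\<^bsub>unitization A\<^esub>" using x nrm_eq_0_iff[of "fst x"] by (cases x) auto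
next
  fix x y assume x: "x \<in> carrier (unitization A)" and y: "y \<in> carrier (unitization A)"
  obtain a s b t where ab: "x = (a, s)" "y = (b, t)" "a \<in> carrier A" "b \<in> carrier A" using x y by auto
  show "unit_norm A (x \<oplus>\<^bsub>unitization A\<^esub> y) \<le> unit_norm A x + unit_norm A y"
    using ab nrm_add[of a b] norm_triangle_ineq[of s t] by (simp add: unit_norm_def)
  have "nrm A (a \<otimes> b \<oplus> s \<odot> b \<oplus> t \<odot> a) \<le> nrm A (a \<otimes> b) + nrm A (s \<odot> b) + nrm A (t \<odot> a)"
    using ab nrm_add[of "a \<otimes> b \<oplus> s \<odot> b" "t \<odot> a"] nrm_add[of "a \<otimes> b" "s \<odot> b"] by (simp add: mult_closed smult_closed)
  also have "\<dots> \<le> nrm A a * nrm A b + cmod s * nrm A b + cmod t * nrm A a"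
    using ab nrm_mult[of a b] by (simp add: nrm_smult)
  finally show "unit_norm A (x \<otimes>\<^bsub>unitization A\<^esub> y) \<le> unit_norm A x * unit_norm A y"
    using ab by (simp add: unit_norm_def norm_mult algebra_simps)
next
  fix x assume "x \<in> carrier (unitization A)"
  then show "unit_norm A (\<ominus>\<^bsub>unitization A\<^esub> x) = unit_norm A x"
    by (auto simp: unitization_minus unit_norm_def)
next
  fix X :: "nat \<Rightarrow> 'a \<times> complex" assume X: "\<And>n. X n \<in> carrier (unitization A)"
    and C: "\<And>e. 0 < e \<Longrightarrow> \<exists>M. \<forall>m\<ge>M. \<forall>n\<ge>M. unit_norm A (X m \<ominus>\<^bsub>unitization A\<^esub> X n) < e"
  have Xa: "fst (X n) \<in> carrier A" for n using X[of n] by (cases "X n") auto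
  have d: "unit_norm A (X m \<ominus>\<^bsub>unitization A\<^esub> X n) = nrm A (fst (X m) \<ominus> fst (X n)) + cmod (snd (X m) - snd (X n))" for m n
    using X by (simp add: unitization_diff unit_norm_def)
  have "alg_cauchy A (\<lambda>n. fst (X n))"
    unfolding alg_cauchy_def
  proof (intro conjI allI impI Xa)
    fix e :: real assume "0 < e"
    from C[OF this] show "\<exists>N. \<forall>m\<ge>N. \<forall>n\<ge>N. nrm A (fst (X m) \<ominus> fst (X n)) < e"
      unfolding d by (smt (verit) norm_ge_zero)
  qed
  from complete[OF this] obtain a where a: "a \<in> carrier A" "(\<lambda>n. nrm A (fst (X n) \<ominus> a)) \<longlonglongrightarrow> 0"
    by (auto simp: alg_tendsto_def)
  have "Cauchy (\<lambda>n. snd (X n))"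
  proof (rule metric_CauchyI)
    fix e :: real assume "0 < e"
    from C[OF this] show "\<exists>N. \<forall>m\<ge>N. \<forall>n\<ge>N. dist (snd (X m)) (snd (X n)) < e"
      unfolding d dist_norm using nrm_nonneg[OF minus_closed[OF Xa Xa]] by (smt (verit))
  qed
  then obtain s where s: "(\<lambda>n. snd (X n)) \<longlonglongrightarrow> s" by (auto simp: Cauchy_convergent_iff convergent_def)
  have "(\<lambda>n. nrm A (fst (X n) \<ominus> a) + cmod (snd (X n) - s)) \<longlonglongrightarrow> 0 + 0"
    by (intro tendsto_add a tendsto_norm_zero LIM_zero s)
  then have "(\<lambda>n. unit_norm A (X n \<ominus>\<^bsub>unitization A\<^esub> (a, s))) \<longlonglongrightarrow> 0"
    using X a(1) by (simp add: unitization_diff unit_norm_def)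
  then show "\<exists>x\<in>carrier (unitization A). (\<lambda>n. unit_norm A (X n \<ominus>\<^bsub>unitization A\<^esub> x)) \<longlonglongrightarrow> 0"
    using a(1) by (intro bexI[of _ "(a, s)"]) auto
qed (auto simp: unit_norm_def)

section \<open>Ring homomorphisms and matrices\<close>

definition mmap :: "('a \<Rightarrow> 'b) \<Rightarrow> (nat \<Rightarrow> nat \<Rightarrow> 'a) \<Rightarrow> nat \<Rightarrow> nat \<Rightarrow> 'b" where
  "mmap h e = (\<lambda>i j. h (e i j))"

context ring_hom_ring begin

lemma hom_finsum:
  "\<lbrakk>finite A; \<And>i. i \<in> A \<Longrightarrow> f i \<in> carrier R\<rbrakk> \<Longrightarrow> h (finsum R f A) = finsum S (\<lambda>i. h (f i)) A"
proof (induction A rule: finite_induct)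
  case (insert a A)
  have "h (finsum R f (insert a A)) = h (f a \<oplus>\<^bsub>R\<^esub> finsum R f A)"
    using insert by (subst R.finsum_insert) auto
  also have "\<dots> = h (f a) \<oplus>\<^bsub>S\<^esub> finsum S (\<lambda>i. h (f i)) A"
    using insert by (subst hom_add) (auto intro!: R.finsum_closed)
  also have "\<dots> = finsum S (\<lambda>i. h (f i)) (insert a A)"
    using insert by (subst S.finsum_insert) auto
  finally show ?case .
qed simp

lemma mmap_corner: "a \<in> corner R n \<Longrightarrow> mmap h a \<in> corner S n"
  by (auto simp: corner_def mmap_def)

lemma mmap_mult:
  assumes a: "a \<in> corner R n" and b: "b \<in> corner R n"
  shows "mmap h (M_mult R a b) = M_mult S (mmap h a) (mmap h b)"
proof (intro ext)
  fix i j
  note c = cornerD(1)[OF a] cornerD(1)[OF b]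
  have "h (\<Oplus>\<^bsub>R\<^esub>k\<in>{..<n}. a i k \<otimes>\<^bsub>R\<^esub> b k j) = (\<Oplus>\<^bsub>S\<^esub>k\<in>{..<n}. h (a i k) \<otimes>\<^bsub>S\<^esub> h (b k j))"
    using c by (subst hom_finsum) (auto intro!: S.finsum_cong')
  then show "mmap h (M_mult R a b) i j = M_mult S (mmap h a) (mmap h b) i j"
    using c by (simp add: mmap_def R.M_mult_eq[OF a] S.M_mult_eq[OF mmap_corner[OF a], unfolded mmap_def])
qed

lemma mmap_idem: "e \<in> idem_inf R \<Longrightarrow> mmap h e \<in> idem_inf S"
  by (auto simp: idem_inf_def M_inf_def mmap_mult[symmetric] intro: mmap_corner)

lemma mmap_rel: "(e, f) \<in> idem_rel R \<Longrightarrow> (mmap h e, mmap h f) \<in> idem_rel S"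
proof -
  assume ef: "(e, f) \<in> idem_rel R"
  obtain n where n: "e \<in> corner R n" "f \<in> corner R n" using R.idem_inf_common R.idem_relD[OF ef] by metis
  obtain x y where "x \<in> corner R n" "y \<in> corner R n" "M_mult R x y = e" "M_mult R y x = f"
    using R.idem_rel_corner[OF ef n] by blast
  then show ?thesis
    using R.idem_relD[OF ef] mmap_idem
    by (intro S.idem_relI[of "mmap h x" n "mmap h y"]) (auto simp: mmap_mult[symmetric] intro: mmap_corner)
qed

lemma mmap_block_diag: "mmap h (block_diag R n e f) = block_diag S n (mmap h e) (mmap h f)"
  by (auto simp: mmap_def block_diag_def fun_eq_iff)

lemma mmap_diff: "\<lbrakk>x \<in> corner R n; y \<in> corner R n\<rbrakk> \<Longrightarrow>
    mmap h (x \<ominus>\<^bsub>mat_ring R n\<^esub> y) = mmap h x \<ominus>\<^bsub>mat_ring S n\<^esub> mmap h y"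
  by (simp add: R.mat_ring_diff S.mat_ring_diff mmap_corner)
     (auto simp: mmap_def fun_eq_iff cornerD a_minus_def)

end

definition umap :: "('a \<Rightarrow> 'b) \<Rightarrow> 'a \<times> complex \<Rightarrow> 'b \<times> complex" where
  "umap h = (\<lambda>(a, s). (h a, s))"

lemma umap_simp [simp]: "umap h (a, s) = (h a, s)"
  by (simp add: umap_def)

lemma umap_ring_hom:
  assumes "complex_algebra A" "complex_algebra B" and h: "h \<in> alg_hom A B"
  shows "ring_hom_ring (unitization A) (unitization B) (umap h)"
proof -
  interpret A: complex_algebra A by fact
  interpret B: complex_algebra B by fact
  have hom: "h a \<in> carrier B" "h (a \<oplus>\<^bsub>A\<^esub> b) = h a \<oplus>\<^bsub>B\<^esub> h b" "h (a \<otimes>\<^bsub>A\<^esub> b) = h a \<otimes>\<^bsub>B\<^esub> h b"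
    "h (s \<odot>\<^bsub>A\<^esub> a) = s \<odot>\<^bsub>B\<^esub> h a" if "a \<in> carrier A" "b \<in> carrier A" for a b s
    using h that by (auto simp: alg_hom_def)
  have "h \<zero>\<^bsub>A\<^esub> = \<zero>\<^bsub>B\<^esub>" using hom(4)[of "\<zero>\<^bsub>A\<^esub>" "\<zero>\<^bsub>A\<^esub>" 0] hom(1)[of "\<zero>\<^bsub>A\<^esub>" "\<zero>\<^bsub>A\<^esub>"] by simp
  then show ?thesis
    by (intro ring_hom_ringI A.unitization_ring B.unitization_ring)
       (auto simp: hom A.mult_closed A.smult_closed hom(4)[OF _ A.zero_closed])
qed

lemma snd_ring_hom:
  assumes "complex_algebra A"
  shows "ring_hom_ring (unitization A) complex_ring snd"
  by (intro ring_hom_ringI complex_algebra.unitization_ring[OF assms] complex_ring) auto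

section \<open>Idempotents over unitizations of direct sums of matrix algebras\<close>

text \<open>The unitization of \<open>\<Oplus> M\<^sub>d\<^sub>j\<close> is isomorphic to \<open>(\<Oplus> M\<^sub>d\<^sub>j) \<oplus> \<complex>\<close>, where \<open>(a, s)\<close> has the
  components \<open>a\<^sub>j + s 1\<close> and \<open>s\<close>. This is an entry of the component in \<open>M\<^sub>d\<^sub>j\<close>.\<close>
definition component_entry :: "nat \<Rightarrow> complex mat list \<times> complex \<Rightarrow> nat \<Rightarrow> nat \<Rightarrow> complex" where
  "component_entry j x r c = (fst x ! j) $$ (r, c) + (if r = c then snd x else 0)"

text \<open>An \<open>n \<times> n\<close> matrix over the unitization has as its component \<open>j\<close> an \<open>n \<times> n\<close> matrix of
  matrices of size \<open>d = ds ! j\<close>, which is regarded as a complex matrix of size \<open>n d\<close>. An index is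
  the pair of its quotient and its remainder modulo \<open>d\<close>.\<close>
definition component :: "nat list \<Rightarrow> nat \<Rightarrow> (nat \<Rightarrow> nat \<Rightarrow> complex mat list \<times> complex) \<Rightarrow> nat \<Rightarrow> nat \<Rightarrow> complex" where
  "component ds j e \<alpha> \<beta> = component_entry j (e (\<alpha> div ds ! j) (\<beta> div ds ! j)) (\<alpha> mod ds ! j) (\<beta> mod ds ! j)"

text \<open>The trace of the part in the algebra alone, without the scalar part. It differs from the
  trace of the component by \<open>d\<close> times the trace of the scalar part, and may be negative.\<close>
definition summand_trace :: "nat list \<Rightarrow> nat \<Rightarrow> nat \<Rightarrow> (nat \<Rightarrow> nat \<Rightarrow> complex mat list \<times> complex) \<Rightarrow> complex" where
  "summand_trace ds n j e = (\<Sum>i<n. \<Sum>r<ds ! j. (fst (e i i) ! j) $$ (r, r))"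

lemma sum_div_mod:
  fixes f :: "nat \<Rightarrow> 'a :: comm_monoid_add"
  assumes "0 < d"
  shows "(\<Sum>\<gamma><n * d. f \<gamma>) = (\<Sum>k<n. \<Sum>r<d. f (k * d + r))"
proof -
  have "(\<Sum>r<d. f (k * d + r)) = sum f {k * d..<k * d + d}" for k
    by (simp add: lessThan_atLeast0 sum.shift_bounds_nat_ivl[of f 0 "k * d" d, simplified, symmetric] add.commute)
  then show ?thesis by (simp add: sum.nat_group)
qed

locale matrix_sum =
  fixes ds :: "nat list" and p :: real
  assumes valid: "valid_dims ds"
begin

abbreviation "MA \<equiv> lp_matrix_sum p ds"
abbreviation "MU \<equiv> unitization (lp_matrix_sum p ds)"

sublocale MA: complex_algebra MA by (rule lp_matrix_sum_algebra)
sublocale MU: ring MU by (rule MA.unitization_ring)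

lemma d_pos: "j < length ds \<Longrightarrow> 0 < ds ! j"
  using valid by (simp add: valid_dims_def)

lemma component_entry_add:
  "\<lbrakk>x \<in> carrier MU; y \<in> carrier MU; j < length ds; r < ds ! j; c < ds ! j\<rbrakk> \<Longrightarrow>
    component_entry j (x \<oplus>\<^bsub>MU\<^esub> y) r c = component_entry j x r c + component_entry j y r c"
proof -
  assume a: "x \<in> carrier MU" "y \<in> carrier MU" "j < length ds" "r < ds ! j" "c < ds ! j"
  then have "fst y ! j \<in> carrier_mat (ds ! j) (ds ! j)" "length (fst x) = length ds" "length (fst y) = length ds"
    by auto
  then show ?thesis using a(3-5) carrier_matD[of "fst y ! j" "ds ! j" "ds ! j"] by (cases x; cases y) (simp add: component_entry_def)
qed

lemma component_entry_mult:
  "\<lbrakk>x \<in> carrier MU; y \<in> carrier MU; j < length ds; r < ds ! j; c < ds ! j\<rbrakk> \<Longrightarrow>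
    component_entry j (x \<otimes>\<^bsub>MU\<^esub> y) r c = (\<Sum>s<ds ! j. component_entry j x r s * component_entry j y s c)"
proof -
  assume a: "x \<in> carrier MU" "y \<in> carrier MU" "j < length ds" "r < ds ! j" "c < ds ! j"
  obtain A s B t where x: "x = (A, s)" "y = (B, t)" by (cases x; cases y) auto
  have c: "A ! j \<in> carrier_mat (ds ! j) (ds ! j)" "B ! j \<in> carrier_mat (ds ! j) (ds ! j)"
    "length A = length ds" "length B = length ds" using a x by auto
  have "component_entry j (x \<otimes>\<^bsub>MU\<^esub> y) r c = (A ! j * B ! j) $$ (r, c) + s * (B ! j) $$ (r, c) + t * (A ! j) $$ (r, c) + (if r = c then s * t else 0)"
    using c carrier_matD[OF c(1)] carrier_matD[OF c(2)] a(3-5) by (simp add: x component_entry_def del: index_mult_mat(1))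
  also have "(A ! j * B ! j) $$ (r, c) = (\<Sum>k<ds ! j. (A ! j) $$ (r, k) * (B ! j) $$ (k, c))"
    by (rule mat_mult_entry[OF c(1,2) a(4,5)])
  also have "s * (B ! j) $$ (r, c) = (\<Sum>k<ds ! j. (if r = k then s else 0) * (B ! j) $$ (k, c))"
    using a(4) by (simp add: if_distrib[of "\<lambda>z. z * _"] cong: if_cong)
  also have "t * (A ! j) $$ (r, c) = (\<Sum>k<ds ! j. (A ! j) $$ (r, k) * (if k = c then t else 0))"
  proof -
    have "(\<Sum>k<ds ! j. (A ! j) $$ (r, k) * (if k = c then t else 0)) = (\<Sum>k<ds ! j. if k = c then t * (A ! j) $$ (r, c) else 0)"
      by (intro sum.cong) auto
    then show ?thesis using a(5) by simp
  qed
  also have "(if r = c then s * t else 0) = (\<Sum>k<ds ! j. (if r = k then s else 0) * (if k = c then t else 0))"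
    using a(4) by (simp add: if_distrib[of "\<lambda>z. z * _"] cong: if_cong)
  finally have "component_entry j (x \<otimes>\<^bsub>MU\<^esub> y) r c = (\<Sum>k<ds ! j. (A ! j) $$ (r, k) * (B ! j) $$ (k, c) +
      (if r = k then s else 0) * (B ! j) $$ (k, c) + (A ! j) $$ (r, k) * (if k = c then t else 0) +
      (if r = k then s else 0) * (if k = c then t else 0))" by (simp only: sum.distrib)
  also have "\<dots> = (\<Sum>k<ds ! j. component_entry j x r k * component_entry j y k c)"
    by (intro sum.cong refl) (simp add: component_entry_def x distrib_left distrib_right)
  finally show ?thesis .
qed

lemma component_entry_zero: "\<lbrakk>j < length ds; r < ds ! j; c < ds ! j\<rbrakk> \<Longrightarrow> component_entry j \<zero>\<^bsub>MU\<^esub> r c = 0"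
  by (simp add: component_entry_def)

lemma component_entry_finsum:
  "\<lbrakk>finite S; \<And>k. k \<in> S \<Longrightarrow> f k \<in> carrier MU; j < length ds; r < ds ! j; c < ds ! j\<rbrakk> \<Longrightarrow>
    component_entry j (finsum MU f S) r c = (\<Sum>k\<in>S. component_entry j (f k) r c)"
proof (induction S rule: finite_induct)
  case (insert a S)
  have "finsum MU f (insert a S) = f a \<oplus>\<^bsub>MU\<^esub> finsum MU f S"
    using insert by (intro MU.finsum_insert) auto
  moreover have "finsum MU f S \<in> carrier MU" by (rule MU.finsum_closed) (use insert in auto)
  ultimately show ?case using insert component_entry_add[of "f a" "finsum MU f S" j r c] by (simp del: unitization_simps)
qed (simp only: MU.finsum_empty component_entry_zero sum.empty)

lemma component_corner:
  assumes e: "e \<in> corner MU n" and j: "j < length ds"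
  shows "component ds j e \<in> corner complex_ring (n * ds ! j)"
proof (rule cornerI)
  fix \<alpha> \<beta> assume "n * ds ! j \<le> \<alpha> \<or> n * ds ! j \<le> \<beta>"
  then have "n \<le> \<alpha> div ds ! j \<or> n \<le> \<beta> div ds ! j"
    using d_pos[OF j] by (auto simp: less_eq_div_iff_mult_less_eq)
  then have "e (\<alpha> div ds ! j) (\<beta> div ds ! j) = \<zero>\<^bsub>MU\<^esub>" by (rule cornerD(2)[OF e])
  then show "component ds j e \<alpha> \<beta> = \<zero>\<^bsub>complex_ring\<^esub>"
    using d_pos[OF j] component_entry_zero[OF j] by (simp add: component_def del: unitization_simps)
qed simp

lemma component_mult:
  assumes e: "e \<in> corner MU n" and f: "f \<in> corner MU n" and j: "j < length ds"
  shows "component ds j (M_mult MU e f) = M_mult complex_ring (component ds j e) (component ds j f)"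
proof (intro ext)
  fix \<alpha> \<beta>
  let ?d = "ds ! j"
  note d = d_pos[OF j]
  have c: "e i k \<in> carrier MU" "f i k \<in> carrier MU" for i k by (rule cornerD(1)[OF e], rule cornerD(1)[OF f])
  have "component ds j (M_mult MU e f) \<alpha> \<beta> =
      component_entry j (\<Oplus>\<^bsub>MU\<^esub>k\<in>{..<n}. e (\<alpha> div ?d) k \<otimes>\<^bsub>MU\<^esub> f k (\<beta> div ?d)) (\<alpha> mod ?d) (\<beta> mod ?d)"
    unfolding component_def by (subst MU.M_mult_eq[OF e c(2)]) simp
  also have "\<dots> = (\<Sum>k<n. component_entry j (e (\<alpha> div ?d) k \<otimes>\<^bsub>MU\<^esub> f k (\<beta> div ?d)) (\<alpha> mod ?d) (\<beta> mod ?d))"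
    by (rule component_entry_finsum) (use c d j in \<open>auto simp del: unitization_simps\<close>)
  also have "\<dots> = (\<Sum>k<n. \<Sum>s<?d. component_entry j (e (\<alpha> div ?d) k) (\<alpha> mod ?d) s * component_entry j (f k (\<beta> div ?d)) s (\<beta> mod ?d))"
    by (intro sum.cong refl component_entry_mult c j) (use d in auto)
  also have "\<dots> = (\<Sum>k<n. \<Sum>s<?d. component ds j e \<alpha> (k * ?d + s) * component ds j f (k * ?d + s) \<beta>)"
    by (intro sum.cong refl) (simp add: component_def)
  also have "\<dots> = (\<Sum>\<gamma><n * ?d. component ds j e \<alpha> \<gamma> * component ds j f \<gamma> \<beta>)" by (rule sum_div_mod[OF d, symmetric])
  also have "\<dots> = M_mult complex_ring (component ds j e) (component ds j f) \<alpha> \<beta>" by (rule C_mult[OF component_corner[OF e j], symmetric])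
  finally show "component ds j (M_mult MU e f) \<alpha> \<beta> = M_mult complex_ring (component ds j e) (component ds j f) \<alpha> \<beta>" .
qed

sublocale SND: ring_hom_ring MU complex_ring snd by (rule snd_ring_hom[OF MA.complex_algebra_axioms])

text \<open>The isomorphism with the sum of matrix algebras is injective on matrices.\<close>
lemma corner_ext:
  assumes x: "x \<in> corner MU n" and y: "y \<in> corner MU n"
    and b: "\<And>j. j < length ds \<Longrightarrow> component ds j x = component ds j y" and s: "mmap snd x = mmap snd y"
  shows "x = y"
proof (intro ext)
  fix i i'
  have c: "x i i' \<in> carrier MU" "y i i' \<in> carrier MU" by (rule cornerD(1)[OF x], rule cornerD(1)[OF y])
  have snd: "snd (x i i') = snd (y i i')" using s by (simp add: mmap_def fun_eq_iff)
  have "fst (x i i') = fst (y i i')"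
  proof (rule nth_equalityI)
    show "length (fst (x i i')) = length (fst (y i i'))" using c by auto
    fix j assume "j < length (fst (x i i'))"
    then have j: "j < length ds" using c by auto
    have m: "fst (x i i') ! j \<in> carrier_mat (ds ! j) (ds ! j)" "fst (y i i') ! j \<in> carrier_mat (ds ! j) (ds ! j)"
      using c j by auto
    show "fst (x i i') ! j = fst (y i i') ! j"
    proof (rule eq_matI)
      fix r c assume "r < dim_row (fst (y i i') ! j)" "c < dim_col (fst (y i i') ! j)"
      then have rc: "r < ds ! j" "c < ds ! j" using m by auto
      have "component ds j x (i * ds ! j + r) (i' * ds ! j + c) = component ds j y (i * ds ! j + r) (i' * ds ! j + c)"
        using b[OF j] by simp
      then show "(fst (x i i') ! j) $$ (r, c) = (fst (y i i') ! j) $$ (r, c)"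
        using rc snd by (cases "r = c") (simp_all add: component_def component_entry_def)
    qed (use m in auto)
  qed
  with snd show "x i i' = y i i'" by (simp add: prod_eq_iff)
qed

text \<open>The inverse of the isomorphism: from prescribed components \<open>X j\<close> and a scalar part \<open>S\<close>.\<close>
definition assemble :: "(nat \<Rightarrow> nat \<Rightarrow> nat \<Rightarrow> complex) \<Rightarrow> (nat \<Rightarrow> nat \<Rightarrow> complex) \<Rightarrow> nat \<Rightarrow> nat \<Rightarrow> complex mat list \<times> complex" where
  "assemble X S = (\<lambda>i i'. (map (\<lambda>j. mat (ds ! j) (ds ! j)
     (\<lambda>(r, c). X j (i * ds ! j + r) (i' * ds ! j + c) - (if r = c then S i i' else 0))) [0..<length ds], S i i'))"

lemma assemble_snd: "mmap snd (assemble X S) = S"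
  by (simp add: mmap_def assemble_def)

lemma assemble_component: "j < length ds \<Longrightarrow> component ds j (assemble X S) = X j"
  using d_pos[of j] by (intro ext) (simp add: component_def component_entry_def assemble_def div_mult_mod_eq cong: if_cong)

lemma assemble_corner:
  assumes X: "\<And>j. j < length ds \<Longrightarrow> X j \<in> corner complex_ring (n * ds ! j)" and S: "S \<in> corner complex_ring n"
  shows "assemble X S \<in> corner MU n"
proof (rule cornerI)
  show "assemble X S i j \<in> carrier MU" for i j by (simp add: assemble_def)
  fix i i' assume i: "n \<le> i \<or> n \<le> i'"
  then have S0: "S i i' = 0" using cornerD(2)[OF S] by simp
  have "X j (i * ds ! j + r) (i' * ds ! j + c) = 0" if "j < length ds" for j r c
    using i cornerD(2)[OF X[OF that], of "i * ds ! j + r" "i' * ds ! j + c"]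
    by (auto simp: trans_le_add1)
  then show "assemble X S i i' = \<zero>\<^bsub>MU\<^esub>"
    by (auto simp: assemble_def S0 intro!: nth_equalityI eq_matI cong: if_cong)
qed

lemma component_idem:
  assumes "e \<in> corner MU n" "M_mult MU e e = e" "j < length ds"
  shows "component ds j e \<in> idem_inf complex_ring"
  using component_mult[OF assms(1,1,3)] assms(2) by (intro C.idem_infI[OF component_corner[OF assms(1,3)]]) simp

text \<open>Idempotents over a sum of matrix algebras are equivalent if and only if they are so in each
  component, where the trace decides.\<close>
lemma idem_rel_MU_iff:
  assumes e: "e \<in> idem_inf MU" and f: "f \<in> idem_inf MU"
  shows "(e, f) \<in> idem_rel MU \<longleftrightarrow>
    (\<forall>j<length ds. ctrace (component ds j e) = ctrace (component ds j f)) \<and> ctrace (mmap snd e) = ctrace (mmap snd f)"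
proof -
  obtain n where n: "e \<in> corner MU n" "f \<in> corner MU n" using MU.idem_inf_common[OF e f] by blast
  have i: "M_mult MU e e = e" "M_mult MU f f = f" using e f by (auto simp: idem_inf_def)
  show ?thesis
  proof (intro iffI conjI allI impI)
    assume ef: "(e, f) \<in> idem_rel MU"
    show "ctrace (mmap snd e) = ctrace (mmap snd f)" by (rule ctrace_rel[OF SND.mmap_rel[OF ef]])
    fix j assume j: "j < length ds"
    obtain x y where "x \<in> corner MU n" "y \<in> corner MU n" "M_mult MU x y = e" "M_mult MU y x = f"
      using MU.idem_rel_corner[OF ef n] by blast
    then show "ctrace (component ds j e) = ctrace (component ds j f)"
      using component_mult[of x n y j] component_mult[of y n x j] j
        ctrace_commute[OF component_corner[of x n j] component_corner[of y n j]] by simp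
  next
    assume tr: "(\<forall>j<length ds. ctrace (component ds j e) = ctrace (component ds j f)) \<and> ctrace (mmap snd e) = ctrace (mmap snd f)"
    have "\<exists>x y. x \<in> corner complex_ring (n * ds ! j) \<and> y \<in> corner complex_ring (n * ds ! j) \<and>
        M_mult complex_ring x y = component ds j e \<and> M_mult complex_ring y x = component ds j f" if j: "j < length ds" for j
    proof -
      have "(component ds j e, component ds j f) \<in> idem_rel complex_ring"
        using tr j complex_idem_rel_iff[OF component_idem[OF n(1) i(1) j] component_idem[OF n(2) i(2) j]] by blast
      from C.idem_rel_corner[OF this component_corner[OF n(1) j] component_corner[OF n(2) j]] show ?thesis by metis
    qed
    then obtain X Y where XY: "\<And>j. j < length ds \<Longrightarrow> X j \<in> corner complex_ring (n * ds ! j)"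
      "\<And>j. j < length ds \<Longrightarrow> Y j \<in> corner complex_ring (n * ds ! j)"
      "\<And>j. j < length ds \<Longrightarrow> M_mult complex_ring (X j) (Y j) = component ds j e"
      "\<And>j. j < length ds \<Longrightarrow> M_mult complex_ring (Y j) (X j) = component ds j f" by metis
    have "(mmap snd e, mmap snd f) \<in> idem_rel complex_ring"
      using tr complex_idem_rel_iff[OF SND.mmap_idem[OF e] SND.mmap_idem[OF f]] by blast
    from C.idem_rel_corner[OF this SND.mmap_corner[OF n(1)] SND.mmap_corner[OF n(2)]]
    obtain S T where ST: "S \<in> corner complex_ring n" "T \<in> corner complex_ring n"
      "M_mult complex_ring S T = mmap snd e" "M_mult complex_ring T S = mmap snd f" by metis
    let ?x = "assemble X S" and ?y = "assemble Y T"
    have xy: "?x \<in> corner MU n" "?y \<in> corner MU n" using assemble_corner XY ST by auto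
    have "M_mult MU ?x ?y = e"
      by (rule corner_ext[OF MU.M_mult_closed[OF xy] n(1)])
         (simp_all add: component_mult[OF xy] assemble_component XY SND.mmap_mult[OF xy] assemble_snd ST)
    moreover have "M_mult MU ?y ?x = f"
      by (rule corner_ext[OF MU.M_mult_closed[OF xy(2,1)] n(2)])
         (simp_all add: component_mult[OF xy(2,1)] assemble_component XY SND.mmap_mult[OF xy(2,1)] assemble_snd ST)
    ultimately show "(e, f) \<in> idem_rel MU" by (rule MU.idem_relI[OF xy _ _ e f])
  qed
qed

lemma ctrace_component:
  assumes e: "e \<in> corner MU n" and j: "j < length ds"
  shows "ctrace (component ds j e) = summand_trace ds n j e + of_nat (ds ! j) * ctrace (mmap snd e)"
proof -
  have "ctrace (component ds j e) = (\<Sum>\<gamma><n * ds ! j. component ds j e \<gamma> \<gamma>)" by (rule ctrace_eq[OF component_corner[OF e j]])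
  also have "\<dots> = (\<Sum>k<n. \<Sum>r<ds ! j. (fst (e k k) ! j) $$ (r, r) + snd (e k k))"
    unfolding sum_div_mod[OF d_pos[OF j]] by (intro sum.cong refl) (simp add: component_def component_entry_def)
  also have "\<dots> = summand_trace ds n j e + of_nat (ds ! j) * (\<Sum>k<n. snd (e k k))"
    by (simp add: sum.distrib summand_trace_def sum_distrib_left)
  also have "(\<Sum>k<n. snd (e k k)) = ctrace (mmap snd e)"
    by (subst ctrace_eq[OF SND.mmap_corner[OF e]]) (simp add: mmap_def)
  finally show ?thesis .
qed

lemma idem_rel_MU_iff':
  assumes e: "e \<in> corner MU n" "M_mult MU e e = e" and f: "f \<in> corner MU n" "M_mult MU f f = f"
  shows "(e, f) \<in> idem_rel MU \<longleftrightarrow>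
    (\<forall>j<length ds. summand_trace ds n j e = summand_trace ds n j f) \<and> ctrace (mmap snd e) = ctrace (mmap snd f)"
  using idem_rel_MU_iff[OF MU.idem_infI[OF e] MU.idem_infI[OF f]] ctrace_component[OF e(1)] ctrace_component[OF f(1)] by auto

lemma ctrace_component_nat:
  assumes e: "e \<in> corner MU n" "M_mult MU e e = e" and j: "j < length ds"
  shows "\<exists>r\<le>n * ds ! j. ctrace (component ds j e) = of_nat r"
  using idempotent_rel_cdiag[OF component_corner[OF e(1) j]] component_idem[OF e j] by (auto simp: idem_inf_def)

lemma ctrace_snd_nat:
  assumes e: "e \<in> corner MU n" "M_mult MU e e = e"
  shows "\<exists>r\<le>n. ctrace (mmap snd e) = of_nat r"
  using idempotent_rel_cdiag[OF SND.mmap_corner[OF e(1)]] SND.mmap_idem[OF MU.idem_infI[OF e]] by (auto simp: idem_inf_def)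

lemma summand_trace_int:
  assumes e: "e \<in> corner MU n" "M_mult MU e e = e" and j: "j < length ds"
  shows "\<exists>t. summand_trace ds n j e = of_int t"
proof -
  obtain r s where "ctrace (component ds j e) = of_nat r" "ctrace (mmap snd e) = of_nat s"
    using ctrace_component_nat[OF e j] ctrace_snd_nat[OF e] by blast
  then have "summand_trace ds n j e = of_int (int r - int (ds ! j) * int s)"
    using ctrace_component[OF e(1) j] by (simp add: eq_diff_eq)
  then show ?thesis by blast
qed

lemma summand_trace_nat:
  assumes e: "e \<in> corner MU n" "M_mult MU e e = e" and j: "j < length ds" and 0: "ctrace (mmap snd e) = 0"
  shows "\<exists>t\<le>n * ds ! j. summand_trace ds n j e = of_nat t"
  using ctrace_component_nat[OF e j] ctrace_component[OF e(1) j] 0 by simp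

text \<open>An idempotent over the algebra itself with prescribed traces.\<close>
definition standard_idem :: "nat \<Rightarrow> (nat \<Rightarrow> nat) \<Rightarrow> nat \<Rightarrow> nat \<Rightarrow> complex mat list \<times> complex" where
  "standard_idem n x = assemble (\<lambda>j. cdiag (x j)) (\<lambda>_ _. 0)"

lemma standard_idem:
  assumes x: "\<And>j. j < length ds \<Longrightarrow> x j \<le> n * ds ! j"
  shows "standard_idem n x \<in> corner MU n" "M_mult MU (standard_idem n x) (standard_idem n x) = standard_idem n x"
    "mmap snd (standard_idem n x) = (\<lambda>_ _. 0)"
    "\<And>j. j < length ds \<Longrightarrow> summand_trace ds n j (standard_idem n x) = of_nat (x j)"
proof -
  show c: "standard_idem n x \<in> corner MU n"
    unfolding standard_idem_def by (intro assemble_corner cdiag_corner x) (auto simp: corner_def)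
  show s: "mmap snd (standard_idem n x) = (\<lambda>_ _. 0)" by (simp add: standard_idem_def assemble_snd)
  have b: "component ds j (standard_idem n x) = cdiag (x j)" if "j < length ds" for j
    using that by (simp add: standard_idem_def assemble_component)
  show "M_mult MU (standard_idem n x) (standard_idem n x) = standard_idem n x"
  proof (rule corner_ext[OF MU.M_mult_closed[OF c c] c])
    show "mmap snd (M_mult MU (standard_idem n x) (standard_idem n x)) = mmap snd (standard_idem n x)"
      unfolding SND.mmap_mult[OF c c] s by (auto simp: M_mult_def fun_eq_iff finsum_complex)
    show "component ds j (M_mult MU (standard_idem n x) (standard_idem n x)) = component ds j (standard_idem n x)"
      if "j < length ds" for j
      unfolding component_mult[OF c c that] b[OF that] using cdiag_idem[of "x j"] by (simp add: idem_inf_def)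
  qed
  show "summand_trace ds n j (standard_idem n x) = of_nat (x j)" if "j < length ds" for j
    using ctrace_component[OF c that] b[OF that] ctrace_cdiag s by (simp add: ctrace_def[of "\<lambda>_ _. 0"])
qed

end

lemma (in block_embedding) summand_trace_block:
  assumes i: "i < length ds'"
  shows "summand_trace ds' n i (mmap (umap block) e) = (\<Sum>j<length ds. of_nat (M i j) * summand_trace ds n j e)"
proof -
  have "summand_trace ds' n i (mmap (umap block) e) =
      (\<Sum>k<n. \<Sum>r<ds' ! i. (block (fst (e k k)) ! i) $$ (r, r))"
    by (simp add: summand_trace_def mmap_def umap_def split_def)
  also have "\<dots> = (\<Sum>k<n. \<Sum>j<length ds. of_nat (M i j) * (\<Sum>s<ds ! j. (fst (e k k) ! j) $$ (s, s)))"
    by (simp only: block_trace[OF i])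
  also have "\<dots> = (\<Sum>j<length ds. \<Sum>k<n. of_nat (M i j) * (\<Sum>s<ds ! j. (fst (e k k) ! j) $$ (s, s)))"
    by (rule sum.swap)
  finally show ?thesis by (simp add: summand_trace_def sum_distrib_left)
qed

section \<open>Grothendieck groups of classified rings\<close>

lemma (in comm_group) quotient_eq_iff:
  assumes "a \<in> carrier G" "b \<in> carrier G" "c \<in> carrier G" "d \<in> carrier G"
  shows "a \<otimes> inv b = c \<otimes> inv d \<longleftrightarrow> a \<otimes> d = c \<otimes> b"
proof -
  have cancel: "inv x \<otimes> (x \<otimes> y) = y" if "x \<in> carrier G" "y \<in> carrier G" for x y
    using that by (simp add: m_assoc[symmetric])
  have "a \<otimes> d = (a \<otimes> inv b) \<otimes> (b \<otimes> d)"
    using assms cancel[of b d] by (simp add: m_assoc)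
  moreover have "c \<otimes> b = (c \<otimes> inv d) \<otimes> (b \<otimes> d)"
    using assms cancel[of d b] by (simp add: m_assoc m_comm[of b d])
  ultimately show ?thesis using assms by simp
qed

text \<open>An additive invariant \<open>v\<close> with values in an abelian group that separates the equivalence
  classes of idempotents. The monoid of classes is then cancellative, and its Grothendieck group
  embeds into \<open>H\<close> by \<open>[e] - [f] \<mapsto> v e - v f\<close>.\<close>
locale classified_ring = ring R + H: comm_group H
  for R :: "('a, 'm) ring_scheme" and H :: "('h, 'k) monoid_scheme" +
  fixes v :: "(nat \<Rightarrow> nat \<Rightarrow> 'a) \<Rightarrow> 'h"
  assumes v_closed [simp]: "e \<in> idem_inf R \<Longrightarrow> v e \<in> carrier H"
    and rel_iff: "\<lbrakk>e \<in> idem_inf R; f \<in> idem_inf R\<rbrakk> \<Longrightarrow> (e, f) \<in> idem_rel R \<longleftrightarrow> v e = v f"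
    and v_block: "\<lbrakk>e \<in> idem_inf R; f \<in> idem_inf R; e \<in> corner R n\<rbrakk> \<Longrightarrow> v (block_diag R n e f) = v e \<otimes>\<^bsub>H\<^esub> v f"
begin

abbreviation (input) "Z \<equiv> (\<lambda>_ _. \<zero>\<^bsub>R\<^esub>) :: nat \<Rightarrow> nat \<Rightarrow> 'a"

lemma v_zero: "v Z = \<one>\<^bsub>H\<^esub>"
proof -
  have "v (block_diag R 0 Z Z) = v Z \<otimes>\<^bsub>H\<^esub> v Z"
    by (rule v_block[OF zero_idem zero_idem]) (simp add: corner_def)
  moreover have "block_diag R 0 Z Z = Z" by (simp add: block_diag_def fun_eq_iff)
  ultimately show ?thesis using zero_idem by (metis H.l_cancel_one' v_closed)
qed

definition cl :: "(nat \<Rightarrow> nat \<Rightarrow> 'a) \<Rightarrow> (nat \<Rightarrow> nat \<Rightarrow> 'a) set" where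
  "cl e = idem_rel R `` {e}"

lemma cl_eq_iff: "\<lbrakk>e \<in> idem_inf R; f \<in> idem_inf R\<rbrakk> \<Longrightarrow> cl e = cl f \<longleftrightarrow> v e = v f"
  unfolding cl_def using eq_equiv_class_iff[OF idem_rel_equiv] rel_iff by blast

lemma cl_memD: "e' \<in> cl e \<Longrightarrow> e' \<in> idem_inf R \<and> e \<in> idem_inf R \<and> v e' = v e"
  unfolding cl_def using idem_relD[of e e'] rel_iff[of e e'] by auto

lemma cl_self: "e \<in> idem_inf R \<Longrightarrow> e \<in> cl e"
  by (simp add: cl_def idem_rel_refl)

lemma V_carrier: "carrier (V_monoid R) = cl ` idem_inf R"
  by (auto simp: V_monoid_def quotient_def cl_def)

lemma V_one: "\<one>\<^bsub>V_monoid R\<^esub> = cl Z"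
  by (simp add: V_monoid_def cl_def)

lemma V_mult:
  assumes e: "e \<in> idem_inf R" "e \<in> corner R n" and f: "f \<in> idem_inf R"
  shows "cl e \<otimes>\<^bsub>V_monoid R\<^esub> cl f = cl (block_diag R n e f)"
proof -
  have eq: "cl (block_diag R m e' f') = cl (block_diag R n e f)"
    if "e' \<in> cl e" "f' \<in> cl f" "e' \<in> corner R m" for e' f' m
    using that cl_memD[of e' e] cl_memD[of f' f] e f by (subst cl_eq_iff) (auto simp: v_block block_diag_idem)
  have "cl e \<otimes>\<^bsub>V_monoid R\<^esub> cl f = (\<Union>e'\<in>cl e. \<Union>f'\<in>cl f. \<Union>m\<in>{m. e' \<in> corner R m}. cl (block_diag R m e' f'))"
    by (simp add: V_monoid_def cl_def)
  also have "\<dots> = cl (block_diag R n e f)"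
  proof (rule equalityI)
    show "(\<Union>e'\<in>cl e. \<Union>f'\<in>cl f. \<Union>m\<in>{m. e' \<in> corner R m}. cl (block_diag R m e' f')) \<subseteq> cl (block_diag R n e f)"
      using eq by blast
    show "cl (block_diag R n e f) \<subseteq> (\<Union>e'\<in>cl e. \<Union>f'\<in>cl f. \<Union>m\<in>{m. e' \<in> corner R m}. cl (block_diag R m e' f'))"
      using cl_self[OF e(1)] cl_self[OF f] e(2) by blast
  qed
  finally show ?thesis .
qed

lemma idem_corner: "e \<in> idem_inf R \<Longrightarrow> \<exists>n. e \<in> corner R n"
  by (auto simp: idem_inf_def M_inf_def)

lemma V_mult_ex:
  assumes "e \<in> idem_inf R" "f \<in> idem_inf R"
  obtains h where "h \<in> idem_inf R" "cl e \<otimes>\<^bsub>V_monoid R\<^esub> cl f = cl h" "v h = v e \<otimes>\<^bsub>H\<^esub> v f"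
proof -
  obtain n where "e \<in> corner R n" using idem_corner assms by blast
  then show thesis using that[of "block_diag R n e f"] V_mult assms v_block block_diag_idem by blast
qed

lemma groth_rel_iff:
  assumes "a \<in> idem_inf R" "b \<in> idem_inf R" "c \<in> idem_inf R" "d \<in> idem_inf R"
  shows "((cl a, cl b), (cl c, cl d)) \<in> groth_rel (V_monoid R) \<longleftrightarrow> v a \<otimes>\<^bsub>H\<^esub> v d = v c \<otimes>\<^bsub>H\<^esub> v b"
proof -
  have key: "cl a \<otimes>\<^bsub>V_monoid R\<^esub> cl d \<otimes>\<^bsub>V_monoid R\<^esub> cl h = cl c \<otimes>\<^bsub>V_monoid R\<^esub> cl b \<otimes>\<^bsub>V_monoid R\<^esub> cl h \<longleftrightarrow>
    v a \<otimes>\<^bsub>H\<^esub> v d = v c \<otimes>\<^bsub>H\<^esub> v b" if h: "h \<in> idem_inf R" for h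
  proof -
    obtain x where x: "x \<in> idem_inf R" "cl a \<otimes>\<^bsub>V_monoid R\<^esub> cl d = cl x" "v x = v a \<otimes>\<^bsub>H\<^esub> v d"
      using V_mult_ex[OF assms(1,4)] by blast
    obtain y where y: "y \<in> idem_inf R" "cl c \<otimes>\<^bsub>V_monoid R\<^esub> cl b = cl y" "v y = v c \<otimes>\<^bsub>H\<^esub> v b"
      using V_mult_ex[OF assms(3,2)] by blast
    obtain s where s: "s \<in> idem_inf R" "cl x \<otimes>\<^bsub>V_monoid R\<^esub> cl h = cl s" "v s = v x \<otimes>\<^bsub>H\<^esub> v h"
      using V_mult_ex[OF x(1) h] by blast
    obtain t where t: "t \<in> idem_inf R" "cl y \<otimes>\<^bsub>V_monoid R\<^esub> cl h = cl t" "v t = v y \<otimes>\<^bsub>H\<^esub> v h"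
      using V_mult_ex[OF y(1) h] by blast
    show ?thesis
      using h x y s t assms by (simp add: cl_eq_iff)
  qed
  show ?thesis
    unfolding groth_rel_def using assms key zero_idem by (auto simp: V_carrier)
qed

text \<open>The class of the formal difference of \<open>e\<close> and \<open>f\<close> in the Grothendieck group.\<close>
definition K_class :: "(nat \<Rightarrow> nat \<Rightarrow> 'a) \<Rightarrow> (nat \<Rightarrow> nat \<Rightarrow> 'a) \<Rightarrow> ((nat \<Rightarrow> nat \<Rightarrow> 'a) set \<times> (nat \<Rightarrow> nat \<Rightarrow> 'a) set) set" where
  "K_class e f = groth_rel (V_monoid R) `` {(cl e, cl f)}"

lemma groth_rel_memD:
  assumes "((cl a, cl b), x) \<in> groth_rel (V_monoid R)"
  obtains c d where "c \<in> idem_inf R" "d \<in> idem_inf R" "x = (cl c, cl d)"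
  using assms by (cases x) (auto simp: groth_rel_def V_carrier)

lemma K_class_mem_iff:
  assumes "a \<in> idem_inf R" "b \<in> idem_inf R"
  shows "x \<in> K_class a b \<longleftrightarrow> (\<exists>c\<in>idem_inf R. \<exists>d\<in>idem_inf R. x = (cl c, cl d) \<and> v a \<otimes>\<^bsub>H\<^esub> v d = v c \<otimes>\<^bsub>H\<^esub> v b)"
proof
  assume "x \<in> K_class a b"
  then have x: "((cl a, cl b), x) \<in> groth_rel (V_monoid R)" by (simp add: K_class_def)
  from groth_rel_memD[OF this] obtain c d where "c \<in> idem_inf R" "d \<in> idem_inf R" "x = (cl c, cl d)" by blast
  then show "\<exists>c\<in>idem_inf R. \<exists>d\<in>idem_inf R. x = (cl c, cl d) \<and> v a \<otimes>\<^bsub>H\<^esub> v d = v c \<otimes>\<^bsub>H\<^esub> v b"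
    using x groth_rel_iff[OF assms] by blast
qed (auto simp: K_class_def groth_rel_iff assms)

lemma K_class_eq_iff:
  assumes "a \<in> idem_inf R" "b \<in> idem_inf R" "c \<in> idem_inf R" "d \<in> idem_inf R"
  shows "K_class a b = K_class c d \<longleftrightarrow> v a \<otimes>\<^bsub>H\<^esub> inv\<^bsub>H\<^esub> (v b) = v c \<otimes>\<^bsub>H\<^esub> inv\<^bsub>H\<^esub> (v d)"
proof -
  have swap: "v x \<otimes>\<^bsub>H\<^esub> v d = v c \<otimes>\<^bsub>H\<^esub> v y \<longleftrightarrow> v x \<otimes>\<^bsub>H\<^esub> inv\<^bsub>H\<^esub> (v y) = v c \<otimes>\<^bsub>H\<^esub> inv\<^bsub>H\<^esub> (v d)"
    if "x \<in> idem_inf R" "y \<in> idem_inf R" "c \<in> idem_inf R" "d \<in> idem_inf R" for x y c d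
    using H.quotient_eq_iff[of "v x" "v y" "v c" "v d"] that by simp
  show ?thesis
  proof
    assume "K_class a b = K_class c d"
    moreover have "(cl c, cl d) \<in> K_class c d" using assms by (auto simp: K_class_mem_iff)
    ultimately have "(cl c, cl d) \<in> K_class a b" by simp
    then have "((cl a, cl b), (cl c, cl d)) \<in> groth_rel (V_monoid R)" by (simp add: K_class_def)
    then show "v a \<otimes>\<^bsub>H\<^esub> inv\<^bsub>H\<^esub> (v b) = v c \<otimes>\<^bsub>H\<^esub> inv\<^bsub>H\<^esub> (v d)"
      using groth_rel_iff swap assms by simp
  next
    assume *: "v a \<otimes>\<^bsub>H\<^esub> inv\<^bsub>H\<^esub> (v b) = v c \<otimes>\<^bsub>H\<^esub> inv\<^bsub>H\<^esub> (v d)"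
    have "(v a \<otimes>\<^bsub>H\<^esub> v y = v x \<otimes>\<^bsub>H\<^esub> v b) = (v c \<otimes>\<^bsub>H\<^esub> v y = v x \<otimes>\<^bsub>H\<^esub> v d)"
      if "x \<in> idem_inf R" "y \<in> idem_inf R" for x y
      using swap[of a b x y] swap[of c d x y] that assms * by simp
    then show "K_class a b = K_class c d" using assms by (auto simp: K_class_mem_iff)
  qed
qed

lemma K_class_eqI:
  assumes "a \<in> idem_inf R" "b \<in> idem_inf R" "c \<in> idem_inf R" "d \<in> idem_inf R" "v a \<otimes>\<^bsub>H\<^esub> v d = v c \<otimes>\<^bsub>H\<^esub> v b"
  shows "K_class c d = K_class a b"
  using H.quotient_eq_iff[of "v a" "v b" "v c" "v d"] K_class_eq_iff[of c d a b] assms by simp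

lemma K00_carrier: "carrier (K00 R) = {K_class e f | e f. e \<in> idem_inf R \<and> f \<in> idem_inf R}"
  by (auto simp: K00_def grothendieck_def quotient_def V_carrier K_class_def)

lemma K00_one: "\<one>\<^bsub>K00 R\<^esub> = K_class Z Z"
  by (simp add: K00_def grothendieck_def K_class_def V_one)

text \<open>The homomorphism from the Grothendieck group to \<open>H\<close> that is induced by \<open>v\<close>.\<close>
definition kval :: "((nat \<Rightarrow> nat \<Rightarrow> 'a) set \<times> (nat \<Rightarrow> nat \<Rightarrow> 'a) set) set \<Rightarrow> 'h" where
  "kval X = (THE z. \<exists>e\<in>idem_inf R. \<exists>f\<in>idem_inf R. X = K_class e f \<and> z = v e \<otimes>\<^bsub>H\<^esub> inv\<^bsub>H\<^esub> (v f))"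

lemma kval_K_class: "\<lbrakk>e \<in> idem_inf R; f \<in> idem_inf R\<rbrakk> \<Longrightarrow> kval (K_class e f) = v e \<otimes>\<^bsub>H\<^esub> inv\<^bsub>H\<^esub> (v f)"
  unfolding kval_def by (rule the_equality) (use K_class_eq_iff in auto)

lemma kval_inj: "inj_on kval (carrier (K00 R))"
proof (rule inj_onI)
  fix x y assume "x \<in> carrier (K00 R)" "y \<in> carrier (K00 R)" and k: "kval x = kval y"
  then obtain a b c d where "x = K_class a b" "y = K_class c d" "a \<in> idem_inf R" "b \<in> idem_inf R" "c \<in> idem_inf R" "d \<in> idem_inf R"
    by (auto simp: K00_carrier)
  with k show "x = y" using K_class_eq_iff[of a b c d] by (simp add: kval_K_class)
qed

lemma K00_mult:
  assumes "a \<in> idem_inf R" "b \<in> idem_inf R" "c \<in> idem_inf R" "d \<in> idem_inf R"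
  obtains e f where "e \<in> idem_inf R" "f \<in> idem_inf R" "K_class a b \<otimes>\<^bsub>K00 R\<^esub> K_class c d = K_class e f"
    "v e = v a \<otimes>\<^bsub>H\<^esub> v c" "v f = v b \<otimes>\<^bsub>H\<^esub> v d"
proof -
  obtain e where e: "e \<in> idem_inf R" "cl a \<otimes>\<^bsub>V_monoid R\<^esub> cl c = cl e" "v e = v a \<otimes>\<^bsub>H\<^esub> v c"
    using V_mult_ex[OF assms(1,3)] by blast
  obtain f where f: "f \<in> idem_inf R" "cl b \<otimes>\<^bsub>V_monoid R\<^esub> cl d = cl f" "v f = v b \<otimes>\<^bsub>H\<^esub> v d"
    using V_mult_ex[OF assms(2,4)] by blast
  have eq: "groth_rel (V_monoid R) `` {(fst x \<otimes>\<^bsub>V_monoid R\<^esub> fst y, snd x \<otimes>\<^bsub>V_monoid R\<^esub> snd y)} = K_class e f"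
    if xy: "x \<in> K_class a b" "y \<in> K_class c d" for x y
  proof -
    obtain a' b' where x: "a' \<in> idem_inf R" "b' \<in> idem_inf R" "x = (cl a', cl b')" "v a \<otimes>\<^bsub>H\<^esub> v b' = v a' \<otimes>\<^bsub>H\<^esub> v b"
      using xy(1) unfolding K_class_mem_iff[OF assms(1,2)] by blast
    obtain c' d' where y: "c' \<in> idem_inf R" "d' \<in> idem_inf R" "y = (cl c', cl d')" "v c \<otimes>\<^bsub>H\<^esub> v d' = v c' \<otimes>\<^bsub>H\<^esub> v d"
      using xy(2) unfolding K_class_mem_iff[OF assms(3,4)] by blast
    obtain e' where e': "e' \<in> idem_inf R" "cl a' \<otimes>\<^bsub>V_monoid R\<^esub> cl c' = cl e'" "v e' = v a' \<otimes>\<^bsub>H\<^esub> v c'"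
      using V_mult_ex[OF x(1) y(1)] by blast
    obtain f' where f': "f' \<in> idem_inf R" "cl b' \<otimes>\<^bsub>V_monoid R\<^esub> cl d' = cl f'" "v f' = v b' \<otimes>\<^bsub>H\<^esub> v d'"
      using V_mult_ex[OF x(2) y(2)] by blast
    have "K_class a' b' = K_class a b" "K_class c' d' = K_class c d"
      by (rule K_class_eqI[OF assms(1,2) x(1,2,4)], rule K_class_eqI[OF assms(3,4) y(1,2,4)])
    then have k: "v a \<otimes>\<^bsub>H\<^esub> inv\<^bsub>H\<^esub> (v b) = v a' \<otimes>\<^bsub>H\<^esub> inv\<^bsub>H\<^esub> (v b')" "v c \<otimes>\<^bsub>H\<^esub> inv\<^bsub>H\<^esub> (v d) = v c' \<otimes>\<^bsub>H\<^esub> inv\<^bsub>H\<^esub> (v d')"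
      using K_class_eq_iff assms x y by blast+
    have "v e' \<otimes>\<^bsub>H\<^esub> inv\<^bsub>H\<^esub> (v f') = (v a' \<otimes>\<^bsub>H\<^esub> inv\<^bsub>H\<^esub> (v b')) \<otimes>\<^bsub>H\<^esub> (v c' \<otimes>\<^bsub>H\<^esub> inv\<^bsub>H\<^esub> (v d'))"
      using e' f' x y by (simp add: H.inv_mult H.m_ac)
    also have "\<dots> = v e \<otimes>\<^bsub>H\<^esub> inv\<^bsub>H\<^esub> (v f)"
      unfolding k[symmetric] using e f assms by (simp add: H.inv_mult H.m_ac)
    finally have "K_class e' f' = K_class e f" using K_class_eq_iff[OF e'(1) f'(1) e(1) f(1)] by blast
    then show ?thesis using x y e' f' by (simp add: K_class_def)
  qed
  have mult: "K_class a b \<otimes>\<^bsub>K00 R\<^esub> K_class c d =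
      (\<Union>x\<in>K_class a b. \<Union>y\<in>K_class c d. groth_rel (V_monoid R) `` {(fst x \<otimes>\<^bsub>V_monoid R\<^esub> fst y, snd x \<otimes>\<^bsub>V_monoid R\<^esub> snd y)})"
    by (simp add: K00_def grothendieck_def split_def)
  have "(cl a, cl b) \<in> K_class a b" "(cl c, cl d) \<in> K_class c d" using assms by (auto simp: K_class_mem_iff)
  then have "K_class a b \<otimes>\<^bsub>K00 R\<^esub> K_class c d = K_class e f"
    unfolding mult using eq by (intro equalityI subsetI) (blast, metis (no_types, lifting) UN_iff)
  then show thesis using that e f by blast
qed

lemma kval_mult:
  assumes "x \<in> carrier (K00 R)" "y \<in> carrier (K00 R)"
  shows "x \<otimes>\<^bsub>K00 R\<^esub> y \<in> carrier (K00 R)" "kval (x \<otimes>\<^bsub>K00 R\<^esub> y) = kval x \<otimes>\<^bsub>H\<^esub> kval y"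
proof -
  obtain a b c d where xy: "x = K_class a b" "y = K_class c d" "a \<in> idem_inf R" "b \<in> idem_inf R" "c \<in> idem_inf R" "d \<in> idem_inf R"
    using assms by (auto simp: K00_carrier)
  obtain e f where ef: "e \<in> idem_inf R" "f \<in> idem_inf R" "K_class a b \<otimes>\<^bsub>K00 R\<^esub> K_class c d = K_class e f"
    "v e = v a \<otimes>\<^bsub>H\<^esub> v c" "v f = v b \<otimes>\<^bsub>H\<^esub> v d"
    using K00_mult[OF xy(3-6)] by blast
  show "x \<otimes>\<^bsub>K00 R\<^esub> y \<in> carrier (K00 R)" using xy ef by (auto simp: K00_carrier)
  show "kval (x \<otimes>\<^bsub>K00 R\<^esub> y) = kval x \<otimes>\<^bsub>H\<^esub> kval y"
    using xy ef by (simp add: kval_K_class H.inv_mult H.m_ac)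
qed

end

locale classified_hom = R: classified_ring R H v + S: classified_ring S J w + ring_hom_ring R S h
  for R :: "('a, 'm) ring_scheme" and H :: "('h, 'k) monoid_scheme" and v
    and S :: "('b, 'n) ring_scheme" and J :: "('j, 'l) monoid_scheme" and w and h
begin

lemma V_map_cl: "e \<in> idem_inf R \<Longrightarrow> V_map S h (R.cl e) = S.cl (mmap h e)"
proof -
  assume e: "e \<in> idem_inf R"
  have "idem_rel S `` {\<lambda>i j. h (e' i j)} = S.cl (mmap h e)" if "e' \<in> R.cl e" for e'
  proof -
    have "(mmap h e, mmap h e') \<in> idem_rel S" using that by (intro mmap_rel) (simp add: R.cl_def)
    then have "S.cl (mmap h e) = S.cl (mmap h e')" unfolding S.cl_def by (rule equiv_class_eq[OF S.idem_rel_equiv])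
    then show ?thesis by (simp add: S.cl_def mmap_def)
  qed
  then show ?thesis unfolding V_map_def using R.cl_self[OF e] by blast
qed

lemma K00_map_K_class:
  assumes "e \<in> idem_inf R" "f \<in> idem_inf R"
  shows "K00_map S h (R.K_class e f) = S.K_class (mmap h e) (mmap h f)"
proof -
  have "groth_rel (V_monoid S) `` {(V_map S h (fst x), V_map S h (snd x))} = S.K_class (mmap h e) (mmap h f)"
    if x: "x \<in> R.K_class e f" for x
  proof -
    obtain c d where cd: "c \<in> idem_inf R" "d \<in> idem_inf R" "x = (R.cl c, R.cl d)" "v e \<otimes>\<^bsub>H\<^esub> v d = v c \<otimes>\<^bsub>H\<^esub> v f"
      using x unfolding R.K_class_mem_iff[OF assms] by blast
    obtain n where n: "e \<in> corner R n" using R.idem_corner assms by blast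
    obtain m where m: "c \<in> corner R m" using R.idem_corner cd by blast
    have "(block_diag R n e d, block_diag R m c f) \<in> idem_rel R"
      using assms cd n m by (subst R.rel_iff) (auto simp: R.v_block R.block_diag_idem)
    from mmap_rel[OF this] have "w (block_diag S n (mmap h e) (mmap h d)) = w (block_diag S m (mmap h c) (mmap h f))"
      using S.rel_iff[of "block_diag S n (mmap h e) (mmap h d)" "block_diag S m (mmap h c) (mmap h f)"]
        S.idem_relD by (auto simp: mmap_block_diag)
    then have "w (mmap h e) \<otimes>\<^bsub>J\<^esub> w (mmap h d) = w (mmap h c) \<otimes>\<^bsub>J\<^esub> w (mmap h f)"
      using assms cd n m by (simp add: S.v_block mmap_idem mmap_corner)
    then have "S.K_class (mmap h c) (mmap h d) = S.K_class (mmap h e) (mmap h f)"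
      using assms cd by (intro S.K_class_eqI) (auto simp: mmap_idem)
    then show ?thesis using cd V_map_cl by (simp add: S.K_class_def)
  qed
  moreover have "(R.cl e, R.cl f) \<in> R.K_class e f" using assms by (auto simp: R.K_class_mem_iff)
  ultimately show ?thesis unfolding K00_map_def split_def by blast
qed

end

section \<open>The ordered group of an algebra whose unitization is classified\<close>

text \<open>Group axioms are reflected by an injective map that is compatible with the operations. This
  shows that the kernel in the definition of \<open>K\<^sub>0\<close> is a group.\<close>
lemma comm_group_transport:
  assumes "comm_group G" and f: "inj_on f (carrier H)" "f ` carrier H = carrier G"
    and closed: "\<And>x y. \<lbrakk>x \<in> carrier H; y \<in> carrier H\<rbrakk> \<Longrightarrow> x \<otimes>\<^bsub>H\<^esub> y \<in> carrier H"
    and hom: "\<And>x y. \<lbrakk>x \<in> carrier H; y \<in> carrier H\<rbrakk> \<Longrightarrow> f (x \<otimes>\<^bsub>H\<^esub> y) = f x \<otimes>\<^bsub>G\<^esub> f y"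
    and one: "\<one>\<^bsub>H\<^esub> \<in> carrier H" "f \<one>\<^bsub>H\<^esub> = \<one>\<^bsub>G\<^esub>"
  shows "comm_group H"
proof -
  interpret G: comm_group G by fact
  have fc: "f x \<in> carrier G" if "x \<in> carrier H" for x using f(2) that by blast
  have eqI: "x = y" if "x \<in> carrier H" "y \<in> carrier H" "f x = f y" for x y
    using f(1) that by (auto simp: inj_on_def)
  show ?thesis
  proof (rule comm_groupI)
    fix x assume x: "x \<in> carrier H"
    have "inv\<^bsub>G\<^esub> (f x) \<in> f ` carrier H" unfolding f(2) using fc[OF x] by simp
    then obtain y where y: "y \<in> carrier H" "f y = inv\<^bsub>G\<^esub> (f x)" by auto
    show "\<exists>y\<in>carrier H. y \<otimes>\<^bsub>H\<^esub> x = \<one>\<^bsub>H\<^esub>"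
      by (rule bexI[OF _ y(1)], rule eqI) (use x y fc in \<open>simp_all add: closed hom one\<close>)
    show "\<one>\<^bsub>H\<^esub> \<otimes>\<^bsub>H\<^esub> x = x" by (rule eqI) (use x fc in \<open>simp_all add: closed hom one\<close>)
  next
    fix x y z assume xyz: "x \<in> carrier H" "y \<in> carrier H" "z \<in> carrier H"
    show "x \<otimes>\<^bsub>H\<^esub> y \<otimes>\<^bsub>H\<^esub> z = x \<otimes>\<^bsub>H\<^esub> (y \<otimes>\<^bsub>H\<^esub> z)"
      by (rule eqI) (use xyz fc in \<open>simp_all add: closed hom G.m_assoc\<close>)
  next
    fix x y assume xyz: "x \<in> carrier H" "y \<in> carrier H"
    show "x \<otimes>\<^bsub>H\<^esub> y = y \<otimes>\<^bsub>H\<^esub> x"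
      by (rule eqI) (use xyz fc in \<open>simp_all add: closed hom G.m_comm\<close>)
  qed (use closed one in auto)
qed

definition emb :: "(nat \<Rightarrow> nat \<Rightarrow> 'a) \<Rightarrow> nat \<Rightarrow> nat \<Rightarrow> 'a \<times> complex" where
  "emb e = (\<lambda>i j. (e i j, 0))"

definition single :: "('a, 'm) ring_scheme \<Rightarrow> 'a \<Rightarrow> nat \<Rightarrow> nat \<Rightarrow> 'a" where
  "single A e = (\<lambda>i j. if i = 0 \<and> j = 0 then e else \<zero>\<^bsub>A\<^esub>)"

context complex_algebra begin

lemma emb_corner_iff: "emb e \<in> corner (unitization A) n \<longleftrightarrow> e \<in> corner A n"
  by (auto simp: emb_def corner_def)

lemma finsum_emb:
  assumes "finite S" "\<And>k. k \<in> S \<Longrightarrow> f k \<in> carrier A"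
  shows "finsum (unitization A) (\<lambda>k. (f k, 0)) S = (finsum A f S, 0)"
proof -
  interpret U: ring "unitization A" by (rule unitization_ring)
  show ?thesis
    using assms
  proof (induction S rule: finite_induct)
    case (insert a S)
    have "finsum (unitization A) (\<lambda>k. (f k, 0)) (insert a S) =
        (f a, 0) \<oplus>\<^bsub>unitization A\<^esub> finsum (unitization A) (\<lambda>k. (f k, 0)) S"
      using insert by (intro U.finsum_insert) auto
    moreover have "finsum A f (insert a S) = f a \<oplus> finsum A f S"
      using insert by (intro finsum_insert) auto
    ultimately show ?case using insert by simp
  qed simp
qed

lemma M_mult_emb:
  assumes a: "a \<in> corner A n" and b: "b \<in> corner A n"
  shows "M_mult (unitization A) (emb a) (emb b) = emb (M_mult A a b)"
proof (intro ext)
  fix i j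
  have fin: "finite {k. a i k \<noteq> \<zero>}"
    by (rule finite_subset[of _ "{..<n}"]) (use cornerD(2)[OF a] in \<open>auto simp: not_le[symmetric]\<close>)
  have "M_mult (unitization A) (emb a) (emb b) i j =
      finsum (unitization A) (\<lambda>k. (a i k, 0) \<otimes>\<^bsub>unitization A\<^esub> (b k j, 0)) {k. a i k \<noteq> \<zero>}"
    by (simp add: M_mult_def emb_def)
  also have "(\<lambda>k. (a i k, 0) \<otimes>\<^bsub>unitization A\<^esub> (b k j, 0)) = (\<lambda>k. (a i k \<otimes> b k j, 0))"
    using cornerD(1)[OF a] cornerD(1)[OF b] by (simp add: mult_closed)
  also have "finsum (unitization A) (\<lambda>k. (a i k \<otimes> b k j, 0)) {k. a i k \<noteq> \<zero>} = emb (M_mult A a b) i j"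
    using finsum_emb[OF fin, of "\<lambda>k. a i k \<otimes> b k j"] cornerD(1)[OF a] cornerD(1)[OF b]
    by (simp add: M_mult_def emb_def mult_closed)
  finally show "M_mult (unitization A) (emb a) (emb b) i j = emb (M_mult A a b) i j" .
qed

lemma emb_idem_iff: "emb e \<in> idem_inf (unitization A) \<longleftrightarrow> e \<in> idem_inf A"
proof -
  have "emb x = emb y \<longleftrightarrow> x = y" for x y :: "nat \<Rightarrow> nat \<Rightarrow> 'a" by (auto simp: emb_def fun_eq_iff)
  then show ?thesis
    unfolding idem_inf_def M_inf_def using emb_corner_iff M_mult_emb by fastforce
qed

lemma emb_fst: "mmap snd e = (\<lambda>_ _. 0) \<Longrightarrow> emb (mmap fst e) = e"
  by (auto simp: emb_def mmap_def fun_eq_iff prod_eq_iff)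

lemma snd_emb: "mmap snd (emb e) = (\<lambda>_ _. 0)"
  by (simp add: emb_def mmap_def)

lemma single_corner: "e \<in> carrier A \<Longrightarrow> single A e \<in> corner A 1"
  by (auto simp: single_def corner_def)

lemma single_idem_iff:
  assumes e: "e \<in> carrier A"
  shows "single A e \<in> idem_inf A \<longleftrightarrow> e \<otimes> e = e"
proof -
  have "M_mult A (single A e) (single A e) = single A (e \<otimes> e)"
  proof (intro ext)
    fix i j
    have s: "{k. single A e i k \<noteq> \<zero>} = (if i = 0 \<and> e \<noteq> \<zero> then {0} else {})" by (auto simp: single_def)
    show "M_mult A (single A e) (single A e) i j = single A (e \<otimes> e) i j"
      unfolding M_mult_def s using e by (auto simp: single_def mult_closed)
  qed
  moreover have "single A x = single A y \<longleftrightarrow> x = y" for x y by (auto simp: single_def fun_eq_iff)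
  ultimately show ?thesis using single_corner[OF e] by (auto simp: idem_inf_def M_inf_def)
qed

lemma corner_1_single: "e \<in> corner A 1 \<Longrightarrow> e = single A (e 0 0)"
  by (auto simp: corner_def single_def fun_eq_iff)

end

text \<open>The additive group of the complex numbers with the group operation as multiplication; the
  value group of the trace.\<close>
definition complex_add :: "complex monoid" where
  "complex_add = \<lparr>carrier = UNIV, monoid.mult = (+), one = 0\<rparr>"

lemma complex_add_simps [simp]:
  "carrier complex_add = UNIV" "x \<otimes>\<^bsub>complex_add\<^esub> y = x + y" "\<one>\<^bsub>complex_add\<^esub> = 0"
  by (simp_all add: complex_add_def)

lemma complex_add_group: "comm_group complex_add"
  by (rule comm_groupI) (auto simp: algebra_simps intro: exI[of _ "- _"] add.left_inverse)

lemma complex_add_inv [simp]: "inv\<^bsub>complex_add\<^esub> z = - z"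
  by (rule group.inv_equality[OF comm_group.axioms(2)[OF complex_add_group]]) auto

interpretation CC: classified_ring complex_ring "complex_add" ctrace
proof (intro classified_ring.intro classified_ring_axioms.intro)
  show "ring complex_ring" by (rule complex_ring)
  show "comm_group (complex_add)" by (rule complex_add_group)
  fix e f n assume e: "e \<in> idem_inf complex_ring" and f: "f \<in> idem_inf complex_ring"
  show "(e, f) \<in> idem_rel complex_ring \<longleftrightarrow> ctrace e = ctrace f" by (rule complex_idem_rel_iff[OF e f])
  assume n: "e \<in> corner complex_ring n"
  obtain m where "f \<in> corner complex_ring m" using f by (auto simp: idem_inf_def M_inf_def)
  then show "ctrace (block_diag complex_ring n e f) = ctrace e \<otimes>\<^bsub>complex_add\<^esub> ctrace f"
    using ctrace_block_diag[OF n] by simp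
qed simp

text \<open>Suppose that idempotents over the unitization are classified by an invariant \<open>g\<close> with values
  in \<open>G\<close> together with the trace of their scalar part. The kernel of the map to \<open>K\<^sub>0\<close> of the
  complex numbers consists of the differences with equal scalar traces. On it the scalar trace
  vanishes, and the difference of the values of \<open>g\<close> is injective. Surjectivity follows from that
  onto the positive cone, since the latter generates \<open>G\<close>.\<close>
theorem K0_isomorphic_if_classified:
  fixes A :: "(complex, 'a, 'm) module_scheme" and G :: "('g, 'n) scaled_group_scheme"
    and g :: "(nat \<Rightarrow> nat \<Rightarrow> 'a \<times> complex) \<Rightarrow> 'g"
  assumes A: "complex_algebra A" and G: "scaled_preordered_group G"
    and generating: "\<And>\<eta>. \<eta> \<in> carrier G \<Longrightarrow> \<exists>a\<in>pos G. \<exists>b\<in>pos G. \<eta> = a \<otimes>\<^bsub>G\<^esub> inv\<^bsub>G\<^esub> b"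
    and classified: "classified_ring (unitization A) (G \<times>\<times> complex_add) (\<lambda>e. (g e, ctrace (mmap snd e)))"
    and pos: "(\<lambda>e. g (emb e)) ` idem_inf A = pos G"
    and scale: "(\<lambda>e. g (emb (single A e))) ` {e \<in> carrier A. e \<otimes>\<^bsub>A\<^esub> e = e} = scale G"
  shows "scaled_isomorphic (K0 A) G"
proof -
  interpret A: complex_algebra A by (rule A)
  interpret G: scaled_preordered_group G by (rule G)
  interpret U: classified_ring "unitization A" "G \<times>\<times> complex_add" "\<lambda>e. (g e, ctrace (mmap snd e))"
    by (rule classified)
  interpret SND: ring_hom_ring "unitization A" complex_ring snd by (rule snd_ring_hom[OF A])
  interpret hom: classified_hom "unitization A" "G \<times>\<times> complex_add" "\<lambda>e. (g e, ctrace (mmap snd e))"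
    complex_ring "complex_add" ctrace snd by unfold_locales
  let ?U = "unitization A"
  have gc: "g e \<in> carrier G" if "e \<in> idem_inf ?U" for e using U.v_closed[OF that] by simp
  have inv: "inv\<^bsub>G \<times>\<times> complex_add\<^esub> (x, z) = (inv\<^bsub>G\<^esub> x, - z)" if "x \<in> carrier G" for x z
    using inv_DirProd[OF G.is_group comm_group.axioms(2)[OF complex_add_group] that, of z] by simp
  have kval: "U.kval (U.K_class e f) = (g e \<otimes>\<^bsub>G\<^esub> inv\<^bsub>G\<^esub> g f, ctrace (mmap snd e) - ctrace (mmap snd f))"
    if "e \<in> idem_inf ?U" "f \<in> idem_inf ?U" for e f
    using that by (simp add: U.kval_K_class inv gc)
  define z0 where "z0 = (\<lambda>(_ :: nat) (_ :: nat). \<zero>\<^bsub>?U\<^esub>)"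
  have z0: "z0 \<in> idem_inf ?U" unfolding z0_def by (rule U.zero_idem)
  have gz0: "g z0 = \<one>\<^bsub>G\<^esub>" "ctrace (mmap snd z0) = 0" using U.v_zero by (auto simp: z0_def)
  have carr: "carrier (K0 A) = {U.K_class e f | e f. e \<in> idem_inf ?U \<and> f \<in> idem_inf ?U \<and> ctrace (mmap snd e) = ctrace (mmap snd f)}"
  proof -
    have "K00_map complex_ring snd (U.K_class e f) = \<one>\<^bsub>K00 complex_ring\<^esub> \<longleftrightarrow> ctrace (mmap snd e) = ctrace (mmap snd f)"
      if ef: "e \<in> idem_inf ?U" "f \<in> idem_inf ?U" for e f
    proof -
      have "K00_map complex_ring snd (U.K_class e f) = \<one>\<^bsub>K00 complex_ring\<^esub> \<longleftrightarrow>
          ctrace (mmap snd e) - ctrace (mmap snd f) = 0"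
        unfolding hom.K00_map_K_class[OF ef] CC.K00_one
        using CC.K_class_eq_iff[OF SND.mmap_idem[OF ef(1)] SND.mmap_idem[OF ef(2)] C.zero_idem C.zero_idem] CC.v_zero
        by simp
      then show ?thesis by simp
    qed
    then show ?thesis by (auto simp: K0_def kernel_def U.K00_carrier)
  qed
  have carrI: "U.K_class e f \<in> carrier (K0 A)"
    if "e \<in> idem_inf ?U" "f \<in> idem_inf ?U" "ctrace (mmap snd e) = ctrace (mmap snd f)" for e f
    unfolding carr using that by blast
  have sub: "carrier (K0 A) \<subseteq> carrier (K00 ?U)" by (auto simp: carr U.K00_carrier)
  define f where "f = (\<lambda>x. fst (U.kval x))"
  have f_K_class: "f (U.K_class e e') = g e \<otimes>\<^bsub>G\<^esub> inv\<^bsub>G\<^esub> g e'" if "e \<in> idem_inf ?U" "e' \<in> idem_inf ?U" for e e'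
    using kval[OF that] by (simp add: f_def)
  have snd0: "snd (U.kval x) = 0" if "x \<in> carrier (K0 A)" for x using that kval by (auto simp: carr)
  have closed: "x \<otimes>\<^bsub>K0 A\<^esub> y \<in> carrier (K0 A)" and hom: "f (x \<otimes>\<^bsub>K0 A\<^esub> y) = f x \<otimes>\<^bsub>G\<^esub> f y"
    if xy: "x \<in> carrier (K0 A)" "y \<in> carrier (K0 A)" for x y
  proof -
    have m: "x \<otimes>\<^bsub>K0 A\<^esub> y = x \<otimes>\<^bsub>K00 ?U\<^esub> y" by (simp add: K0_def)
    note k = U.kval_mult[of x y]
    have xy': "x \<in> carrier (K00 ?U)" "y \<in> carrier (K00 ?U)" using xy sub by auto
    have k2: "U.kval (x \<otimes>\<^bsub>K0 A\<^esub> y) = (fst (U.kval x) \<otimes>\<^bsub>G\<^esub> fst (U.kval y), snd (U.kval x) + snd (U.kval y))"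
      unfolding m k(2)[OF xy'] by (cases "U.kval x"; cases "U.kval y") simp
    then show "f (x \<otimes>\<^bsub>K0 A\<^esub> y) = f x \<otimes>\<^bsub>G\<^esub> f y" by (simp add: f_def)
    obtain e e' where e: "x \<otimes>\<^bsub>K0 A\<^esub> y = U.K_class e e'" "e \<in> idem_inf ?U" "e' \<in> idem_inf ?U"
      using k(1)[OF xy'] unfolding m U.K00_carrier by blast
    moreover have "snd (U.kval (x \<otimes>\<^bsub>K0 A\<^esub> y)) = 0" using k2 snd0 xy by simp
    ultimately show "x \<otimes>\<^bsub>K0 A\<^esub> y \<in> carrier (K0 A)" using kval[OF e(2,3)] by (auto simp: carr)
  qed
  have inj: "inj_on f (carrier (K0 A))"
  proof (rule inj_onI)
    fix x y assume "x \<in> carrier (K0 A)" "y \<in> carrier (K0 A)" "f x = f y"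
    then show "x = y" using inj_onD[OF U.kval_inj, of x y] snd0[of x] snd0[of y] sub by (auto simp: f_def prod_eq_iff)
  qed
  have emb_idem: "emb e \<in> idem_inf ?U" if "e \<in> idem_inf A" for e using that A.emb_idem_iff by simp
  have tr_emb: "ctrace (mmap snd (emb e)) = 0" for e :: "nat \<Rightarrow> nat \<Rightarrow> 'a"
    unfolding A.snd_emb by (simp add: ctrace_def)
  have class_eq: "K0_class A e = U.K_class (emb e) z0" for e
    by (simp add: K0_class_def U.K_class_def U.V_one z0_def U.cl_def emb_def)
  have class_carr: "K0_class A e \<in> carrier (K0 A)" and f_class: "f (K0_class A e) = g (emb e)" if e: "e \<in> idem_inf A" for e
    using emb_idem[OF e] z0 tr_emb[of e] gz0 gc[OF emb_idem[OF e]] unfolding class_eq by (auto simp: f_K_class intro!: carrI)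
  have posK: "pos (K0 A) = K0_class A ` idem_inf A" by (simp add: K0_def)
  have scaleK: "scale (K0 A) = K0_class A ` (single A ` {e \<in> carrier A. e \<otimes>\<^bsub>A\<^esub> e = e})"
    by (auto simp: K0_def single_def image_iff)
  have f_pos: "f ` pos (K0 A) = pos G" unfolding posK pos[symmetric] image_image using f_class by simp
  have f_scale: "f ` scale (K0 A) = scale G"
    unfolding scaleK scale[symmetric] image_image using f_class A.single_idem_iff by (intro image_cong) auto
  have pos_carr: "pos (K0 A) \<subseteq> carrier (K0 A)" using class_carr by (auto simp: posK)
  have scale_carr: "scale (K0 A) \<subseteq> carrier (K0 A)" using class_carr A.single_idem_iff by (auto simp: scaleK)
  have surj: "f ` carrier (K0 A) = carrier G"
  proof (intro equalityI subsetI)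
    fix \<eta> assume "\<eta> \<in> f ` carrier (K0 A)"
    then show "\<eta> \<in> carrier G" using gc by (auto simp: carr f_K_class)
  next
    fix \<eta> assume "\<eta> \<in> carrier G"
    then obtain a b where ab: "a \<in> pos G" "b \<in> pos G" "\<eta> = a \<otimes>\<^bsub>G\<^esub> inv\<^bsub>G\<^esub> b" using generating by blast
    obtain e e' where e: "e \<in> idem_inf A" "a = g (emb e)" "e' \<in> idem_inf A" "b = g (emb e')"
      using ab(1,2) unfolding pos[symmetric] by blast
    have "\<eta> = f (U.K_class (emb e) (emb e'))" using ab e emb_idem by (simp add: f_K_class)
    moreover have "U.K_class (emb e) (emb e') \<in> carrier (K0 A)" using e emb_idem tr_emb by (intro carrI) auto
    ultimately show "\<eta> \<in> f ` carrier (K0 A)" by blast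
  qed
  have one: "\<one>\<^bsub>K0 A\<^esub> = U.K_class z0 z0" by (simp add: K0_def U.K00_one z0_def)
  have one': "\<one>\<^bsub>K0 A\<^esub> \<in> carrier (K0 A)" "f \<one>\<^bsub>K0 A\<^esub> = \<one>\<^bsub>G\<^esub>"
    unfolding one using z0 gz0 by (auto simp: carr f_K_class)
  interpret K: comm_group "K0 A"
    by (rule comm_group_transport[OF G.comm_group_axioms inj surj closed hom one'])
  \<comment> \<open>All remaining axioms of a scaled preordered group are pulled back along \<open>f\<close>.\<close>
  have reflect: "x \<in> S" if "x \<in> carrier (K0 A)" "f x \<in> f ` S" "S \<subseteq> carrier (K0 A)" for x S
    using that inj by (auto simp: inj_on_def)
  have "scaled_preordered_group (K0 A)"
  proof (intro scaled_preordered_group.intro scaled_preordered_group_axioms.intro K.comm_group_axioms pos_carr)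
    show "\<one>\<^bsub>K0 A\<^esub> \<in> pos (K0 A)"
      by (rule reflect[OF one'(1) _ pos_carr]) (simp only: f_pos one'(2) G.one_pos)
    show "\<one>\<^bsub>K0 A\<^esub> \<in> scale (K0 A)"
      by (rule reflect[OF one'(1) _ scale_carr]) (simp only: f_scale one'(2) G.one_scale)
    show "scale (K0 A) \<subseteq> pos (K0 A)"
    proof
      fix x assume x: "x \<in> scale (K0 A)"
      then have "f x \<in> pos G" using f_scale G.scale_subset by blast
      then show "x \<in> pos (K0 A)" using reflect[OF _ _ pos_carr] x scale_carr f_pos by blast
    qed
    fix x y assume xy: "x \<in> pos (K0 A)" "y \<in> pos (K0 A)"
    then have c: "x \<in> carrier (K0 A)" "y \<in> carrier (K0 A)" using pos_carr by auto
    have "f x \<in> pos G" "f y \<in> pos G" using xy f_pos by auto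
    then have "f (x \<otimes>\<^bsub>K0 A\<^esub> y) \<in> f ` pos (K0 A)" unfolding f_pos hom[OF c] by (rule G.pos_closed)
    then show "x \<otimes>\<^bsub>K0 A\<^esub> y \<in> pos (K0 A)" by (rule reflect[OF closed[OF c] _ pos_carr])
  qed
  moreover have "f \<in> iso (K0 A) G"
    using inj surj hom by (auto simp: iso_def hom_def bij_betw_def)
  ultimately show ?thesis
    unfolding scaled_isomorphic_def using G f_pos f_scale by blast
qed

section \<open>The direct system of a Bratteli diagram\<close>

text \<open>A Bratteli diagram for \<open>G\<close> as provided by \<open>Bratteli_data\<close>. The algebra of stage \<open>k\<close> is the
  sum of the matrix algebras of sizes \<open>u k i\<close>.\<close>
locale Bratteli_system = scaled_Riesz_group G + lp_exponent p
  for G :: "'g scaled_group" (structure) and p :: real +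
  fixes n :: "nat \<Rightarrow> nat" and u :: "nat \<Rightarrow> nat \<Rightarrow> nat" and M :: "nat \<Rightarrow> nat \<Rightarrow> nat \<Rightarrow> nat" and g :: "nat \<Rightarrow> nat \<Rightarrow> 'g"
  assumes n_pos: "0 < n k" and u_pos: "0 < u k i"
    and ref: "refines (n k) (g k) (n (Suc k)) (g (Suc k)) (M k)" and g_pos: "g k i \<in> pos G"
    and u_le: "i < n (Suc k) \<Longrightarrow> (\<Sum>j<n k. M k i j * u k j) \<le> u (Suc k) i"
    and kernel_killed: "\<lbrakk>lincomb (n k) (g k) a = \<one>; i < n (Suc k)\<rbrakk> \<Longrightarrow> mat_vec (n k) (M k) a i = 0"
    and le_u_scale: "(\<And>i. i < n k \<Longrightarrow> x i \<le> u k i) \<Longrightarrow> lincomb (n k) (g k) (\<lambda>i. int (x i)) \<in> scale G"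
    and scale_ex: "s \<in> scale G \<Longrightarrow> \<exists>k x. (\<forall>i<n k. x i \<le> u k i) \<and> s = lincomb (n k) (g k) (\<lambda>i. int (x i))"
    and pos_ex: "s \<in> pos G \<Longrightarrow> \<exists>k x. s = lincomb (n k) (g k) (\<lambda>i. int (x i))"
begin

definition ds :: "nat \<Rightarrow> nat list" where
  "ds k = map (u k) [0..<n k]"

lemma ds_simps [simp]: "length (ds k) = n k" "j < n k \<Longrightarrow> ds k ! j = u k j"
  by (simp_all add: ds_def)

lemma ds_valid: "valid_dims (ds k)"
  using n_pos u_pos by (auto simp: valid_dims_def ds_def)

sublocale E: lp_block_embedding "ds k" "ds (Suc k)" "M k" p for k
  by unfold_locales (use u_le in simp)

sublocale MS: matrix_sum "ds k" p for k
  by unfold_locales (rule ds_valid)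

definition step :: "nat \<Rightarrow> complex mat list \<Rightarrow> complex mat list" where
  "step k = block_embedding.block (ds k) (ds (Suc k)) (M k)"

primrec phi :: "nat \<Rightarrow> nat \<Rightarrow> complex mat list \<Rightarrow> complex mat list" where
  "phi 0 m a = a"
| "phi (Suc l) m a = (if Suc l \<le> m then a else step l (phi l m a))"

lemma phi_same [simp]: "phi m m a = a"
  by (cases m) simp_all

lemma phi_hom: "m \<le> l \<Longrightarrow> phi l m \<in> alg_hom (LP (ds m)) (LP (ds l))"
proof (induction l rule: dec_induct)
  case base
  then show ?case by (simp add: alg_hom_def del: lp_matrix_sum_simps)
next
  case (step l)
  have "phi (Suc l) m = (\<lambda>a. E.block l (phi l m a))"
    using step.hyps by (simp add: fun_eq_iff step_def)
  then show ?case using step.IH E.block_hom[of l p]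
    by (auto simp: alg_hom_def Pi_iff simp del: lp_matrix_sum_simps)
qed

lemma phi_contractive:
  assumes "m \<le> l" and a: "a \<in> carrier (LP (ds m))"
  shows "nrm (LP (ds l)) (phi l m a) \<le> nrm (LP (ds m)) a"
  using assms(1)
proof (induction l rule: dec_induct)
  case (step l)
  have "phi l m a \<in> carrier (LP (ds l))" using phi_hom[OF step.hyps(1)] a by (auto simp: alg_hom_def simp del: lp_matrix_sum_simps)
  then have "nrm (LP (ds (Suc l))) (E.block l (phi l m a)) \<le> nrm (LP (ds l)) (phi l m a)"
    by (intro E.block_contractive ds_valid)
  then show ?case using step.IH step.hyps by (simp add: step_def del: lp_matrix_sum_simps)
qed simp

lemma phi_comp:
  assumes "k \<le> m" "m \<le> l"
  shows "phi l m (phi m k a) = phi l k a"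
  using assms(2,1) by (induction l rule: dec_induct) simp_all

sublocale contractive_system "\<lambda>k. LP (ds k)" phi
proof (rule contractive_system.intro)
  show "Banach_algebra (LP (ds k))" for k by (rule LP_Banach[OF ds_valid])
qed (simp_all add: phi_hom phi_contractive phi_comp del: lp_matrix_sum_simps)

lemma phi_diag_list:
  assumes "m \<le> l" and h: "\<And>k r. h k r = 0 \<or> h k r = (1 :: complex)"
  shows "\<exists>h'. phi l m (diag_list (ds m) h) = diag_list (ds l) h' \<and> (\<forall>k r. h' k r = 0 \<or> h' k r = 1)"
  using assms(1)
proof (induction l rule: dec_induct)
  case base
  then show ?case using h by auto
next
  case (step l)
  obtain h' where h': "phi l m (diag_list (ds m) h) = diag_list (ds l) h'" "\<forall>k r. h' k r = 0 \<or> h' k r = 1"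
    using step.IH by (elim exE conjE)
  obtain h'' where h'': "E.block l (diag_list (ds l) h') = diag_list (ds (Suc l)) h''" "\<forall>k r. h'' k r = 0 \<or> h'' k r = 1"
    by (rule E.block_diag_list[where h = h' and k = l]) (use h'(2) that in blast)+
  have "phi (Suc l) m (diag_list (ds m) h) = diag_list (ds (Suc l)) h''"
    using h'(1) h''(1) step.hyps by (simp add: step_def)
  then show ?case using h''(2) by (intro exI[of _ h''] conjI)
qed

lemma summand_one_diag: "lp_summand_one (ds m) k = diag_list (ds m) (\<lambda>j r. if j = k then 1 else 0)"
proof (rule nth_equalityI)
  fix j assume "j < length (lp_summand_one (ds m) k)"
  then have "j < n m" by (simp add: lp_summand_one_def)
  then show "lp_summand_one (ds m) k ! j = diag_list (ds m) (\<lambda>j r. if j = k then 1 else 0) ! j"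
    by (cases "j = k") (auto simp: lp_summand_one_def diag_list_nth intro!: eq_matI)
qed (simp add: lp_summand_one_def diag_list_def)

text \<open>Every identity of a summand is a diagonal idempotent, and so is its image under the block
  embeddings. Hence it is hermitian.\<close>
lemma AF_system: "spatial_AF_system p (\<lambda>k. LP (ds k)) phi"
proof -
  have id: "(\<lambda>x. x) \<in> isometric_iso (LP (ds k)) (LP (ds k))" for k
    by (auto simp: isometric_iso_def alg_hom_def bij_betw_def simp del: lp_matrix_sum_simps)
  have "spatial_ss_fd p (LP (ds m))" for m
    unfolding spatial_ss_fd_def using LP_Banach[OF ds_valid] ds_valid id by blast
  moreover have "spatial_hom p (LP (ds m)) (LP (ds l)) (phi l m)" if ml: "m \<le> l" for m l
    unfolding spatial_hom_def
  proof (intro conjI phi_hom ml exI[of _ "ds m"] exI[of _ "\<lambda>x. x"] ds_valid id allI impI)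
    fix k assume "k < length (ds m)"
    show "contractive_on ((\<lambda>x. x) ` lp_summand p (ds m) k) (LP (ds m)) (LP (ds l)) (phi l m)"
      unfolding contractive_on_def using phi_contractive[OF ml] by (auto simp: lp_summand_def simp del: lp_matrix_sum_simps)
    have "\<exists>h'. phi l m (lp_summand_one (ds m) k) = diag_list (ds l) h' \<and> (\<forall>k r. h' k r = 0 \<or> h' k r = 1)"
      unfolding summand_one_diag by (rule phi_diag_list[OF ml]) simp
    then obtain h' where h': "phi l m (lp_summand_one (ds m) k) = diag_list (ds l) h'" "\<And>k r. h' k r = 0 \<or> h' k r = 1"
      by blast
    show "hermitian_idempotent (LP (ds l)) (phi l m (lp_summand_one (ds m) k))"
      unfolding h'(1) by (rule diag_list_hermitian[OF ds_valid h'(2)])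
  qed
  moreover have "contractive_on (carrier (LP (ds m))) (LP (ds m)) (LP (ds l)) (phi l m)" if "m \<le> l" for m l
    unfolding contractive_on_def using phi_contractive[OF that] by blast
  ultimately show ?thesis
    unfolding spatial_AF_system_def using phi_comp by simp
qed

lemma AF_algebra: "spatial_Lp_AF_algebra p B"
proof -
  have "(\<lambda>x. x) \<in> isometric_iso B B" by (auto simp: isometric_iso_def alg_hom_def bij_betw_def)
  then show ?thesis unfolding spatial_Lp_AF_algebra_def using limit_Banach AF_system by blast
qed

section \<open>Matrices over the stages and over the limit\<close>

abbreviation "UD k \<equiv> unitization (LP (ds k))"
abbreviation "UB \<equiv> unitization B"
abbreviation "ND k \<equiv> mat_norm (unit_norm (LP (ds k)))"
abbreviation "NB \<equiv> mat_norm (unit_norm B)"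

text \<open>The matrices over the unitizations of the stages and the limit form again a direct system,
  with the maps \<open>up l k\<close> and \<open>lim k\<close>.\<close>
definition up :: "nat \<Rightarrow> nat \<Rightarrow> (nat \<Rightarrow> nat \<Rightarrow> complex mat list \<times> complex) \<Rightarrow> nat \<Rightarrow> nat \<Rightarrow> complex mat list \<times> complex" where
  "up l k = mmap (umap (phi l k))"

definition lim :: "nat \<Rightarrow> (nat \<Rightarrow> nat \<Rightarrow> complex mat list \<times> complex) \<Rightarrow> nat \<Rightarrow> nat \<Rightarrow> AF_element \<times> complex" where
  "lim k = mmap (umap (\<psi> k))"

lemma up_hom: "k \<le> l \<Longrightarrow> ring_hom_ring (UD k) (UD l) (umap (phi l k))"
  by (intro umap_ring_hom lp_matrix_sum_algebra phi_hom)

lemma lim_hom: "ring_hom_ring (UD k) UB (umap (\<psi> k))"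
  by (intro umap_ring_hom lp_matrix_sum_algebra B.complex_algebra_axioms \<psi>_hom)

sublocale UB: ring UB by (rule B.unitization_ring)

lemmas up_corner = ring_hom_ring.mmap_corner[OF up_hom, folded up_def]
lemmas up_mult = ring_hom_ring.mmap_mult[OF up_hom, folded up_def]
lemmas up_diff = ring_hom_ring.mmap_diff[OF up_hom, folded up_def]
lemmas lim_corner = ring_hom_ring.mmap_corner[OF lim_hom, folded lim_def]
lemmas lim_mult = ring_hom_ring.mmap_mult[OF lim_hom, folded lim_def]
lemmas lim_diff = ring_hom_ring.mmap_diff[OF lim_hom, folded lim_def]
lemmas lim_rel = ring_hom_ring.mmap_rel[OF lim_hom, folded lim_def]
lemmas lim_block_diag = ring_hom_ring.mmap_block_diag[OF lim_hom, folded lim_def]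

lemma corner_fst: "a \<in> corner (unitization A) N \<Longrightarrow> fst (a i j) \<in> carrier A"
  using cornerD(1)[of a "unitization A" N i j] by (cases "a i j") simp

lemma lim_up: "\<lbrakk>k \<le> l; a \<in> corner (UD k) N\<rbrakk> \<Longrightarrow> lim l (up l k a) = lim k a"
  by (intro ext) (simp add: lim_def up_def mmap_def umap_def split_def \<psi>_push corner_fst del: lp_matrix_sum_simps)

lemma up_up: "\<lbrakk>k \<le> m; m \<le> l\<rbrakk> \<Longrightarrow> up l m (up m k a) = up l k a"
  by (auto simp: up_def mmap_def umap_def fun_eq_iff split_def phi_comp)

lemma up_same [simp]: "up k k a = a"
  by (auto simp: up_def mmap_def umap_def fun_eq_iff split_def)

text \<open>Whatever is small in the limit is small at a late stage; this brings inequalities for norms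
  down to a stage.\<close>
lemma norm_up_tendsto: "a \<in> corner (UD k) N \<Longrightarrow> (\<lambda>l. ND l N (up l k a)) \<longlonglongrightarrow> NB N (lim k a)"
  unfolding mat_norm_def unit_norm_def up_def lim_def mmap_def umap_def split_def fst_conv snd_conv
  by (intro tendsto_sum tendsto_add tendsto_const \<psi>_nrm corner_fst)

lemma norm_lim_le: "a \<in> corner (UD k) N \<Longrightarrow> NB N (lim k a) \<le> ND k N a"
  unfolding mat_norm_def unit_norm_def lim_def mmap_def umap_def split_def fst_conv snd_conv
proof (intro sum_mono add_right_mono)
  fix i j assume "a \<in> corner (UD k) N"
  then have c: "fst (a i j) \<in> carrier (LP (ds k))" by (rule corner_fst)
  show "nrm B (\<psi> k (fst (a i j))) \<le> nrm (LP (ds k)) (fst (a i j))"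
    by (rule LIMSEQ_le_const2[OF \<psi>_nrm[OF c]]) (use contr[OF _ c] in blast)
qed

lemma mat_B_ring: "Banach_ring (mat_ring UB N) (NB N)"
  by (rule Banach_ring.mat_Banach_ring[OF B.unitization_Banach_ring])

lemma mat_D_ring: "Banach_ring (mat_ring (UD k) N) (ND k N)"
  by (rule Banach_ring.mat_Banach_ring[OF Dk.unitization_Banach_ring])

text \<open>Each of the finitely many entries is approximated at some stage. All these are moved to the
  common stage \<open>K\<close>; scalar parts need no approximation.\<close>
lemma mat_dense:
  assumes X: "X \<in> corner UB N" and e: "0 < e"
  shows "\<exists>k. \<exists>a\<in>corner (UD k) N. NB N (X \<ominus>\<^bsub>mat_ring UB N\<^esub> lim k a) < e"
proof -
  define d where "d = e / (real N * real N + 1)"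
  have d: "d > 0" using e by (auto simp: d_def intro!: divide_pos_pos add_nonneg_pos)
  have "\<exists>k a. a \<in> carrier (LP (ds k)) \<and> nrm B (fst (X i j) \<ominus>\<^bsub>B\<^esub> \<psi> k a) < d" for i j
    using \<psi>_dense[OF corner_fst[OF X, of i j] d] by blast
  then obtain k a where a: "\<And>i j. a i j \<in> carrier (LP (ds (k i j)))"
    "\<And>i j. nrm B (fst (X i j) \<ominus>\<^bsub>B\<^esub> \<psi> (k i j) (a i j)) < d" by metis
  define K where "K = (\<Sum>i<N. \<Sum>j<N. k i j)"
  have K: "k i j \<le> K" if "i < N" "j < N" for i j
  proof -
    have "k i j \<le> (\<Sum>j<N. k i j)" using that by (intro member_le_sum) auto
    also have "\<dots> \<le> K" unfolding K_def using that by (intro member_le_sum[of i _ "\<lambda>i. \<Sum>j<N. k i j"]) auto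
    finally show ?thesis .
  qed
  define b where "b = (\<lambda>i j. if i < N \<and> j < N then (phi K (k i j) (a i j), snd (X i j)) else \<zero>\<^bsub>UD K\<^esub>)"
  have b: "b \<in> corner (UD K) N"
    using hom_closed[OF K a(1)] MS.MU.zero_closed[of K]
    by (intro cornerI) (auto simp: b_def simp del: lp_matrix_sum_simps)
  have lb: "lim K b \<in> corner UB N" by (rule lim_corner[OF b])
  have entry: "unit_norm B ((X \<ominus>\<^bsub>mat_ring UB N\<^esub> lim K b) i j) \<le> d" if ij: "i < N" "j < N" for i j
  proof -
    have "lim K b i j = (\<psi> (k i j) (a i j), snd (X i j))"
      using ij \<psi>_push[OF K[OF ij] a(1)] by (simp add: lim_def mmap_def b_def)
    then have "(X \<ominus>\<^bsub>mat_ring UB N\<^esub> lim K b) i j = (fst (X i j) \<ominus>\<^bsub>B\<^esub> \<psi> (k i j) (a i j), 0)"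
      using B.unitization_diff[OF cornerD(1)[OF X, of i j] cornerD(1)[OF lb, of i j]]
      by (simp add: UB.mat_ring_diff[OF X lb])
    then show ?thesis using a(2)[of i j] by (simp add: unit_norm_def)
  qed
  have "NB N (X \<ominus>\<^bsub>mat_ring UB N\<^esub> lim K b) \<le> (\<Sum>i<N. \<Sum>j<N. d)"
    unfolding mat_norm_def by (intro sum_mono entry) auto
  also have "\<dots> = real N * real N * d" by simp
  also have "\<dots> < e"
  proof -
    have "real N * real N * d < (real N * real N + 1) * d" using d by (simp add: distrib_right)
    also have "\<dots> = e" using add_nonneg_pos[of "real N * real N" 1] by (simp add: d_def)
    finally show ?thesis .
  qed
  finally show ?thesis using b by blast
qed

lemma mat_sequence:
  assumes X: "X \<in> corner UB N"
  obtains k a where "\<And>m. a m \<in> corner (UD (k m)) N" "Banach_ring.lims (mat_ring UB N) (NB N) (\<lambda>m. lim (k m) (a m)) X"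
proof -
  interpret RB: Banach_ring "mat_ring UB N" "NB N" by (rule mat_B_ring)
  have "\<exists>k a. a \<in> corner (UD k) N \<and> NB N (X \<ominus>\<^bsub>mat_ring UB N\<^esub> lim k a) < 1 / real (Suc m)" for m
    using mat_dense[OF X, of "1 / real (Suc m)"] by auto
  then obtain k a where a: "\<And>m. a m \<in> corner (UD (k m)) N"
    "\<And>m. NB N (X \<ominus>\<^bsub>mat_ring UB N\<^esub> lim (k m) (a m)) < 1 / real (Suc m)" by metis
  have lim_carrier: "lim (k m) (a m) \<in> carrier (mat_ring UB N)" for m using lim_corner[OF a(1)] by simp
  have "RB.lims (\<lambda>m. lim (k m) (a m)) X"
  proof (rule RB.lims_bound[OF lim_carrier])
    show "X \<in> carrier (mat_ring UB N)" using X by simp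
    then show "NB N (lim (k m) (a m) \<ominus>\<^bsub>mat_ring UB N\<^esub> X) \<le> 1 / real (Suc m)" for m
      using a(2)[of m] RB.N_diff_commute[OF lim_carrier[of m]] by simp
    show "(\<lambda>m. 1 / real (Suc m)) \<longlonglongrightarrow> 0" using LIMSEQ_inverse_real_of_nat by (simp add: inverse_eq_divide)
  qed
  then show thesis using that a(1) by blast
qed

definition stage :: "nat \<Rightarrow> nat \<Rightarrow> (nat \<Rightarrow> nat \<Rightarrow> complex mat list \<times> complex) \<Rightarrow> bool" where
  "stage k N e \<longleftrightarrow> e \<in> corner (UD k) N \<and> M_mult (UD k) e e = e"

lemma stageD: "stage k N e \<Longrightarrow> e \<in> corner (UD k) N" "stage k N e \<Longrightarrow> M_mult (UD k) e e = e"
  by (auto simp: stage_def)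

lemma stage_up: "\<lbrakk>k \<le> l; stage k N e\<rbrakk> \<Longrightarrow> stage l N (up l k e)"
  by (auto simp: stage_def up_corner up_mult[symmetric])

lemma stage_lim: "stage k N e \<Longrightarrow> lim k e \<in> idem_inf UB"
  by (auto simp: stage_def lim_mult[symmetric] intro!: UB.idem_infI[OF lim_corner])

lemma norm_one_D: "ND k N \<one>\<^bsub>mat_ring (UD k) N\<^esub> = real N"
proof -
  have "unit_norm (LP (ds k)) (\<one>\<^bsub>mat_ring (UD k) N\<^esub> i j) = (if i = j then 1 else 0)" if "i < N" for i j
    using that Dk.nrm_zero[of k] by (simp add: mat_ring_def unit_norm_def del: lp_matrix_sum_simps)
  then have "ND k N \<one>\<^bsub>mat_ring (UD k) N\<^esub> = (\<Sum>i<N. \<Sum>j<N. if i = j then 1 else 0)"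
    unfolding mat_norm_def by (intro sum.cong refl) auto
  then show ?thesis by simp
qed

text \<open>Every idempotent over the limit is equivalent to one that comes from a stage. An
  approximation \<open>X\<close> of \<open>E\<close> from a stage is nearly idempotent in the limit, hence also at a later
  stage, where \<open>idempotent_near\<close> makes it idempotent without moving it far. The result is close to
  \<open>E\<close>, hence equivalent to it.\<close>
lemma idempotent_from_stage:
  assumes E: "E \<in> corner UB N" "M_mult UB E E = E"
  shows "\<exists>k e. stage k N e \<and> (E, lim k e) \<in> idem_rel UB"
proof -
  interpret RB: Banach_ring "mat_ring UB N" "NB N" by (rule mat_B_ring)
  have Ec: "E \<in> carrier (mat_ring UB N)" using E by simp
  define c where "c = NB N E + 1"
  define K where "K = real N + 1"
  \<comment> \<open>An idempotent at distance less than \<open>\<eta>\<close> from \<open>E\<close> has norm at most \<open>c\<close> and is equivalent to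
    \<open>E\<close>. A defect below \<open>\<delta>\<close> permits the Newton iteration at a stage and lets it move by at most
    \<open>\<eta> / 2\<close>. Here \<open>K\<close> bounds the norm of the unit matrix.\<close>
  define \<eta> where "\<eta> = 1 / (2 * (c + 1) * (c + 1))"
  define \<delta> where "\<delta> = min (1 / (16 * K)) (\<eta> / (4 * (K + 2 * c)))"
  have c: "c \<ge> 1" using RB.N_nonneg[OF Ec] by (simp add: c_def)
  have K: "K \<ge> 1" by (simp add: K_def)
  have \<eta>: "\<eta> > 0" using c by (simp add: \<eta>_def)
  have \<delta>: "\<delta> > 0" using \<eta> c K by (auto simp: \<delta>_def)
  have "2 * \<delta> * (K + 2 * c) \<le> 2 * (\<eta> / (4 * (K + 2 * c))) * (K + 2 * c)"
    using c K by (intro mult_right_mono mult_left_mono) (auto simp: \<delta>_def)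
  also have "\<dots> = \<eta> / 2" using c K by (simp add: field_simps)
  finally have \<delta>\<eta>: "2 * \<delta> * (K + 2 * c) \<le> \<eta> / 2" .
  obtain ks as where as: "\<And>m. as m \<in> corner (UD (ks m)) N" "RB.lims (\<lambda>m. lim (ks m) (as m)) E"
    using mat_sequence[OF E(1)] by blast
  let ?X = "\<lambda>m. lim (ks m) (as m)"
  have "E \<otimes>\<^bsub>mat_ring UB N\<^esub> E \<ominus>\<^bsub>mat_ring UB N\<^esub> E = \<zero>\<^bsub>mat_ring UB N\<^esub>"
    using E(2) Ec by (simp add: a_minus_def[of "mat_ring UB N"] RB.r_neg del: mat_ring_simps(3,4))
  then have 1: "(\<lambda>m. NB N (?X m \<otimes>\<^bsub>mat_ring UB N\<^esub> ?X m \<ominus>\<^bsub>mat_ring UB N\<^esub> ?X m)) \<longlonglongrightarrow> 0"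
    using RB.lims_N[OF RB.lims_diff[OF RB.lims_mult[OF as(2) as(2)] as(2)]] RB.N_zero by simp
  have 2: "(\<lambda>m. NB N (?X m)) \<longlonglongrightarrow> NB N E" by (rule RB.lims_N[OF as(2)])
  have 3: "(\<lambda>m. NB N (?X m \<ominus>\<^bsub>mat_ring UB N\<^esub> E)) \<longlonglongrightarrow> 0" by (rule RB.limsD(3)[OF as(2)])
  have "\<forall>\<^sub>F m in sequentially. NB N (?X m \<otimes>\<^bsub>mat_ring UB N\<^esub> ?X m \<ominus>\<^bsub>mat_ring UB N\<^esub> ?X m) < \<delta> \<and>
      NB N (?X m) < c \<and> NB N (?X m \<ominus>\<^bsub>mat_ring UB N\<^esub> E) < \<eta> / 2"
    using order_tendstoD(2)[OF 1 \<delta>] order_tendstoD(2)[OF 2, of c] order_tendstoD(2)[OF 3, of "\<eta> / 2"] \<eta>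
    by (auto simp: c_def eventually_conj_iff)
  then obtain m where m: "NB N (?X m \<otimes>\<^bsub>mat_ring UB N\<^esub> ?X m \<ominus>\<^bsub>mat_ring UB N\<^esub> ?X m) < \<delta>"
      "NB N (?X m) < c" "NB N (?X m \<ominus>\<^bsub>mat_ring UB N\<^esub> E) < \<eta> / 2"
    using eventually_happens'[OF sequentially_bot] by blast
  define k where "k = ks m"
  define a where "a = as m"
  define X where "X = lim k a"
  have a: "a \<in> corner (UD k) N" using as(1) by (simp add: a_def k_def)
  have Xc: "X \<in> carrier (mat_ring UB N)" using lim_corner[OF a] by (simp add: X_def)
  interpret RK: Banach_ring "mat_ring (UD k) N" "ND k N" by (rule mat_D_ring)
  define w where "w = a \<otimes>\<^bsub>mat_ring (UD k) N\<^esub> a \<ominus>\<^bsub>mat_ring (UD k) N\<^esub> a"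
  have aa: "M_mult (UD k) a a \<in> corner (UD k) N" using a by (intro MS.MU.M_mult_closed)
  have w: "w \<in> corner (UD k) N" using RK.minus_closed[of "a \<otimes>\<^bsub>mat_ring (UD k) N\<^esub> a" a] a aa by (simp add: w_def)
  have "lim k w = X \<otimes>\<^bsub>mat_ring UB N\<^esub> X \<ominus>\<^bsub>mat_ring UB N\<^esub> X"
    using a aa by (simp add: w_def lim_diff lim_mult X_def)
  then have "NB N (lim k w) < \<delta>" using m(1) by (simp add: X_def a_def k_def)
  then have "\<forall>\<^sub>F l in sequentially. ND l N (up l k w) < \<delta> \<and> ND l N (up l k a) < c \<and> k \<le> l"
    using order_tendstoD(2)[OF norm_up_tendsto[OF w]] order_tendstoD(2)[OF norm_up_tendsto[OF a], of c] m(2)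
    by (auto simp: eventually_conj_iff a_def k_def eventually_ge_at_top)
  then obtain l where l: "ND l N (up l k w) < \<delta>" "ND l N (up l k a) < c" "k \<le> l"
    using eventually_happens'[OF sequentially_bot] by blast
  interpret RL: Banach_ring "mat_ring (UD l) N" "ND l N" by (rule mat_D_ring)
  define z where "z = up l k a"
  have z: "z \<in> carrier (mat_ring (UD l) N)" using up_corner[OF l(3) a] by (simp add: z_def)
  have uw: "up l k w = z \<otimes>\<^bsub>mat_ring (UD l) N\<^esub> z \<ominus>\<^bsub>mat_ring (UD l) N\<^esub> z"
    using a aa l(3) by (simp add: w_def up_diff up_mult z_def)
  have "\<exists>e\<in>carrier (mat_ring (UD l) N). e \<otimes>\<^bsub>mat_ring (UD l) N\<^esub> e = e \<and>
      ND l N (e \<ominus>\<^bsub>mat_ring (UD l) N\<^esub> z) \<le> 2 * ND l N (z \<otimes>\<^bsub>mat_ring (UD l) N\<^esub> z \<ominus>\<^bsub>mat_ring (UD l) N\<^esub> z) * (K + 2 * ND l N z)"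
  proof (rule RL.idempotent_near[OF z K])
    show "ND l N \<one>\<^bsub>mat_ring (UD l) N\<^esub> \<le> K" using norm_one_D[of l N] by (simp add: K_def)
    have "ND l N (up l k w) \<le> 1 / (16 * K)" using l(1) by (simp add: \<delta>_def)
    then show "ND l N (z \<otimes>\<^bsub>mat_ring (UD l) N\<^esub> z \<ominus>\<^bsub>mat_ring (UD l) N\<^esub> z) \<le> 1 / (16 * K)" by (simp only: uw)
  qed
  then obtain e where e: "e \<in> corner (UD l) N" "M_mult (UD l) e e = e"
    "ND l N (e \<ominus>\<^bsub>mat_ring (UD l) N\<^esub> z) \<le> 2 * ND l N (up l k w) * (K + 2 * ND l N z)" unfolding uw by auto
  have "2 * ND l N (up l k w) * (K + 2 * ND l N z) \<le> 2 * \<delta> * (K + 2 * c)"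
    using l(1,2) \<delta> K RL.N_nonneg[OF z] RL.N_nonneg[of "up l k w"] up_corner[OF l(3) w]
    by (intro mult_mono add_mono) (auto simp: z_def)
  then have ez: "ND l N (e \<ominus>\<^bsub>mat_ring (UD l) N\<^esub> z) \<le> \<eta> / 2" using e(3) \<delta>\<eta> by linarith
  define F where "F = lim l e"
  have Fc: "F \<in> carrier (mat_ring UB N)" using lim_corner[OF e(1)] by (simp add: F_def)
  have FF: "F \<otimes>\<^bsub>mat_ring UB N\<^esub> F = F" using lim_mult[OF e(1) e(1)] e(2) by (simp add: F_def)
  have Xz: "X = lim l z" unfolding X_def z_def using lim_up[OF l(3) a] by simp
  have ez': "e \<ominus>\<^bsub>mat_ring (UD l) N\<^esub> z \<in> corner (UD l) N" using RL.minus_closed[of e z] e(1) z by simp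
  have "NB N (F \<ominus>\<^bsub>mat_ring UB N\<^esub> X) \<le> \<eta> / 2"
    using norm_lim_le[OF ez'] ez lim_diff[of e l N z] e(1) z by (simp add: F_def Xz)
  then have EF: "NB N (E \<ominus>\<^bsub>mat_ring UB N\<^esub> F) < \<eta>"
    using RB.N_diff_triangle[OF Fc Xc Ec] m(3) RB.N_diff_commute[OF Ec Fc] by (simp add: X_def a_def k_def)
  have "\<eta> \<le> 1 / 2"
    unfolding \<eta>_def using c mult_mono[of 1 "c + 1" 1 "c + 1"] by (simp add: divide_le_eq algebra_simps)
  then have NF: "NB N F \<le> c"
    using RB.N_add[of "F \<ominus>\<^bsub>mat_ring UB N\<^esub> E" E] Fc Ec EF RB.N_diff_commute[OF Ec Fc]
    by (simp add: c_def a_minus_def RB.a_assoc RB.l_neg del: mat_ring_simps)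
  have small: "c * \<eta> * c < 1"
  proof -
    have "c * c < 2 * (c + 1) * (c + 1)" using c by (simp add: algebra_simps add_strict_increasing)
    then show ?thesis using c by (simp add: \<eta>_def divide_less_eq)
  qed
  have bound: "NB N V * NB N (E \<ominus>\<^bsub>mat_ring UB N\<^esub> F) * NB N V < 1" if "V \<in> carrier (mat_ring UB N)" "NB N V \<le> c" for V
  proof -
    have "NB N V * NB N (E \<ominus>\<^bsub>mat_ring UB N\<^esub> F) * NB N V \<le> c * \<eta> * c"
      using that EF RB.N_nonneg[OF that(1)] RB.N_nonneg[OF RB.minus_closed[OF Ec Fc]] c \<eta> by (intro mult_mono) auto
    then show ?thesis using small by linarith
  qed
  have "\<exists>x\<in>carrier (mat_ring UB N). \<exists>y\<in>carrier (mat_ring UB N). x \<otimes>\<^bsub>mat_ring UB N\<^esub> y = E \<and> y \<otimes>\<^bsub>mat_ring UB N\<^esub> x = F"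
    by (rule RB.equivalent_if_near[OF Ec _ Fc FF bound[OF Ec] bound[OF Fc NF]]) (use E(2) in \<open>auto simp: c_def\<close>)
  then obtain x y where "x \<in> corner UB N" "y \<in> corner UB N" "M_mult UB x y = E" "M_mult UB y x = F" by auto
  moreover have "stage l N e" using e by (simp add: stage_def)
  ultimately have "(E, lim l e) \<in> idem_rel UB"
    using UB.idem_infI[OF E] stage_lim[of l N e] by (intro UB.idem_relI[of x N y]) (auto simp: F_def)
  then show ?thesis using \<open>stage l N e\<close> by blast
qed

text \<open>If idempotents from a stage become equivalent in the limit, by \<open>X\<close> and \<open>Y\<close>, then
  approximations of \<open>X\<close> and \<open>Y\<close> from a stage, cut down by the idempotents, are nearly inverse to
  each other in the limit, hence at a later stage. There the Neumann series makes them inverse.\<close>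
lemma stage_rel_descends:
  assumes e: "stage k N e" and f: "stage k N f" and rel: "(lim k e, lim k f) \<in> idem_rel UB"
  shows "\<exists>l\<ge>k. (up l k e, up l k f) \<in> idem_rel (UD l)"
proof -
  interpret RB: Banach_ring "mat_ring UB N" "NB N" by (rule mat_B_ring)
  define E F where "E = lim k e" and "F = lim k f"
  have E: "E \<in> corner UB N" and F: "F \<in> corner UB N"
    unfolding E_def F_def using lim_corner stageD(1) e f by blast+
  obtain X Y where X: "X \<in> corner UB N" and Y: "Y \<in> corner UB N"
    and XY: "M_mult UB X Y = E" "M_mult UB Y X = F" "M_mult UB E X = X" "M_mult UB X F = X" "M_mult UB F Y = Y" "M_mult UB Y E = Y"
    using UB.idem_rel_corner[OF rel[folded E_def F_def] E F] by blast
  obtain k1 a where a: "\<And>m. a m \<in> corner (UD (k1 m)) N" "RB.lims (\<lambda>m. lim (k1 m) (a m)) X"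
    using mat_sequence[OF X] by blast
  obtain k2 b where b: "\<And>m. b m \<in> corner (UD (k2 m)) N" "RB.lims (\<lambda>m. lim (k2 m) (b m)) Y"
    using mat_sequence[OF Y] by blast
  define x where "x = (\<lambda>m. M_mult UB (M_mult UB E (lim (k1 m) (a m))) F)"
  define y where "y = (\<lambda>m. M_mult UB (M_mult UB F (lim (k2 m) (b m))) E)"
  have cE: "RB.lims (\<lambda>_. E) E" and cF: "RB.lims (\<lambda>_. F) F"
    by (rule RB.lims_const, use E F in simp)+
  have lx: "RB.lims x X"
    using RB.lims_mult[OF RB.lims_mult[OF cE a(2)] cF] XY by (simp add: x_def)
  have ly: "RB.lims y Y"
    using RB.lims_mult[OF RB.lims_mult[OF cF b(2)] cE] XY by (simp add: y_def)
  have z: "E \<ominus>\<^bsub>mat_ring UB N\<^esub> E = \<zero>\<^bsub>mat_ring UB N\<^esub>" "F \<ominus>\<^bsub>mat_ring UB N\<^esub> F = \<zero>\<^bsub>mat_ring UB N\<^esub>"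
    using E F RB.r_neg[of E] RB.r_neg[of F] by (simp_all add: a_minus_def[of "mat_ring UB N"] del: mat_ring_simps(3,4))
  have 1: "(\<lambda>m. NB N (E \<ominus>\<^bsub>mat_ring UB N\<^esub> M_mult UB (x m) (y m))) \<longlonglongrightarrow> 0"
    using RB.lims_N[OF RB.lims_diff[OF cE RB.lims_mult[OF lx ly]]] XY z RB.N_zero by simp
  have 2: "(\<lambda>m. NB N (F \<ominus>\<^bsub>mat_ring UB N\<^esub> M_mult UB (y m) (x m))) \<longlonglongrightarrow> 0"
    using RB.lims_N[OF RB.lims_diff[OF cF RB.lims_mult[OF ly lx]]] XY z RB.N_zero by simp
  have "\<forall>\<^sub>F m in sequentially. NB N (E \<ominus>\<^bsub>mat_ring UB N\<^esub> M_mult UB (x m) (y m)) < 1 \<and>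
      NB N (F \<ominus>\<^bsub>mat_ring UB N\<^esub> M_mult UB (y m) (x m)) < 1"
    using order_tendstoD(2)[OF 1, of 1] order_tendstoD(2)[OF 2, of 1] by (auto simp: eventually_conj_iff)
  then obtain m where m: "NB N (E \<ominus>\<^bsub>mat_ring UB N\<^esub> M_mult UB (x m) (y m)) < 1"
      "NB N (F \<ominus>\<^bsub>mat_ring UB N\<^esub> M_mult UB (y m) (x m)) < 1"
    using eventually_happens'[OF sequentially_bot] by blast
  define l0 where "l0 = max k (max (k1 m) (k2 m))"
  have le: "k \<le> l0" "k1 m \<le> l0" "k2 m \<le> l0" by (auto simp: l0_def)
  \<comment> \<open>The defect of the cut down elements \<open>e a f\<close> and \<open>f b e\<close> from being inverse to each other,
    written for an arbitrary stage so that its image at later stages and in the limit can be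
    computed.\<close>
  define nearly where "nearly = (\<lambda>l e f a b. e \<ominus>\<^bsub>mat_ring (UD l) N\<^esub>
      M_mult (UD l) (M_mult (UD l) (M_mult (UD l) e a) f) (M_mult (UD l) (M_mult (UD l) f b) e))"
  define e0 f0 a0 b0 where "e0 = up l0 k e" and "f0 = up l0 k f" and "a0 = up l0 (k1 m) (a m)" and "b0 = up l0 (k2 m) (b m)"
  have c0: "e0 \<in> corner (UD l0) N" "f0 \<in> corner (UD l0) N" "a0 \<in> corner (UD l0) N" "b0 \<in> corner (UD l0) N"
    unfolding e0_def f0_def a0_def b0_def using up_corner le stageD(1) e f a(1) b(1) by blast+
  have lim0: "lim l0 e0 = E" "lim l0 f0 = F" "lim l0 a0 = lim (k1 m) (a m)" "lim l0 b0 = lim (k2 m) (b m)"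
    unfolding e0_def f0_def a0_def b0_def E_def F_def
    using lim_up[OF le(1) stageD(1)[OF e]] lim_up[OF le(1) stageD(1)[OF f]] lim_up[OF le(2) a(1)] lim_up[OF le(3) b(1)] by auto
  have nearly_corner: "nearly l p q r s \<in> corner (UD l) N"
    if "p \<in> corner (UD l) N" "q \<in> corner (UD l) N" "r \<in> corner (UD l) N" "s \<in> corner (UD l) N" for l p q r s
  proof -
    interpret RL: Banach_ring "mat_ring (UD l) N" "ND l N" by (rule mat_D_ring)
    show ?thesis
      unfolding nearly_def using that
        RL.minus_closed[of p "M_mult (UD l) (M_mult (UD l) (M_mult (UD l) p r) q) (M_mult (UD l) (M_mult (UD l) q s) p)"]
      by (simp add: MS.MU.M_mult_closed)
  qed
  have lim_nearly: "lim l0 (nearly l0 e0 f0 a0 b0) = E \<ominus>\<^bsub>mat_ring UB N\<^esub> M_mult UB (x m) (y m)"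
    "lim l0 (nearly l0 f0 e0 b0 a0) = F \<ominus>\<^bsub>mat_ring UB N\<^esub> M_mult UB (y m) (x m)"
    unfolding nearly_def x_def y_def
    using c0 lim0 by (simp_all add: lim_diff[where n = N] lim_mult[where n = N] MS.MU.M_mult_closed)
  have "\<forall>\<^sub>F l in sequentially. ND l N (up l l0 (nearly l0 e0 f0 a0 b0)) < 1 \<and>
      ND l N (up l l0 (nearly l0 f0 e0 b0 a0)) < 1 \<and> l0 \<le> l"
    using order_tendstoD(2)[OF norm_up_tendsto[OF nearly_corner[OF c0(1-4)]], of 1]
      order_tendstoD(2)[OF norm_up_tendsto[OF nearly_corner[OF c0(2,1,4,3)]], of 1] m
    by (auto simp: eventually_conj_iff lim_nearly eventually_ge_at_top)
  then obtain l where l: "ND l N (up l l0 (nearly l0 e0 f0 a0 b0)) < 1"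
      "ND l N (up l l0 (nearly l0 f0 e0 b0 a0)) < 1" "l0 \<le> l"
    using eventually_happens'[OF sequentially_bot] by blast
  interpret RL: Banach_ring "mat_ring (UD l) N" "ND l N" by (rule mat_D_ring)
  define e1 f1 a1 b1 where "e1 = up l l0 e0" and "f1 = up l l0 f0" and "a1 = up l l0 a0" and "b1 = up l l0 b0"
  have c1: "e1 \<in> corner (UD l) N" "f1 \<in> corner (UD l) N" "a1 \<in> corner (UD l) N" "b1 \<in> corner (UD l) N"
    unfolding e1_def f1_def a1_def b1_def using up_corner[OF l(3)] c0 by blast+
  have up_nearly: "up l l0 (nearly l0 e0 f0 a0 b0) = nearly l e1 f1 a1 b1" "up l l0 (nearly l0 f0 e0 b0 a0) = nearly l f1 e1 b1 a1"
    unfolding nearly_def e1_def f1_def a1_def b1_def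
    using c0 l(3) by (simp_all add: up_diff[where n = N] up_mult[where n = N] MS.MU.M_mult_closed)
  have e1: "e1 = up l k e" "f1 = up l k f" unfolding e1_def f1_def e0_def f0_def using up_up le(1) l(3) by auto
  have idem: "M_mult (UD l) e1 e1 = e1" "M_mult (UD l) f1 f1 = f1"
    unfolding e1 using stageD(2)[OF stage_up] e f le(1) l(3) by (meson order_trans)+
  note assoc = MS.MU.M_mult_assoc[of _ _ N]
  let ?x = "M_mult (UD l) (M_mult (UD l) e1 a1) f1" and ?y = "M_mult (UD l) (M_mult (UD l) f1 b1) e1"
  have "\<exists>y'\<in>carrier (mat_ring (UD l) N). ?x \<otimes>\<^bsub>mat_ring (UD l) N\<^esub> y' = e1 \<and> y' \<otimes>\<^bsub>mat_ring (UD l) N\<^esub> ?x = f1"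
  proof (rule RL.equivalent_if_nearly_inverse[where y = ?y])
    show "e1 \<otimes>\<^bsub>mat_ring (UD l) N\<^esub> ?x = ?x" "f1 \<otimes>\<^bsub>mat_ring (UD l) N\<^esub> ?y = ?y"
      using c1 idem by (simp_all add: assoc[symmetric] MS.MU.M_mult_closed)
    show "?x \<otimes>\<^bsub>mat_ring (UD l) N\<^esub> f1 = ?x" "?y \<otimes>\<^bsub>mat_ring (UD l) N\<^esub> e1 = ?y"
      using c1 idem by (simp_all add: assoc MS.MU.M_mult_closed)
    show "ND l N (e1 \<ominus>\<^bsub>mat_ring (UD l) N\<^esub> ?x \<otimes>\<^bsub>mat_ring (UD l) N\<^esub> ?y) < 1"
      "ND l N (f1 \<ominus>\<^bsub>mat_ring (UD l) N\<^esub> ?y \<otimes>\<^bsub>mat_ring (UD l) N\<^esub> ?x) < 1"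
      using l(1,2) unfolding up_nearly by (simp_all add: nearly_def)
  qed (use c1 idem in \<open>simp_all add: MS.MU.M_mult_closed\<close>)
  then obtain y' where "y' \<in> corner (UD l) N" "M_mult (UD l) ?x y' = e1" "M_mult (UD l) y' ?x = f1" by auto
  then have "(e1, f1) \<in> idem_rel (UD l)"
    using c1 idem by (intro MS.MU.idem_relI[of ?x l N y']) (auto intro: MS.MU.M_mult_closed MS.MU.idem_infI)
  then show ?thesis using e1 le(1) l(3) by (intro exI[of _ l]) auto
qed

end

section \<open>The classifying invariant of the limit\<close>

lemma sum_lessThan_add: "(\<Sum>i<m + n. f i) = (\<Sum>i<m. f i) + (\<Sum>i<n. f (m + i) :: 'a :: comm_monoid_add)" for m n :: nat
  by (induction n) (simp_all add: add.assoc)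

context Bratteli_system begin

text \<open>The traces are integers by \<open>summand_trace_int\<close>, so that rounding down only changes the
  type.\<close>
definition trace_vec :: "nat \<Rightarrow> nat \<Rightarrow> (nat \<Rightarrow> nat \<Rightarrow> complex mat list \<times> complex) \<Rightarrow> nat \<Rightarrow> int" where
  "trace_vec k N e j = \<lfloor>Re (summand_trace (ds k) N j e)\<rfloor>"

text \<open>The class of an idempotent of a stage, as an element of \<open>G\<close>.\<close>
definition val :: "nat \<Rightarrow> nat \<Rightarrow> (nat \<Rightarrow> nat \<Rightarrow> complex mat list \<times> complex) \<Rightarrow> 'g" where
  "val k N e = lincomb (n k) (g k) (trace_vec k N e)"

lemma g_carrier: "g k i \<in> carrier G"
  using g_pos pos_carrier by blast

lemma val_closed: "val k N e \<in> carrier G"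
  unfolding val_def by (rule lincomb_closed) (rule g_carrier)

lemma trace_vec:
  assumes "stage k N e" "j < n k"
  shows "of_int (trace_vec k N e j) = summand_trace (ds k) N j e"
proof -
  obtain t where "summand_trace (ds k) N j e = of_int t"
    using MS.summand_trace_int[of e k N j] stageD[OF assms(1)] assms(2) by auto
  then show ?thesis by (simp add: trace_vec_def)
qed

lemma trace_vec_eqI: "\<lbrakk>stage k N e; j < n k; summand_trace (ds k) N j e = of_int t\<rbrakk> \<Longrightarrow> trace_vec k N e j = t"
  using trace_vec[of k N e j] by simp

lemma stage_mono: "\<lbrakk>stage k N e; N \<le> N'\<rbrakk> \<Longrightarrow> stage k N' e"
  by (auto simp: stage_def corner_mono)

lemma val_mono:
  assumes e: "stage k N e" and le: "N \<le> N'"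
  shows "val k N' e = val k N e"
proof -
  have "trace_vec k N' e j = trace_vec k N e j" if j: "j < n k" for j
  proof (rule trace_vec_eqI[OF stage_mono[OF e le] j])
    have "summand_trace (ds k) N' j e = summand_trace (ds k) N j e"
      unfolding summand_trace_def
    proof (rule sum.mono_neutral_right)
      show "\<forall>i\<in>{..<N'} - {..<N}. (\<Sum>r<ds k ! j. (fst (e i i) ! j) $$ (r, r)) = 0"
        using stageD(1)[OF e] j by (auto simp: corner_def intro!: sum.neutral)
    qed (use le in auto)
    then show "summand_trace (ds k) N' j e = of_int (trace_vec k N e j)" using trace_vec[OF e j] by simp
  qed
  then show ?thesis unfolding val_def by (intro lincomb_cong) simp
qed

lemma trace_vec_up:
  assumes e: "stage k N e" and i: "i < n (Suc k)"
  shows "trace_vec (Suc k) N (up (Suc k) k e) i = mat_vec (n k) (M k) (trace_vec k N e) i"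
proof (rule trace_vec_eqI[OF stage_up[OF _ e] i])
  have "up (Suc k) k e = mmap (umap (E.block k)) e"
    by (simp add: up_def mmap_def umap_def fun_eq_iff split_def step_def)
  then have "summand_trace (ds (Suc k)) N i (up (Suc k) k e) = (\<Sum>j<n k. of_nat (M k i j) * summand_trace (ds k) N j e)"
    using E.summand_trace_block[of i k N e] i by simp
  also have "\<dots> = of_int (mat_vec (n k) (M k) (trace_vec k N e) i)"
    by (simp add: mat_vec_def trace_vec[OF e])
  finally show "summand_trace (ds (Suc k)) N i (up (Suc k) k e) = of_int (mat_vec (n k) (M k) (trace_vec k N e) i)" .
qed simp

text \<open>The value in \<open>G\<close> does not change along the system, since the generators of a stage are the
  combinations of those of the next one with the same matrix.\<close>
lemma val_up:
  assumes "k \<le> l" and e: "stage k N e"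
  shows "val l N (up l k e) = val k N e"
  using assms(1)
proof (induction l rule: dec_induct)
  case (step l)
  have "val (Suc l) N (up (Suc l) k e) = val (Suc l) N (up (Suc l) l (up l k e))"
    using up_up[of k l "Suc l"] step.hyps by simp
  also have "\<dots> = lincomb (n (Suc l)) (g (Suc l)) (mat_vec (n l) (M l) (trace_vec l N (up l k e)))"
    unfolding val_def using trace_vec_up[OF stage_up[OF step.hyps(1) e]] by (intro lincomb_cong) simp
  also have "\<dots> = val l N (up l k e)" unfolding val_def by (rule refines_lincomb[OF ref, symmetric])
  finally show ?case using step.IH by simp
qed simp

lemma snd_up [simp]: "mmap snd (up l k e) = mmap snd e"
  and snd_lim [simp]: "mmap snd (lim k e) = mmap snd e"
  by (simp_all add: mmap_def up_def lim_def umap_def split_def)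

text \<open>From left to right, the equivalence holds at a later stage, where it implies equality of
  traces. Conversely, if the values agree, then the difference of the traces is a relation between
  the generators of the stage, which the next stage kills; the idempotents are equivalent there.\<close>
lemma lim_rel_iff_same_stage:
  assumes e: "stage k N e" and f: "stage k N f"
  shows "(lim k e, lim k f) \<in> idem_rel UB \<longleftrightarrow>
    val k N e = val k N f \<and> ctrace (mmap snd e) = ctrace (mmap snd f)"
proof (intro iffI conjI)
  assume "(lim k e, lim k f) \<in> idem_rel UB"
  then obtain l where l: "k \<le> l" "(up l k e, up l k f) \<in> idem_rel (UD l)"
    using stage_rel_descends[OF e f] by blast
  have e': "stage l N (up l k e)" and f': "stage l N (up l k f)" using stage_up l(1) e f by blast+
  have tr: "(\<forall>j<n l. summand_trace (ds l) N j (up l k e) = summand_trace (ds l) N j (up l k f)) \<and>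
      ctrace (mmap snd e) = ctrace (mmap snd f)"
    using MS.idem_rel_MU_iff'[OF stageD[OF e'] stageD[OF f']] l(2) by simp
  then show "ctrace (mmap snd e) = ctrace (mmap snd f)" by blast
  have "val l N (up l k e) = val l N (up l k f)"
    unfolding val_def trace_vec_def using tr by (intro lincomb_cong) simp
  then show "val k N e = val k N f" using val_up[OF l(1)] e f by simp
next
  assume *: "val k N e = val k N f \<and> ctrace (mmap snd e) = ctrace (mmap snd f)"
  have e': "stage (Suc k) N (up (Suc k) k e)" and f': "stage (Suc k) N (up (Suc k) k f)"
    using stage_up[of k "Suc k"] e f by simp_all
  have "lincomb (n k) (g k) (\<lambda>i. trace_vec k N e i - trace_vec k N f i) = \<one>"
    using * val_closed[of k N f] by (simp add: lincomb_diff g_carrier val_def)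
  then have "mat_vec (n k) (M k) (trace_vec k N e) i = mat_vec (n k) (M k) (trace_vec k N f) i" if "i < n (Suc k)" for i
    using kernel_killed[OF _ that, of "\<lambda>i. trace_vec k N e i - trace_vec k N f i"] by (simp add: mat_vec_diff)
  then have "summand_trace (ds (Suc k)) N i (up (Suc k) k e) = summand_trace (ds (Suc k)) N i (up (Suc k) k f)" if "i < n (Suc k)" for i
    using trace_vec_up[OF e that] trace_vec_up[OF f that] trace_vec[OF e' that] trace_vec[OF f' that] that by simp
  then have "(up (Suc k) k e, up (Suc k) k f) \<in> idem_rel (UD (Suc k))"
    using MS.idem_rel_MU_iff'[OF stageD[OF e'] stageD[OF f']] * by simp
  then have "(lim (Suc k) (up (Suc k) k e), lim (Suc k) (up (Suc k) k f)) \<in> idem_rel UB" by (rule lim_rel)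
  then show "(lim k e, lim k f) \<in> idem_rel UB"
    using lim_up[of k "Suc k" _ N] stageD(1)[OF e] stageD(1)[OF f] by simp
qed

text \<open>Both idempotents are moved to a common stage and a common matrix size.\<close>
lemma lim_rel_iff:
  assumes e: "stage k N e" and f: "stage l P f"
  shows "(lim k e, lim l f) \<in> idem_rel UB \<longleftrightarrow>
    val k N e = val l P f \<and> ctrace (mmap snd e) = ctrace (mmap snd f)"
proof -
  define m Q where "m = max k l" and "Q = max N P"
  have le: "k \<le> m" "l \<le> m" "N \<le> Q" "P \<le> Q" by (simp_all add: m_def Q_def)
  have e': "stage k Q e" and f': "stage l Q f" using stage_mono[OF e le(3)] stage_mono[OF f le(4)] .
  show ?thesis
    using lim_rel_iff_same_stage[OF stage_up[OF le(1) e'] stage_up[OF le(2) f']]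
    by (simp add: lim_up[OF le(1) stageD(1)[OF e']] lim_up[OF le(2) stageD(1)[OF f']]
        val_up[OF le(1) e'] val_up[OF le(2) f'] val_mono[OF e le(3)] val_mono[OF f le(4)])
qed

text \<open>The choice of the equivalent idempotent of a stage does not matter, by \<open>lim_rel_iff\<close>.\<close>
definition classify :: "(nat \<Rightarrow> nat \<Rightarrow> AF_element \<times> complex) \<Rightarrow> 'g" where
  "classify E = (SOME \<gamma>. \<exists>k N e. stage k N e \<and> (E, lim k e) \<in> idem_rel UB \<and> \<gamma> = val k N e)"

lemma classify_eq:
  assumes e: "stage k N e" and rel: "(E, lim k e) \<in> idem_rel UB"
  shows "classify E = val k N e"
  unfolding classify_def
proof (rule some_equality)
  show "\<exists>k' N' e'. stage k' N' e' \<and> (E, lim k' e') \<in> idem_rel UB \<and> val k N e = val k' N' e'"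
    using e rel by blast
  fix \<gamma> assume "\<exists>k N e. stage k N e \<and> (E, lim k e) \<in> idem_rel UB \<and> \<gamma> = val k N e"
  then obtain l P f where f: "stage l P f" "(E, lim l f) \<in> idem_rel UB" "\<gamma> = val l P f" by blast
  have "(lim l f, lim k e) \<in> idem_rel UB" using UB.idem_rel_trans[OF UB.idem_rel_sym[OF f(2)] rel] .
  then show "\<gamma> = val k N e" using lim_rel_iff[OF f(1) e] f(3) by blast
qed

lemma obtain_stage:
  assumes "E \<in> idem_inf UB" "E \<in> corner UB N"
  obtains k e where "stage k N e" "(E, lim k e) \<in> idem_rel UB"
  using assms idempotent_from_stage[of E N] by (auto simp: idem_inf_def)

sublocale SNB: ring_hom_ring UB complex_ring snd by (rule snd_ring_hom[OF B.complex_algebra_axioms])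

lemma ctrace_snd_rel: "(E, F) \<in> idem_rel UB \<Longrightarrow> ctrace (mmap snd E) = ctrace (mmap snd F)"
  using SNB.mmap_rel[of E F] complex_idem_rel_iff C.idem_relD by blast

lemma val_block_diag:
  assumes e: "stage k N e" and f: "stage k P f"
  shows "stage k (N + P) (block_diag (UD k) N e f)"
    "val k (N + P) (block_diag (UD k) N e f) = val k N e \<otimes> val k P f"
proof -
  let ?b = "block_diag (UD k) N e f"
  show b: "stage k (N + P) ?b"
    using stageD[OF e] stageD[OF f] MS.MU.block_diag_corner[of e k N f P] MS.MU.block_diag_mult[of e k N f P e f]
    by (simp add: stage_def)
  have "trace_vec k (N + P) ?b j = trace_vec k N e j + trace_vec k P f j" if j: "j < n k" for j
  proof (rule trace_vec_eqI[OF b j])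
    have "summand_trace (ds k) (N + P) j ?b = summand_trace (ds k) N j e + summand_trace (ds k) P j f"
      unfolding summand_trace_def sum_lessThan_add by (simp add: block_diag_def)
    then show "summand_trace (ds k) (N + P) j ?b = of_int (trace_vec k N e j + trace_vec k P f j)"
      using trace_vec[OF e j] trace_vec[OF f j] by simp
  qed
  then have "val k (N + P) ?b = lincomb (n k) (g k) (\<lambda>j. trace_vec k N e j + trace_vec k P f j)"
    unfolding val_def by (intro lincomb_cong) simp
  then show "val k (N + P) ?b = val k N e \<otimes> val k P f" by (simp add: val_def lincomb_add g_carrier)
qed

lemma idem_inf_corner: "E \<in> idem_inf R \<Longrightarrow> \<exists>N. E \<in> corner R N"
  by (auto simp: idem_inf_def M_inf_def)

lemma classify_block_diag:
  assumes E: "E \<in> idem_inf UB" "E \<in> corner UB N" and F: "F \<in> idem_inf UB"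
  shows "classify (block_diag UB N E F) = classify E \<otimes> classify F"
proof -
  obtain P where P: "F \<in> corner UB P" using idem_inf_corner[OF F] by blast
  obtain k e where e: "stage k N e" "(E, lim k e) \<in> idem_rel UB" by (rule obtain_stage[OF E])
  obtain l f where f: "stage l P f" "(F, lim l f) \<in> idem_rel UB" by (rule obtain_stage[OF F P])
  define m where "m = max k l"
  have le: "k \<le> m" "l \<le> m" by (simp_all add: m_def)
  define e' f' where "e' = up m k e" and "f' = up m l f"
  have e': "stage m N e'" "(E, lim m e') \<in> idem_rel UB"
    using stage_up[OF le(1) e(1)] e(2) lim_up[OF le(1) stageD(1)[OF e(1)]] by (simp_all add: e'_def)
  have f': "stage m P f'" "(F, lim m f') \<in> idem_rel UB"
    using stage_up[OF le(2) f(1)] f(2) lim_up[OF le(2) stageD(1)[OF f(1)]] by (simp_all add: f'_def)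
  have "lim m (block_diag (UD m) N e' f') = block_diag UB N (lim m e') (lim m f')"
    by (rule lim_block_diag)
  moreover have "(block_diag UB N E F, block_diag UB N (lim m e') (lim m f')) \<in> idem_rel UB"
    by (rule UB.block_diag_rel[OF E(2) lim_corner[OF stageD(1)[OF e'(1)]] e'(2) f'(2)])
  ultimately have "classify (block_diag UB N E F) = val m (N + P) (block_diag (UD m) N e' f')"
    by (intro classify_eq[OF val_block_diag(1)[OF e'(1) f'(1)]]) simp
  then show ?thesis
    using val_block_diag(2)[OF e'(1) f'(1)] classify_eq[OF e'] classify_eq[OF f'] by simp
qed

lemma classified: "classified_ring UB (G \<times>\<times> complex_add) (\<lambda>E. (classify E, ctrace (mmap snd E)))"
proof (intro classified_ring.intro classified_ring_axioms.intro)
  show "ring UB" by (rule UB.ring_axioms)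
  show "comm_group (G \<times>\<times> complex_add)"
    by (intro group.group_comm_groupI DirProd_group is_group comm_group.axioms(2)[OF complex_add_group])
      (auto simp: m_comm add.commute)
  fix E assume E: "E \<in> idem_inf UB"
  then obtain N where EN: "E \<in> corner UB N" using idem_inf_corner by blast
  obtain k e where e: "stage k N e" "(E, lim k e) \<in> idem_rel UB" by (rule obtain_stage[OF E EN])
  show "(classify E, ctrace (mmap snd E)) \<in> carrier (G \<times>\<times> complex_add)"
    using classify_eq[OF e] val_closed by simp
  fix F assume F: "F \<in> idem_inf UB"
  then obtain P where FP: "F \<in> corner UB P" using idem_inf_corner by blast
  obtain l f where f: "stage l P f" "(F, lim l f) \<in> idem_rel UB" by (rule obtain_stage[OF F FP])
  have "(E, F) \<in> idem_rel UB \<longleftrightarrow> (lim k e, lim l f) \<in> idem_rel UB"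
    using UB.idem_rel_trans UB.idem_rel_sym e(2) f(2) by blast
  also have "\<dots> \<longleftrightarrow> classify E = classify F \<and> ctrace (mmap snd E) = ctrace (mmap snd F)"
    using lim_rel_iff[OF e(1) f(1)] classify_eq[OF e] classify_eq[OF f] ctrace_snd_rel[OF e(2)] ctrace_snd_rel[OF f(2)] by simp
  finally show "(E, F) \<in> idem_rel UB \<longleftrightarrow> (classify E, ctrace (mmap snd E)) = (classify F, ctrace (mmap snd F))" by simp
  fix n assume "E \<in> corner UB n"
  then show "(classify (block_diag UB n E F), ctrace (mmap snd (block_diag UB n E F))) =
      (classify E, ctrace (mmap snd E)) \<otimes>\<^bsub>G \<times>\<times> complex_add\<^esub> (classify F, ctrace (mmap snd F))"
    using classify_block_diag[OF E _ F] SNB.mmap_block_diag[of n E F]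
      ctrace_block_diag[OF SNB.mmap_corner SNB.mmap_corner[OF FP]] by simp
qed

text \<open>An idempotent over the limit algebra itself has scalar part zero. For an equivalent
  idempotent of a stage, the scalar trace is then zero, so that its traces are natural numbers,
  bounded by the sizes of the matrices.\<close>
lemma classify_emb:
  assumes f: "f \<in> idem_inf B" "f \<in> corner B N"
  shows "\<exists>k x. (\<forall>j<n k. x j \<le> N * u k j) \<and> classify (emb f) = lincomb (n k) (g k) (\<lambda>j. int (x j))"
proof -
  have "emb f \<in> idem_inf UB" "emb f \<in> corner UB N" using f B.emb_idem_iff B.emb_corner_iff by blast+
  then obtain k e where e: "stage k N e" "(emb f, lim k e) \<in> idem_rel UB" by (rule obtain_stage)
  have "ctrace (mmap snd e) = 0"
    using ctrace_snd_rel[OF e(2)] B.snd_emb[of f] by (simp add: ctrace_def)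
  then have "\<exists>t\<le>N * u k j. trace_vec k N e j = int t" if "j < n k" for j
    using MS.summand_trace_nat[OF stageD[OF e(1)], of j] that trace_vec_eqI[OF e(1) that] by fastforce
  then obtain x where x: "\<And>j. j < n k \<Longrightarrow> x j \<le> N * u k j \<and> trace_vec k N e j = int (x j)" by metis
  have "classify (emb f) = val k N e" by (rule classify_eq[OF e])
  also have "\<dots> = lincomb (n k) (g k) (\<lambda>j. int (x j))" unfolding val_def using x by (intro lincomb_cong) simp
  finally show ?thesis using x by (intro exI[of _ k] exI[of _ x]) simp
qed

text \<open>Conversely, a standard idempotent realizes any vector of traces within these bounds.\<close>
lemma emb_realizes:
  assumes x: "\<And>j. j < n k \<Longrightarrow> x j \<le> N * u k j"
  shows "\<exists>f\<in>idem_inf B. f \<in> corner B N \<and> classify (emb f) = lincomb (n k) (g k) (\<lambda>j. int (x j))"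
proof -
  define e where "e = MS.standard_idem k N x"
  have x': "\<And>j. j < length (ds k) \<Longrightarrow> x j \<le> N * ds k ! j" using x by simp
  note st = MS.standard_idem[OF x', folded e_def]
  have e: "stage k N e" using st by (simp add: stage_def)
  define f where "f = mmap fst (lim k e)"
  have ef: "emb f = lim k e" unfolding f_def by (rule B.emb_fst) (use st(3) in simp)
  have "f \<in> idem_inf B" using stage_lim[OF e] B.emb_idem_iff[of f] by (simp add: ef)
  moreover have "f \<in> corner B N" using lim_corner[OF st(1)] B.emb_corner_iff[of f N] by (simp add: ef)
  moreover have "classify (emb f) = lincomb (n k) (g k) (\<lambda>j. int (x j))"
  proof -
    have "classify (emb f) = val k N e"
      unfolding ef by (rule classify_eq[OF e UB.idem_rel_refl[OF stage_lim[OF e]]])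
    also have "\<dots> = lincomb (n k) (g k) (\<lambda>j. int (x j))"
      unfolding val_def using trace_vec_eqI[OF e, of _ "int (x _)"] st(4) by (intro lincomb_cong) simp
    finally show ?thesis .
  qed
  ultimately show ?thesis by blast
qed

text \<open>The positive cone is obtained from matrices of any size, for which the bounds on the traces
  are no restriction. The scale is obtained from matrices of size one, and then the traces are
  bounded by the dimension vector, exactly as in the description of the scale of \<open>G\<close> by the
  diagram.\<close>
theorem K0_limit: "scaled_isomorphic (K0 B) G"
proof (rule K0_isomorphic_if_classified[OF B.complex_algebra_axioms scaled_preordered_group_axioms generating classified])
  show "(\<lambda>f. classify (emb f)) ` idem_inf B = pos G"
  proof (intro equalityI subsetI)
    fix s assume "s \<in> (\<lambda>f. classify (emb f)) ` idem_inf B"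
    then obtain f where f: "f \<in> idem_inf B" "s = classify (emb f)" by blast
    obtain N where "f \<in> corner B N" using idem_inf_corner[OF f(1)] by blast
    then obtain k x where "s = lincomb (n k) (g k) (\<lambda>j. int (x j))" using classify_emb[OF f(1)] f(2) by blast
    then show "s \<in> pos G" using g_pos by (simp add: lincomb_pos)
  next
    fix s assume "s \<in> pos G"
    then obtain k x where s: "s = lincomb (n k) (g k) (\<lambda>j. int (x j))" using pos_ex by blast
    have "x j \<le> (\<Sum>i<n k. x i) * u k j" if "j < n k" for j
    proof -
      have "x j \<le> (\<Sum>i<n k. x i)" using that by (intro member_le_sum) auto
      also have "\<dots> \<le> (\<Sum>i<n k. x i) * u k j" using u_pos[of k j] by simp
      finally show ?thesis .
    qed
    then obtain f where "f \<in> idem_inf B" "classify (emb f) = s" using emb_realizes[of k x] s by auto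
    then show "s \<in> (\<lambda>f. classify (emb f)) ` idem_inf B" by (intro image_eqI[of _ _ f]) simp_all
  qed
  show "(\<lambda>a. classify (emb (single B a))) ` {a \<in> carrier B. a \<otimes>\<^bsub>B\<^esub> a = a} = scale G"
  proof (intro equalityI subsetI)
    fix s assume "s \<in> (\<lambda>a. classify (emb (single B a))) ` {a \<in> carrier B. a \<otimes>\<^bsub>B\<^esub> a = a}"
    then obtain a where a: "a \<in> carrier B" "a \<otimes>\<^bsub>B\<^esub> a = a" "s = classify (emb (single B a))" by blast
    have "single B a \<in> idem_inf B" using B.single_idem_iff[OF a(1)] a(2) by simp
    from classify_emb[OF this B.single_corner[OF a(1)]]
    obtain k x where "\<forall>j<n k. x j \<le> 1 * u k j" "classify (emb (single B a)) = lincomb (n k) (g k) (\<lambda>j. int (x j))"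
      by (elim exE conjE) (rule that)
    then show "s \<in> scale G" using le_u_scale[of k x] a(3) by simp
  next
    fix s assume "s \<in> scale G"
    then obtain k x where x: "\<forall>j<n k. x j \<le> u k j" "s = lincomb (n k) (g k) (\<lambda>j. int (x j))" using scale_ex by blast
    then obtain f where f: "f \<in> idem_inf B" "f \<in> corner B 1" "classify (emb f) = s"
      using emb_realizes[of k x 1] by auto
    have fs: "f = single B (f 0 0)" by (rule B.corner_1_single[OF f(2)])
    have c: "f 0 0 \<in> carrier B" by (rule cornerD(1)[OF f(2)])
    have "f 0 0 \<otimes>\<^bsub>B\<^esub> f 0 0 = f 0 0" using B.single_idem_iff[OF c] f(1) fs by simp
    then show "s \<in> (\<lambda>a. classify (emb (single B a))) ` {a \<in> carrier B. a \<otimes>\<^bsub>B\<^esub> a = a}"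
      using c f(3) fs by (intro image_eqI[of _ _ "f 0 0"]) auto
  qed
qed

end

theorem theorem10p17:
  fixes p :: real and G :: "'g scaled_group"
  assumes "p \<ge> 1" and "p \<noteq> 2"
    and "scaled_Riesz_group G" and "countable (carrier G)"
  shows "\<exists>A :: AF_element normed_alg.
           spatial_Lp_AF_algebra p A \<and> scaled_isomorphic (K0 A) G"
proof -
  interpret scaled_Riesz_group G by (rule assms(3))
  obtain n u M g where data: "\<And>k. 0 < n k" "\<And>k i. 0 < u k i"
    "\<And>k. refines (n k) (g k) (n (Suc k)) (g (Suc k)) (M k)" "\<And>k i. g k i \<in> pos G"
    "\<And>k i. i < n (Suc k) \<Longrightarrow> (\<Sum>j<n k. M k i j * u k j) \<le> u (Suc k) i"
    "\<And>k a i. \<lbrakk>lincomb (n k) (g k) a = \<one>\<^bsub>G\<^esub>; i < n (Suc k)\<rbrakk> \<Longrightarrow> mat_vec (n k) (M k) a i = 0"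
    "\<And>k x. (\<And>i. i < n k \<Longrightarrow> x i \<le> u k i) \<Longrightarrow> lincomb (n k) (g k) (\<lambda>i. int (x i)) \<in> scale G"
    "\<And>s. s \<in> scale G \<Longrightarrow> \<exists>k x. (\<forall>i<n k. x i \<le> u k i) \<and> s = lincomb (n k) (g k) (\<lambda>i. int (x i))"
    "\<And>s. s \<in> pos G \<Longrightarrow> \<exists>k x. s = lincomb (n k) (g k) (\<lambda>i. int (x i))"
    by (rule Bratteli_data[OF assms(4)]) (blast intro: that)
  interpret Bratteli_system G p n u M g
    by unfold_locales (use assms(1) data in auto)
  show ?thesis using AF_algebra K0_limit by blast
qed

end
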